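(* Let $(\mathcal{G},T)$ and $(\mathcal{G}',T')$ be Ehresmann sites. A double functor $M\colon\mathcal{G}\to\mathcal{G}'$ gives rise to a geometric morphism $\mathrm{Sh}(\mathcal{G}',T')\to\mathrm{Sh}(\mathcal{G},T)$ (that is, composition with $M$ sends $T'$-sheaves to $T$-sheaves and the resulting functor $M^*\colon \mathrm{Sh}(\mathcal{G}',T')\to\mathrm{Sh}(\mathcal{G},T)$ is part of such a geometric morphism, namely its direct image) if and only if $M$ is covering preserving and covering flat.
   Context: An ordered groupoid is a small groupoid $\mathcal{G}$ with a partial order $\le$ on its arrows, inducing one on objects via identities, such that: $a\le b$ implies $a^{-1}\le b^{-1}$; $a\le b$ and $c\le d$ imply $ac\le bd$ when both composites are defined; and for each $f\colon A\to B$ and $A'\le A$ there is a unique arrow $f|_{A'}\colon A'\to B'$ with domain $A'$ and $f|_{A'}\le f$. Groupoid arrows are called horizontal; relations $A'\le A$ are called vertical arrows. A double functor is an order-preserving functor. A vertical sieve on an object $A$ is a downward closed subset of $\downarrow A=\{A'\mid A'\le A\}$. For a vertical sieve $\mathcal{B}$ on $B$ and a horizontal $f\colon A\to B'$ with $B'\le B$, $f^*\mathcal{B}=\{A'\le A\mid \mathrm{cod}(f|_{A'})\in\mathcal{B}\}$. An Ehresmann topology $T$ on $\mathcal{G}$ assigns to each object $A$ a collection $T(A)$ of (covering) vertical sieves on $A$ such that: (ET.1) $\downarrow A\in T(A)$; (ET.2) if $\mathcal{B}\in T(B)$ and $f\colon A\to B'$ with $B'\le B$, then $f^*\mathcal{B}\in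 T(A)$; (ET.3) if $\mathcal{A}\in T(A)$ and $\mathcal{B}$ is a vertical sieve on $A$ such that $f^*\mathcal{B}\in T(C)$ for every $f\colon C\to A'$ with $A'\in\mathcal{A}$, then $\mathcal{B}\in T(A)$. An Ehresmann site is an ordered groupoid with an Ehresmann topology. A presheaf $F$ on $\mathcal{G}$ assigns to each object $A$ a set $F(A)$, to each horizontal $f\colon A\to B$ a function $F(f)\colon F(B)\to F(A)$ and to each $A'\le A$ a function $F(A)\to F(A')$ (written $x\mapsto x|_{A'}$), both contravariantly functorial, such that each relation $f'\le f$ (with $f'\colon A'\to B'$, $f\colon A\to B$) gives $F(f')(x|_{B'})=(F(f)(x))|_{A'}$. Morphisms are families of functions natural in both horizontal and vertical arrows. $F$ is a sheaf for $T$ if for every $\mathcal{A}\in T(A)$ and every family $(x_{A'}\in F(A'))_{A'\in\mathcal{A}}$ with $x_{A'}|_{A''}=x_{A''}$ whenever $A''\le A'$ in $\mathcal{A}$, there is a unique $x\in F(A)$ with $x|_{A'}=x_{A'}$ for all $A'\in\mathcal{A}$. $\mathrm{Sh}(\mathcal{G},T)$ is the full subcategory of presheaves on the sheaves. A finite diagram in $\mathcal{G}$ is a double functor $D\colon\mathbb{I}\to\mathcal{G}$ with $\mathbb{I}$ a finite ordered groupoid; write $D_i=D(i)$ and $D_\alpha=D(\alpha)$. An hv-cone over $D$ consists of an object $U$ and, for each object $i$ of $\mathbb{I}$, a horizontal arrow $\xi_i\colon U\to E_i$ with $E_i\le D_i$, such that for each horizontal $\alpha\colon i\to i'$ in $\mathbb{I}$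 the arrow $D_\alpha|_{E_i}$ has codomain $E_{i'}$ and $D_\alpha|_{E_i}\circ\xi_i=\xi_{i'}$, and for $i\le i'$ in $\mathbb{I}$ one has $\xi_i=\xi_{i'}$. $M$ is covering preserving if for each $\mathcal{A}\in T(A)$ the vertical sieve on $MA$ generated by the image $M\mathcal{A}$ belongs to $T'(MA)$. $M$ is covering flat if for each finite diagram $D\colon\mathbb{I}\to\mathcal{G}$ and each hv-cone $(\xi_i\colon U\to E_i\le MD_i)_{i}$ over $MD$ in $\mathcal{G}'$ there is a covering vertical sieve $\{U'_k\le U\mid k\in K\}\in T'(U)$ such that for each $k\in K$ there are an hv-cone $(\theta_{ik}\colon T_k\to A_{ik}\le D_i)_i$ over $D$ in $\mathcal{G}$ and a horizontal arrow $h_k\colon U'_k\to T'_k$ with $T'_k\le MT_k$ such that $\xi_i|_{U'_k}=(M\theta_{ik})|_{T'_k}\circ h_k$ for all objects $i$ of $\mathbb{I}$. *)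

theory Defs
  imports "HOL-Library.FuncSet" "HOL-Library.Equipollence"
begin

section \<open>Categories, functors, limits, geometric morphisms\<close>

record ('o, 'a) category =
  Obj :: "'o set"
  Arr :: "'a set"
  Dom :: "'a \<Rightarrow> 'o"
  Cod :: "'a \<Rightarrow> 'o"
  Idt :: "'o \<Rightarrow> 'a"
  Cmp :: "'a \<Rightarrow> 'a \<Rightarrow> 'a"  \<comment> \<open>\<open>Cmp C g f\<close> is "g after f"\<close>

definition hom :: "('o, 'a, 'z) category_scheme \<Rightarrow> 'o \<Rightarrow> 'o \<Rightarrow> 'a set" where
  "hom C A B = {f \<in> Arr C. Dom C f = A \<and> Cod C f = B}"

locale is_category =
  fixes C :: "('o, 'a, 'z) category_scheme"
  assumes Dom_Obj: "f \<in> Arr C \<Longrightarrow> Dom C f \<in> Obj C"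
    and Cod_Obj: "f \<in> Arr C \<Longrightarrow> Cod C f \<in> Obj C"
    and Idt_hom: "A \<in> Obj C \<Longrightarrow> Idt C A \<in> hom C A A"
    and Cmp_hom: "f \<in> hom C A B \<Longrightarrow> g \<in> hom C B D \<Longrightarrow> Cmp C g f \<in> hom C A D"
    and Cmp_Idt: "f \<in> Arr C \<Longrightarrow> Cmp C f (Idt C (Dom C f)) = f"
    and Idt_Cmp: "f \<in> Arr C \<Longrightarrow> Cmp C (Idt C (Cod C f)) f = f"
    and Cmp_assoc: "f \<in> hom C A B \<Longrightarrow> g \<in> hom C B D \<Longrightarrow> h \<in> hom C D E \<Longrightarrow>
      Cmp C h (Cmp C g f) = Cmp C (Cmp C h g) f"

record ('o, 'a, 'p, 'b) fnctr =
  on_obj :: "'o \<Rightarrow> 'p"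
  on_arr :: "'a \<Rightarrow> 'b"

definition fnctr_comp ::
  "('p, 'b, 'q, 'c) fnctr \<Rightarrow> ('o, 'a, 'p, 'b) fnctr \<Rightarrow> ('o, 'a, 'q, 'c) fnctr" where
  "fnctr_comp F D = \<lparr>on_obj = on_obj F \<circ> on_obj D, on_arr = on_arr F \<circ> on_arr D\<rparr>"

locale is_functor = source: is_category C + target: is_category D
  for C :: "('o, 'a, 'z) category_scheme"
    and D :: "('p, 'b, 'y) category_scheme" +
  fixes F :: "('o, 'a, 'p, 'b) fnctr"
  assumes fnctr_obj: "A \<in> Obj C \<Longrightarrow> on_obj F A \<in> Obj D"
    and fnctr_arr: "f \<in> hom C A B \<Longrightarrow> on_arr F f \<in> hom D (on_obj F A) (on_obj F B)"
    and fnctr_Idt: "A \<in> Obj C \<Longrightarrow> on_arr F (Idt C A) = Idt D (on_obj F A)"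
    and fnctr_Cmp: "f \<in> hom C A B \<Longrightarrow> g \<in> hom C B E \<Longrightarrow>
      on_arr F (Cmp C g f) = Cmp D (on_arr F g) (on_arr F f)"

definition is_cone ::
  "('i, 'j, 'x) category_scheme \<Rightarrow> ('o, 'a, 'z) category_scheme \<Rightarrow> ('i, 'j, 'o, 'a) fnctr
    \<Rightarrow> 'o \<Rightarrow> ('i \<Rightarrow> 'a) \<Rightarrow> bool" where
  "is_cone J C D V p \<longleftrightarrow>
     V \<in> Obj C \<and>
     (\<forall>i\<in>Obj J. p i \<in> hom C V (on_obj D i)) \<and>
     (\<forall>u\<in>Arr J. Cmp C (on_arr D u) (p (Dom J u)) = p (Cod J u))"

definition is_limit_cone ::
  "('i, 'j, 'x) category_scheme \<Rightarrow> ('o, 'a, 'z) category_scheme \<Rightarrow> ('i, 'j, 'o, 'a) fnctr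
    \<Rightarrow> 'o \<Rightarrow> ('i \<Rightarrow> 'a) \<Rightarrow> bool" where
  "is_limit_cone J C D V p \<longleftrightarrow>
     is_cone J C D V p \<and>
     (\<forall>W q. is_cone J C D W q \<longrightarrow>
        (\<exists>!k. k \<in> hom C W V \<and> (\<forall>i\<in>Obj J. Cmp C (p i) k = q i)))"

text \<open>Every finite category is isomorphic to one whose objects and arrows are natural numbers,
  so quantifying over the latter loses no finite diagram shape.\<close>

definition preserves_finite_limits ::
  "('o, 'a, 'z) category_scheme \<Rightarrow> ('p, 'b, 'y) category_scheme \<Rightarrow> ('o, 'a, 'p, 'b) fnctr
    \<Rightarrow> bool" where
  "preserves_finite_limits C D F \<longleftrightarrow>
     (\<forall>(J :: (nat, nat) category) K V p.
        is_category J \<and> finite (Obj J) \<and> finite (Arr J) \<and>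
        is_functor J C K \<and> is_limit_cone J C K V p \<longrightarrow>
        is_limit_cone J D (fnctr_comp F K) (on_obj F V) (on_arr F \<circ> p))"

definition is_left_adjoint ::
  "('o, 'a, 'z) category_scheme \<Rightarrow> ('p, 'b, 'y) category_scheme \<Rightarrow>
    ('o, 'a, 'p, 'b) fnctr \<Rightarrow> ('p, 'b, 'o, 'a) fnctr \<Rightarrow> bool" where
  "is_left_adjoint C D L R \<longleftrightarrow>
     is_functor C D L \<and> is_functor D C R \<and>
     (\<exists>\<phi>.
        (\<forall>X\<in>Obj C. \<forall>Y\<in>Obj D.
           bij_betw (\<phi> X Y) (hom D (on_obj L X) Y) (hom C X (on_obj R Y))) \<and>
        (\<forall>X\<in>Obj C. \<forall>X'\<in>Obj C. \<forall>Y\<in>Obj D. \<forall>Y'\<in>Obj D.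
           \<forall>u\<in>hom C X' X. \<forall>v\<in>hom D Y Y'. \<forall>k\<in>hom D (on_obj L X) Y.
             \<phi> X' Y' (Cmp D v (Cmp D k (on_arr L u))) =
             Cmp C (on_arr R v) (Cmp C (\<phi> X Y k) u)))"

text \<open>A geometric morphism \<open>E \<rightarrow> E'\<close> with direct image \<open>dir : E \<rightarrow> E'\<close> and
  inverse image \<open>inv_im : E' \<rightarrow> E\<close>.\<close>

definition is_geometric_morphism ::
  "('o, 'a, 'z) category_scheme \<Rightarrow> ('p, 'b, 'y) category_scheme \<Rightarrow>
    ('o, 'a, 'p, 'b) fnctr \<Rightarrow> ('p, 'b, 'o, 'a) fnctr \<Rightarrow> bool" where
  "is_geometric_morphism E E' dir inv_im \<longleftrightarrow>
     is_left_adjoint E' E inv_im dir \<and> preserves_finite_limits E' E inv_im"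


section \<open>Ordered groupoids and Ehresmann sites\<close>

locale is_groupoid = is_category +
  assumes ex_inverse: "f \<in> Arr C \<Longrightarrow>
    \<exists>g \<in> hom C (Cod C f) (Dom C f).
      Cmp C g f = Idt C (Dom C f) \<and> Cmp C f g = Idt C (Cod C f)"

definition arr_inv :: "('o, 'a, 'z) category_scheme \<Rightarrow> 'a \<Rightarrow> 'a" where
  "arr_inv C f = (THE g. g \<in> hom C (Cod C f) (Dom C f) \<and>
      Cmp C g f = Idt C (Dom C f) \<and> Cmp C f g = Idt C (Cod C f))"

text \<open>The order is on arrows; only its values on \<open>Arr G\<close> matter.\<close>

record ('o, 'a) ordered_groupoid = "('o, 'a) category" +
  ale :: "'a \<Rightarrow> 'a \<Rightarrow> bool"

definition ole :: "('o, 'a, 'z) ordered_groupoid_scheme \<Rightarrow> 'o \<Rightarrow> 'o \<Rightarrow> bool" where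
  "ole G A B \<longleftrightarrow> A \<in> Obj G \<and> B \<in> Obj G \<and> ale G (Idt G A) (Idt G B)"

locale is_ordered_groupoid = is_groupoid G
  for G :: "('o, 'a, 'z) ordered_groupoid_scheme" +
  assumes ale_refl: "a \<in> Arr G \<Longrightarrow> ale G a a"
    and ale_antisym: "a \<in> Arr G \<Longrightarrow> b \<in> Arr G \<Longrightarrow> ale G a b \<Longrightarrow> ale G b a \<Longrightarrow> a = b"
    and ale_trans: "a \<in> Arr G \<Longrightarrow> b \<in> Arr G \<Longrightarrow> c \<in> Arr G \<Longrightarrow>
      ale G a b \<Longrightarrow> ale G b c \<Longrightarrow> ale G a c"
    and ale_inv: "a \<in> Arr G \<Longrightarrow> b \<in> Arr G \<Longrightarrow> ale G a b \<Longrightarrow>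
      ale G (arr_inv G a) (arr_inv G b)"
    and ale_Cmp: "a \<in> Arr G \<Longrightarrow> b \<in> Arr G \<Longrightarrow> c \<in> Arr G \<Longrightarrow> d \<in> Arr G \<Longrightarrow>
      Cod G c = Dom G a \<Longrightarrow> Cod G d = Dom G b \<Longrightarrow> ale G a b \<Longrightarrow> ale G c d \<Longrightarrow>
      ale G (Cmp G a c) (Cmp G b d)"
    and ex1_restriction: "f \<in> Arr G \<Longrightarrow> ole G A' (Dom G f) \<Longrightarrow>
      \<exists>!f'. f' \<in> Arr G \<and> Dom G f' = A' \<and> ale G f' f"

definition arr_restrict :: "('o, 'a, 'z) ordered_groupoid_scheme \<Rightarrow> 'a \<Rightarrow> 'o \<Rightarrow> 'a" where
  "arr_restrict G f A' = (THE f'. f' \<in> Arr G \<and> Dom G f' = A' \<and> ale G f' f)"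

locale is_double_functor =
  source: is_ordered_groupoid G + target: is_ordered_groupoid G' + is_functor G G' M
  for G :: "('o, 'a, 'z) ordered_groupoid_scheme"
    and G' :: "('p, 'b, 'y) ordered_groupoid_scheme"
    and M :: "('o, 'a, 'p, 'b) fnctr" +
  assumes fnctr_ale: "f \<in> Arr G \<Longrightarrow> g \<in> Arr G \<Longrightarrow> ale G f g \<Longrightarrow>
    ale G' (on_arr M f) (on_arr M g)"

definition down :: "('o, 'a, 'z) ordered_groupoid_scheme \<Rightarrow> 'o \<Rightarrow> 'o set" where
  "down G A = {A'. ole G A' A}"

definition is_vertical_sieve ::
  "('o, 'a, 'z) ordered_groupoid_scheme \<Rightarrow> 'o \<Rightarrow> 'o set \<Rightarrow> bool" where
  "is_vertical_sieve G A S \<longleftrightarrow>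
     S \<subseteq> down G A \<and> (\<forall>B\<in>S. \<forall>B'. ole G B' B \<longrightarrow> B' \<in> S)"

definition sieve_pullback ::
  "('o, 'a, 'z) ordered_groupoid_scheme \<Rightarrow> 'a \<Rightarrow> 'o set \<Rightarrow> 'o set" where
  "sieve_pullback G f S = {A'. ole G A' (Dom G f) \<and> Cod G (arr_restrict G f A') \<in> S}"

definition sieve_generated ::
  "('o, 'a, 'z) ordered_groupoid_scheme \<Rightarrow> 'o set \<Rightarrow> 'o set" where
  "sieve_generated G X = {B. \<exists>A\<in>X. ole G B A}"

locale is_Ehresmann_site = is_ordered_groupoid G
  for G :: "('o, 'a, 'z) ordered_groupoid_scheme" +
  fixes T :: "'o \<Rightarrow> 'o set set"
  assumes covering_sieve: "A \<in> Obj G \<Longrightarrow> S \<in> T A \<Longrightarrow> is_vertical_sieve G A S"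
    and ET1: "A \<in> Obj G \<Longrightarrow> down G A \<in> T A"
    and ET2: "S \<in> T B \<Longrightarrow> ole G B' B \<Longrightarrow> f \<in> hom G A B' \<Longrightarrow> sieve_pullback G f S \<in> T A"
    and ET3: "A \<in> Obj G \<Longrightarrow> R \<in> T A \<Longrightarrow> is_vertical_sieve G A S \<Longrightarrow>
      (\<And>A' C f. A' \<in> R \<Longrightarrow> f \<in> hom G C A' \<Longrightarrow> sieve_pullback G f S \<in> T C) \<Longrightarrow> S \<in> T A"

definition covering_preserving ::
  "('o, 'a, 'z) ordered_groupoid_scheme \<Rightarrow> ('o \<Rightarrow> 'o set set) \<Rightarrow>
    ('p, 'b, 'y) ordered_groupoid_scheme \<Rightarrow> ('p \<Rightarrow> 'p set set) \<Rightarrow>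
    ('o, 'a, 'p, 'b) fnctr \<Rightarrow> bool" where
  "covering_preserving G T G' T' M \<longleftrightarrow>
     (\<forall>A\<in>Obj G. \<forall>S\<in>T A. sieve_generated G' (on_obj M ` S) \<in> T' (on_obj M A))"

text \<open>The objects \<open>E\<^sub>i\<close> of an hv-cone are the codomains of the arrows \<open>\<xi>\<^sub>i\<close>.\<close>

definition is_hv_cone ::
  "('i, 'j, 'x) ordered_groupoid_scheme \<Rightarrow> ('o, 'a, 'z) ordered_groupoid_scheme \<Rightarrow>
    ('i, 'j, 'o, 'a) fnctr \<Rightarrow> 'o \<Rightarrow> ('i \<Rightarrow> 'a) \<Rightarrow> bool" where
  "is_hv_cone I G D U \<xi> \<longleftrightarrow>
     U \<in> Obj G \<and>
     (\<forall>i\<in>Obj I. \<xi> i \<in> Arr G \<and> Dom G (\<xi> i) = U \<and> ole G (Cod G (\<xi> i)) (on_obj D i)) \<and>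
     (\<forall>i i' \<alpha>. \<alpha> \<in> hom I i i' \<longrightarrow>
        (let D\<alpha> = arr_restrict G (on_arr D \<alpha>) (Cod G (\<xi> i))
         in Cod G D\<alpha> = Cod G (\<xi> i') \<and> Cmp G D\<alpha> (\<xi> i) = \<xi> i')) \<and>
     (\<forall>i i'. ole I i i' \<longrightarrow> \<xi> i = \<xi> i')"

text \<open>As with finite limits, finite ordered groupoids on natural numbers exhaust all
  finite ordered groupoids up to isomorphism.\<close>

definition covering_flat ::
  "('o, 'a, 'z) ordered_groupoid_scheme \<Rightarrow>
    ('p, 'b, 'y) ordered_groupoid_scheme \<Rightarrow> ('p \<Rightarrow> 'p set set) \<Rightarrow>
    ('o, 'a, 'p, 'b) fnctr \<Rightarrow> bool" where
  "covering_flat G G' T' M \<longleftrightarrow>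
     (\<forall>(I :: (nat, nat) ordered_groupoid) D U \<xi>.
        finite (Obj I) \<and> finite (Arr I) \<and> is_double_functor I G D \<and>
        is_hv_cone I G' (fnctr_comp M D) U \<xi> \<longrightarrow>
        (\<exists>S\<in>T' U. \<forall>U'\<in>S. \<exists>V \<theta> V' h.
           is_hv_cone I G D V \<theta> \<and>
           ole G' V' (on_obj M V) \<and> h \<in> hom G' U' V' \<and>
           (\<forall>i\<in>Obj I. arr_restrict G' (\<xi> i) U' =
              Cmp G' (arr_restrict G' (on_arr M (\<theta> i)) V') h)))"


section \<open>Presheaves and sheaves\<close>

text \<open>Sets are the subsets of a type \<open>'u\<close>. The fields are meaningful only on
  objects and arrows of the groupoid; presheaves that differ elsewhere are isomorphic, so the
  category of presheaves is unaffected up to equivalence. \<open>vmap F A A'\<close> is the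
  restriction map \<open>F(A) \<rightarrow> F(A')\<close>.\<close>

record ('o, 'a, 'u) presheaf =
  val :: "'o \<Rightarrow> 'u set"
  hmap :: "'a \<Rightarrow> 'u \<Rightarrow> 'u"
  vmap :: "'o \<Rightarrow> 'o \<Rightarrow> 'u \<Rightarrow> 'u"

definition is_presheaf ::
  "('o, 'a, 'z) ordered_groupoid_scheme \<Rightarrow> ('o, 'a, 'u) presheaf \<Rightarrow> bool" where
  "is_presheaf G F \<longleftrightarrow>
     (\<forall>A B f. f \<in> hom G A B \<longrightarrow> hmap F f \<in> val F B \<rightarrow> val F A) \<and>
     (\<forall>A\<in>Obj G. \<forall>x\<in>val F A. hmap F (Idt G A) x = x) \<and>
     (\<forall>A B C f g. f \<in> hom G A B \<longrightarrow> g \<in> hom G B C \<longrightarrow>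
        (\<forall>x\<in>val F C. hmap F (Cmp G g f) x = hmap F f (hmap F g x))) \<and>
     (\<forall>A A'. ole G A' A \<longrightarrow> vmap F A A' \<in> val F A \<rightarrow> val F A') \<and>
     (\<forall>A\<in>Obj G. \<forall>x\<in>val F A. vmap F A A x = x) \<and>
     (\<forall>A A' A''. ole G A'' A' \<longrightarrow> ole G A' A \<longrightarrow>
        (\<forall>x\<in>val F A. vmap F A A'' x = vmap F A' A'' (vmap F A A' x))) \<and>
     (\<forall>A B A' B' f f'. f \<in> hom G A B \<longrightarrow> f' \<in> hom G A' B' \<longrightarrow> ale G f' f \<longrightarrow>
        (\<forall>x\<in>val F B. hmap F f' (vmap F B B' x) = vmap F A A' (hmap F f x)))"

definition is_sheaf ::
  "('o, 'a, 'z) ordered_groupoid_scheme \<Rightarrow> ('o \<Rightarrow> 'o set set) \<Rightarrow> ('o, 'a, 'u) presheaf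
    \<Rightarrow> bool" where
  "is_sheaf G T F \<longleftrightarrow>
     is_presheaf G F \<and>
     (\<forall>A\<in>Obj G. \<forall>S\<in>T A. \<forall>x.
        (\<forall>A'\<in>S. x A' \<in> val F A') \<and>
        (\<forall>A'\<in>S. \<forall>A''\<in>S. ole G A'' A' \<longrightarrow> vmap F A' A'' (x A') = x A'') \<longrightarrow>
        (\<exists>!y. y \<in> val F A \<and> (\<forall>A'\<in>S. vmap F A A' y = x A')))"

record ('o, 'a, 'u) presheaf_mor =
  src :: "('o, 'a, 'u) presheaf"
  tgt :: "('o, 'a, 'u) presheaf"
  cmpt :: "'o \<Rightarrow> 'u \<Rightarrow> 'u"

text \<open>Components are extensional, so that equal families of functions are equal morphisms.\<close>

definition is_presheaf_mor ::
  "('o, 'a, 'z) ordered_groupoid_scheme \<Rightarrow> ('o, 'a, 'u) presheaf_mor \<Rightarrow> bool" where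
  "is_presheaf_mor G m \<longleftrightarrow>
     cmpt m \<in> (\<Pi>\<^sub>E A\<in>Obj G. val (src m) A \<rightarrow>\<^sub>E val (tgt m) A) \<and>
     (\<forall>A B f. f \<in> hom G A B \<longrightarrow>
        (\<forall>x\<in>val (src m) B. cmpt m A (hmap (src m) f x) = hmap (tgt m) f (cmpt m B x))) \<and>
     (\<forall>A A'. ole G A' A \<longrightarrow>
        (\<forall>x\<in>val (src m) A. cmpt m A' (vmap (src m) A A' x) = vmap (tgt m) A A' (cmpt m A x)))"

definition Sh ::
  "('o, 'a, 'z) ordered_groupoid_scheme \<Rightarrow> ('o \<Rightarrow> 'o set set) \<Rightarrow>
    (('o, 'a, 'u) presheaf, ('o, 'a, 'u) presheaf_mor) category" where
  "Sh G T =
     \<lparr>Obj = {F. is_sheaf G T F},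
      Arr = {m. is_sheaf G T (src m) \<and> is_sheaf G T (tgt m) \<and> is_presheaf_mor G m},
      Dom = src,
      Cod = tgt,
      Idt = (\<lambda>F. \<lparr>src = F, tgt = F, cmpt = (\<lambda>A\<in>Obj G. \<lambda>x\<in>val F A. x)\<rparr>),
      Cmp = (\<lambda>n m. \<lparr>src = src m, tgt = tgt n,
               cmpt = (\<lambda>A\<in>Obj G. compose (val (src m) A) (cmpt n A) (cmpt m A))\<rparr>)\<rparr>"

definition presheaf_precomp ::
  "('o, 'a, 'p, 'b) fnctr \<Rightarrow> ('p, 'b, 'u) presheaf \<Rightarrow> ('o, 'a, 'u) presheaf" where
  "presheaf_precomp M F =
     \<lparr>val = (\<lambda>A. val F (on_obj M A)),
      hmap = (\<lambda>f. hmap F (on_arr M f)),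
      vmap = (\<lambda>A A'. vmap F (on_obj M A) (on_obj M A'))\<rparr>"

definition precomp_functor ::
  "('o, 'a, 'z) ordered_groupoid_scheme \<Rightarrow> ('o, 'a, 'p, 'b) fnctr \<Rightarrow>
    (('p, 'b, 'u) presheaf, ('p, 'b, 'u) presheaf_mor,
     ('o, 'a, 'u) presheaf, ('o, 'a, 'u) presheaf_mor) fnctr" where
  "precomp_functor G M =
     \<lparr>on_obj = presheaf_precomp M,
      on_arr = (\<lambda>m. \<lparr>src = presheaf_precomp M (src m), tgt = presheaf_precomp M (tgt m),
                  cmpt = (\<lambda>A\<in>Obj G. cmpt m (on_obj M A))\<rparr>)\<rparr>"

text \<open>Smallness of \<open>G\<close> relative to the type \<open>'u\<close> of set elements: with
  \<open>\<lambda>\<close> the cardinality of \<open>'u\<close>, it says that \<open>\<lambda>\<close> is infinite and that the class of sets of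
  cardinality at most \<open>\<lambda>\<close> is closed under powers indexed by the arrows of \<open>G\<close>. There are
  arbitrarily large such types, see \<open>small_groupoid_example\<close> below.\<close>

definition small_groupoid :: "'u itself \<Rightarrow> ('o, 'a, 'z) ordered_groupoid_scheme \<Rightarrow> bool" where
  "small_groupoid U G \<longleftrightarrow>
     infinite (UNIV :: 'u set) \<and> (Arr G \<rightarrow>\<^sub>E (UNIV :: 'u set)) \<lesssim> (UNIV :: 'u set)"

lemma small_groupoid_example:
  fixes G :: "('o, 'a, 'z) ordered_groupoid_scheme"
    and G' :: "('p, 'b, 'y) ordered_groupoid_scheme"
  shows "small_groupoid TYPE((('a + 'b) list \<times> 'w) set) G"
    and "small_groupoid TYPE((('a + 'b) list \<times> 'w) set) G'"
proof -
  have inf: "infinite (UNIV :: (('a + 'b) list \<times> 'w) set set)"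
  proof
    assume "finite (UNIV :: (('a + 'b) list \<times> 'w) set set)"
    then have "finite (UNIV :: (('a + 'b) list \<times> 'w) set)"
      using Finite_Set.finite_set by blast
    then show False
      by (metis UNIV_Times_UNIV UNIV_not_empty finite_cartesian_productD1 infinite_UNIV_listI)
  qed
  have main: "(S \<rightarrow>\<^sub>E (UNIV :: (('a + 'b) list \<times> 'w) set set)) \<lesssim>
      (UNIV :: (('a + 'b) list \<times> 'w) set set)"
    if "inj e" for S :: "'c set" and e :: "'c \<Rightarrow> 'a + 'b"
  proof -
    define \<iota> where "\<iota> f = {(e a # l, w) |a l w. (l, w) \<in> f a}"
      for f :: "'c \<Rightarrow> (('a + 'b) list \<times> 'w) set"
    have "f a = {(l, w). (e a # l, w) \<in> \<iota> f}" for f a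
      using \<open>inj e\<close> by (auto simp: \<iota>_def dest: injD)
    then have "inj \<iota>"
      by (intro injI ext) metis
    then show ?thesis
      unfolding lepoll_def by (meson inj_on_subset subset_UNIV)
  qed
  show "small_groupoid TYPE((('a + 'b) list \<times> 'w) set) G"
    unfolding small_groupoid_def using inf main[of Inl] by simp
  show "small_groupoid TYPE((('a + 'b) list \<times> 'w) set) G'"
    unfolding small_groupoid_def using inf main[of Inr] by simp
qed

end

theory Submission
  imports Defs "HOL-Library.Nat_Bijection"
begin

text \<open>An ordered groupoid is a left cancellative category in disguise: an arrow \<open>B \<rightarrow> A\<close> is a
  horizontal arrow from \<open>B\<close> to some \<open>A' \<le> A\<close>. Ehresmann topologies then become Grothendieck
  topologies and double functors become functors.

  If \<open>M\<close> is covering preserving and covering flat, the inverse image of a sheaf \<open>F\<close> is the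
  sheafification of its left Kan extension along \<open>M\<close>. Its local sections are represented by pairs
  of an arrow \<open>h : U \<rightarrow> M A\<close> and some \<open>x \<in> F A\<close>; flatness makes these pairs locally
  cofiltered, hence two of them agree if and only if they locally become equal along a single span,
  and finitely many of them locally live over a common \<open>h\<close>. So finite limits are preserved.

  Conversely, let \<open>L\<close> be the inverse image functor. If \<open>R\<close> is the sieve generated by the image of a
  covering sieve on \<open>A\<close>, glue two copies of the representable sheaf on \<open>M A\<close> along \<open>R\<close>: composition
  with \<open>M\<close> gives a sheaf, in particular a separated presheaf, so the two copies coincide and \<open>R\<close> is
  covering. For flatness, an hv-cone over \<open>M D\<close> with vertex \<open>U\<close> defines an element at \<open>U\<close> of the limit of the
  sheaves \<open>L (y D\<^sub>i)\<close>, that is, of \<open>L\<close> applied to the limit of the representable sheaves \<open>y D\<^sub>i\<close>; the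
  latter is locally generated by hv-cones over \<open>D\<close>, and \<open>L\<close> of it by the image of the unit.\<close>

section \<open>Ordered groupoids as left cancellative categories\<close>

text \<open>Sections of a sheaf must be elements of the fixed type \<open>'u\<close>, while the
  constructions produce sets of pairs or families. Sheaves are therefore built on a natural type and
  carried over to \<open>'u\<close> by a bijection, after counting sections: a section of a
  sheafification is determined by one chosen representative for each arrow, and the functions from
  \<open>Arr G\<close> to \<open>'u\<close> are exactly what \<open>small_groupoid\<close> bounds.

  Arguments are elementwise. A sheafification is known by its generators: sections are locally
  generators, and two generators agree exactly when they are congruent. Universal properties and
  exactness are derived from this. The topology enters through the modality \<open>locally\<close>,
  for which pullback, transitivity and finite conjunction are proved once.

  For sufficiency, flatness is applied to two kinds of shape only, finite discrete ones and one that
  equalizes a parallel pair; all other uses are composed of these. Necessity has to treat every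
  finite shape, and there the inverse image is an arbitrary left adjoint, accessible only through
  its unit and its preservation of finite limits.\<close>

text \<open>A horizontal arrow \<open>h : B \<rightarrow> A'\<close> with \<open>A' \<le> A\<close> is regarded as a single arrow from
  \<open>B\<close> to \<open>A\<close>. This turns an ordered groupoid into an ordinary category, with presheaves as
  ordinary presheaves, vertical sieves as sieves, and hv-cones as cones. The target \<open>A\<close> is not
  recorded in \<open>h\<close>.\<close>

definition hvhom :: "('o, 'a, 'z) ordered_groupoid_scheme \<Rightarrow> 'o \<Rightarrow> 'o \<Rightarrow> 'a set" where
  "hvhom G B A = {h \<in> Arr G. Dom G h = B \<and> ole G (Cod G h) A}"

text \<open>The arrow \<open>t\<close> starts at an object above \<open>Cod G h\<close>, so a
  horizontal composite exists only after \<open>t\<close> is restricted to that codomain.\<close>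

definition hvcmp :: "('o, 'a, 'z) ordered_groupoid_scheme \<Rightarrow> 'a \<Rightarrow> 'a \<Rightarrow> 'a" where
  "hvcmp G t h = Cmp G (arr_restrict G t (Cod G h)) h"

text \<open>Restriction along \<open>h\<close>, taken as an arrow from its domain to
  \<open>A\<close>: first down to the actual codomain, then across. The object \<open>A\<close> has
  to be an argument because \<open>h\<close> does not determine it.\<close>

definition pull ::
  "('o, 'a, 'z) ordered_groupoid_scheme \<Rightarrow> ('o, 'a, 's) presheaf \<Rightarrow> 'o \<Rightarrow> 'a \<Rightarrow> 's \<Rightarrow> 's" where
  "pull G F A h x = hmap F h (vmap F A (Cod G h) x)"

text \<open>A modality in the style of forcing semantics: most proofs handle truth on a covering
  sieve through its rules and do not mention sieves. \<open>P\<close> need not be downward closed;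
  only the witnessing sieve is.\<close>

definition locally :: "('o \<Rightarrow> 'o set set) \<Rightarrow> 'o \<Rightarrow> ('o \<Rightarrow> bool) \<Rightarrow> bool" where
  "locally T A P \<longleftrightarrow> (\<exists>S\<in>T A. \<forall>B\<in>S. P B)"

context is_category
begin

lemma hom_Obj: "f \<in> hom C A B \<Longrightarrow> A \<in> Obj C \<and> B \<in> Obj C"
  using Dom_Obj Cod_Obj by (auto simp: hom_def)

lemma hom_Arr: "f \<in> hom C A B \<Longrightarrow> f \<in> Arr C \<and> Dom C f = A \<and> Cod C f = B"
  by (simp add: hom_def)

lemma Arr_hom: "f \<in> Arr C \<Longrightarrow> f \<in> hom C (Dom C f) (Cod C f)"
  by (simp add: hom_def)

lemma Idt_sel [simp]:
  "A \<in> Obj C \<Longrightarrow> Idt C A \<in> Arr C" "A \<in> Obj C \<Longrightarrow> Dom C (Idt C A) = A"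
  "A \<in> Obj C \<Longrightarrow> Cod C (Idt C A) = A"
  using Idt_hom by (auto simp: hom_def)

lemma Cmp_Idt_hom: "f \<in> hom C A B \<Longrightarrow> Cmp C f (Idt C A) = f"
  using Cmp_Idt by (auto simp: hom_def)

lemma Idt_Cmp_hom: "f \<in> hom C A B \<Longrightarrow> Cmp C (Idt C B) f = f"
  using Idt_Cmp by (auto simp: hom_def)

lemma Cmp_sel:
  assumes "f \<in> Arr C" "g \<in> Arr C" "Cod C f = Dom C g"
  shows "Cmp C g f \<in> Arr C" "Dom C (Cmp C g f) = Dom C f" "Cod C (Cmp C g f) = Cod C g"
  using Cmp_hom[of f "Dom C f" "Dom C g" g "Cod C g"] assms by (auto simp: hom_def)

end

context is_groupoid
begin

lemma arr_inv_hom: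
  assumes "f \<in> Arr C"
  shows "arr_inv C f \<in> hom C (Cod C f) (Dom C f) \<and>
    Cmp C (arr_inv C f) f = Idt C (Dom C f) \<and> Cmp C f (arr_inv C f) = Idt C (Cod C f)"
proof -
  obtain g where g: "g \<in> hom C (Cod C f) (Dom C f)"
    "Cmp C g f = Idt C (Dom C f)" "Cmp C f g = Idt C (Cod C f)"
    using ex_inverse[OF assms] by blast
  have f: "f \<in> hom C (Dom C f) (Cod C f)"
    using assms by (rule Arr_hom)
  have "g' = g" if g': "g' \<in> hom C (Cod C f) (Dom C f)" "Cmp C g' f = Idt C (Dom C f)" for g'
  proof -
    have "g' = Cmp C g' (Cmp C f g)"
      using g(3) Cmp_Idt_hom[OF g'(1)] by simp
    also have "\<dots> = Cmp C (Cmp C g' f) g"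
      using Cmp_assoc[OF g(1) f g'(1)] .
    also have "\<dots> = g"
      using g'(2) Idt_Cmp_hom[OF g(1)] by simp
    finally show ?thesis .
  qed
  then have "\<exists>!g. g \<in> hom C (Cod C f) (Dom C f) \<and>
      Cmp C g f = Idt C (Dom C f) \<and> Cmp C f g = Idt C (Cod C f)"
    using g by blast
  from theI'[OF this] show ?thesis
    unfolding arr_inv_def .
qed

end

section \<open>Order, restriction and composition of arrows in the left cancellative
  category\<close>

context is_ordered_groupoid
begin

lemma ole_Obj: "ole G B A \<Longrightarrow> B \<in> Obj G \<and> A \<in> Obj G"
  by (simp add: ole_def)

lemma ole_refl: "A \<in> Obj G \<Longrightarrow> ole G A A"
  by (simp add: ole_def ale_refl)

lemma ole_trans: "ole G A B \<Longrightarrow> ole G B C \<Longrightarrow> ole G A C"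
  unfolding ole_def using ale_trans Idt_sel(1) by blast

lemma ale_Dom: "f \<in> Arr G \<Longrightarrow> g \<in> Arr G \<Longrightarrow> ale G f g \<Longrightarrow> ole G (Dom G f) (Dom G g)"
  and ale_Cod: "f \<in> Arr G \<Longrightarrow> g \<in> Arr G \<Longrightarrow> ale G f g \<Longrightarrow> ole G (Cod G f) (Cod G g)"
proof -
  assume a: "f \<in> Arr G" "g \<in> Arr G" "ale G f g"
  note inv = arr_inv_hom[OF a(1)] arr_inv_hom[OF a(2)] ale_inv[OF a]
  have "ale G (Cmp G (arr_inv G f) f) (Cmp G (arr_inv G g) g)"
    by (rule ale_Cmp) (use inv a in \<open>auto simp: hom_def\<close>)
  then show "ole G (Dom G f) (Dom G g)"
    using inv a Dom_Obj by (simp add: ole_def)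
  have "ale G (Cmp G f (arr_inv G f)) (Cmp G g (arr_inv G g))"
    by (rule ale_Cmp) (use inv a in \<open>auto simp: hom_def\<close>)
  then show "ole G (Cod G f) (Cod G g)"
    using inv a Cod_Obj by (simp add: ole_def)
qed

lemma arr_restrict:
  assumes "f \<in> Arr G" "ole G A (Dom G f)"
  shows "arr_restrict G f A \<in> Arr G" "Dom G (arr_restrict G f A) = A"
    "ale G (arr_restrict G f A) f"
  using theI'[OF ex1_restriction[OF assms]] by (simp_all add: arr_restrict_def)

text \<open>Uniqueness of restrictions; this is how a composite of restrictions is recognized as the
  restriction of a composite.\<close>

lemma arr_restrict_eqI:
  assumes "f \<in> Arr G" "g \<in> Arr G" "ale G g f"
  shows "arr_restrict G f (Dom G g) = g"
  using ex1_restriction[OF assms(1) ale_Dom[OF assms(2,1,3)]] arr_restrict[OF assms(1) ale_Dom[OF assms(2,1,3)]]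
    assms by blast

lemma Cod_arr_restrict:
  assumes "f \<in> Arr G" "ole G A (Dom G f)"
  shows "ole G (Cod G (arr_restrict G f A)) (Cod G f)"
  using ale_Cod arr_restrict[OF assms] assms(1) by blast

lemma hvhom_Dom: "h \<in> hvhom G B A \<Longrightarrow> Dom G h = B"
  by (simp add: hvhom_def)

lemma hvhom_Obj: "h \<in> hvhom G B A \<Longrightarrow> B \<in> Obj G \<and> A \<in> Obj G"
  using Dom_Obj ole_Obj by (auto simp: hvhom_def)

lemma Arr_hvhom: "h \<in> Arr G \<Longrightarrow> h \<in> hvhom G (Dom G h) (Cod G h)"
  by (simp add: hvhom_def ole_refl Cod_Obj)

text \<open>A vertical arrow from \<open>B\<close> to \<open>A\<close> is encoded by the identity of
  \<open>B\<close>; throughout, \<open>Idt G B\<close> also stands for the inclusion of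
  \<open>B\<close> into whatever larger object the context names.\<close>

lemma Idt_hvhom: "ole G B A \<Longrightarrow> Idt G B \<in> hvhom G B A"
  using ole_Obj by (auto simp: hvhom_def)

lemma hvhom_mono: "h \<in> hvhom G B A \<Longrightarrow> ole G A A' \<Longrightarrow> h \<in> hvhom G B A'"
  using ole_trans by (auto simp: hvhom_def)

lemma hvcmp:
  assumes h: "h \<in> hvhom G B A" and t: "t \<in> Arr G" "Dom G t = A"
  shows "hvcmp G t h \<in> Arr G" "Dom G (hvcmp G t h) = B"
    "Cod G (hvcmp G t h) = Cod G (arr_restrict G t (Cod G h))"
    "ole G (Cod G (hvcmp G t h)) (Cod G t)"
proof -
  have l: "ole G (Cod G h) (Dom G t)"
    using h t by (simp add: hvhom_def)
  note r = arr_restrict[OF t(1) l]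
  show "hvcmp G t h \<in> Arr G" "Dom G (hvcmp G t h) = B"
    and c: "Cod G (hvcmp G t h) = Cod G (arr_restrict G t (Cod G h))"
    using Cmp_sel[of h "arr_restrict G t (Cod G h)"] r h by (auto simp: hvcmp_def hvhom_def)
  show "ole G (Cod G (hvcmp G t h)) (Cod G t)"
    using c Cod_arr_restrict[OF t(1) l] by simp
qed

lemma hvcmp_hvhom:
  "h \<in> hvhom G B A \<Longrightarrow> t \<in> hvhom G A D \<Longrightarrow> hvcmp G t h \<in> hvhom G B D"
  using hvcmp[of h B A t] ole_trans by (auto simp: hvhom_def)

lemma hvcmp_Idt_right:
  assumes "t \<in> Arr G" "ole G B (Dom G t)"
  shows "hvcmp G t (Idt G B) = arr_restrict G t B"
  using arr_restrict[OF assms] Cmp_Idt ole_Obj[OF assms(2)] by (metis Idt_sel(3) hvcmp_def)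

lemma arr_restrict_Dom:
  assumes "t \<in> Arr G"
  shows "arr_restrict G t (Dom G t) = t"
  using arr_restrict_eqI[OF assms assms] ale_refl assms by blast

lemma hom_hvhom: "f \<in> hom G A B \<Longrightarrow> f \<in> hvhom G A B"
  using Arr_hvhom[of f] by (auto simp: hom_def)

lemma hvhom_hom: "f \<in> hvhom G A B \<Longrightarrow> f \<in> hom G A (Cod G f)"
  by (auto simp: hom_def hvhom_def)

lemma hvcmp_eq_Cmp: "f \<in> hom G A B \<Longrightarrow> g \<in> hom G B D \<Longrightarrow> hvcmp G g f = Cmp G g f"
  using arr_restrict_Dom[of g] by (simp add: hvcmp_def hom_def)

lemma hvcmp_Idt: "t \<in> hvhom G A D \<Longrightarrow> hvcmp G t (Idt G A) = t"
  using hvcmp_Idt_right arr_restrict_Dom ole_refl Dom_Obj by (auto simp: hvhom_def)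

lemma Idt_hvcmp:
  assumes "h \<in> hvhom G B A"
  shows "hvcmp G (Idt G A) h = h"
proof -
  have c: "ole G (Cod G h) A" and h: "h \<in> Arr G"
    using assms by (auto simp: hvhom_def)
  then have "arr_restrict G (Idt G A) (Cod G h) = Idt G (Cod G h)"
    using arr_restrict_eqI[of "Idt G A" "Idt G (Cod G h)"] by (auto simp: ole_def)
  then show ?thesis
    using Idt_Cmp h by (simp add: hvcmp_def)
qed

text \<open>Both sides are \<open>s''\<close> after \<open>t'\<close> after \<open>h\<close>, where
  \<open>t'\<close> is \<open>t\<close> restricted to the codomain of \<open>h\<close> and
  \<open>s''\<close> is \<open>s\<close> restricted to the codomain of \<open>t'\<close>. Uniqueness
  of restrictions identifies \<open>Cmp G s'' t'\<close> with the restriction of the composite of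
  \<open>s\<close> and \<open>t\<close>.\<close>

lemma hvcmp_assoc:
  assumes h: "h \<in> hvhom G B A" and t: "t \<in> hvhom G A D" and s: "s \<in> hvhom G D E"
  shows "hvcmp G (hvcmp G s t) h = hvcmp G s (hvcmp G t h)"
proof -
  have arr: "h \<in> Arr G" "t \<in> Arr G" "s \<in> Arr G" and dom: "Dom G t = A" "Dom G s = D"
    and le: "ole G (Cod G h) (Dom G t)" "ole G (Cod G t) (Dom G s)"
    using assms by (auto simp: hvhom_def)
  define s' where "s' = arr_restrict G s (Cod G t)"
  define t' where "t' = arr_restrict G t (Cod G h)"
  define s'' where "s'' = arr_restrict G s' (Cod G t')"
  have s': "s' \<in> Arr G" "Dom G s' = Cod G t" "ale G s' s"
    using arr_restrict[OF arr(3) le(2)] by (auto simp: s'_def)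
  have t': "t' \<in> Arr G" "Dom G t' = Cod G h" "ale G t' t" "ole G (Cod G t') (Dom G s')"
    using arr_restrict[OF arr(2) le(1)] Cod_arr_restrict[OF arr(2) le(1)] s'
    by (auto simp: t'_def)
  have s'': "s'' \<in> Arr G" "Dom G s'' = Cod G t'" "ale G s'' s'"
    using arr_restrict[OF s'(1) t'(4)] by (auto simp: s''_def)
  have s''s: "s'' = arr_restrict G s (Cod G t')"
    using arr_restrict_eqI[OF arr(3) s''(1)] s'' s' arr ale_trans by metis
  have st: "hvcmp G s t = Cmp G s' t"
    by (simp add: hvcmp_def s'_def)
  have "ale G (Cmp G s'' t') (Cmp G s' t)"
    by (rule ale_Cmp) (use s'' s' t' arr in auto)
  moreover have "Dom G (Cmp G s'' t') = Cod G h" "Cmp G s'' t' \<in> Arr G" "Cmp G s' t \<in> Arr G"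
    using Cmp_sel s'' t' s' arr by auto
  ultimately have "arr_restrict G (Cmp G s' t) (Cod G h) = Cmp G s'' t'"
    using arr_restrict_eqI by metis
  then have "hvcmp G (hvcmp G s t) h = Cmp G (Cmp G s'' t') h"
    unfolding st by (simp add: hvcmp_def)
  also have "\<dots> = Cmp G s'' (Cmp G t' h)"
    by (rule Cmp_assoc[symmetric]) (use arr t' s'' in \<open>auto simp: hom_def\<close>)
  also have "Cmp G t' h = hvcmp G t h"
    by (simp add: hvcmp_def t'_def)
  also have "Cmp G s'' (hvcmp G t h) = hvcmp G s (hvcmp G t h)"
    using hvcmp(3)[OF h] arr dom s''s t'_def by (simp add: hvcmp_def)
  finally show ?thesis .
qed

lemma Cod_hvcmp_Idt:
  assumes "h \<in> hvhom G B A" "ole G B' B"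
  shows "ole G (Cod G (hvcmp G h (Idt G B'))) (Cod G h)"
  using hvcmp(4)[OF Idt_hvhom[OF assms(2)]] assms by (auto simp: hvhom_def)

text \<open>Factorization of the restriction of \<open>h\<close> to \<open>B'\<close>: an arrow onto
  its own codomain, followed by the inclusion of that codomain into \<open>A\<close>. A property
  known on a sieve of \<open>A\<close> is used at this codomain.\<close>

lemma hvcmp_restrict:
  assumes "h \<in> hvhom G B A" "ole G B' B"
  shows "hvcmp G h (Idt G B') \<in> hvhom G B' (Cod G (hvcmp G h (Idt G B')))"
    "hvcmp G (Idt G (Cod G (hvcmp G h (Idt G B')))) (hvcmp G h (Idt G B')) = hvcmp G h (Idt G B')"
    "ole G (Cod G (hvcmp G h (Idt G B'))) A"
proof -
  have *: "hvcmp G h (Idt G B') \<in> hvhom G B' A"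
    using hvcmp_hvhom[OF Idt_hvhom[OF assms(2)] assms(1)] .
  show 1: "hvcmp G h (Idt G B') \<in> hvhom G B' (Cod G (hvcmp G h (Idt G B')))"
    using Arr_hvhom * by (auto simp: hvhom_def)
  show "hvcmp G (Idt G (Cod G (hvcmp G h (Idt G B')))) (hvcmp G h (Idt G B')) = hvcmp G h (Idt G B')"
    using Idt_hvcmp[OF 1] .
  show "ole G (Cod G (hvcmp G h (Idt G B'))) A"
    using * by (simp add: hvhom_def)
qed

lemma hvcmp_Idt_Idt:
  assumes "h \<in> hvhom G B A" "ole G B' B" "ole G B'' B'"
  shows "hvcmp G (hvcmp G h (Idt G B')) (Idt G B'') = hvcmp G h (Idt G B'')"
  using hvcmp_assoc[OF Idt_hvhom[OF assms(3)] Idt_hvhom[OF assms(2)] assms(1)]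
    Idt_hvcmp[OF Idt_hvhom[OF assms(3)]] by simp

lemma hvcmp_move:
  assumes "h \<in> hvhom G B A" "k \<in> hvhom G D B" "ole G D' D"
  shows "hvcmp G (hvcmp G h k) (Idt G D') = hvcmp G h (hvcmp G k (Idt G D'))"
  using hvcmp_assoc[OF Idt_hvhom[OF assms(3)] assms(2,1)] .

end

section \<open>Covering sieves and the rules for local truth\<close>

context is_Ehresmann_site
begin

lemma locally_all: "A \<in> Obj G \<Longrightarrow> (\<And>B. ole G B A \<Longrightarrow> P B) \<Longrightarrow> locally T A P"
  unfolding locally_def by (intro bexI[OF _ ET1]) (auto simp: down_def)

lemma covering_le: "A \<in> Obj G \<Longrightarrow> S \<in> T A \<Longrightarrow> B \<in> S \<Longrightarrow> ole G B A"
  using covering_sieve by (fastforce simp: is_vertical_sieve_def down_def)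

lemma covering_down: "A \<in> Obj G \<Longrightarrow> S \<in> T A \<Longrightarrow> B \<in> S \<Longrightarrow> ole G B' B \<Longrightarrow> B' \<in> S"
  using covering_sieve by (fastforce simp: is_vertical_sieve_def)

lemma locally_mono:
  "A \<in> Obj G \<Longrightarrow> locally T A P \<Longrightarrow> (\<And>B. ole G B A \<Longrightarrow> P B \<Longrightarrow> Q B) \<Longrightarrow> locally T A Q"
  unfolding locally_def using covering_le by blast

text \<open>Along any arrow into a member of \<open>R\<close> the sieve \<open>S\<close> pulls back
  to the maximal sieve, which covers by \<open>ET1\<close>; so \<open>ET3\<close> applies.\<close>

lemma covering_superset:
  assumes A: "A \<in> Obj G" and R: "R \<in> T A" and S: "is_vertical_sieve G A S" and "R \<subseteq> S"
  shows "S \<in> T A"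
proof (rule ET3[OF A R S])
  fix A' D f
  assume *: "A' \<in> R" "f \<in> hom G D A'"
  have f: "f \<in> Arr G" "Dom G f = D" "Cod G f = A'"
    using * by (auto simp: hom_def)
  have "Cod G (arr_restrict G f B) \<in> S" if "ole G B D" for B
    using Cod_arr_restrict[OF f(1)] f that *(1) \<open>R \<subseteq> S\<close> S by (auto simp: is_vertical_sieve_def)
  then have "sieve_pullback G f S = down G D"
    using f by (auto simp: sieve_pullback_def down_def)
  then show "sieve_pullback G f S \<in> T D"
    using ET1 f Dom_Obj by auto
qed

lemma covering_pullback:
  assumes "S \<in> T A" "h \<in> hvhom G B A"
  shows "{B'. ole G B' B \<and> Cod G (hvcmp G h (Idt G B')) \<in> S} \<in> T B"
proof -
  have "h \<in> hom G B (Cod G h)" "ole G (Cod G h) A"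
    using assms(2) by (auto simp: hvhom_def hom_def)
  from ET2[OF assms(1) this(2,1)] have "sieve_pullback G h S \<in> T B" .
  moreover have "sieve_pullback G h S = {B'. ole G B' B \<and> Cod G (hvcmp G h (Idt G B')) \<in> S}"
    using assms(2) hvcmp_Idt_right[of h] by (auto simp: sieve_pullback_def hvhom_def)
  ultimately show ?thesis by simp
qed

lemma locally_pull:
  assumes "locally T A P" "h \<in> hvhom G B A"
  shows "locally T B (\<lambda>B'. P (Cod G (hvcmp G h (Idt G B'))))"
proof -
  obtain S where S: "S \<in> T A" "\<forall>B\<in>S. P B"
    using assms(1) by (auto simp: locally_def)
  then show ?thesis
    unfolding locally_def by (intro bexI[OF _ covering_pullback[OF S(1) assms(2)]]) auto
qed

text \<open>Stability under pullback, packaged for use: at an object \<open>D\<close> below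
  \<open>B\<close> the restricted arrow \<open>k\<close> ends at some \<open>E\<close> below
  \<open>A\<close> where \<open>P\<close> is known, and the premises supply the factorization of
  \<open>k\<close> through the inclusion of \<open>E\<close>.\<close>

lemma locally_pullI:
  assumes "locally T A P" and h: "h \<in> hvhom G B A"
    and Q: "\<And>D E k. ole G D B \<Longrightarrow> k = hvcmp G h (Idt G D) \<Longrightarrow> k \<in> hvhom G D E \<Longrightarrow>
      hvcmp G (Idt G E) k = k \<Longrightarrow> ole G E A \<Longrightarrow> P E \<Longrightarrow> Q D"
  shows "locally T B Q"
proof (rule locally_mono[OF _ locally_pull[OF assms(1,2)]])
  show "B \<in> Obj G" using hvhom_Obj[OF h] by simp
qed (rule Q[OF _ refl hvcmp_restrict[OF h]])

lemma locally_down: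
  assumes "locally T A P" "ole G B A"
  shows "locally T B P"
proof (rule locally_mono[OF _ locally_pull[OF assms(1) Idt_hvhom[OF assms(2)]]])
  show "B \<in> Obj G"
    using ole_Obj assms by blast
  show "P B'" if "ole G B' B" "P (Cod G (hvcmp G (Idt G B) (Idt G B')))" for B'
    using that Idt_hvcmp[OF Idt_hvhom[OF that(1)]] ole_Obj by simp
qed

text \<open>Transitivity of the topology. Along an arrow \<open>f\<close> into a member
  \<open>A'\<close> of \<open>S\<close>, the pullback of the union contains the pullback of the
  covering sieve \<open>R A'\<close>, so \<open>ET3\<close> applies.\<close>

lemma covering_bind:
  assumes A: "A \<in> Obj G" and S: "S \<in> T A" and R: "\<And>B. B \<in> S \<Longrightarrow> R B \<in> T B"
  shows "(\<Union>B\<in>S. R B) \<in> T A"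
proof (rule ET3[OF A S])
  have SO: "B \<in> Obj G" "ole G B A" if "B \<in> S" for B
    using covering_le[OF A S that] ole_Obj by auto
  show sv: "is_vertical_sieve G A (\<Union>B\<in>S. R B)"
    unfolding is_vertical_sieve_def down_def
    using covering_le[OF _ R] covering_down[OF _ R] SO ole_trans by blast
  fix A' D f
  assume *: "A' \<in> S" "f \<in> hom G D A'"
  have f: "f \<in> hvhom G D A'"
    using * Cod_Obj by (auto simp: hom_def hvhom_def intro!: ole_refl)
  have D: "D \<in> Obj G"
    using hvhom_Obj[OF f] by simp
  have s: "sieve_pullback G f X = {B'. ole G B' D \<and> Cod G (hvcmp G f (Idt G B')) \<in> X}" for X
    using f hvcmp_Idt_right[of f] by (auto simp: sieve_pullback_def hvhom_def)
  show "sieve_pullback G f (\<Union>B\<in>S. R B) \<in> T D"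
    unfolding s
  proof (rule covering_superset[OF D covering_pullback[OF R[OF *(1)] f]])
    show "is_vertical_sieve G D {B'. ole G B' D \<and> Cod G (hvcmp G f (Idt G B')) \<in> (\<Union>B\<in>S. R B)}"
      unfolding is_vertical_sieve_def down_def
    proof (intro conjI ballI allI impI)
      show "{B'. ole G B' D \<and> Cod G (hvcmp G f (Idt G B')) \<in> \<Union> (R ` S)} \<subseteq> {A'. ole G A' D}"
        by auto
      fix B B'
      assume "B \<in> {B'. ole G B' D \<and> Cod G (hvcmp G f (Idt G B')) \<in> \<Union> (R ` S)}" and le: "ole G B' B"
      then have B: "ole G B D" "Cod G (hvcmp G f (Idt G B)) \<in> \<Union> (R ` S)" by auto
      have "ole G (Cod G (hvcmp G f (Idt G B'))) (Cod G (hvcmp G f (Idt G B)))"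
        using Cod_hvcmp_Idt[OF hvcmp_restrict(1)[OF f B(1)] le] hvcmp_Idt_Idt[OF f B(1) le] by simp
      then show "B' \<in> {B'. ole G B' D \<and> Cod G (hvcmp G f (Idt G B')) \<in> \<Union> (R ` S)}"
        using B le ole_trans sv unfolding is_vertical_sieve_def by blast
    qed
  qed (use * in blast)
qed

lemma locally_bind:
  assumes "A \<in> Obj G" "locally T A P" "\<And>B. ole G B A \<Longrightarrow> P B \<Longrightarrow> locally T B Q"
  shows "locally T A Q"
proof -
  obtain S where S: "S \<in> T A" "\<forall>B\<in>S. P B"
    using assms(2) by (auto simp: locally_def)
  then have "\<forall>B\<in>S. \<exists>R\<in>T B. \<forall>D\<in>R. Q D"
    using assms(3) covering_le[OF assms(1) S(1)] by (auto simp: locally_def)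
  then obtain R where "\<And>B. B \<in> S \<Longrightarrow> R B \<in> T B \<and> (\<forall>D\<in>R B. Q D)"
    by metis
  then show ?thesis
    unfolding locally_def using covering_bind[OF assms(1) S(1), of R] by blast
qed

text \<open>Intersecting covers is a case of transitivity: inside a cover for \<open>P\<close>, the
  cover for \<open>Q\<close> is restricted to each member.\<close>

lemma locally_conj:
  assumes A: "A \<in> Obj G" and "locally T A P" "locally T A Q"
  shows "locally T A (\<lambda>B. P B \<and> Q B)"
proof -
  obtain S where S: "S \<in> T A" "\<forall>B\<in>S. P B"
    using assms(2) by (auto simp: locally_def)
  have "locally T A (\<lambda>B. B \<in> S)"
    using S by (auto simp: locally_def)
  then show ?thesis
  proof (rule locally_bind[OF A])
    fix B assume B: "ole G B A" "B \<in> S"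
    show "locally T B (\<lambda>B. P B \<and> Q B)"
    proof (rule locally_mono[OF _ locally_down[OF assms(3) B(1)]])
      show "B \<in> Obj G"
        using B ole_Obj by blast
    qed (use S covering_down[OF A S(1) B(2)] in blast)
  qed
qed

lemma locally_finite_ball:
  assumes "A \<in> Obj G" "finite X" "\<And>x. x \<in> X \<Longrightarrow> locally T A (P x)"
  shows "locally T A (\<lambda>B. \<forall>x\<in>X. P x B)"
  using assms(2,3)
proof (induction X)
  case empty
  then show ?case using locally_all assms(1) by simp
next
  case (insert x X)
  then show ?case using locally_conj[OF assms(1), of "P x" "\<lambda>B. \<forall>x\<in>X. P x B"] by simp
qed

end

section \<open>Presheaves and sheaves\<close>

text \<open>Presheaves are constructed from a single action of the arrows of the left cancellative
  category; horizontal and vertical maps are its two special cases.\<close>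

definition presheaf_of_pull ::
  "('o, 'a, 'z) ordered_groupoid_scheme \<Rightarrow> ('o \<Rightarrow> 's set) \<Rightarrow> ('o \<Rightarrow> 'a \<Rightarrow> 's \<Rightarrow> 's) \<Rightarrow> ('o, 'a, 's) presheaf"
  where
  "presheaf_of_pull G v a =
     \<lparr>val = v, hmap = (\<lambda>f. a (Cod G f) f), vmap = (\<lambda>A A'. a A (Idt G A'))\<rparr>"

context is_ordered_groupoid
begin

lemma hmap_in:
  assumes "is_presheaf G F" "f \<in> hom G A B" "x \<in> val F B"
  shows "hmap F f x \<in> val F A"
proof -
  have "hmap F f \<in> val F B \<rightarrow> val F A"
    using assms(1,2) unfolding is_presheaf_def by (elim conjE) blast
  then show ?thesis using assms(3) by (rule funcset_mem)
qed

lemma vmap_in: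
  assumes "is_presheaf G F" "ole G B A" "x \<in> val F A"
  shows "vmap F A B x \<in> val F B"
proof -
  have "vmap F A B \<in> val F A \<rightarrow> val F B"
    using assms(1,2) unfolding is_presheaf_def by (elim conjE) blast
  then show ?thesis using assms(3) by (rule funcset_mem)
qed

lemma pull_in:
  assumes F: "is_presheaf G F" and x: "x \<in> val F A" and h: "h \<in> hvhom G B A"
  shows "pull G F A h x \<in> val F B"
proof -
  have "h \<in> hom G B (Cod G h)" "ole G (Cod G h) A"
    using h by (auto simp: hvhom_def hom_def)
  then show ?thesis
    using hmap_in[OF F] vmap_in[OF F] x unfolding pull_def by blast
qed

lemma vmap_pull:
  assumes F: "is_presheaf G F" and x: "x \<in> val F A" and B: "ole G B A"
  shows "vmap F A B x = pull G F A (Idt G B) x"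
proof -
  have "vmap F A B x \<in> val F B"
    using vmap_in[OF F B x] .
  then show ?thesis
    using F B ole_Obj unfolding is_presheaf_def pull_def by auto
qed

lemma hmap_pull:
  assumes F: "is_presheaf G F" and f: "f \<in> hom G A B" and x: "x \<in> val F B"
  shows "hmap F f x = pull G F B f x"
proof -
  have "vmap F B B x = x" "Cod G f = B"
    using F f x hom_Obj unfolding is_presheaf_def by (auto simp: hom_def)
  then show ?thesis by (simp add: pull_def)
qed

lemma pull_Idt:
  assumes F: "is_presheaf G F" and A: "A \<in> Obj G" and x: "x \<in> val F A"
  shows "pull G F A (Idt G A) x = x"
proof -
  have "vmap F A A x = x" "hmap F (Idt G A) x = x"
    using assms unfolding is_presheaf_def by auto
  then show ?thesis using A by (simp add: pull_def)
qed

text \<open>The square law for presheaves, applied to the restriction of \<open>h\<close> to the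
  codomain of \<open>k\<close>, moves the vertical map of \<open>k\<close> past the horizontal map
  of \<open>h\<close>; then each kind of map composes with its own kind.\<close>

lemma pull_pull:
  assumes F: "is_presheaf G F" and x: "x \<in> val F A"
    and h: "h \<in> hvhom G B A" and k: "k \<in> hvhom G D B"
  shows "pull G F B k (pull G F A h x) = pull G F A (hvcmp G h k) x"
proof -
  define h' where "h' = arr_restrict G h (Cod G k)"
  have arr: "h \<in> Arr G" "Dom G h = B" "ole G (Cod G h) A"
    "k \<in> Arr G" "Dom G k = D" "ole G (Cod G k) (Dom G h)"
    using h k by (auto simp: hvhom_def)
  have h': "h' \<in> Arr G" "Dom G h' = Cod G k" "ale G h' h" "ole G (Cod G h') (Cod G h)"
    using arr_restrict[OF arr(1,6)] Cod_arr_restrict[OF arr(1,6)] by (auto simp: h'_def)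
  define y where "y = vmap F A (Cod G h) x"
  have y: "y \<in> val F (Cod G h)"
    using vmap_in[OF F arr(3) x] y_def by simp
  have y': "vmap F (Cod G h) (Cod G h') y \<in> val F (Cod G h')"
    using vmap_in[OF F h'(4) y] .
  have "pull G F B k (pull G F A h x) = hmap F k (vmap F B (Cod G k) (hmap F h y))"
    by (simp add: pull_def y_def)
  also have "vmap F B (Cod G k) (hmap F h y) = hmap F h' (vmap F (Cod G h) (Cod G h') y)"
  proof -
    have "h \<in> hom G B (Cod G h)" "h' \<in> hom G (Cod G k) (Cod G h')"
      using arr h' by (auto simp: hom_def)
    then show ?thesis
      using F h'(3) y unfolding is_presheaf_def by metis
  qed
  also have "hmap F k \<dots> = hmap F (Cmp G h' k) (vmap F (Cod G h) (Cod G h') y)"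
  proof -
    have "k \<in> hom G D (Cod G k)" "h' \<in> hom G (Cod G k) (Cod G h')"
      using arr h' by (auto simp: hom_def)
    then show ?thesis
      using F y' unfolding is_presheaf_def by metis
  qed
  also have "vmap F (Cod G h) (Cod G h') y = vmap F A (Cod G h') x"
    using F x arr h'(4) unfolding is_presheaf_def y_def by metis
  also have "Cmp G h' k = hvcmp G h k"
    by (simp add: h'_def hvcmp_def)
  also have "hmap F (hvcmp G h k) (vmap F A (Cod G h') x) = pull G F A (hvcmp G h k) x"
    using hvcmp(3)[OF k, of h] arr by (simp add: pull_def h'_def)
  finally show ?thesis .
qed

lemma presheaf_of_pull:
  assumes v: "\<And>A B h x. h \<in> hvhom G B A \<Longrightarrow> x \<in> v A \<Longrightarrow> a A h x \<in> v B"
    and i: "\<And>A x. A \<in> Obj G \<Longrightarrow> x \<in> v A \<Longrightarrow> a A (Idt G A) x = x"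
    and c: "\<And>A B D h k x. h \<in> hvhom G B A \<Longrightarrow> k \<in> hvhom G D B \<Longrightarrow> x \<in> v A \<Longrightarrow>
      a B k (a A h x) = a A (hvcmp G h k) x"
  shows "is_presheaf G (presheaf_of_pull G v a)"
    and "h \<in> hvhom G B A \<Longrightarrow> x \<in> v A \<Longrightarrow> pull G (presheaf_of_pull G v a) A h x = a A h x"
    and "val (presheaf_of_pull G v a) = v"
proof -
  let ?F = "presheaf_of_pull G v a"
  have hv: "f \<in> hvhom G A B" if "f \<in> hom G A B" for f A B
    using that Arr_hvhom[of f] by (auto simp: hom_def)
  \<comment> \<open>Both sides are the action on \<open>x\<close> of \<open>f'\<close>, regarded as
    an arrow from \<open>A'\<close> to \<open>B\<close>: it factors through the inclusion of
    \<open>B'\<close> and is also the restriction of \<open>f\<close> to \<open>A'\<close>.\<close>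
  have sq: "a B' f' (a B (Idt G B') x) = a A (Idt G A') (a B f x)"
    if f: "f \<in> hom G A B" and f': "f' \<in> hom G A' B'" and le: "ale G f' f" and x: "x \<in> v B"
    for A B A' B' f f' x
  proof -
    have fs: "f \<in> Arr G" "f' \<in> Arr G" "Dom G f = A" "Cod G f = B" "Dom G f' = A'" "Cod G f' = B'"
      using f f' by (auto simp: hom_def)
    have l: "ole G A' A" "ole G B' B"
      using ale_Dom[OF fs(2,1) le] ale_Cod[OF fs(2,1) le] fs by auto
    have "hvcmp G (Idt G B') f' = f'"
      using Idt_hvcmp[OF hv[OF f']] .
    moreover have "hvcmp G f (Idt G A') = f'"
      using hvcmp_Idt_right[of f A'] arr_restrict_eqI[of f f'] fs le l by auto
    ultimately show ?thesis
      using c[OF Idt_hvhom[OF l(2)] hv[OF f'] x] c[OF hv[OF f] Idt_hvhom[OF l(1)] x] by simp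
  qed
  show "is_presheaf G ?F"
    unfolding is_presheaf_def
  proof (intro conjI allI impI ballI)
    fix A B f assume "f \<in> hom G A B"
    then show "hmap ?F f
        \<in> val ?F B \<rightarrow> val ?F A"
      using v[OF hv] by (auto simp: presheaf_of_pull_def hom_def)
  next
    fix A x assume "A \<in> Obj G" "x \<in> val ?F A"
    then show "hmap ?F (Idt G A) x = x"
      "vmap ?F A A x = x"
      using i by (auto simp: presheaf_of_pull_def)
  next
    fix A B D f g x
    assume *: "f \<in> hom G A B" "g \<in> hom G B D" "x \<in> val ?F D"
    have "hvcmp G g f = Cmp G g f"
      using * arr_restrict_Dom[of g] by (simp add: hvcmp_def hom_def)
    then show "hmap ?F (Cmp G g f) x =
      hmap ?F f (hmap ?F g x)"
      using * c[OF hv[OF *(2)] hv[OF *(1)]] Cmp_hom[OF *(1,2)]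
      by (simp add: presheaf_of_pull_def hom_def)
  next
    fix A A' assume "ole G A' A"
    then show "vmap ?F A A'
        \<in> val ?F A \<rightarrow> val ?F A'"
      using v[OF Idt_hvhom] by (auto simp: presheaf_of_pull_def)
  next
    fix A A' A'' x
    assume *: "ole G A'' A'" "ole G A' A" "x \<in> val ?F A"
    have "hvcmp G (Idt G A') (Idt G A'') = Idt G A''"
      using Idt_hvcmp[OF Idt_hvhom[OF *(1)]] .
    then show "vmap ?F A A'' x =
       vmap ?F A' A'' (vmap ?F A A' x)"
      using c[OF Idt_hvhom[OF *(2)] Idt_hvhom[OF *(1)]] *(3) by (simp add: presheaf_of_pull_def)
  next
    fix A B A' B' f f' x
    assume *: "f \<in> hom G A B" "f' \<in> hom G A' B'" "ale G f' f"
      "x \<in> val ?F B"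
    show "hmap ?F f' (vmap ?F B B' x) =
       vmap ?F A A' (hmap ?F f x)"
      using sq[OF *(1-3)] * by (simp add: presheaf_of_pull_def hom_def)
  qed
  show "val (presheaf_of_pull G v a) = v"
    by (simp add: presheaf_of_pull_def)
  assume h: "h \<in> hvhom G B A" and x: "x \<in> v A"
  have le: "ole G (Cod G h) A" and hc: "h \<in> hvhom G B (Cod G h)"
    using h Arr_hvhom by (auto simp: hvhom_def)
  show "pull G (presheaf_of_pull G v a) A h x = a A h x"
    using c[OF Idt_hvhom[OF le] hc x] Idt_hvcmp[OF hc] by (simp add: presheaf_of_pull_def pull_def)
qed

lemma presheaf_mor_iff:
  assumes "is_presheaf G (src m)" "is_presheaf G (tgt m)"
  shows "is_presheaf_mor G m \<longleftrightarrow>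
     cmpt m \<in> (\<Pi>\<^sub>E A\<in>Obj G. val (src m) A \<rightarrow>\<^sub>E val (tgt m) A) \<and>
     (\<forall>A B h. h \<in> hvhom G B A \<longrightarrow> (\<forall>x\<in>val (src m) A.
        cmpt m B (pull G (src m) A h x) = pull G (tgt m) A h (cmpt m A x)))"
    (is "_ \<longleftrightarrow> ?E \<and> ?P")
proof (intro iffI conjI allI impI ballI)
  assume m: "is_presheaf_mor G m"
  then show ?E by (auto simp: is_presheaf_mor_def)
  fix A B h x assume h: "h \<in> hvhom G B A" and x: "x \<in> val (src m) A"
  then have *: "h \<in> hom G B (Cod G h)" "ole G (Cod G h) A"
    by (auto simp: hvhom_def hom_def)
  have "vmap (src m) A (Cod G h) x \<in> val (src m) (Cod G h)"
    using vmap_in[OF assms(1) *(2) x] .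
  then show "cmpt m B (pull G (src m) A h x) = pull G (tgt m) A h (cmpt m A x)"
    using m * x unfolding is_presheaf_mor_def pull_def by simp
next
  assume EP: "?E \<and> ?P"
  then have E: ?E and P: ?P by auto
  have val: "cmpt m A x \<in> val (tgt m) A" if "A \<in> Obj G" "x \<in> val (src m) A" for A x
    using E that by blast
  show "is_presheaf_mor G m"
    unfolding is_presheaf_mor_def
  proof (intro conjI allI impI ballI)
    fix A B f x assume f: "f \<in> hom G A B" and x: "x \<in> val (src m) B"
    have "f \<in> hvhom G A B"
      using f Arr_hvhom[of f] by (auto simp: hom_def)
    then show "cmpt m A (hmap (src m) f x) = hmap (tgt m) f (cmpt m B x)"
      using P x hmap_pull[OF assms(1) f x] hmap_pull[OF assms(2) f] val hom_Obj[OF f] by auto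
  next
    fix A A' x assume A: "ole G A' A" and x: "x \<in> val (src m) A"
    then show "cmpt m A' (vmap (src m) A A' x) = vmap (tgt m) A A' (cmpt m A x)"
      using P Idt_hvhom[OF A] vmap_pull[OF assms(1) x A] vmap_pull[OF assms(2) _ A] val ole_Obj[OF A]
      by auto
  qed (rule E)
qed

end

section \<open>The category of sheaves, separatedness and gluing\<close>

lemma Sh_sel [simp]:
  "Obj (Sh G T) = {F. is_sheaf G T F}"
  "Arr (Sh G T) = {m. is_sheaf G T (src m) \<and> is_sheaf G T (tgt m) \<and> is_presheaf_mor G m}"
  "Dom (Sh G T) = src" "Cod (Sh G T) = tgt"
  by (simp_all add: Sh_def)

lemma Sh_hom:
  "m \<in> hom (Sh G T) F F' \<longleftrightarrow>
     is_sheaf G T F \<and> is_sheaf G T F' \<and> src m = F \<and> tgt m = F' \<and> is_presheaf_mor G m"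
  by (auto simp: hom_def)

lemma presheaf_mor_eqI:
  assumes "is_presheaf_mor G m" "is_presheaf_mor G m'" "src m = src m'" "tgt m = tgt m'"
    and "\<And>A x. A \<in> Obj G \<Longrightarrow> x \<in> val (src m) A \<Longrightarrow> cmpt m A x = cmpt m' A x"
  shows "m = m'"
proof -
  have "cmpt m = cmpt m'"
  proof (rule ext)
    fix A
    show "cmpt m A = cmpt m' A"
    proof (cases "A \<in> Obj G")
      case True
      then have "cmpt m A \<in> val (src m) A \<rightarrow>\<^sub>E val (tgt m) A" "cmpt m' A \<in> val (src m) A \<rightarrow>\<^sub>E val (tgt m) A"
        using assms(1-4) by (auto simp: is_presheaf_mor_def dest: PiE_mem)
      then show ?thesis
        using assms(5)[OF True] by (auto intro: PiE_ext)
    next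
      case False
      then show ?thesis
        using PiE_arb[OF conjunct1[OF assms(1)[unfolded is_presheaf_mor_def]] False]
          PiE_arb[OF conjunct1[OF assms(2)[unfolded is_presheaf_mor_def]] False] by simp
    qed
  qed
  then show ?thesis
    using assms(3,4) by (cases m; cases m') auto
qed

context is_Ehresmann_site
begin

lemma sheaf_presheaf: "is_sheaf G T F \<Longrightarrow> is_presheaf G F"
  by (simp add: is_sheaf_def)

lemma sheaf_ex1:
  assumes "is_sheaf G T F" "A \<in> Obj G" "S \<in> T A" "\<And>B. B \<in> S \<Longrightarrow> x B \<in> val F B"
    and "\<And>B D. B \<in> S \<Longrightarrow> D \<in> S \<Longrightarrow> ole G D B \<Longrightarrow> vmap F B D (x B) = x D"
  shows "\<exists>!y. y \<in> val F A \<and> (\<forall>B\<in>S. vmap F A B y = x B)"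
proof -
  have "(\<forall>B\<in>S. x B \<in> val F B) \<and> (\<forall>B\<in>S. \<forall>D\<in>S. ole G D B \<longrightarrow> vmap F B D (x B) = x D)"
    using assms(4,5) by simp
  then show ?thesis
    by (rule conjunct2[OF assms(1)[unfolded is_sheaf_def], THEN bspec, OF assms(2), THEN bspec,
          OF assms(3), THEN spec, THEN mp])
qed

lemmas sheaf_pull_in = pull_in[OF sheaf_presheaf]
lemmas sheaf_pull_Idt = pull_Idt[OF sheaf_presheaf]
lemmas sheaf_pull_pull = pull_pull[OF sheaf_presheaf]

text \<open>The family of restrictions of \<open>x\<close> is matching, and both \<open>x\<close>
  and \<open>y\<close> amalgamate it.\<close>

lemma sheaf_separated:
  assumes F: "is_sheaf G T F" and A: "A \<in> Obj G" and x: "x \<in> val F A" "y \<in> val F A"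
    and l: "locally T A (\<lambda>B. pull G F A (Idt G B) x = pull G F A (Idt G B) y)"
  shows "x = y"
proof -
  obtain S where S: "S \<in> T A" "\<forall>B\<in>S. pull G F A (Idt G B) x = pull G F A (Idt G B) y"
    using l by (auto simp: locally_def)
  note le = covering_le[OF A S(1)]
  note P = sheaf_presheaf[OF F]
  have "\<exists>!z. z \<in> val F A \<and> (\<forall>B\<in>S. vmap F A B z = vmap F A B x)"
  proof -
    have "\<forall>B\<in>S. vmap F A B x \<in> val F B"
      using vmap_in[OF P le] x by blast
    moreover have "\<forall>B\<in>S. \<forall>D\<in>S. ole G D B \<longrightarrow> vmap F B D (vmap F A B x) = vmap F A D x"
      using P x le unfolding is_presheaf_def by metis
    ultimately show ?thesis
      using sheaf_ex1[OF F A S(1), of "\<lambda>B. vmap F A B x"] by blast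
  qed
  moreover have "\<forall>B\<in>S. vmap F A B y = vmap F A B x"
    using S(2) vmap_pull[OF P _ le] x by simp
  ultimately show ?thesis
    using x by blast
qed

text \<open>Gluing by description: \<open>Q B z\<close> says that \<open>z\<close> is the right
  section at \<open>B\<close>. Uniqueness turns arbitrary choices on a cover into a matching family,
  and by separatedness the result agrees with every described section, also outside the cover that
  was used.\<close>

lemma sheaf_glue:
  assumes F: "is_sheaf G T F" and A: "A \<in> Obj G"
    and ex: "locally T A (\<lambda>B. \<exists>z\<in>val F B. Q B z)"
    and down: "\<And>B D z. ole G B A \<Longrightarrow> ole G D B \<Longrightarrow> z \<in> val F B \<Longrightarrow> Q B z \<Longrightarrow> Q D (pull G F B (Idt G D) z)"
    and uniq: "\<And>B z w. ole G B A \<Longrightarrow> z \<in> val F B \<Longrightarrow> w \<in> val F B \<Longrightarrow> Q B z \<Longrightarrow> Q B w \<Longrightarrow> z = w"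
  shows "\<exists>y\<in>val F A. \<forall>B z. ole G B A \<longrightarrow> z \<in> val F B \<longrightarrow> Q B z \<longrightarrow> pull G F A (Idt G B) y = z"
proof -
  note P = sheaf_presheaf[OF F]
  obtain S where S: "S \<in> T A" "\<forall>B\<in>S. \<exists>z\<in>val F B. Q B z"
    using ex by (auto simp: locally_def)
  note le = covering_le[OF A S(1)]
  from S(2) obtain x where x: "\<And>B. B \<in> S \<Longrightarrow> x B \<in> val F B \<and> Q B (x B)"
    by metis
  have "vmap F B D (x B) = x D" if "B \<in> S" "D \<in> S" "ole G D B" for B D
    using uniq[OF le[OF that(2)] pull_in[OF P _ Idt_hvhom[OF that(3)]], of "x B" "x D"]
      down[OF le[OF that(1)] that(3)] x[OF that(1)] x[OF that(2)] vmap_pull[OF P _ that(3)] by auto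
  then have "\<exists>!y. y \<in> val F A \<and> (\<forall>B\<in>S. vmap F A B y = x B)"
    using sheaf_ex1[OF F A S(1), of x] x by blast
  then obtain y where y: "y \<in> val F A" "\<And>B. B \<in> S \<Longrightarrow> vmap F A B y = x B"
    by blast
  have "pull G F A (Idt G B) y = z" if B: "ole G B A" and z: "z \<in> val F B" "Q B z" for B z
  proof (rule sheaf_separated[OF F])
    show BO: "B \<in> Obj G"
      using B ole_Obj by blast
    show yB: "pull G F A (Idt G B) y \<in> val F B"
      using pull_in[OF P y(1) Idt_hvhom[OF B]] .
    show "z \<in> val F B" by fact
    have "locally T A (\<lambda>B. B \<in> S)"
      using S by (auto simp: locally_def)
    from locally_down[OF this B]
    show "locally T B (\<lambda>D. pull G F B (Idt G D) (pull G F A (Idt G B) y) = pull G F B (Idt G D) z)"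
    proof (rule locally_mono[OF BO])
      fix D assume D: "ole G D B" "D \<in> S"
      have "pull G F B (Idt G D) (pull G F A (Idt G B) y) = pull G F A (Idt G D) y"
        using pull_pull[OF P y(1) Idt_hvhom[OF B] Idt_hvhom[OF D(1)]] Idt_hvcmp[OF Idt_hvhom[OF D(1)]]
        by simp
      also have "\<dots> = x D"
        using y(2)[OF D(2)] vmap_pull[OF P y(1) le[OF D(2)]] by simp
      also have "\<dots> = pull G F B (Idt G D) z"
        using uniq[OF le[OF D(2)]] x[OF D(2)] down[OF B D(1) z] pull_in[OF P z(1) Idt_hvhom[OF D(1)]]
        by blast
      finally show "pull G F B (Idt G D) (pull G F A (Idt G B) y) = pull G F B (Idt G D) z" .
    qed
  qed
  then show ?thesis using y(1) by blast
qed

text \<open>Splits the sheaf condition into separatedness and existence, both phrased by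
  \<open>pull\<close>. In the gluing premise \<open>D\<close> has only to lie below
  \<open>B\<close>, because sieves are downward closed.\<close>

lemma is_sheafI:
  assumes P: "is_presheaf G F"
    and sep: "\<And>A x y. A \<in> Obj G \<Longrightarrow> x \<in> val F A \<Longrightarrow> y \<in> val F A \<Longrightarrow>
      locally T A (\<lambda>B. pull G F A (Idt G B) x = pull G F A (Idt G B) y) \<Longrightarrow> x = y"
    and glue: "\<And>A S x. A \<in> Obj G \<Longrightarrow> S \<in> T A \<Longrightarrow> (\<And>B. B \<in> S \<Longrightarrow> x B \<in> val F B) \<Longrightarrow>
      (\<And>B D. B \<in> S \<Longrightarrow> ole G D B \<Longrightarrow> pull G F B (Idt G D) (x B) = x D) \<Longrightarrow>
      \<exists>y\<in>val F A. \<forall>B\<in>S. pull G F A (Idt G B) y = x B"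
  shows "is_sheaf G T F"
  unfolding is_sheaf_def
proof (intro conjI ballI allI impI)
  fix A S x
  assume A: "A \<in> Obj G" and S: "S \<in> T A"
    and x: "(\<forall>B\<in>S. x B \<in> val F B) \<and> (\<forall>B\<in>S. \<forall>D\<in>S. ole G D B \<longrightarrow> vmap F B D (x B) = x D)"
  note le = covering_le[OF A S]
  have "pull G F B (Idt G D) (x B) = x D" if "B \<in> S" "ole G D B" for B D
    using x that covering_down[OF A S that] vmap_pull[OF P _ that(2)] by force
  with glue[OF A S] x obtain y where y: "y \<in> val F A" "\<forall>B\<in>S. pull G F A (Idt G B) y = x B"
    by blast
  show "\<exists>!y. y \<in> val F A \<and> (\<forall>B\<in>S. vmap F A B y = x B)"
  proof (intro ex1I[of _ y] conjI ballI)
    show "vmap F A B y = x B" if "B \<in> S" for B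
      using y that vmap_pull[OF P y(1) le] by simp
    fix z assume z: "z \<in> val F A \<and> (\<forall>B\<in>S. vmap F A B z = x B)"
    then have "\<forall>B\<in>S. pull G F A (Idt G B) z = pull G F A (Idt G B) y"
      using y vmap_pull[OF P _ le] by force
    then show "z = y"
      using sep[OF A _ y(1)] z S by (auto simp: locally_def)
  qed (rule y(1))
qed (rule P)

lemma Sh_mor_in: "m \<in> hom (Sh G T) F F' \<Longrightarrow> A \<in> Obj G \<Longrightarrow> x \<in> val F A \<Longrightarrow> cmpt m A x \<in> val F' A"
  by (auto simp: Sh_hom is_presheaf_mor_def)

lemma Sh_mor_pull:
  assumes "m \<in> hom (Sh G T) F F'" "h \<in> hvhom G B A" "x \<in> val F A"
  shows "cmpt m B (pull G F A h x) = pull G F' A h (cmpt m A x)"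
proof -
  have "is_presheaf G (src m)" "is_presheaf G (tgt m)" "is_presheaf_mor G m" "src m = F" "tgt m = F'"
    using assms(1) sheaf_presheaf by (auto simp: Sh_hom)
  then show ?thesis
    using presheaf_mor_iff[of m] assms(2,3) by auto
qed

lemma Sh_mor_eqI:
  assumes "m \<in> hom (Sh G T) F F'" "m' \<in> hom (Sh G T) F F'"
    and "\<And>A x. A \<in> Obj G \<Longrightarrow> x \<in> val F A \<Longrightarrow> cmpt m A x = cmpt m' A x"
  shows "m = m'"
  using presheaf_mor_eqI[of G m m'] assms by (auto simp: Sh_hom)

lemma Sh_mor_ex:
  assumes F: "is_sheaf G T F" "is_sheaf G T F'"
    and c: "\<And>A x. A \<in> Obj G \<Longrightarrow> x \<in> val F A \<Longrightarrow> c A x \<in> val F' A"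
    and n: "\<And>A B h x. h \<in> hvhom G B A \<Longrightarrow> x \<in> val F A \<Longrightarrow> c B (pull G F A h x) = pull G F' A h (c A x)"
  shows "\<exists>m\<in>hom (Sh G T) F F'. \<forall>A\<in>Obj G. \<forall>x\<in>val F A. cmpt m A x = c A x"
proof
  define m where "m = \<lparr>src = F, tgt = F', cmpt = (\<lambda>A\<in>Obj G. \<lambda>x\<in>val F A. c A x)\<rparr>"
  show "\<forall>A\<in>Obj G. \<forall>x\<in>val F A. cmpt m A x = c A x"
    by (simp add: m_def)
  have "is_presheaf_mor G m"
    using F c n hvhom_Obj pull_in[OF sheaf_presheaf[OF F(1)]]
    by (subst presheaf_mor_iff) (auto simp: m_def sheaf_presheaf)
  then show "m \<in> hom (Sh G T) F F'"
    using F by (simp add: Sh_hom m_def)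
qed

lemma Sh_Idt:
  assumes "is_sheaf G T F"
  shows "Idt (Sh G T) F \<in> hom (Sh G T) F F"
proof -
  define i where "i = Idt (Sh G T) F"
  have i: "src i = F" "tgt i = F" "cmpt i = (\<lambda>A\<in>Obj G. \<lambda>x\<in>val F A. x)"
    by (auto simp: i_def Sh_def)
  have "is_presheaf_mor G i"
    using sheaf_pull_in[OF assms] hvhom_Obj
    by (subst presheaf_mor_iff) (auto simp: i sheaf_presheaf[OF assms])
  then show ?thesis
    using assms i by (simp add: Sh_hom i_def[symmetric])
qed

lemma Sh_Idt_apply: "A \<in> Obj G \<Longrightarrow> x \<in> val F A \<Longrightarrow> cmpt (Idt (Sh G T) F) A x = x"
  by (simp add: Sh_def)

lemma Sh_Cmp_apply:
  assumes "m \<in> hom (Sh G T) F F'" "A \<in> Obj G" "x \<in> val F A"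
  shows "cmpt (Cmp (Sh G T) n m) A x = cmpt n A (cmpt m A x)"
  using assms by (simp add: Sh_def hom_def compose_def)

lemma Sh_Cmp:
  assumes m: "m \<in> hom (Sh G T) F F'" and n: "n \<in> hom (Sh G T) F' F''"
  shows "Cmp (Sh G T) n m \<in> hom (Sh G T) F F''"
proof -
  define c where "c = Cmp (Sh G T) n m"
  have c: "src c = F" "tgt c = F''" "cmpt c = (\<lambda>A\<in>Obj G. compose (val F A) (cmpt n A) (cmpt m A))"
    using m n by (auto simp: c_def Sh_def hom_def)
  have sh: "is_sheaf G T F" "is_sheaf G T F''"
    using m n by (auto simp: Sh_hom)
  have "is_presheaf_mor G c"
  proof (subst presheaf_mor_iff)
    show "cmpt c \<in> (\<Pi>\<^sub>E A\<in>Obj G. val (src c) A \<rightarrow>\<^sub>E val (tgt c) A) \<and>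
      (\<forall>A B h. h \<in> hvhom G B A \<longrightarrow> (\<forall>x\<in>val (src c) A.
        cmpt c B (pull G (src c) A h x) = pull G (tgt c) A h (cmpt c A x)))"
      using Sh_mor_in[OF m] Sh_mor_in[OF n] Sh_mor_pull[OF m] Sh_mor_pull[OF n] hvhom_Obj
        pull_in[OF sheaf_presheaf[OF sh(1)]]
      by (auto simp: c compose_def)
  qed (use sh sheaf_presheaf c in auto)
  then show ?thesis
    using sh c by (simp add: Sh_hom c_def[symmetric])
qed

lemma Sh_category: "is_category (Sh G T)"
proof
  fix f :: "('o, 'a, 'u) presheaf_mor"
  assume f: "f \<in> Arr (Sh G T)"
  then show "Dom (Sh G T) f \<in> Obj (Sh G T)" "Cod (Sh G T) f \<in> Obj (Sh G T)"
    by auto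
  have f': "f \<in> hom (Sh G T) (src f) (tgt f)" and i: "is_sheaf G T (src f)" "is_sheaf G T (tgt f)"
    using f by (auto simp: Sh_hom)
  show "Cmp (Sh G T) f (Idt (Sh G T) (Dom (Sh G T) f)) = f"
    using Sh_mor_eqI[OF Sh_Cmp[OF Sh_Idt[OF i(1)] f'] f'] Sh_Cmp_apply[OF Sh_Idt[OF i(1)]]
    by (simp add: Sh_Idt_apply)
  show "Cmp (Sh G T) (Idt (Sh G T) (Cod (Sh G T) f)) f = f"
    using Sh_mor_eqI[OF Sh_Cmp[OF f' Sh_Idt[OF i(2)]] f'] Sh_Cmp_apply[OF f'] Sh_mor_in[OF f']
    by (simp add: Sh_Idt_apply)
next
  fix f g h :: "('o, 'a, 'u) presheaf_mor" and A B D E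
  assume f: "f \<in> hom (Sh G T) A B" and g: "g \<in> hom (Sh G T) B D"
  show "Cmp (Sh G T) g f \<in> hom (Sh G T) A D"
    using Sh_Cmp[OF f g] .
  assume h: "h \<in> hom (Sh G T) D E"
  show "Cmp (Sh G T) h (Cmp (Sh G T) g f) = Cmp (Sh G T) (Cmp (Sh G T) h g) f"
    using Sh_mor_eqI[OF Sh_Cmp[OF Sh_Cmp[OF f g] h] Sh_Cmp[OF f Sh_Cmp[OF g h]]]
      Sh_Cmp_apply[OF Sh_Cmp[OF f g]] Sh_Cmp_apply[OF f] Sh_Cmp_apply[OF g] Sh_mor_in[OF f] by simp
qed (use Sh_Idt in auto)

end

section \<open>Cardinality bounds\<close>

lemma infinite_times_lepoll:
  assumes "infinite (UNIV :: 'u set)" "A \<lesssim> (UNIV :: 'u set)" "B \<lesssim> (UNIV :: 'u set)"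
  shows "A \<times> B \<lesssim> (UNIV :: 'u set)"
proof -
  have "(UNIV :: 'u set) \<times> (UNIV :: 'u set) \<approx> (UNIV :: 'u set)"
    using card_of_Times_same_infinite[OF assms(1)] by (simp add: eqpoll_iff_card_of_ordIso)
  then show ?thesis
    using times_lepoll_mono[OF assms(2,3)] lepoll_trans2 by blast
qed

lemma finite_funcset_lepoll:
  assumes "infinite (UNIV :: 'u set)" "finite J"
  shows "(J \<rightarrow>\<^sub>E (UNIV :: 'u set)) \<lesssim> (UNIV :: 'u set)"
  using assms(2)
proof (induction J)
  case empty
  then show ?case
    using assms(1) by (simp add: PiE_empty_domain finite_lepoll_infinite)
next
  case (insert j J)
  have "inj_on (\<lambda>f. (f j, restrict f J)) (insert j J \<rightarrow>\<^sub>E (UNIV :: 'u set))"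
  proof (rule inj_onI)
    fix f g assume fg: "f \<in> insert j J \<rightarrow>\<^sub>E (UNIV :: 'u set)" "g \<in> insert j J \<rightarrow>\<^sub>E UNIV"
      "(f j, restrict f J) = (g j, restrict g J)"
    show "f = g"
    proof (rule PiE_ext[OF fg(1,2)])
      fix i assume "i \<in> insert j J"
      then show "f i = g i"
        using fg(3) by (metis insertE prod.inject restrict_apply')
    qed
  qed
  then have "(insert j J \<rightarrow>\<^sub>E (UNIV :: 'u set)) \<lesssim> (UNIV :: 'u set) \<times> (J \<rightarrow>\<^sub>E (UNIV :: 'u set))"
    unfolding lepoll_def by (intro exI[of _ "\<lambda>f. (f j, restrict f J)"]) auto
  then show ?case
    using infinite_times_lepoll[OF assms(1) lepoll_refl insert.IH] lepoll_trans by blast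
qed

lemma (in is_category) Obj_lepoll_Arr: "Obj C \<lesssim> Arr C"
  unfolding lepoll_def
  by (intro exI[of _ "Idt C"] conjI inj_onI) (metis Idt_sel(2), auto)

text \<open>Two distinct elements of \<open>'u\<close> encode subsets of \<open>Arr G\<close> as
  functions, whose number is bounded by smallness; singletons then embed \<open>Arr G\<close>
  itself.\<close>

lemma small_groupoid_Arr:
  assumes "small_groupoid TYPE('u) G"
  shows "Arr G \<lesssim> (UNIV :: 'u set)" and "Pow (Arr G) \<lesssim> (UNIV :: 'u set)"
proof -
  have "infinite (UNIV :: 'u set)"
    using assms by (simp add: small_groupoid_def)
  then obtain u v :: 'u where uv: "u \<noteq> v"
    by (metis (full_types) UNIV_I finite.intros(1) finite.intros(2) finite_subset insertCI subsetI)
  have "inj_on (\<lambda>X. \<lambda>a\<in>Arr G. if a \<in> X then u else v) (Pow (Arr G))"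
  proof (rule inj_onI)
    fix X Y assume *: "X \<in> Pow (Arr G)" "Y \<in> Pow (Arr G)"
      "(\<lambda>a\<in>Arr G. if a \<in> X then u else v) = (\<lambda>a\<in>Arr G. if a \<in> Y then u else v)"
    have "a \<in> X \<longleftrightarrow> a \<in> Y" if "a \<in> Arr G" for a
    proof -
      have "(if a \<in> X then u else v) = (if a \<in> Y then u else v)"
        using fun_cong[OF *(3), of a] that by simp
      then show ?thesis using uv by metis
    qed
    then show "X = Y" using * by blast
  qed
  then have "Pow (Arr G) \<lesssim> (Arr G \<rightarrow>\<^sub>E (UNIV :: 'u set))"
    unfolding lepoll_def by (intro exI conjI) auto
  then show P: "Pow (Arr G) \<lesssim> (UNIV :: 'u set)"
    using assms lepoll_trans unfolding small_groupoid_def by blast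
  have "Arr G \<lesssim> Pow (Arr G)"
    unfolding lepoll_def by (intro exI[of _ "\<lambda>a. {a}"]) auto
  then show "Arr G \<lesssim> (UNIV :: 'u set)"
    using P lepoll_trans by blast
qed

section \<open>Construction of sheaves\<close>

context is_Ehresmann_site
begin

lemma sheaf_glue_family:
  assumes F: "is_sheaf G T F" and A: "A \<in> Obj G" and S: "S \<in> T A"
    and x: "\<And>B. B \<in> S \<Longrightarrow> x B \<in> val F B"
    and m: "\<And>B D. B \<in> S \<Longrightarrow> ole G D B \<Longrightarrow> pull G F B (Idt G D) (x B) = x D"
  shows "\<exists>y\<in>val F A. \<forall>B\<in>S. pull G F A (Idt G B) y = x B"
proof -
  note P = sheaf_presheaf[OF F]
  have "\<exists>!y. y \<in> val F A \<and> (\<forall>B\<in>S. vmap F A B y = x B)"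
  proof (rule sheaf_ex1[OF F A S x])
    show "vmap F B D (x B) = x D" if "B \<in> S" "ole G D B" for B D
      using m[OF that] vmap_pull[OF P x[OF that(1)] that(2)] by simp
  qed
  then obtain y where y: "y \<in> val F A" "\<And>B. B \<in> S \<Longrightarrow> vmap F A B y = x B"
    by blast
  show ?thesis
    using y(2) vmap_pull[OF P y(1) covering_le[OF A S]] by (intro bexI[OF _ y(1)]) simp
qed

text \<open>Sections may be renamed along injections into \<open>'u\<close>, one at each object,
  with the action conjugated accordingly. This brings constructions on sets of pairs or families
  back to the type over which \<open>Sh\<close> is formed.\<close>

lemma sheaf_transport:
  fixes F :: "('o, 'a, 's) presheaf"
  assumes F: "is_sheaf G T F" and size: "\<And>A. A \<in> Obj G \<Longrightarrow> val F A \<lesssim> (UNIV :: 'u set)"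
  shows "\<exists>(F' :: ('o, 'a, 'u) presheaf) e. is_sheaf G T F' \<and>
    (\<forall>A\<in>Obj G. bij_betw (e A) (val F A) (val F' A)) \<and>
    (\<forall>A B h x. h \<in> hvhom G B A \<longrightarrow> x \<in> val F A \<longrightarrow>
       e B (pull G F A h x) = pull G F' A h (e A x))"
proof -
  from size have "\<forall>A\<in>Obj G. \<exists>e :: 's \<Rightarrow> 'u. inj_on e (val F A)"
    by (auto simp: lepoll_def)
  then obtain e :: "'o \<Rightarrow> 's \<Rightarrow> 'u" where e: "\<And>A. A \<in> Obj G \<Longrightarrow> inj_on (e A) (val F A)"
    by metis
  define d where "d A = inv_into (val F A) (e A)" for A
  have de: "d A (e A x) = x" if "A \<in> Obj G" "x \<in> val F A" for A x
    using that e by (simp add: d_def)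
  define v where "v A = e A ` val F A" for A
  define a where "a A h y = e (Dom G h) (pull G F A h (d A y))" for A h y
  define F' where "F' = presheaf_of_pull G v a"
  note in_F = sheaf_pull_in[OF F]
  have a_e: "a A h (e A x) = e B (pull G F A h x)" if "h \<in> hvhom G B A" "x \<in> val F A" for A B h x
    using that de hvhom_Obj[OF that(1)] hvhom_Dom[OF that(1)] by (simp add: a_def)
  have av: "a A h y \<in> v B" if h: "h \<in> hvhom G B A" and y: "y \<in> v A" for A B h y
  proof -
    obtain x where x: "y = e A x" "x \<in> val F A" using y by (auto simp: v_def)
    show ?thesis
      using in_F[OF x(2) h] a_e[OF h x(2)] x by (simp add: v_def)
  qed
  have ai: "a A (Idt G A) y = y" if A: "A \<in> Obj G" and y: "y \<in> v A" for A y
  proof -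
    obtain x where x: "y = e A x" "x \<in> val F A" using y by (auto simp: v_def)
    show ?thesis
      using a_e[OF Idt_hvhom[OF ole_refl[OF A]] x(2)] sheaf_pull_Idt[OF F A x(2)] x by simp
  qed
  have ac: "a B k (a A h y) = a A (hvcmp G h k) y"
    if h: "h \<in> hvhom G B A" and k: "k \<in> hvhom G D B" and y: "y \<in> v A" for A B D h k y
  proof -
    obtain x where x: "y = e A x" "x \<in> val F A" using y by (auto simp: v_def)
    show ?thesis
      using a_e[OF h x(2)] a_e[OF k in_F[OF x(2) h]] a_e[OF hvcmp_hvhom[OF k h] x(2)]
        sheaf_pull_pull[OF F x(2) h k] x by simp
  qed
  have vF': "val F' = v"
    by (simp add: F'_def presheaf_of_pull_def)
  have P: "is_presheaf G F'"
    unfolding F'_def by (rule presheaf_of_pull(1)) (rule av ai ac; assumption)+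
  have pullF': "pull G F' A h x = a A h x" if "h \<in> hvhom G B A" "x \<in> v A" for A B h x
    unfolding F'_def using that by (intro presheaf_of_pull(2)[where v = v]) (rule av ai ac; assumption)+
  have pe: "pull G F' A h (e A x) = e B (pull G F A h x)" if "h \<in> hvhom G B A" "x \<in> val F A" for A B h x
    using pullF'[OF that(1)] a_e[OF that] that(2) by (simp add: v_def)
  have "is_sheaf G T F'"
  proof (rule is_sheafI[OF P])
    fix A x y
    assume A: "A \<in> Obj G" and xy: "x \<in> val F' A" "y \<in> val F' A"
      and l: "locally T A (\<lambda>B. pull G F' A (Idt G B) x = pull G F' A (Idt G B) y)"
    obtain x' y' where *: "x = e A x'" "y = e A y'" "x' \<in> val F A" "y' \<in> val F A"
      using xy by (auto simp: vF' v_def)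
    have "x' = y'"
    proof (rule sheaf_separated[OF F A *(3,4) locally_mono[OF A l]])
      fix B assume B: "ole G B A" "pull G F' A (Idt G B) x = pull G F' A (Idt G B) y"
      note i = Idt_hvhom[OF B(1)]
      have "e B (pull G F A (Idt G B) x') = e B (pull G F A (Idt G B) y')"
        using B(2) pe[OF i] * by simp
      then show "pull G F A (Idt G B) x' = pull G F A (Idt G B) y'"
        using in_F[OF *(3) i] in_F[OF *(4) i] e[of B] ole_Obj[OF B(1)] by (simp add: inj_on_eq_iff)
    qed
    then show "x = y" using * by simp
  next
    fix A S x
    assume A: "A \<in> Obj G" and S: "S \<in> T A" and x: "\<And>B. B \<in> S \<Longrightarrow> x B \<in> val F' B"
      and m: "\<And>B D. B \<in> S \<Longrightarrow> ole G D B \<Longrightarrow> pull G F' B (Idt G D) (x B) = x D"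
    have SO: "B \<in> Obj G" if "B \<in> S" for B
      using covering_le[OF A S that] ole_Obj by blast
    have dx: "d B (x B) \<in> val F B" "e B (d B (x B)) = x B" if "B \<in> S" for B
      using x[OF that] de SO[OF that] by (auto simp: vF' v_def)
    have "\<exists>y\<in>val F A. \<forall>B\<in>S. pull G F A (Idt G B) y = d B (x B)"
    proof (rule sheaf_glue_family[OF F A S dx(1)])
      fix B D assume *: "B \<in> S" "ole G D B"
      have D: "D \<in> S" using covering_down[OF A S *] .
      show "pull G F B (Idt G D) (d B (x B)) = d D (x D)"
        using m[OF *] pe[OF Idt_hvhom[OF *(2)] dx(1)[OF *(1)]] dx[OF *(1)]
          de[OF SO[OF D] in_F[OF dx(1)[OF *(1)] Idt_hvhom[OF *(2)]]] by simp
    qed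
    then obtain y where y: "y \<in> val F A" "\<And>B. B \<in> S \<Longrightarrow> pull G F A (Idt G B) y = d B (x B)"
      by blast
    have "e A y \<in> val F' A"
      using y by (simp add: vF' v_def)
    moreover have "pull G F' A (Idt G B) (e A y) = x B" if "B \<in> S" for B
      using pe[OF Idt_hvhom[OF covering_le[OF A S that]] y(1)] y(2) dx that by simp
    ultimately show "\<exists>y\<in>val F' A. \<forall>B\<in>S. pull G F' A (Idt G B) y = x B" by blast
  qed
  moreover have "\<forall>A\<in>Obj G. bij_betw (e A) (val F A) (val F' A)"
    using e by (simp add: vF' v_def bij_betw_def)
  ultimately show ?thesis
    using pe[symmetric] by (intro exI[of _ F'] exI[of _ e] conjI allI impI) assumption+
qed

text \<open>A section of \<open>N\<close> is locally a generator, so its image is forced locally;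
  \<open>c_eq\<close> makes the forced values match, and they glue in \<open>Y\<close>.
  Representables and inverse images both obtain their universal property here.\<close>

lemma extend_along_generators:
  assumes N: "is_sheaf G T N" and Y: "is_sheaf G T Y"
    and \<iota>: "\<And>A g. A \<in> Obj G \<Longrightarrow> g \<in> P A \<Longrightarrow> \<iota> A g \<in> val N A"
    and \<iota>_r: "\<And>A B h g. h \<in> hvhom G B A \<Longrightarrow> g \<in> P A \<Longrightarrow> r h g \<in> P B \<and> pull G N A h (\<iota> A g) = \<iota> B (r h g)"
    and gen: "\<And>A z. A \<in> Obj G \<Longrightarrow> z \<in> val N A \<Longrightarrow>
      locally T A (\<lambda>B. \<exists>g\<in>P B. pull G N A (Idt G B) z = \<iota> B g)"
    and c: "\<And>A g. A \<in> Obj G \<Longrightarrow> g \<in> P A \<Longrightarrow> c A g \<in> val Y A"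
    and c_r: "\<And>A B h g. h \<in> hvhom G B A \<Longrightarrow> g \<in> P A \<Longrightarrow> pull G Y A h (c A g) = c B (r h g)"
    and c_eq: "\<And>A g g'. A \<in> Obj G \<Longrightarrow> g \<in> P A \<Longrightarrow> g' \<in> P A \<Longrightarrow> \<iota> A g = \<iota> A g' \<Longrightarrow> c A g = c A g'"
  shows "\<exists>m\<in>hom (Sh G T) N Y. \<forall>A\<in>Obj G. \<forall>g\<in>P A. cmpt m A (\<iota> A g) = c A g"
proof -
  \<comment> \<open>All arrows into \<open>A\<close> are quantified over, not only inclusions. This
    makes the condition stable under pullback, so naturality of the values follows from their
    uniqueness.\<close>
  define ext where "ext A z y \<longleftrightarrow> (\<forall>U h g. h \<in> hvhom G U A \<longrightarrow> g \<in> P U \<longrightarrow>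
    pull G N A h z = \<iota> U g \<longrightarrow> pull G Y A h y = c U g)" for A z y
  have ex: "\<exists>y\<in>val Y A. ext A z y" if A: "A \<in> Obj G" and z: "z \<in> val N A" for A z
  proof -
    define Q where "Q B w \<longleftrightarrow> (\<exists>g\<in>P B. pull G N A (Idt G B) z = \<iota> B g \<and> w = c B g)" for B w
    have "\<exists>y\<in>val Y A. \<forall>B w. ole G B A \<longrightarrow> w \<in> val Y B \<longrightarrow> Q B w \<longrightarrow> pull G Y A (Idt G B) y = w"
    proof (rule sheaf_glue[OF Y A])
      show "locally T A (\<lambda>B. \<exists>w\<in>val Y B. Q B w)"
      proof (rule locally_mono[OF A gen[OF A z]])
        fix B assume "ole G B A" "\<exists>g\<in>P B. pull G N A (Idt G B) z = \<iota> B g"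
        then show "\<exists>w\<in>val Y B. Q B w"
          using c[of B] ole_Obj[of B A] unfolding Q_def by blast
      qed
    next
      fix B D w assume B: "ole G B A" and D: "ole G D B" and "w \<in> val Y B" "Q B w"
      then obtain g where g: "g \<in> P B" "pull G N A (Idt G B) z = \<iota> B g" "w = c B g"
        by (auto simp: Q_def)
      have "pull G N A (Idt G D) z = \<iota> D (r (Idt G D) g)"
        using sheaf_pull_pull[OF N z Idt_hvhom[OF B] Idt_hvhom[OF D]] Idt_hvcmp[OF Idt_hvhom[OF D]]
          \<iota>_r[OF Idt_hvhom[OF D] g(1)] g(2) by simp
      then show "Q D (pull G Y B (Idt G D) w)"
        using c_r[OF Idt_hvhom[OF D] g(1)] g \<iota>_r[OF Idt_hvhom[OF D] g(1)] unfolding Q_def by blast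
    next
      fix B w w' assume "ole G B A" "Q B w" "Q B w'"
      then show "w = w'"
        unfolding Q_def using c_eq ole_Obj by metis
    qed
    then obtain y where y: "y \<in> val Y A"
      "\<And>B w. ole G B A \<Longrightarrow> w \<in> val Y B \<Longrightarrow> Q B w \<Longrightarrow> pull G Y A (Idt G B) y = w"
      by blast
    have "ext A z y"
      unfolding ext_def
    proof (intro allI impI)
      fix U h g assume h: "h \<in> hvhom G U A" and g: "g \<in> P U" and zg: "pull G N A h z = \<iota> U g"
      have U: "U \<in> Obj G" using hvhom_Obj[OF h] by simp
      \<comment> \<open>On the pullback along \<open>h\<close> of the generating cover of
        \<open>z\<close>, the generator \<open>g\<close> and a pulled back local generator
        \<open>g'\<close> of \<open>z\<close> have the same image in \<open>N\<close>, so
        \<open>c_eq\<close> compares their values.\<close>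
      show "pull G Y A h y = c U g"
      proof (rule sheaf_separated[OF Y U sheaf_pull_in[OF Y y(1) h] c[OF U g]])
        show "locally T U (\<lambda>B. pull G Y U (Idt G B) (pull G Y A h y) = pull G Y U (Idt G B) (c U g))"
        proof (rule locally_pullI[OF gen[OF A z] h])
          fix B D k assume B: "ole G B U" and k_def: "k = hvcmp G h (Idt G B)"
            and k: "k \<in> hvhom G B D" "hvcmp G (Idt G D) k = k" and D: "ole G D A"
            and "\<exists>g\<in>P D. pull G N A (Idt G D) z = \<iota> D g"
          then obtain g' where g': "g' \<in> P D" "pull G N A (Idt G D) z = \<iota> D g'"
            by blast
          note iB = Idt_hvhom[OF B] and iD = Idt_hvhom[OF D]
          have "\<iota> B (r (Idt G B) g) = pull G N U (Idt G B) (pull G N A h z)"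
            using \<iota>_r[OF iB g] zg by simp
          also have "\<dots> = pull G N A k z"
            using sheaf_pull_pull[OF N z h iB] by (simp add: k_def)
          also have "\<dots> = pull G N D k (pull G N A (Idt G D) z)"
            using sheaf_pull_pull[OF N z iD k(1)] k(2) by simp
          also have "\<dots> = \<iota> B (r k g')"
            using \<iota>_r[OF k(1) g'(1)] g'(2) by simp
          finally have "c B (r (Idt G B) g) = c B (r k g')"
            using c_eq[of B] ole_Obj[OF B] \<iota>_r[OF iB g] \<iota>_r[OF k(1) g'(1)] by blast
          moreover have "pull G Y A (Idt G D) y = c D g'"
            using y(2)[OF D c[OF _ g'(1)]] g' ole_Obj[OF D] by (auto simp: Q_def)
          then have "pull G Y A k y = c B (r k g')"
            using sheaf_pull_pull[OF Y y(1) iD k(1)] k(2) c_r[OF k(1) g'(1)] by simp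
          ultimately show "pull G Y U (Idt G B) (pull G Y A h y) = pull G Y U (Idt G B) (c U g)"
            using sheaf_pull_pull[OF Y y(1) h iB] c_r[OF iB g] by (simp add: k_def)
        qed
      qed
    qed
    then show ?thesis using y(1) by blast
  qed
  have uniq: "y = y'" if A: "A \<in> Obj G" and z: "z \<in> val N A" and y: "y \<in> val Y A" "y' \<in> val Y A"
    and e: "ext A z y" "ext A z y'" for A z y y'
  proof (rule sheaf_separated[OF Y A y locally_mono[OF A gen[OF A z]]])
    fix B assume "ole G B A" "\<exists>g\<in>P B. pull G N A (Idt G B) z = \<iota> B g"
    then show "pull G Y A (Idt G B) y = pull G Y A (Idt G B) y'"
      using e Idt_hvhom unfolding ext_def by metis
  qed
  define C where "C A z = (SOME y. y \<in> val Y A \<and> ext A z y)" for A z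
  have C: "C A z \<in> val Y A" "ext A z (C A z)" if "A \<in> Obj G" "z \<in> val N A" for A z
    using someI_ex[of "\<lambda>y. y \<in> val Y A \<and> ext A z y"] ex[OF that] unfolding C_def by blast+
  have "\<exists>m\<in>hom (Sh G T) N Y. \<forall>A\<in>Obj G. \<forall>x\<in>val N A. cmpt m A x = C A x"
  proof (rule Sh_mor_ex[OF N Y C(1)])
    fix A B h z assume h: "h \<in> hvhom G B A" and z: "z \<in> val N A"
    have O: "A \<in> Obj G" "B \<in> Obj G" using hvhom_Obj[OF h] by auto
    note hz = sheaf_pull_in[OF N z h]
    show "C B (pull G N A h z) = pull G Y A h (C A z)"
    proof (rule uniq[OF O(2) hz C(1)[OF O(2) hz] sheaf_pull_in[OF Y C(1)[OF O(1) z] h] C(2)[OF O(2) hz]])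
      show "ext B (pull G N A h z) (pull G Y A h (C A z))"
        unfolding ext_def
      proof (intro allI impI)
        fix U k g assume k: "k \<in> hvhom G U B" and g: "g \<in> P U" "pull G N B k (pull G N A h z) = \<iota> U g"
        have "pull G N A (hvcmp G h k) z = \<iota> U g"
          using sheaf_pull_pull[OF N z h k] g(2) by simp
        then have "pull G Y A (hvcmp G h k) (C A z) = c U g"
          using C(2)[OF O(1) z] hvcmp_hvhom[OF k h] g(1) unfolding ext_def by blast
        then show "pull G Y B k (pull G Y A h (C A z)) = c U g"
          using sheaf_pull_pull[OF Y C(1)[OF O(1) z] h k] by simp
      qed
    qed
  qed
  moreover have "C A (\<iota> A g) = c A g" if A: "A \<in> Obj G" and g: "g \<in> P A" for A g
  proof -
    have "pull G Y A (Idt G A) (C A (\<iota> A g)) = c A g"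
      using C(2)[OF A \<iota>[OF A g]] Idt_hvhom[OF ole_refl[OF A]] g sheaf_pull_Idt[OF N A \<iota>[OF A g]]
      unfolding ext_def by blast
    then show ?thesis
      using sheaf_pull_Idt[OF Y A C(1)[OF A \<iota>[OF A g]]] by simp
  qed
  ultimately show ?thesis
    using \<iota> by metis
qed

end

section \<open>Sheafification\<close>

text \<open>\<open>P\<close> is a presheaf with restriction \<open>r\<close>, and \<open>eqv\<close> a congruence on it that is local for the
  topology; the associated sheaf of the quotient is built in one step, as the sheaf of
  those closed subpresheaves of \<open>y A \<times> P\<close> that locally are the graph of an \<open>eqv\<close>-class.\<close>

locale local_congruence = is_Ehresmann_site G T
  for G :: "('o, 'a, 'z) ordered_groupoid_scheme" and T :: "'o \<Rightarrow> 'o set set" +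
  fixes P :: "'o \<Rightarrow> 'g set" and r :: "'a \<Rightarrow> 'g \<Rightarrow> 'g" and eqv :: "'o \<Rightarrow> 'g \<Rightarrow> 'g \<Rightarrow> bool"
  assumes r_in: "h \<in> hvhom G B A \<Longrightarrow> g \<in> P A \<Longrightarrow> r h g \<in> P B"
    and r_Idt: "A \<in> Obj G \<Longrightarrow> g \<in> P A \<Longrightarrow> r (Idt G A) g = g"
    and r_r: "h \<in> hvhom G B A \<Longrightarrow> k \<in> hvhom G D B \<Longrightarrow> g \<in> P A \<Longrightarrow> r k (r h g) = r (hvcmp G h k) g"
    and eqv_refl: "A \<in> Obj G \<Longrightarrow> g \<in> P A \<Longrightarrow> eqv A g g"
    and eqv_sym: "A \<in> Obj G \<Longrightarrow> g \<in> P A \<Longrightarrow> g' \<in> P A \<Longrightarrow> eqv A g g' \<Longrightarrow> eqv A g' g"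
    and eqv_trans: "A \<in> Obj G \<Longrightarrow> g \<in> P A \<Longrightarrow> g' \<in> P A \<Longrightarrow> g'' \<in> P A \<Longrightarrow>
      eqv A g g' \<Longrightarrow> eqv A g' g'' \<Longrightarrow> eqv A g g''"
    and eqv_r: "h \<in> hvhom G B A \<Longrightarrow> g \<in> P A \<Longrightarrow> g' \<in> P A \<Longrightarrow> eqv A g g' \<Longrightarrow> eqv B (r h g) (r h g')"
    and eqv_local: "A \<in> Obj G \<Longrightarrow> g \<in> P A \<Longrightarrow> g' \<in> P A \<Longrightarrow>
      locally T A (\<lambda>B. eqv B (r (Idt G B) g) (r (Idt G B) g')) \<Longrightarrow> eqv A g g'"
begin

text \<open>A pair \<open>(j, g)\<close> in \<open>\<sigma>\<close> asserts that the section,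
  restricted along \<open>j\<close>, is represented by \<open>g\<close>. Saturation under
  \<open>eqv\<close> and under covers leaves one set per section, so equality of sections is
  equality of sets.\<close>

definition sec :: "'o \<Rightarrow> ('a \<times> 'g) set set" where
  "sec A = {\<sigma>.
     (\<forall>j g. (j, g) \<in> \<sigma> \<longrightarrow> j \<in> hvhom G (Dom G j) A \<and> g \<in> P (Dom G j)) \<and>
     (\<forall>U j g g'. j \<in> hvhom G U A \<longrightarrow> (j, g) \<in> \<sigma> \<longrightarrow> g' \<in> P U \<longrightarrow> (j, g') \<in> \<sigma> \<longleftrightarrow> eqv U g g') \<and>
     (\<forall>U U' j i g. j \<in> hvhom G U A \<longrightarrow> i \<in> hvhom G U' U \<longrightarrow> (j, g) \<in> \<sigma> \<longrightarrow> (hvcmp G j i, r i g) \<in> \<sigma>) \<and>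
     (\<forall>U j g. j \<in> hvhom G U A \<longrightarrow> g \<in> P U \<longrightarrow>
        locally T U (\<lambda>B. (hvcmp G j (Idt G B), r (Idt G B) g) \<in> \<sigma>) \<longrightarrow> (j, g) \<in> \<sigma>) \<and>
     locally T A (\<lambda>B. \<exists>g. (Idt G B, g) \<in> \<sigma>)}"

lemma secD:
  assumes "\<sigma> \<in> sec A"
  shows "(j, g) \<in> \<sigma> \<Longrightarrow> j \<in> hvhom G (Dom G j) A \<and> g \<in> P (Dom G j)"
    and "j \<in> hvhom G U A \<Longrightarrow> (j, g) \<in> \<sigma> \<Longrightarrow> g' \<in> P U \<Longrightarrow> (j, g') \<in> \<sigma> \<longleftrightarrow> eqv U g g'"
    and "j \<in> hvhom G U A \<Longrightarrow> i \<in> hvhom G U' U \<Longrightarrow> (j, g) \<in> \<sigma> \<Longrightarrow> (hvcmp G j i, r i g) \<in> \<sigma>"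
    and "j \<in> hvhom G U A \<Longrightarrow> g \<in> P U \<Longrightarrow>
        locally T U (\<lambda>B. (hvcmp G j (Idt G B), r (Idt G B) g) \<in> \<sigma>) \<Longrightarrow> (j, g) \<in> \<sigma>"
    and "locally T A (\<lambda>B. \<exists>g. (Idt G B, g) \<in> \<sigma>)"
proof -
  note s = assms[unfolded sec_def mem_Collect_eq]
  show "(j, g) \<in> \<sigma> \<Longrightarrow> j \<in> hvhom G (Dom G j) A \<and> g \<in> P (Dom G j)"
    using conjunct1[OF s] by blast
  show "j \<in> hvhom G U A \<Longrightarrow> (j, g) \<in> \<sigma> \<Longrightarrow> g' \<in> P U \<Longrightarrow> (j, g') \<in> \<sigma> \<longleftrightarrow> eqv U g g'"
    using conjunct1[OF conjunct2[OF s]] by blast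
  show "j \<in> hvhom G U A \<Longrightarrow> i \<in> hvhom G U' U \<Longrightarrow> (j, g) \<in> \<sigma> \<Longrightarrow> (hvcmp G j i, r i g) \<in> \<sigma>"
    using conjunct1[OF conjunct2[OF conjunct2[OF s]]] by blast
  show "j \<in> hvhom G U A \<Longrightarrow> g \<in> P U \<Longrightarrow>
        locally T U (\<lambda>B. (hvcmp G j (Idt G B), r (Idt G B) g) \<in> \<sigma>) \<Longrightarrow> (j, g) \<in> \<sigma>"
    using conjunct1[OF conjunct2[OF conjunct2[OF conjunct2[OF s]]]] by blast
  show "locally T A (\<lambda>B. \<exists>g. (Idt G B, g) \<in> \<sigma>)"
    using conjunct2[OF conjunct2[OF conjunct2[OF conjunct2[OF s]]]] .
qed

lemma secI:
  assumes "\<And>j g. (j, g) \<in> \<sigma> \<Longrightarrow> j \<in> hvhom G (Dom G j) A \<and> g \<in> P (Dom G j)"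
    and "\<And>U j g g'. j \<in> hvhom G U A \<Longrightarrow> (j, g) \<in> \<sigma> \<Longrightarrow> g' \<in> P U \<Longrightarrow> (j, g') \<in> \<sigma> \<longleftrightarrow> eqv U g g'"
    and "\<And>U U' j i g. j \<in> hvhom G U A \<Longrightarrow> i \<in> hvhom G U' U \<Longrightarrow> (j, g) \<in> \<sigma> \<Longrightarrow>
      (hvcmp G j i, r i g) \<in> \<sigma>"
    and "\<And>U j g. j \<in> hvhom G U A \<Longrightarrow> g \<in> P U \<Longrightarrow>
        locally T U (\<lambda>B. (hvcmp G j (Idt G B), r (Idt G B) g) \<in> \<sigma>) \<Longrightarrow> (j, g) \<in> \<sigma>"
    and "locally T A (\<lambda>B. \<exists>g. (Idt G B, g) \<in> \<sigma>)"
  shows "\<sigma> \<in> sec A"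
  unfolding sec_def
proof (intro CollectI conjI)
  show "\<forall>j g. (j, g) \<in> \<sigma> \<longrightarrow> j \<in> hvhom G (Dom G j) A \<and> g \<in> P (Dom G j)"
    by (intro allI impI) (rule assms(1))
  show "\<forall>U j g g'. j \<in> hvhom G U A \<longrightarrow> (j, g) \<in> \<sigma> \<longrightarrow> g' \<in> P U \<longrightarrow> ((j, g') \<in> \<sigma>) = eqv U g g'"
    by (intro allI impI) (rule assms(2); assumption)
  show "\<forall>U U' j i g. j \<in> hvhom G U A \<longrightarrow> i \<in> hvhom G U' U \<longrightarrow> (j, g) \<in> \<sigma> \<longrightarrow>
      (hvcmp G j i, r i g) \<in> \<sigma>"
    by (intro allI impI) (rule assms(3); assumption)
  show "\<forall>U j g. j \<in> hvhom G U A \<longrightarrow> g \<in> P U \<longrightarrow>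
      locally T U (\<lambda>B. (hvcmp G j (Idt G B), r (Idt G B) g) \<in> \<sigma>) \<longrightarrow> (j, g) \<in> \<sigma>"
    by (intro allI impI) (rule assms(4); assumption)
qed (rule assms(5))

definition res :: "'o \<Rightarrow> 'a \<Rightarrow> ('a \<times> 'g) set \<Rightarrow> ('a \<times> 'g) set" where
  "res A h \<sigma> = {(i, g). i \<in> hvhom G (Dom G i) (Dom G h) \<and> (hvcmp G h i, g) \<in> \<sigma>}"

lemma res_iff: "h \<in> hvhom G B A \<Longrightarrow> i \<in> hvhom G U B \<Longrightarrow> (i, g) \<in> res A h \<sigma> \<longleftrightarrow> (hvcmp G h i, g) \<in> \<sigma>"
  using hvhom_Dom[of h B A] hvhom_Dom[of i U B] by (simp add: res_def)

lemma res_sec: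
  assumes h: "h \<in> hvhom G B A" and \<sigma>: "\<sigma> \<in> sec A"
  shows "res A h \<sigma> \<in> sec B"
proof (rule secI)
  show "j \<in> hvhom G (Dom G j) B \<and> g \<in> P (Dom G j)" if "(j, g) \<in> res A h \<sigma>" for j g
  proof -
    have j: "j \<in> hvhom G (Dom G j) B" and g: "(hvcmp G h j, g) \<in> \<sigma>"
      using that hvhom_Dom[OF h] by (auto simp: res_def)
    show ?thesis
      using j secD(1)[OF \<sigma> g] hvhom_Dom[OF hvcmp_hvhom[OF j h]] by simp
  qed
  fix U j g assume j: "j \<in> hvhom G U B"
  note hj = hvcmp_hvhom[OF j h]
  show "(j, g') \<in> res A h \<sigma> \<longleftrightarrow> eqv U g g'" if "(j, g) \<in> res A h \<sigma>" "g' \<in> P U" for g'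
    using that secD(2)[OF \<sigma> hj, of g g'] res_iff[OF h j] by simp
  show "(hvcmp G j i, r i g) \<in> res A h \<sigma>" if "i \<in> hvhom G U' U" "(j, g) \<in> res A h \<sigma>" for U' i
    using that secD(3)[OF \<sigma> hj that(1)] res_iff[OF h j] res_iff[OF h hvcmp_hvhom[OF that(1) j]]
      hvcmp_assoc[OF that(1) j h] by simp
  assume g: "g \<in> P U"
    and l: "locally T U (\<lambda>B. (hvcmp G j (Idt G B), r (Idt G B) g) \<in> res A h \<sigma>)"
  have "locally T U (\<lambda>B. (hvcmp G (hvcmp G h j) (Idt G B), r (Idt G B) g) \<in> \<sigma>)"
  proof (rule locally_mono[OF _ l])
    show "U \<in> Obj G" using hvhom_Obj[OF j] by simp
    fix D assume D: "ole G D U" "(hvcmp G j (Idt G D), r (Idt G D) g) \<in> res A h \<sigma>"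
    show "(hvcmp G (hvcmp G h j) (Idt G D), r (Idt G D) g) \<in> \<sigma>"
      using D(2) res_iff[OF h hvcmp_hvhom[OF Idt_hvhom[OF D(1)] j]] hvcmp_move[OF h j D(1)] by simp
  qed
  then show "(j, g) \<in> res A h \<sigma>"
    using secD(4)[OF \<sigma> hj g] res_iff[OF h j] by simp
next
  show "locally T B (\<lambda>D. \<exists>g. (Idt G D, g) \<in> res A h \<sigma>)"
  proof (rule locally_pullI[OF secD(5)[OF \<sigma>] h])
    fix D E k assume D: "ole G D B" and k_def: "k = hvcmp G h (Idt G D)"
      and k: "k \<in> hvhom G D E" "hvcmp G (Idt G E) k = k" and E: "ole G E A"
      and "\<exists>g. (Idt G E, g) \<in> \<sigma>"
    then obtain g where "(Idt G E, g) \<in> \<sigma>"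
      by blast
    then have "(k, r k g) \<in> \<sigma>"
      using secD(3)[OF \<sigma> Idt_hvhom[OF E] k(1)] k(2) by simp
    then show "\<exists>g. (Idt G D, g) \<in> res A h \<sigma>"
      using res_iff[OF h Idt_hvhom[OF D]] k_def by blast
  qed
qed

definition shf :: "('o, 'a, ('a \<times> 'g) set) presheaf" where
  "shf = presheaf_of_pull G sec res"

lemma res_Idt:
  assumes "A \<in> Obj G" "\<sigma> \<in> sec A"
  shows "res A (Idt G A) \<sigma> = \<sigma>"
proof -
  have "(i, g) \<in> res A (Idt G A) \<sigma> \<longleftrightarrow> (i, g) \<in> \<sigma>" for i g
    using secD(1)[OF assms(2), of i g] assms(1) Idt_hvcmp[of i _ A] by (auto simp: res_def)
  then show ?thesis by auto
qed

lemma res_res: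
  assumes h: "h \<in> hvhom G B A" and k: "k \<in> hvhom G D B"
  shows "res B k (res A h \<sigma>) = res A (hvcmp G h k) \<sigma>"
proof -
  have "(i, g) \<in> res B k (res A h \<sigma>) \<longleftrightarrow> (i, g) \<in> res A (hvcmp G h k) \<sigma>" for i g
  proof (cases "i \<in> hvhom G (Dom G i) D")
    case True
    then show ?thesis
      using res_iff[OF k True] res_iff[OF h hvcmp_hvhom[OF True k]]
        res_iff[OF hvcmp_hvhom[OF k h] True] hvcmp_assoc[OF True k h] by simp
  next
    case False
    then show ?thesis
      using hvhom_Dom[OF k] hvhom_Dom[OF hvcmp_hvhom[OF k h]] by (simp add: res_def)
  qed
  then show ?thesis by auto
qed

lemma shf_presheaf: "is_presheaf G shf"
  unfolding shf_def by (rule presheaf_of_pull(1)) (simp_all add: res_sec res_Idt res_res)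

lemma shf_val: "val shf = sec"
  by (simp add: shf_def presheaf_of_pull_def)

lemma shf_pull: "h \<in> hvhom G B A \<Longrightarrow> \<sigma> \<in> sec A \<Longrightarrow> pull G shf A h \<sigma> = res A h \<sigma>"
  unfolding shf_def by (rule presheaf_of_pull(2)) (simp_all add: res_sec res_Idt res_res)

text \<open>A pair of \<open>\<sigma>\<close> belongs to \<open>\<tau>\<close> locally on its
  domain, by pulling back the cover along \<open>j\<close>; since \<open>\<tau>\<close> is closed
  under covers, it belongs to \<open>\<tau>\<close>.\<close>

lemma sec_subset:
  assumes A: "A \<in> Obj G" and \<sigma>: "\<sigma> \<in> sec A" and \<tau>: "\<tau> \<in> sec A"
    and l: "locally T A (\<lambda>B. res A (Idt G B) \<sigma> = res A (Idt G B) \<tau>)"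
  shows "\<sigma> \<subseteq> \<tau>"
proof safe
  fix j g assume jg: "(j, g) \<in> \<sigma>"
  define U where "U = Dom G j"
  have j: "j \<in> hvhom G U A" and g: "g \<in> P U"
    using secD(1)[OF \<sigma> jg] by (auto simp: U_def)
  show "(j, g) \<in> \<tau>"
  proof (rule secD(4)[OF \<tau> j g locally_pullI[OF l j]])
    fix B E k assume B: "ole G B U" and k_def: "k = hvcmp G j (Idt G B)"
      and k: "k \<in> hvhom G B E" "hvcmp G (Idt G E) k = k" and E: "ole G E A"
      and "res A (Idt G E) \<sigma> = res A (Idt G E) \<tau>"
    then have "(k, r (Idt G B) g) \<in> res A (Idt G E) \<sigma> \<longleftrightarrow> (k, r (Idt G B) g) \<in> res A (Idt G E) \<tau>"
      by simp
    moreover have "(k, r (Idt G B) g) \<in> \<sigma>"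
      using secD(3)[OF \<sigma> j Idt_hvhom[OF B] jg] by (simp add: k_def)
    ultimately show "(hvcmp G j (Idt G B), r (Idt G B) g) \<in> \<tau>"
      using res_iff[OF Idt_hvhom[OF E] k(1)] k(2) k_def by simp
  qed
qed

lemma sec_glue:
  assumes A: "A \<in> Obj G" and S: "S \<in> T A" and x: "\<And>B. B \<in> S \<Longrightarrow> x B \<in> sec B"
    and m: "\<And>B D. B \<in> S \<Longrightarrow> ole G D B \<Longrightarrow> res B (Idt G D) (x B) = x D"
  shows "\<exists>\<sigma>\<in>sec A. \<forall>B\<in>S. res A (Idt G B) \<sigma> = x B"
proof
  \<comment> \<open>The members of the given family, collected into one relation over
    \<open>A\<close>; the matching condition makes membership independent of the \<open>B\<close> in
    which it is tested. This union need not be closed under covers, so \<open>\<sigma>\<close> takes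
    the pairs that lie in it locally.\<close>
  define R where "R j g \<longleftrightarrow> Cod G j \<in> S \<and> (j, g) \<in> x (Cod G j)" for j g
  define \<sigma> where "\<sigma> = {(j, g). j \<in> hvhom G (Dom G j) A \<and> g \<in> P (Dom G j) \<and>
    locally T (Dom G j) (\<lambda>B. R (hvcmp G j (Idt G B)) (r (Idt G B) g))}"
  have \<sigma>: "(j, g) \<in> \<sigma> \<longleftrightarrow> g \<in> P U \<and> locally T U (\<lambda>B. R (hvcmp G j (Idt G B)) (r (Idt G B) g))"
    if "j \<in> hvhom G U A" for U j g
    using that hvhom_Dom[OF that] by (auto simp: \<sigma>_def)
  have le: "B \<in> Obj G" "ole G B A" if "B \<in> S" for B
    using covering_le[OF A S that] ole_Obj by auto
  have R_x: "R j g \<longleftrightarrow> (j, g) \<in> x B" if B: "B \<in> S" and j: "j \<in> hvhom G U B" for j g B U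
  proof -
    have jc: "ole G (Cod G j) B" and j': "j \<in> hvhom G U (Cod G j)"
      using j Arr_hvhom by (auto simp: hvhom_def)
    have "Cod G j \<in> S" using covering_down[OF A S B jc] .
    moreover have "(j, g) \<in> x (Cod G j) \<longleftrightarrow> (j, g) \<in> x B"
      using m[OF B jc] res_iff[OF Idt_hvhom[OF jc] j'] Idt_hvcmp[OF j'] by metis
    ultimately show ?thesis by (simp add: R_def)
  qed
  have Rj: "Cod G j \<in> S" "j \<in> hvhom G U (Cod G j)" "g \<in> P U" if "R j g" "Dom G j = U" for j g U
    using that secD(1)[OF x, of "Cod G j" j g] by (auto simp: R_def)
  have R_down: "R (hvcmp G j i) (r i g)" if "R j g" "i \<in> hvhom G U' U" "Dom G j = U" for j g i U U'
    using secD(3)[OF x[OF Rj(1)[OF that(1,3)]] Rj(2)[OF that(1,3)] that(2)]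
      R_x[OF Rj(1)[OF that(1,3)] Rj(2)[OF that(1,3)]] that(1)
      R_x[OF Rj(1)[OF that(1,3)] hvcmp_hvhom[OF that(2) Rj(2)[OF that(1,3)]]] by simp
  have R_eqv: "R j g' \<longleftrightarrow> eqv U g g'" if "R j g" "Dom G j = U" "g' \<in> P U" for j g g' U
    using secD(2)[OF x[OF Rj(1)[OF that(1,2)]] Rj(2)[OF that(1,2)] _ that(3), of g]
      R_x[OF Rj(1)[OF that(1,2)] Rj(2)[OF that(1,2)]] that(1) by simp
  \<comment> \<open>Over a member \<open>B\<close> of the cover the closure adds nothing, because
    \<open>x B\<close> is itself closed under covers.\<close>
  have \<sigma>x: "(j, g) \<in> \<sigma> \<longleftrightarrow> (j, g) \<in> x B" if B: "B \<in> S" and j: "j \<in> hvhom G U B" for j g B U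
  proof
    have jA: "j \<in> hvhom G U A" using hvhom_mono[OF j] le[OF B] by simp
    have U: "U \<in> Obj G" using hvhom_Obj[OF j] by simp
    have eq: "R (hvcmp G j (Idt G D)) (r (Idt G D) g) \<longleftrightarrow>
      (hvcmp G j (Idt G D), r (Idt G D) g) \<in> x B" if "ole G D U" for D
      using R_x[OF B hvcmp_hvhom[OF Idt_hvhom[OF that] j]] .
    show "(j, g) \<in> x B" if "(j, g) \<in> \<sigma>"
    proof (rule secD(4)[OF x[OF B] j])
      show "g \<in> P U" using that \<sigma>[OF jA] by simp
      have "locally T U (\<lambda>B. R (hvcmp G j (Idt G B)) (r (Idt G B) g))"
        using that \<sigma>[OF jA] by simp
      then show "locally T U (\<lambda>D. (hvcmp G j (Idt G D), r (Idt G D) g) \<in> x B)"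
        by (rule locally_mono[OF U]) (use eq in auto)
    qed
    show "(j, g) \<in> \<sigma>" if jg: "(j, g) \<in> x B"
      unfolding \<sigma>[OF jA]
    proof
      show "g \<in> P U" using secD(1)[OF x[OF B] jg] hvhom_Dom[OF j] by simp
      show "locally T U (\<lambda>B. R (hvcmp G j (Idt G B)) (r (Idt G B) g))"
        using secD(3)[OF x[OF B] j Idt_hvhom jg] eq by (intro locally_all[OF U]) simp
    qed
  qed
  show "\<sigma> \<in> sec A"
  proof (rule secI)
    show "j \<in> hvhom G (Dom G j) A \<and> g \<in> P (Dom G j)" if "(j, g) \<in> \<sigma>" for j g
      using that by (simp add: \<sigma>_def)
    fix U j g assume j: "j \<in> hvhom G U A"
    have U: "U \<in> Obj G" using hvhom_Obj[OF j] by simp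
    have dj: "Dom G (hvcmp G j (Idt G B)) = B" if "ole G B U" for B
      using hvcmp_hvhom[OF Idt_hvhom[OF that] j] by (simp add: hvhom_def)
    show "(j, g') \<in> \<sigma> \<longleftrightarrow> eqv U g g'" if jg: "(j, g) \<in> \<sigma>" and g': "g' \<in> P U" for g'
    proof
      have g: "g \<in> P U" and l: "locally T U (\<lambda>B. R (hvcmp G j (Idt G B)) (r (Idt G B) g))"
        using jg \<sigma>[OF j] by auto
      show "eqv U g g'" if "(j, g') \<in> \<sigma>"
      proof (rule eqv_local[OF U g g'])
        have l': "locally T U (\<lambda>B. R (hvcmp G j (Idt G B)) (r (Idt G B) g'))"
          using that \<sigma>[OF j] by auto
        show "locally T U (\<lambda>B. eqv B (r (Idt G B) g) (r (Idt G B) g'))"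
        proof (rule locally_mono[OF U locally_conj[OF U l l']])
          fix B assume B: "ole G B U" "R (hvcmp G j (Idt G B)) (r (Idt G B) g) \<and>
            R (hvcmp G j (Idt G B)) (r (Idt G B) g')"
          then show "eqv B (r (Idt G B) g) (r (Idt G B) g')"
            using R_eqv[OF _ dj[OF B(1)] r_in[OF Idt_hvhom[OF B(1)] g']] by blast
        qed
      qed
      show "(j, g') \<in> \<sigma>" if e: "eqv U g g'"
        unfolding \<sigma>[OF j]
      proof
        show "locally T U (\<lambda>B. R (hvcmp G j (Idt G B)) (r (Idt G B) g'))"
        proof (rule locally_mono[OF U l])
          fix B assume B: "ole G B U" "R (hvcmp G j (Idt G B)) (r (Idt G B) g)"
          show "R (hvcmp G j (Idt G B)) (r (Idt G B) g')"
            using R_eqv[OF B(2) dj[OF B(1)] r_in[OF Idt_hvhom[OF B(1)] g']]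
              eqv_r[OF Idt_hvhom[OF B(1)] g g' e] by simp
        qed
      qed (rule g')
    qed
    show "(hvcmp G j i, r i g) \<in> \<sigma>" if i: "i \<in> hvhom G U' U" and jg: "(j, g) \<in> \<sigma>" for U' i
      unfolding \<sigma>[OF hvcmp_hvhom[OF i j]]
    proof
      have g: "g \<in> P U" and l: "locally T U (\<lambda>B. R (hvcmp G j (Idt G B)) (r (Idt G B) g))"
        using jg \<sigma>[OF j] by auto
      show "r i g \<in> P U'" using r_in[OF i g] .
      show "locally T U' (\<lambda>B. R (hvcmp G (hvcmp G j i) (Idt G B)) (r (Idt G B) (r i g)))"
      proof (rule locally_pullI[OF l i])
        fix B E k assume B: "ole G B U'" and k_def: "k = hvcmp G i (Idt G B)"
          and k: "k \<in> hvhom G B E" "hvcmp G (Idt G E) k = k" and E: "ole G E U"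
          and RE: "R (hvcmp G j (Idt G E)) (r (Idt G E) g)"
        note iE = Idt_hvhom[OF E]
        from R_down[OF RE k(1) dj[OF E]]
        have "R (hvcmp G j k) (r k g)"
          using hvcmp_assoc[OF k(1) iE j] r_r[OF iE k(1) g] k(2) by simp
        then show "R (hvcmp G (hvcmp G j i) (Idt G B)) (r (Idt G B) (r i g))"
          using hvcmp_move[OF j i B] r_r[OF i Idt_hvhom[OF B] g] by (simp add: k_def)
      qed
    qed
    assume g: "g \<in> P U" and l: "locally T U (\<lambda>B. (hvcmp G j (Idt G B), r (Idt G B) g) \<in> \<sigma>)"
    have "locally T U (\<lambda>B. R (hvcmp G j (Idt G B)) (r (Idt G B) g))"
    proof (rule locally_bind[OF U l])
      fix B assume B: "ole G B U" "(hvcmp G j (Idt G B), r (Idt G B) g) \<in> \<sigma>"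
      note iB = Idt_hvhom[OF B(1)]
      have BO: "B \<in> Obj G" using ole_Obj[OF B(1)] by simp
      have "locally T B (\<lambda>D. R (hvcmp G (hvcmp G j (Idt G B)) (Idt G D)) (r (Idt G D) (r (Idt G B) g)))"
        using B(2) \<sigma>[OF hvcmp_hvhom[OF iB j]] by simp
      then show "locally T B (\<lambda>D. R (hvcmp G j (Idt G D)) (r (Idt G D) g))"
      proof (rule locally_mono[OF BO])
        fix D assume D: "ole G D B"
        assume "R (hvcmp G (hvcmp G j (Idt G B)) (Idt G D)) (r (Idt G D) (r (Idt G B) g))"
        then show "R (hvcmp G j (Idt G D)) (r (Idt G D) g)"
          using hvcmp_Idt_Idt[OF j B(1) D] r_r[OF iB Idt_hvhom[OF D] g] Idt_hvcmp[OF Idt_hvhom[OF D]]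
          by simp
      qed
    qed
    then show "(j, g) \<in> \<sigma>" using \<sigma>[OF j] g by simp
  next
    have "locally T A (\<lambda>B. B \<in> S)"
      using S by (auto simp: locally_def)
    then show "locally T A (\<lambda>B. \<exists>g. (Idt G B, g) \<in> \<sigma>)"
    proof (rule locally_bind[OF A])
      fix B assume B: "ole G B A" "B \<in> S"
      show "locally T B (\<lambda>D. \<exists>g. (Idt G D, g) \<in> \<sigma>)"
        using \<sigma>x[OF B(2) Idt_hvhom] by (intro locally_mono[OF le(1)[OF B(2)] secD(5)[OF x[OF B(2)]]]) blast
    qed
  qed
  show "\<forall>B\<in>S. res A (Idt G B) \<sigma> = x B"
  proof
    fix B assume B: "B \<in> S"
    have "(j, g) \<in> res A (Idt G B) \<sigma> \<longleftrightarrow> (j, g) \<in> x B" for j g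
    proof (cases "j \<in> hvhom G (Dom G j) B")
      case True
      then show ?thesis
        using res_iff[OF Idt_hvhom[OF le(2)[OF B]] True] Idt_hvcmp[OF True] \<sigma>x[OF B True] by simp
    next
      case False
      then show ?thesis
        using secD(1)[OF x[OF B]] le(1)[OF B] by (auto simp: res_def)
    qed
    then show "res A (Idt G B) \<sigma> = x B" by auto
  qed
qed

lemma shf_sheaf: "is_sheaf G T shf"
proof (rule is_sheafI[OF shf_presheaf])
  fix A x y
  assume A: "A \<in> Obj G" and xy: "x \<in> val shf A" "y \<in> val shf A"
    and l: "locally T A (\<lambda>B. pull G shf A (Idt G B) x = pull G shf A (Idt G B) y)"
  have xs: "x \<in> sec A" "y \<in> sec A" using xy by (auto simp: shf_val)
  have "locally T A (\<lambda>B. res A (Idt G B) x = res A (Idt G B) y)"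
    using shf_pull[OF Idt_hvhom] xs by (intro locally_mono[OF A l]) simp
  moreover have "locally T A (\<lambda>B. res A (Idt G B) y = res A (Idt G B) x)"
    using shf_pull[OF Idt_hvhom] xs by (intro locally_mono[OF A l]) simp
  ultimately show "x = y"
    using sec_subset[OF A xs] sec_subset[OF A xs(2,1)] by blast
next
  fix A S x
  assume A: "A \<in> Obj G" and S: "S \<in> T A" and x: "\<And>B. B \<in> S \<Longrightarrow> x B \<in> val shf B"
    and m: "\<And>B D. B \<in> S \<Longrightarrow> ole G D B \<Longrightarrow> pull G shf B (Idt G D) (x B) = x D"
  have xs: "x B \<in> sec B" if "B \<in> S" for B using x[OF that] by (simp add: shf_val)
  have "res B (Idt G D) (x B) = x D" if "B \<in> S" "ole G D B" for B D
    using m[OF that] shf_pull[OF Idt_hvhom[OF that(2)] xs[OF that(1)]] by simp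
  from sec_glue[OF A S xs this] obtain \<sigma> where \<sigma>: "\<sigma> \<in> sec A" "\<And>B. B \<in> S \<Longrightarrow> res A (Idt G B) \<sigma> = x B"
    by blast
  then show "\<exists>y\<in>val shf A. \<forall>B\<in>S. pull G shf A (Idt G B) y = x B"
    using shf_pull[OF Idt_hvhom[OF covering_le[OF A S]] \<sigma>(1)]
    by (intro bexI[of _ \<sigma>]) (simp_all add: shf_val)
qed

section \<open>Generators, their kernel and the number of sections\<close>

definition unit_sec :: "'o \<Rightarrow> 'g \<Rightarrow> ('a \<times> 'g) set" where
  "unit_sec A g = {(j, g'). j \<in> hvhom G (Dom G j) A \<and> g' \<in> P (Dom G j) \<and> eqv (Dom G j) (r j g) g'}"

lemma unit_sec_iff:
  "j \<in> hvhom G U A \<Longrightarrow> (j, g') \<in> unit_sec A g \<longleftrightarrow> g' \<in> P U \<and> eqv U (r j g) g'"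
  using hvhom_Dom[of j U A] by (simp add: unit_sec_def)

lemma unit_sec:
  assumes A: "A \<in> Obj G" and g: "g \<in> P A"
  shows "unit_sec A g \<in> sec A"
proof (rule secI)
  show "j \<in> hvhom G (Dom G j) A \<and> g' \<in> P (Dom G j)" if "(j, g') \<in> unit_sec A g" for j g'
    using that by (simp add: unit_sec_def)
  fix U j g1 assume j: "j \<in> hvhom G U A"
  have U: "U \<in> Obj G" using hvhom_Obj[OF j] by simp
  note jg = r_in[OF j g]
  show "(j, g') \<in> unit_sec A g \<longleftrightarrow> eqv U g1 g'" if "(j, g1) \<in> unit_sec A g" "g' \<in> P U" for g'
    using that unit_sec_iff[OF j] eqv_trans[OF U, of "r j g"] eqv_trans[OF U, of g1 "r j g" g']
      eqv_sym[OF U, of "r j g" g1] jg by blast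
  show "(hvcmp G j i, r i g1) \<in> unit_sec A g" if i: "i \<in> hvhom G U' U" and "(j, g1) \<in> unit_sec A g" for U' i
    using that(2) unit_sec_iff[OF j] unit_sec_iff[OF hvcmp_hvhom[OF i j]] r_in[OF i]
      eqv_r[OF i jg, of g1] r_r[OF j i g] by simp
  assume g1: "g1 \<in> P U"
    and l: "locally T U (\<lambda>B. (hvcmp G j (Idt G B), r (Idt G B) g1) \<in> unit_sec A g)"
  have "locally T U (\<lambda>B. eqv B (r (Idt G B) (r j g)) (r (Idt G B) g1))"
    using unit_sec_iff[OF hvcmp_hvhom[OF Idt_hvhom j]] r_r[OF j Idt_hvhom g]
    by (intro locally_mono[OF U l]) simp
  then show "(j, g1) \<in> unit_sec A g"
    using eqv_local[OF U jg g1] unit_sec_iff[OF j] g1 by simp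
next
  show "locally T A (\<lambda>B. \<exists>g'. (Idt G B, g') \<in> unit_sec A g)"
    using unit_sec_iff[OF Idt_hvhom] r_in[OF Idt_hvhom g] eqv_refl ole_Obj
    by (intro locally_all[OF A]) metis
qed

lemma res_unit_sec:
  assumes h: "h \<in> hvhom G B A" and g: "g \<in> P A"
  shows "res A h (unit_sec A g) = unit_sec B (r h g)"
proof -
  have "(j, g') \<in> res A h (unit_sec A g) \<longleftrightarrow> (j, g') \<in> unit_sec B (r h g)" for j g'
  proof (cases "j \<in> hvhom G (Dom G j) B")
    case True
    then show ?thesis
      using res_iff[OF h True] unit_sec_iff[OF True] unit_sec_iff[OF hvcmp_hvhom[OF True h]]
        r_r[OF h True g] by simp
  next
    case False
    then show ?thesis
      using hvhom_Dom[OF h] by (simp add: res_def unit_sec_def)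
  qed
  then show ?thesis by auto
qed

lemma unit_sec_eq_iff:
  assumes A: "A \<in> Obj G" and g: "g \<in> P A" "g' \<in> P A"
  shows "unit_sec A g = unit_sec A g' \<longleftrightarrow> eqv A g g'"
proof
  note i = Idt_hvhom[OF ole_refl[OF A]]
  assume "unit_sec A g = unit_sec A g'"
  moreover have "(Idt G A, g') \<in> unit_sec A g'"
    using unit_sec_iff[OF i] r_Idt[OF A g(2)] eqv_refl[OF A g(2)] g by simp
  ultimately show "eqv A g g'"
    using unit_sec_iff[OF i] r_Idt[OF A g(1)] by metis
next
  assume e: "eqv A g g'"
  have "(j, g1) \<in> unit_sec A g \<longleftrightarrow> (j, g1) \<in> unit_sec A g'" for j g1
  proof (cases "j \<in> hvhom G (Dom G j) A")
    case True
    have D: "Dom G j \<in> Obj G" using hvhom_Obj[OF True] by simp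
    note rg = r_in[OF True g(1)] r_in[OF True g(2)]
    note e1 = eqv_r[OF True g e]
    show ?thesis
      using unit_sec_iff[OF True] eqv_trans[OF D rg(1) rg(2) _ e1] eqv_trans[OF D rg(2) rg(1)]
        eqv_sym[OF D rg e1] by blast
  qed (simp add: unit_sec_def)
  then show "unit_sec A g = unit_sec A g'" by auto
qed

text \<open>Once a section has a representative at \<open>B\<close>, saturation under
  \<open>eqv\<close> and closure under restriction leave no freedom below \<open>B\<close>. Both
  local generation and the counting of sections rest on this.\<close>

lemma res_eq_unit_sec:
  assumes \<sigma>: "\<sigma> \<in> sec A" and B: "ole G B A" and g: "(Idt G B, g) \<in> \<sigma>"
  shows "res A (Idt G B) \<sigma> = unit_sec B g"
proof -
  note iB = Idt_hvhom[OF B]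
  have "(j, g') \<in> res A (Idt G B) \<sigma> \<longleftrightarrow> (j, g') \<in> unit_sec B g" for j g'
  proof (cases "j \<in> hvhom G (Dom G j) B")
    case True
    note jA = hvhom_mono[OF True B]
    have jg: "(j, r j g) \<in> \<sigma>"
      using secD(3)[OF \<sigma> iB True g] Idt_hvcmp[OF True] by simp
    have "(j, g') \<in> \<sigma> \<longleftrightarrow> g' \<in> P (Dom G j) \<and> eqv (Dom G j) (r j g) g'"
      using secD(2)[OF \<sigma> jA jg] secD(1)[OF \<sigma>, of j g'] by blast
    then show ?thesis
      using res_iff[OF iB True] unit_sec_iff[OF True] Idt_hvcmp[OF True] by simp
  next
    case False
    then show ?thesis
      using ole_Obj[OF B] by (simp add: res_def unit_sec_def)
  qed
  then show ?thesis by auto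
qed

text \<open>A section is recovered from a choice of one representative for each arrow: where two
  sections have the same chosen representative at \<open>Idt G B\<close>, they coincide below
  \<open>B\<close>, and such \<open>B\<close> cover. The choice is a function from
  \<open>Arr G\<close> to \<open>'u\<close>, and smallness bounds these.\<close>

lemma sec_lepoll:
  assumes small: "small_groupoid TYPE('u) G" and size: "(\<Union>A\<in>Obj G. P A) \<lesssim> (UNIV :: 'u set)"
    and A: "A \<in> Obj G"
  shows "sec A \<lesssim> (UNIV :: 'u set)"
proof -
  obtain e :: "'g \<Rightarrow> 'u" where e: "inj_on e (\<Union>A\<in>Obj G. P A)"
    using size by (auto simp: lepoll_def)
  \<comment> \<open>At arrows without a representative the value is arbitrary; only identities
    \<open>Idt G B\<close> at which both sections have a representative are compared.\<close>
  define c where "c \<sigma> = (\<lambda>j\<in>Arr G. e (SOME g. (j, g) \<in> \<sigma>))" for \<sigma>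
  have sub: "\<sigma> \<subseteq> \<tau>" if \<sigma>: "\<sigma> \<in> sec A" and \<tau>: "\<tau> \<in> sec A" and eq: "c \<sigma> = c \<tau>" for \<sigma> \<tau>
  proof (rule sec_subset[OF A \<sigma> \<tau>])
    show "locally T A (\<lambda>B. res A (Idt G B) \<sigma> = res A (Idt G B) \<tau>)"
    proof (rule locally_mono[OF A locally_conj[OF A secD(5)[OF \<sigma>] secD(5)[OF \<tau>]]])
      fix B assume B: "ole G B A" and ex: "(\<exists>g. (Idt G B, g) \<in> \<sigma>) \<and> (\<exists>g. (Idt G B, g) \<in> \<tau>)"
      define g where "g = (SOME g. (Idt G B, g) \<in> \<sigma>)"
      define g' where "g' = (SOME g. (Idt G B, g) \<in> \<tau>)"
      have g\<sigma>: "(Idt G B, g) \<in> \<sigma>" and g\<tau>: "(Idt G B, g') \<in> \<tau>"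
        using ex someI_ex[of "\<lambda>g. (Idt G B, g) \<in> \<sigma>"] someI_ex[of "\<lambda>g. (Idt G B, g) \<in> \<tau>"]
        unfolding g_def g'_def by blast+
      have BO: "B \<in> Obj G" using ole_Obj[OF B] by simp
      have "g \<in> P B" "g' \<in> P B"
        using secD(1)[OF \<sigma> g\<sigma>] secD(1)[OF \<tau> g\<tau>] BO by auto
      moreover have "e g = e g'"
        using fun_cong[OF eq, of "Idt G B"] BO by (simp add: c_def g_def g'_def)
      ultimately have "g = g'"
        using e BO by (auto simp: inj_on_def)
      then show "res A (Idt G B) \<sigma> = res A (Idt G B) \<tau>"
        using res_eq_unit_sec[OF \<sigma> B g\<sigma>] res_eq_unit_sec[OF \<tau> B g\<tau>] by simp
    qed
  qed
  have "inj_on c (sec A)"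
    using sub by (intro inj_onI subset_antisym) auto
  then have "sec A \<lesssim> (Arr G \<rightarrow>\<^sub>E (UNIV :: 'u set))"
    unfolding lepoll_def by (intro exI[of _ c]) (auto simp: c_def)
  then show ?thesis
    using small lepoll_trans unfolding small_groupoid_def by blast
qed

text \<open>An elementwise substitute for the universal property, which
  \<open>extend_along_generators\<close> recovers: local generation says that there are no further
  sections, and the last clause determines the kernel of \<open>\<iota>\<close> exactly.\<close>

definition is_sheafification :: "('o, 'a, 'u) presheaf \<Rightarrow> ('o \<Rightarrow> 'g \<Rightarrow> 'u) \<Rightarrow> bool" where
  "is_sheafification N \<iota> \<longleftrightarrow> is_sheaf G T N \<and>
    (\<forall>A g. A \<in> Obj G \<longrightarrow> g \<in> P A \<longrightarrow> \<iota> A g \<in> val N A) \<and>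
    (\<forall>A B h g. h \<in> hvhom G B A \<longrightarrow> g \<in> P A \<longrightarrow> pull G N A h (\<iota> A g) = \<iota> B (r h g)) \<and>
    (\<forall>A z. A \<in> Obj G \<longrightarrow> z \<in> val N A \<longrightarrow>
       locally T A (\<lambda>B. \<exists>g\<in>P B. pull G N A (Idt G B) z = \<iota> B g)) \<and>
    (\<forall>A g g'. A \<in> Obj G \<longrightarrow> g \<in> P A \<longrightarrow> g' \<in> P A \<longrightarrow> \<iota> A g = \<iota> A g' \<longleftrightarrow> eqv A g g')"

lemma is_sheafificationD:
  assumes "is_sheafification N \<iota>"
  shows "is_sheaf G T N"
    and "A \<in> Obj G \<Longrightarrow> g \<in> P A \<Longrightarrow> \<iota> A g \<in> val N A"
    and "h \<in> hvhom G B A \<Longrightarrow> g \<in> P A \<Longrightarrow> pull G N A h (\<iota> A g) = \<iota> B (r h g)"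
    and "A \<in> Obj G \<Longrightarrow> z \<in> val N A \<Longrightarrow>
      locally T A (\<lambda>B. \<exists>g\<in>P B. pull G N A (Idt G B) z = \<iota> B g)"
    and "A \<in> Obj G \<Longrightarrow> g \<in> P A \<Longrightarrow> g' \<in> P A \<Longrightarrow> \<iota> A g = \<iota> A g' \<longleftrightarrow> eqv A g g'"
  using assms by (simp_all add: is_sheafification_def)

theorem sheafification:
  assumes small: "small_groupoid TYPE('u) G" and size: "(\<Union>A\<in>Obj G. P A) \<lesssim> (UNIV :: 'u set)"
  shows "\<exists>(N :: ('o, 'a, 'u) presheaf) \<iota>. is_sheafification N \<iota>"
proof -
  have "\<exists>(F' :: ('o, 'a, 'u) presheaf) e. is_sheaf G T F' \<and>
    (\<forall>A\<in>Obj G. bij_betw (e A) (val shf A) (val F' A)) \<and>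
    (\<forall>A B h x. h \<in> hvhom G B A \<longrightarrow> x \<in> val shf A \<longrightarrow>
       e B (pull G shf A h x) = pull G F' A h (e A x))"
    using sec_lepoll[OF small size] by (intro sheaf_transport[OF shf_sheaf]) (simp add: shf_val)
  then obtain N :: "('o, 'a, 'u) presheaf" and e where N: "is_sheaf G T N"
    and bij: "\<And>A. A \<in> Obj G \<Longrightarrow> bij_betw (e A) (sec A) (val N A)"
    and nat: "\<And>A B h x. h \<in> hvhom G B A \<Longrightarrow> x \<in> sec A \<Longrightarrow> e B (res A h x) = pull G N A h (e A x)"
    unfolding shf_val using shf_pull by metis
  define \<iota> where "\<iota> A g = e A (unit_sec A g)" for A g
  have "\<iota> A g \<in> val N A" if "A \<in> Obj G" "g \<in> P A" for A g
    using that bij_betwE[OF bij] unit_sec by (simp add: \<iota>_def)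
  moreover have "pull G N A h (\<iota> A g) = \<iota> B (r h g)" if "h \<in> hvhom G B A" "g \<in> P A" for A B h g
    using nat[OF that(1) unit_sec, symmetric] hvhom_Obj[OF that(1)] that(2) res_unit_sec[OF that]
    by (simp add: \<iota>_def)
  moreover have "locally T A (\<lambda>B. \<exists>g\<in>P B. pull G N A (Idt G B) z = \<iota> B g)"
    if A: "A \<in> Obj G" and z: "z \<in> val N A" for A z
  proof -
    obtain \<sigma> where \<sigma>: "\<sigma> \<in> sec A" "z = e A \<sigma>"
      using bij[OF A] z by (auto simp: bij_betw_def)
    show ?thesis
    proof (rule locally_mono[OF A secD(5)[OF \<sigma>(1)]])
      fix B assume B: "ole G B A" "\<exists>g. (Idt G B, g) \<in> \<sigma>"
      then obtain g where g: "(Idt G B, g) \<in> \<sigma>" by blast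
      have "g \<in> P B"
        using secD(1)[OF \<sigma>(1) g] ole_Obj[OF B(1)] by simp
      moreover have "pull G N A (Idt G B) z = \<iota> B g"
        using nat[OF Idt_hvhom[OF B(1)] \<sigma>(1)] res_eq_unit_sec[OF \<sigma>(1) B(1) g] \<sigma>(2) by (simp add: \<iota>_def)
      ultimately show "\<exists>g\<in>P B. pull G N A (Idt G B) z = \<iota> B g" by blast
    qed
  qed
  moreover have "\<iota> A g = \<iota> A g' \<longleftrightarrow> eqv A g g'" if "A \<in> Obj G" "g \<in> P A" "g' \<in> P A" for A g g'
    using inj_on_eq_iff[OF bij_betw_imp_inj_on[OF bij[OF that(1)]]
        unit_sec[OF that(1,2)] unit_sec[OF that(1,3)]] unit_sec_eq_iff[OF that]
    by (simp add: \<iota>_def)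
  ultimately show ?thesis
    using N unfolding is_sheafification_def by (intro exI[of _ N] exI[of _ \<iota>]) blast
qed

end

section \<open>Universal arrows and adjoints\<close>

definition universal_arrow ::
  "('o, 'a, 'z) category_scheme \<Rightarrow> ('p, 'b, 'y) category_scheme \<Rightarrow> ('p, 'b, 'o, 'a) fnctr \<Rightarrow>
    'o \<Rightarrow> 'p \<Rightarrow> 'a \<Rightarrow> bool" where
  "universal_arrow C D R X U e \<longleftrightarrow> U \<in> Obj D \<and> e \<in> hom C X (on_obj R U) \<and>
     (\<forall>Y\<in>Obj D. \<forall>g\<in>hom C X (on_obj R Y). \<exists>!k. k \<in> hom D U Y \<and> Cmp C (on_arr R k) e = g)"

lemma ex1_unique: "\<exists>!x. P x \<Longrightarrow> P a \<Longrightarrow> P b \<Longrightarrow> a = b"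
  by blast

text \<open>The additional conclusions keep the given objects and unit visible: exactness of the
  inverse image is later computed on elements that come from the unit.\<close>

lemma left_adjoint_of_universal_arrows:
  fixes C :: "('o, 'a, 'z) category_scheme" and D :: "('p, 'b, 'y) category_scheme"
  assumes R: "is_functor D C R"
    and univ: "\<And>X. X \<in> Obj C \<Longrightarrow> universal_arrow C D R X (U X) (\<eta> X)"
  shows "\<exists>L. is_left_adjoint C D L R \<and> (\<forall>X\<in>Obj C. on_obj L X = U X) \<and>
    (\<forall>X X' f. f \<in> hom C X X' \<longrightarrow> Cmp C (on_arr R (on_arr L f)) (\<eta> X) = Cmp C (\<eta> X') f)"
proof -
  interpret R: is_functor D C R by (rule R)
  have U: "U X \<in> Obj D" and \<eta>: "\<eta> X \<in> hom C X (on_obj R (U X))" if "X \<in> Obj C" for X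
    using univ[OF that] by (auto simp: universal_arrow_def)
  define tr where "tr X Y g = (THE k. k \<in> hom D (U X) Y \<and> Cmp C (on_arr R k) (\<eta> X) = g)" for X Y g
  have ex1: "\<exists>!k. k \<in> hom D (U X) Y \<and> Cmp C (on_arr R k) (\<eta> X) = g"
    if "X \<in> Obj C" "Y \<in> Obj D" "g \<in> hom C X (on_obj R Y)" for X Y g
    using univ[OF that(1)] that(2,3) unfolding universal_arrow_def by blast
  have tr: "tr X Y g \<in> hom D (U X) Y \<and> Cmp C (on_arr R (tr X Y g)) (\<eta> X) = g"
    if "X \<in> Obj C" "Y \<in> Obj D" "g \<in> hom C X (on_obj R Y)" for X Y g
    using theI'[OF ex1[OF that]] unfolding tr_def .
  have uniq: "k = k'" if "X \<in> Obj C" "Y \<in> Obj D" "k \<in> hom D (U X) Y" "k' \<in> hom D (U X) Y"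
    "Cmp C (on_arr R k) (\<eta> X) = Cmp C (on_arr R k') (\<eta> X)" for X Y k k'
    by (rule ex1_unique[OF ex1[OF that(1,2) R.target.Cmp_hom[OF \<eta>[OF that(1)] R.fnctr_arr[OF that(4)]]]])
      (use that(3-5) in simp_all)
  define L where "L = \<lparr>on_obj = U, on_arr = (\<lambda>f. tr (Dom C f) (U (Cod C f)) (Cmp C (\<eta> (Cod C f)) f))\<rparr>"
  have L_arr: "on_arr L f \<in> hom D (U X) (U X') \<and>
      Cmp C (on_arr R (on_arr L f)) (\<eta> X) = Cmp C (\<eta> X') f"
    if "f \<in> hom C X X'" for X X' f
  proof -
    have X: "X \<in> Obj C" "X' \<in> Obj C" using R.target.hom_Obj[OF that] by auto
    show ?thesis
      using tr[OF X(1) U[OF X(2)] R.target.Cmp_hom[OF that \<eta>[OF X(2)]]] that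
      by (simp add: L_def hom_def)
  qed
  have step: "Cmp C (on_arr R (Cmp D g h)) (\<eta> X) = Cmp C (on_arr R g) (Cmp C (on_arr R h) (\<eta> X))"
    if "X \<in> Obj C" "h \<in> hom D (U X) Y" "g \<in> hom D Y Z" for X Y Z g h
    using R.fnctr_Cmp[OF that(2,3)]
      R.target.Cmp_assoc[OF \<eta>[OF that(1)] R.fnctr_arr[OF that(2)] R.fnctr_arr[OF that(3)]] by simp
  have L: "is_functor C D L"
  proof
    fix X assume X: "X \<in> Obj C"
    show "on_obj L X \<in> Obj D" using U[OF X] by (simp add: L_def)
    have i: "Idt C X \<in> hom C X X" using R.target.Idt_hom[OF X] .
    show "on_arr L (Idt C X) = Idt D (on_obj L X)"
    proof (rule uniq[OF X U[OF X]])
      show "on_arr L (Idt C X) \<in> hom D (U X) (U X)" using L_arr[OF i] by simp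
      show "Idt D (on_obj L X) \<in> hom D (U X) (U X)"
        using R.source.Idt_hom[OF U[OF X]] by (simp add: L_def)
      show "Cmp C (on_arr R (on_arr L (Idt C X))) (\<eta> X) = Cmp C (on_arr R (Idt D (on_obj L X))) (\<eta> X)"
        using L_arr[OF i] R.fnctr_Idt[OF U[OF X]] R.target.Cmp_Idt_hom[OF \<eta>[OF X]]
          R.target.Idt_Cmp_hom[OF \<eta>[OF X]] by (simp add: L_def)
    qed
  next
    fix X Y Z f g
    assume f: "f \<in> hom C X Y"
    then show "on_arr L f \<in> hom D (on_obj L X) (on_obj L Y)"
      using L_arr by (simp add: L_def)
    assume g: "g \<in> hom C Y Z"
    have X: "X \<in> Obj C" "Y \<in> Obj C" "Z \<in> Obj C"
      using R.target.hom_Obj[OF f] R.target.hom_Obj[OF g] by auto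
    note Lf = L_arr[OF f] and Lg = L_arr[OF g] and gf = R.target.Cmp_hom[OF f g]
    show "on_arr L (Cmp C g f) = Cmp D (on_arr L g) (on_arr L f)"
    proof (rule uniq[OF X(1) U[OF X(3)]])
      show "on_arr L (Cmp C g f) \<in> hom D (U X) (U Z)" using L_arr[OF gf] by simp
      show "Cmp D (on_arr L g) (on_arr L f) \<in> hom D (U X) (U Z)"
        using R.source.Cmp_hom[of "on_arr L f" "U X" "U Y" "on_arr L g" "U Z"] Lf Lg by simp
      have "Cmp C (on_arr R (Cmp D (on_arr L g) (on_arr L f))) (\<eta> X) =
          Cmp C (on_arr R (on_arr L g)) (Cmp C (\<eta> Y) f)"
        using step[OF X(1), of "on_arr L f" "U Y" "on_arr L g" "U Z"] Lf Lg by simp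
      also have "\<dots> = Cmp C (Cmp C (\<eta> Z) g) f"
        using R.target.Cmp_assoc[OF f \<eta>[OF X(2)] R.fnctr_arr, of "on_arr L g" "U Z"] Lg by simp
      also have "\<dots> = Cmp C (\<eta> Z) (Cmp C g f)"
        using R.target.Cmp_assoc[OF f g \<eta>[OF X(3)]] by simp
      finally show "Cmp C (on_arr R (on_arr L (Cmp C g f))) (\<eta> X) =
          Cmp C (on_arr R (Cmp D (on_arr L g) (on_arr L f))) (\<eta> X)"
        using L_arr[OF gf] by simp
    qed
  qed
  define \<phi> where "\<phi> X (Y :: 'p) k = Cmp C (on_arr R k) (\<eta> X)" for X Y k
  have "is_left_adjoint C D L R"
    unfolding is_left_adjoint_def
  proof (intro conjI exI[of _ \<phi>] ballI)
    fix X Y assume X: "X \<in> Obj C" and Y: "Y \<in> Obj D"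
    show "bij_betw (\<phi> X Y) (hom D (on_obj L X) Y) (hom C X (on_obj R Y))"
    proof (rule bij_betw_imageI)
      show "inj_on (\<phi> X Y) (hom D (on_obj L X) Y)"
        using uniq[OF X Y] by (auto simp: inj_on_def \<phi>_def L_def)
      show "\<phi> X Y ` hom D (on_obj L X) Y = hom C X (on_obj R Y)"
      proof safe
        show "\<phi> X Y k \<in> hom C X (on_obj R Y)" if "k \<in> hom D (on_obj L X) Y" for k
          using that R.target.Cmp_hom[OF \<eta>[OF X] R.fnctr_arr] by (simp add: \<phi>_def L_def)
        show "g \<in> \<phi> X Y ` hom D (on_obj L X) Y" if "g \<in> hom C X (on_obj R Y)" for g
          using tr[OF X Y that] by (intro image_eqI[of _ _ "tr X Y g"]) (simp_all add: \<phi>_def L_def)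
      qed
    qed
  next
    fix X X' Y Y' u v k
    assume X: "X \<in> Obj C" "X' \<in> Obj C" and Y: "Y \<in> Obj D" "Y' \<in> Obj D"
      and u: "u \<in> hom C X' X" and v: "v \<in> hom D Y Y'" and k': "k \<in> hom D (on_obj L X) Y"
    have k: "k \<in> hom D (U X) Y" using k' by (simp add: L_def)
    have Lu: "on_arr L u \<in> hom D (U X') (U X)" "Cmp C (on_arr R (on_arr L u)) (\<eta> X') = Cmp C (\<eta> X) u"
      using L_arr[OF u] by auto
    have "\<phi> X' Y' (Cmp D v (Cmp D k (on_arr L u))) =
        Cmp C (on_arr R v) (Cmp C (on_arr R k) (Cmp C (\<eta> X) u))"
      using step[OF X(2) R.source.Cmp_hom[OF Lu(1) k] v] step[OF X(2) Lu(1) k] Lu(2)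
      by (simp add: \<phi>_def)
    then show "\<phi> X' Y' (Cmp D v (Cmp D k (on_arr L u))) = Cmp C (on_arr R v) (Cmp C (\<phi> X Y k) u)"
      using R.target.Cmp_assoc[OF u \<eta>[OF X(1)] R.fnctr_arr[OF k]] by (simp add: \<phi>_def)
  qed (rule L R)+
  then show ?thesis
    using L_arr by (intro exI[of _ L]) (simp add: L_def)
qed

text \<open>The unit is the transpose of the identity; naturality of the bijection
  \<open>\<phi>\<close> makes every transpose a composite with it. The necessity part knows the
  adjunction only in this form.\<close>

lemma universal_arrows_of_left_adjoint:
  assumes "is_left_adjoint C D L R"
  shows "\<exists>\<eta>. (\<forall>X\<in>Obj C. universal_arrow C D R X (on_obj L X) (\<eta> X)) \<and>
    (\<forall>X X' f. f \<in> hom C X X' \<longrightarrow> Cmp C (on_arr R (on_arr L f)) (\<eta> X) = Cmp C (\<eta> X') f)"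
proof -
  from assms have L: "is_functor C D L" and R: "is_functor D C R"
    by (auto simp: is_left_adjoint_def)
  interpret L: is_functor C D L by (rule L)
  interpret R: is_functor D C R by (rule R)
  from assms obtain \<phi> where
    bij: "\<And>X Y. X \<in> Obj C \<Longrightarrow> Y \<in> Obj D \<Longrightarrow>
      bij_betw (\<phi> X Y) (hom D (on_obj L X) Y) (hom C X (on_obj R Y))"
    and nat: "\<And>X X' Y Y' u v k. X \<in> Obj C \<Longrightarrow> X' \<in> Obj C \<Longrightarrow> Y \<in> Obj D \<Longrightarrow> Y' \<in> Obj D \<Longrightarrow>
      u \<in> hom C X' X \<Longrightarrow> v \<in> hom D Y Y' \<Longrightarrow> k \<in> hom D (on_obj L X) Y \<Longrightarrow>
      \<phi> X' Y' (Cmp D v (Cmp D k (on_arr L u))) = Cmp C (on_arr R v) (Cmp C (\<phi> X Y k) u)"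
    unfolding is_left_adjoint_def by blast
  define \<eta> where "\<eta> X = \<phi> X (on_obj L X) (Idt D (on_obj L X))" for X
  have LX: "on_obj L X \<in> Obj D" "Idt D (on_obj L X) \<in> hom D (on_obj L X) (on_obj L X)" if "X \<in> Obj C" for X
    using L.fnctr_obj[OF that] L.target.Idt_hom by auto
  have \<eta>: "\<eta> X \<in> hom C X (on_obj R (on_obj L X))" if "X \<in> Obj C" for X
    using bij_betwE[OF bij[OF that LX(1)[OF that]]] LX[OF that] by (simp add: \<eta>_def)
  have \<phi>: "\<phi> X Y v = Cmp C (on_arr R v) (\<eta> X)" if X: "X \<in> Obj C" and v: "v \<in> hom D (on_obj L X) Y" for X Y v
  proof -
    have Y: "Y \<in> Obj D" using L.target.hom_Obj[OF v] by simp
    show ?thesis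
      using nat[OF X X LX(1)[OF X] Y L.source.Idt_hom[OF X] v LX(2)[OF X]]
        L.fnctr_Idt[OF X] L.target.Cmp_Idt_hom[OF LX(2)[OF X]] L.target.Cmp_Idt_hom[OF v]
        L.source.Cmp_Idt_hom[OF \<eta>[OF X]] by (simp add: \<eta>_def)
  qed
  have "universal_arrow C D R X (on_obj L X) (\<eta> X)" if X: "X \<in> Obj C" for X
    unfolding universal_arrow_def
  proof (intro conjI ballI LX(1)[OF X] \<eta>[OF X])
    fix Y g assume Y: "Y \<in> Obj D" and g: "g \<in> hom C X (on_obj R Y)"
    note b = bij[OF X Y]
    have "g \<in> \<phi> X Y ` hom D (on_obj L X) Y"
      using bij_betw_imp_surj_on[OF b] g by simp
    then obtain k where "k \<in> hom D (on_obj L X) Y" "\<phi> X Y k = g"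
      by blast
    then show "\<exists>!k. k \<in> hom D (on_obj L X) Y \<and> Cmp C (on_arr R k) (\<eta> X) = g"
      using bij_betw_imp_inj_on[OF b] \<phi>[OF X] by (auto simp: inj_on_def)
  qed
  moreover have "Cmp C (on_arr R (on_arr L u)) (\<eta> X') = Cmp C (\<eta> X) u" if u: "u \<in> hom C X' X" for X X' u
  proof -
    have X: "X \<in> Obj C" "X' \<in> Obj C" using L.source.hom_Obj[OF u] by auto
    note Lu = L.fnctr_arr[OF u] and i = LX(2)[OF X(1)]
    have RI: "Cmp C (on_arr R (Idt D (on_obj L X))) (Cmp C (\<eta> X) u) = Cmp C (\<eta> X) u"
      using R.fnctr_Idt[OF LX(1)[OF X(1)]] L.source.Idt_Cmp_hom[OF L.source.Cmp_hom[OF u \<eta>[OF X(1)]]]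
      by simp
    have "\<phi> X' (on_obj L X) (on_arr L u) = Cmp C (\<eta> X) u"
      using nat[OF X LX(1)[OF X(1)] LX(1)[OF X(1)] u i i] L.target.Idt_Cmp_hom[OF Lu] RI
      by (simp add: \<eta>_def)
    then show ?thesis using \<phi>[OF X(2) Lu] by simp
  qed
  ultimately show ?thesis by blast
qed

section \<open>Representable sheaves\<close>

text \<open>A representable presheaf need not be a sheaf, so \<open>N\<close> stands for its
  sheafification and \<open>u\<close> for the image of the identity. Arrows into \<open>A\<close>
  are therefore seen only up to local equality. The existence half of the Yoneda property is
  included.\<close>

definition represents ::
  "('o, 'a, 'z) ordered_groupoid_scheme \<Rightarrow> ('o \<Rightarrow> 'o set set) \<Rightarrow> 'o \<Rightarrow> ('o, 'a, 'u) presheaf \<Rightarrow> 'u \<Rightarrow> bool"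
  where
  "represents G T A N u \<longleftrightarrow> is_sheaf G T N \<and> u \<in> val N A \<and>
     (\<forall>V\<in>Obj G. \<forall>z\<in>val N V.
        locally T V (\<lambda>B. \<exists>t\<in>hvhom G B A. pull G N V (Idt G B) z = pull G N A t u)) \<and>
     (\<forall>V. \<forall>t\<in>hvhom G V A. \<forall>t'\<in>hvhom G V A. pull G N A t u = pull G N A t' u \<longrightarrow>
        locally T V (\<lambda>B. hvcmp G t (Idt G B) = hvcmp G t' (Idt G B))) \<and>
     (\<forall>(Y :: ('o, 'a, 'u) presheaf) y. is_sheaf G T Y \<longrightarrow> y \<in> val Y A \<longrightarrow>
        (\<exists>m\<in>hom (Sh G T) N Y. cmpt m A u = y))"

context is_Ehresmann_site
begin

text \<open>Localizing keeps an equivalence relation stable because covers can be intersected and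
  pulled back, and localizing twice gives nothing new by transitivity of the topology.\<close>

lemma local_congruence_of_equiv:
  assumes r_in: "\<And>A B h g. h \<in> hvhom G B A \<Longrightarrow> g \<in> P A \<Longrightarrow> r h g \<in> P B"
    and r_Idt: "\<And>A g. A \<in> Obj G \<Longrightarrow> g \<in> P A \<Longrightarrow> r (Idt G A) g = g"
    and r_r: "\<And>A B D h k g. h \<in> hvhom G B A \<Longrightarrow> k \<in> hvhom G D B \<Longrightarrow> g \<in> P A \<Longrightarrow>
      r k (r h g) = r (hvcmp G h k) g"
    and refl: "\<And>A g. E A g g"
    and sym: "\<And>A g g'. E A g g' \<Longrightarrow> E A g' g"
    and trans: "\<And>A g g' g''. E A g g' \<Longrightarrow> E A g' g'' \<Longrightarrow> E A g g''"
    and E_r: "\<And>A B h g g'. h \<in> hvhom G B A \<Longrightarrow> g \<in> P A \<Longrightarrow> g' \<in> P A \<Longrightarrow> E A g g' \<Longrightarrow> E B (r h g) (r h g')"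
  shows "local_congruence G T P r (\<lambda>A g g'. locally T A (\<lambda>B. E B (r (Idt G B) g) (r (Idt G B) g')))"
proof
  show "locally T A (\<lambda>B. E B (r (Idt G B) g) (r (Idt G B) g))" if "A \<in> Obj G" for A g
    using refl by (rule locally_all[OF that])
  show "locally T A (\<lambda>B. E B (r (Idt G B) g') (r (Idt G B) g))"
    if "A \<in> Obj G" "locally T A (\<lambda>B. E B (r (Idt G B) g) (r (Idt G B) g'))" for A g g'
    by (rule locally_mono[OF that]) (rule sym)
  show "locally T A (\<lambda>B. E B (r (Idt G B) g) (r (Idt G B) g''))"
    if "A \<in> Obj G" "locally T A (\<lambda>B. E B (r (Idt G B) g) (r (Idt G B) g'))"
      "locally T A (\<lambda>B. E B (r (Idt G B) g') (r (Idt G B) g''))" for A g g' g''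
    by (rule locally_mono[OF that(1) locally_conj[OF that]]) (use trans in blast)
  show "locally T B (\<lambda>D. E D (r (Idt G D) (r h g)) (r (Idt G D) (r h g')))"
    if h: "h \<in> hvhom G B A" and g: "g \<in> P A" "g' \<in> P A"
      and e: "locally T A (\<lambda>B. E B (r (Idt G B) g) (r (Idt G B) g'))" for A B h g g'
  proof (rule locally_pullI[OF e h])
    fix D F k assume D: "ole G D B" and k_def: "k = hvcmp G h (Idt G D)"
      and k: "k \<in> hvhom G D F" "hvcmp G (Idt G F) k = k" and F: "ole G F A"
      and EF: "E F (r (Idt G F) g) (r (Idt G F) g')"
    note iF = Idt_hvhom[OF F]
    from E_r[OF k(1) r_in[OF iF g(1)] r_in[OF iF g(2)] EF]
    show "E D (r (Idt G D) (r h g)) (r (Idt G D) (r h g'))"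
      using r_r[OF iF k(1)] r_r[OF h Idt_hvhom[OF D]] g k(2) by (simp add: k_def)
  qed
  show "locally T A (\<lambda>B. E B (r (Idt G B) g) (r (Idt G B) g'))"
    if A: "A \<in> Obj G" and g: "g \<in> P A" "g' \<in> P A"
      and l: "locally T A (\<lambda>B. locally T B (\<lambda>D. E D (r (Idt G D) (r (Idt G B) g)) (r (Idt G D) (r (Idt G B) g'))))"
    for A g g'
  proof (rule locally_bind[OF A l])
    fix B assume B: "ole G B A"
      and l': "locally T B (\<lambda>D. E D (r (Idt G D) (r (Idt G B) g)) (r (Idt G D) (r (Idt G B) g')))"
    have BO: "B \<in> Obj G" using ole_Obj[OF B] by simp
    show "locally T B (\<lambda>D. E D (r (Idt G D) g) (r (Idt G D) g'))"
    proof (rule locally_mono[OF BO l'])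
      fix D assume D: "ole G D B" and "E D (r (Idt G D) (r (Idt G B) g)) (r (Idt G D) (r (Idt G B) g'))"
      then show "E D (r (Idt G D) g) (r (Idt G D) g')"
        using r_r[OF Idt_hvhom[OF B] Idt_hvhom[OF D]] g Idt_hvcmp[OF Idt_hvhom[OF D]] by simp
    qed
  qed
qed (rule r_in r_Idt r_r; assumption)+

lemma representable_sheaf:
  assumes small: "small_groupoid TYPE('u) G" and A: "A \<in> Obj G"
  shows "\<exists>(N :: ('o, 'a, 'u) presheaf) u. represents G T A N u"
proof -
  \<comment> \<open>Arrows into \<open>A\<close> are identified when they agree on a cover; this is
    equality made local.\<close>
  define E where "E V t t' \<longleftrightarrow> locally T V (\<lambda>B. hvcmp G t (Idt G B) = hvcmp G t' (Idt G B))" for V t t'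
  interpret local_congruence G T "\<lambda>V. hvhom G V A" "\<lambda>k t. hvcmp G t k" E
    unfolding E_def
    by (rule local_congruence_of_equiv[where E = "\<lambda>_. (=)" and r = "\<lambda>k t. hvcmp G t k"])
      (auto intro: hvcmp_hvhom hvcmp_Idt hvcmp_assoc)
  have "(\<Union>V\<in>Obj G. hvhom G V A) \<subseteq> Arr G" by (auto simp: hvhom_def)
  then have size: "(\<Union>V\<in>Obj G. hvhom G V A) \<lesssim> (UNIV :: 'u set)"
    using small_groupoid_Arr(1)[OF small] subset_imp_lepoll lepoll_trans by blast
  obtain N :: "('o, 'a, 'u) presheaf" and \<iota> where "is_sheafification N \<iota>"
    using sheafification[OF small size] by blast
  note N = is_sheafificationD(1)[OF this] and \<iota> = is_sheafificationD(2)[OF this]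
    and \<iota>_r = is_sheafificationD(3)[OF this] and gen = is_sheafificationD(4)[OF this]
    and eq = is_sheafificationD(5)[OF this]
  have iA: "Idt G A \<in> hvhom G A A" using Idt_hvhom[OF ole_refl[OF A]] .
  define u where "u = \<iota> A (Idt G A)"
  have u: "u \<in> val N A" using \<iota>[OF A iA] by (simp add: u_def)
  have tu: "pull G N A t u = \<iota> V t" if "t \<in> hvhom G V A" for t V
    using \<iota>_r[OF that iA] Idt_hvcmp[OF that] by (simp add: u_def)
  have "represents G T A N u"
    unfolding represents_def
  proof (intro conjI N u ballI allI impI)
    show "locally T V (\<lambda>B. \<exists>t\<in>hvhom G B A. pull G N V (Idt G B) z = pull G N A t u)"
      if "V \<in> Obj G" "z \<in> val N V" for V z
      by (rule locally_mono[OF that(1) gen[OF that]]) (use tu in force)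
    show "locally T V (\<lambda>B. hvcmp G t (Idt G B) = hvcmp G t' (Idt G B))"
      if "t \<in> hvhom G V A" "t' \<in> hvhom G V A" "pull G N A t u = pull G N A t' u" for V t t'
      using that eq[of V t t'] tu hvhom_Obj[OF that(1)] by (simp add: E_def)
    fix Y :: "('o, 'a, 'u) presheaf" and y
    assume Y: "is_sheaf G T Y" and y: "y \<in> val Y A"
    have "\<exists>m\<in>hom (Sh G T) N Y. \<forall>V\<in>Obj G. \<forall>t\<in>hvhom G V A. cmpt m V (\<iota> V t) = pull G Y A t y"
    proof (rule extend_along_generators[OF N Y, where r = "\<lambda>h t. hvcmp G t h"])
      fix V t t' assume V: "V \<in> Obj G" and t: "t \<in> hvhom G V A" "t' \<in> hvhom G V A" "\<iota> V t = \<iota> V t'"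
      show "pull G Y A t y = pull G Y A t' y"
      proof (rule sheaf_separated[OF Y V sheaf_pull_in[OF Y y t(1)] sheaf_pull_in[OF Y y t(2)]])
        have "E V t t'" using eq[OF V t(1,2)] t(3) by simp
        then show "locally T V (\<lambda>B. pull G Y V (Idt G B) (pull G Y A t y) =
            pull G Y V (Idt G B) (pull G Y A t' y))"
          unfolding E_def
        proof (rule locally_mono[OF V])
          fix B assume B: "ole G B V" "hvcmp G t (Idt G B) = hvcmp G t' (Idt G B)"
          then show "pull G Y V (Idt G B) (pull G Y A t y) = pull G Y V (Idt G B) (pull G Y A t' y)"
            using sheaf_pull_pull[OF Y y t(1) Idt_hvhom] sheaf_pull_pull[OF Y y t(2) Idt_hvhom] by simp
        qed
      qed
    next
      fix V B h t assume "h \<in> hvhom G B V" "t \<in> hvhom G V A"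
      then show "hvcmp G t h \<in> hvhom G B A \<and> pull G N V h (\<iota> V t) = \<iota> B (hvcmp G t h)"
        using hvcmp_hvhom \<iota>_r by blast
      show "pull G Y V h (pull G Y A t y) = pull G Y A (hvcmp G t h) y"
        using sheaf_pull_pull[OF Y y] \<open>h \<in> _\<close> \<open>t \<in> _\<close> by blast
    qed (use \<iota> gen sheaf_pull_in[OF Y y] in auto)
    then obtain m where m: "m \<in> hom (Sh G T) N Y"
      "\<forall>V\<in>Obj G. \<forall>t\<in>hvhom G V A. cmpt m V (\<iota> V t) = pull G Y A t y" by blast
    then have "cmpt m A u = y"
      using A iA sheaf_pull_Idt[OF Y A y] by (simp add: u_def)
    then show "\<exists>m\<in>hom (Sh G T) N Y. cmpt m A u = y"
      using m(1) by blast
  qed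
  then show ?thesis by blast
qed

text \<open>The witness consists of two copies of the representable sheaf on \<open>A\<close>, glued along \<open>R\<close>;
  \<open>u\<close> and \<open>v\<close> are their universal elements.\<close>

lemma sieve_detecting_sheaf:
  assumes small: "small_groupoid TYPE('u) G" and A: "A \<in> Obj G" and R: "is_vertical_sieve G A R"
  shows "\<exists>(N :: ('o, 'a, 'u) presheaf) u v. is_sheaf G T N \<and> u \<in> val N A \<and> v \<in> val N A \<and>
    (\<forall>B\<in>R. pull G N A (Idt G B) u = pull G N A (Idt G B) v) \<and> (u = v \<longrightarrow> R \<in> T A)"
proof -
  have R_le: "ole G B A" and R_down: "ole G B' B \<Longrightarrow> B' \<in> R" if "B \<in> R" for B B'
    using R that by (auto simp: is_vertical_sieve_def down_def)
  define P where "P V = hvhom G V A \<times> (UNIV :: bool set)" for V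
  define r where "r k = (\<lambda>(t, b :: bool). (hvcmp G t k, b))" for k
  \<comment> \<open>The Boolean names the copy. The copies are identified along arrows whose
    codomain lies in \<open>R\<close>, a condition stable under precomposition since
    \<open>R\<close> is downward closed.\<close>
  define E where "E = (\<lambda>_ :: 'o. \<lambda>(t, b :: bool) (t', b'). t = t' \<and> (b = b' \<or> Cod G t \<in> R))"
  interpret local_congruence G T P r "\<lambda>A g g'. locally T A (\<lambda>B. E B (r (Idt G B) g) (r (Idt G B) g'))"
  proof (rule local_congruence_of_equiv)
    show "E B (r h g) (r h g')" if h: "h \<in> hvhom G B V" and "g \<in> P V" "g' \<in> P V" "E V g g'" for V B h g g'
      using that R_down hvcmp(4)[OF h] by (auto simp: E_def r_def P_def hvhom_def)
  qed (auto simp: P_def r_def E_def intro: hvcmp_hvhom hvcmp_Idt hvcmp_assoc)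
  have inf: "infinite (UNIV :: 'u set)" using small by (simp add: small_groupoid_def)
  have "(\<Union>V\<in>Obj G. P V) \<subseteq> Arr G \<times> (UNIV :: bool set)" by (auto simp: P_def hvhom_def)
  moreover have "Arr G \<times> (UNIV :: bool set) \<lesssim> (UNIV :: 'u set)"
    by (intro infinite_times_lepoll[OF inf] small_groupoid_Arr(1)[OF small] finite_lepoll_infinite inf finite)
  ultimately have size: "(\<Union>V\<in>Obj G. P V) \<lesssim> (UNIV :: 'u set)"
    using subset_imp_lepoll lepoll_trans by blast
  obtain N :: "('o, 'a, 'u) presheaf" and \<iota> where "is_sheafification N \<iota>"
    using sheafification[OF small size] by blast
  note N = is_sheafificationD[OF this]
  have iA: "Idt G A \<in> hvhom G A A" using Idt_hvhom[OF ole_refl[OF A]] .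
  have g: "(Idt G A, b) \<in> P A" for b using iA by (simp add: P_def)
  have Bb: "(Idt G B, b) \<in> P B" if "ole G B A" for B b using Idt_hvhom[OF that] by (simp add: P_def)
  show ?thesis
  proof (intro exI conjI ballI impI)
    show "is_sheaf G T N" by (rule N(1))
    show "\<iota> A (Idt G A, True) \<in> val N A" "\<iota> A (Idt G A, False) \<in> val N A"
      using N(2)[OF A g] by simp_all
    fix B assume B: "B \<in> R"
    have BO: "B \<in> Obj G" using R_le[OF B] ole_Obj by blast
    have "locally T B (\<lambda>D. E D (r (Idt G D) (Idt G B, True)) (r (Idt G D) (Idt G B, False)))"
    proof (rule locally_all[OF BO])
      fix D assume D: "ole G D B"
      show "E D (r (Idt G D) (Idt G B, True)) (r (Idt G D) (Idt G B, False))"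
        using Idt_hvcmp[OF Idt_hvhom[OF D]] R_down[OF B D] ole_Obj[OF D] by (simp add: E_def r_def)
    qed
    then have "\<iota> B (Idt G B, True) = \<iota> B (Idt G B, False)"
      using N(5)[OF BO Bb[OF R_le[OF B]] Bb[OF R_le[OF B]]] by simp
    moreover have "pull G N A (Idt G B) (\<iota> A (Idt G A, b)) = \<iota> B (Idt G B, b)" for b
      using N(3)[OF Idt_hvhom[OF R_le[OF B]] g] Idt_hvcmp[OF Idt_hvhom[OF R_le[OF B]]] by (simp add: r_def)
    ultimately show "pull G N A (Idt G B) (\<iota> A (Idt G A, True)) = pull G N A (Idt G B) (\<iota> A (Idt G A, False))"
      by simp
  next
    \<comment> \<open>The two tags differ, so local agreement of the two identities puts every
      member of some covering sieve into \<open>R\<close>.\<close>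
    assume "\<iota> A (Idt G A, True) = \<iota> A (Idt G A, False)"
    then have "locally T A (\<lambda>D. E D (r (Idt G D) (Idt G A, True)) (r (Idt G D) (Idt G A, False)))"
      using N(5)[OF A g g] by simp
    then obtain S where S: "S \<in> T A" "\<forall>D\<in>S. E D (r (Idt G D) (Idt G A, True)) (r (Idt G D) (Idt G A, False))"
      by (auto simp: locally_def)
    have "D \<in> R" if "D \<in> S" for D
    proof -
      have "hvcmp G (Idt G A) (Idt G D) = Idt G D" "D \<in> Obj G"
        using Idt_hvcmp[OF Idt_hvhom] covering_le[OF A S(1) that] ole_Obj by blast+
      then show ?thesis using S(2) that by (auto simp: E_def r_def)
    qed
    then show "R \<in> T A" using covering_superset[OF A S(1) R] by blast
  qed
qed

text \<open>The uniqueness half of the Yoneda property: locally every section is a pullback of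
  \<open>u\<close>, and sections of \<open>Y\<close> are determined locally.\<close>

lemma represents_mor_eqI:
  assumes N: "represents G T A N u" and m: "m \<in> hom (Sh G T) N Y" "m' \<in> hom (Sh G T) N Y"
    and eq: "cmpt m A u = cmpt m' A u"
  shows "m = m'"
proof (rule Sh_mor_eqI[OF m])
  have u: "u \<in> val N A" using N by (simp add: represents_def)
  have Y: "is_sheaf G T Y" using m by (simp add: Sh_hom)
  fix V z assume V: "V \<in> Obj G" and z: "z \<in> val N V"
  show "cmpt m V z = cmpt m' V z"
  proof (rule sheaf_separated[OF Y V Sh_mor_in[OF m(1) V z] Sh_mor_in[OF m(2) V z]])
    have "locally T V (\<lambda>B. \<exists>t\<in>hvhom G B A. pull G N V (Idt G B) z = pull G N A t u)"
      using N V z unfolding represents_def by blast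
    then show "locally T V (\<lambda>B. pull G Y V (Idt G B) (cmpt m V z) = pull G Y V (Idt G B) (cmpt m' V z))"
    proof (rule locally_mono[OF V])
      fix B assume B: "ole G B V" and "\<exists>t\<in>hvhom G B A. pull G N V (Idt G B) z = pull G N A t u"
      then obtain t where t: "t \<in> hvhom G B A" "pull G N V (Idt G B) z = pull G N A t u" by blast
      note iB = Idt_hvhom[OF B]
      have "pull G Y V (Idt G B) (cmpt m V z) = pull G Y A t (cmpt m A u)"
        using Sh_mor_pull[OF m(1) iB z] Sh_mor_pull[OF m(1) t(1) u] t(2) by simp
      moreover have "pull G Y V (Idt G B) (cmpt m' V z) = pull G Y A t (cmpt m' A u)"
        using Sh_mor_pull[OF m(2) iB z] Sh_mor_pull[OF m(2) t(1) u] t(2) by simp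
      ultimately show "pull G Y V (Idt G B) (cmpt m V z) = pull G Y V (Idt G B) (cmpt m' V z)"
        using eq by simp
    qed
  qed
qed

end

section \<open>Finite limits of sheaves are computed pointwise\<close>

definition matching ::
  "('i, 'j, 'x) category_scheme \<Rightarrow> ('i, 'j, ('o, 'a, 'u) presheaf, ('o, 'a, 'u) presheaf_mor) fnctr \<Rightarrow>
    'o \<Rightarrow> ('i \<Rightarrow> 'u) \<Rightarrow> bool" where
  "matching J K A x \<longleftrightarrow> (\<forall>j\<in>Obj J. x j \<in> val (on_obj K j) A) \<and>
     (\<forall>u\<in>Arr J. cmpt (on_arr K u) A (x (Dom J u)) = x (Cod J u))"

text \<open>A limit in \<open>Sh G T\<close> is a statement about all sheaves, but exactness is
  tested on elements. For diagrams with finitely many objects the two notions are shown equivalent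
  below.\<close>

definition pointwise_limit ::
  "('o, 'a, 'z) ordered_groupoid_scheme \<Rightarrow> ('o \<Rightarrow> 'o set set) \<Rightarrow> ('i, 'j, 'x) category_scheme \<Rightarrow>
    ('i, 'j, ('o, 'a, 'u) presheaf, ('o, 'a, 'u) presheaf_mor) fnctr \<Rightarrow>
    ('o, 'a, 'u) presheaf \<Rightarrow> ('i \<Rightarrow> ('o, 'a, 'u) presheaf_mor) \<Rightarrow> bool" where
  "pointwise_limit G T J K V p \<longleftrightarrow> is_cone J (Sh G T) K V p \<and>
     (\<forall>A\<in>Obj G. \<forall>x. matching J K A x \<longrightarrow>
        (\<exists>!z. z \<in> val V A \<and> (\<forall>j\<in>Obj J. cmpt (p j) A z = x j)))"

context is_Ehresmann_site
begin

lemma cone_matching: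
  assumes J: "is_category J" and c: "is_cone J (Sh G T) K V p" and A: "A \<in> Obj G" and z: "z \<in> val V A"
  shows "matching J K A (\<lambda>j. cmpt (p j) A z)"
  unfolding matching_def
proof (intro conjI ballI)
  have p: "p j \<in> hom (Sh G T) V (on_obj K j)" if "j \<in> Obj J" for j
    using c that by (simp add: is_cone_def)
  show "cmpt (p j) A z \<in> val (on_obj K j) A" if "j \<in> Obj J" for j
    using Sh_mor_in[OF p[OF that] A z] .
  fix u assume u: "u \<in> Arr J"
  then have "Cmp (Sh G T) (on_arr K u) (p (Dom J u)) = p (Cod J u)"
    using c by (simp add: is_cone_def)
  then show "cmpt (on_arr K u) A (cmpt (p (Dom J u)) A z) = cmpt (p (Cod J u)) A z"
    using Sh_Cmp_apply[OF p[OF is_category.Dom_Obj[OF J u]] A z, of "on_arr K u"] by simp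
qed

lemma pointwise_limit_imp_limit:
  assumes J: "is_category J" and pl: "pointwise_limit G T J K V p"
  shows "is_limit_cone J (Sh G T) K V p"
  unfolding is_limit_cone_def
proof (intro conjI allI impI)
  show c: "is_cone J (Sh G T) K V p" using pl by (simp add: pointwise_limit_def)
  have p: "p j \<in> hom (Sh G T) V (on_obj K j)" if "j \<in> Obj J" for j
    using c that by (simp add: is_cone_def)
  have V: "is_sheaf G T V" using c by (simp add: is_cone_def)
  fix W q assume cq: "is_cone J (Sh G T) K W q"
  have q: "q j \<in> hom (Sh G T) W (on_obj K j)" if "j \<in> Obj J" for j
    using cq that by (simp add: is_cone_def)
  have W: "is_sheaf G T W" using cq by (simp add: is_cone_def)
  have ex1: "\<exists>!z. z \<in> val V A \<and> (\<forall>j\<in>Obj J. cmpt (p j) A z = cmpt (q j) A w)"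
    if "A \<in> Obj G" "w \<in> val W A" for A w
    using pl cone_matching[OF J cq that] that(1) unfolding pointwise_limit_def by simp
  define c where "c A w = (THE z. z \<in> val V A \<and> (\<forall>j\<in>Obj J. cmpt (p j) A z = cmpt (q j) A w))" for A w
  have cp: "c A w \<in> val V A" "\<And>j. j \<in> Obj J \<Longrightarrow> cmpt (p j) A (c A w) = cmpt (q j) A w"
    if "A \<in> Obj G" "w \<in> val W A" for A w
    using theI'[OF ex1[OF that]] unfolding c_def by auto
  have "\<exists>m\<in>hom (Sh G T) W V. \<forall>A\<in>Obj G. \<forall>x\<in>val W A. cmpt m A x = c A x"
  proof (rule Sh_mor_ex[OF W V cp(1)])
    fix A B h w assume h: "h \<in> hvhom G B A" and w: "w \<in> val W A"
    have O: "A \<in> Obj G" "B \<in> Obj G" using hvhom_Obj[OF h] by auto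
    note hw = sheaf_pull_in[OF W w h]
    have "cmpt (p j) B (pull G V A h (c A w)) = cmpt (q j) B (pull G W A h w)" if "j \<in> Obj J" for j
      using Sh_mor_pull[OF p[OF that] h cp(1)[OF O(1) w]] cp(2)[OF O(1) w that]
        Sh_mor_pull[OF q[OF that] h w] by simp
    moreover have "cmpt (p j) B (c B (pull G W A h w)) = cmpt (q j) B (pull G W A h w)" if "j \<in> Obj J" for j
      using cp(2)[OF O(2) hw that] .
    ultimately show "c B (pull G W A h w) = pull G V A h (c A w)"
      using ex1[OF O(2) hw] cp(1)[OF O(2) hw] sheaf_pull_in[OF V cp(1)[OF O(1) w] h] by blast
  qed
  then obtain m where m: "m \<in> hom (Sh G T) W V" "\<And>A x. A \<in> Obj G \<Longrightarrow> x \<in> val W A \<Longrightarrow> cmpt m A x = c A x"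
    by blast
  show "\<exists>!k. k \<in> hom (Sh G T) W V \<and> (\<forall>i\<in>Obj J. Cmp (Sh G T) (p i) k = q i)"
  proof (intro ex1I[of _ m] conjI ballI m(1))
    show "Cmp (Sh G T) (p i) m = q i" if "i \<in> Obj J" for i
      using Sh_mor_eqI[OF Sh_Cmp[OF m(1) p[OF that]] q[OF that]] Sh_Cmp_apply[OF m(1)] m(2) cp(2) that
      by simp
    fix k assume k: "k \<in> hom (Sh G T) W V \<and> (\<forall>i\<in>Obj J. Cmp (Sh G T) (p i) k = q i)"
    then have kh: "k \<in> hom (Sh G T) W V" by simp
    show "k = m"
    proof (rule Sh_mor_eqI[OF kh m(1)])
      fix A w assume A: "A \<in> Obj G" and w: "w \<in> val W A"
      have "cmpt (p j) A (cmpt k A w) = cmpt (q j) A w" if "j \<in> Obj J" for j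
        using k that Sh_Cmp_apply[OF kh A w, of "p j"] by simp
      then show "cmpt k A w = cmpt m A w"
        by (intro ex1_unique[OF ex1[OF A w]]) (use Sh_mor_in[OF kh A w] cp[OF A w] m(2)[OF A w] in simp_all)
    qed
  qed
qed

text \<open>The limit consists of matching families, taken extensional so that families are equal
  when their components are. Finiteness of \<open>Obj J\<close> keeps their number within
  \<open>'u\<close>.\<close>

lemma pointwise_limit_exists:
  fixes K :: "('i, 'j, ('o, 'a, 'u) presheaf, ('o, 'a, 'u) presheaf_mor) fnctr"
  assumes K: "is_functor J (Sh G T) K" and fin: "finite (Obj J)" and inf: "infinite (UNIV :: 'u set)"
  shows "\<exists>V p. pointwise_limit G T J K V p"
proof -
  interpret K: is_functor J "Sh G T" K by (rule K)
  have Ks: "is_sheaf G T (on_obj K j)" if "j \<in> Obj J" for j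
    using K.fnctr_obj[OF that] by simp
  have Ku: "on_arr K u \<in> hom (Sh G T) (on_obj K (Dom J u)) (on_obj K (Cod J u))" if "u \<in> Arr J" for u
    using K.fnctr_arr[OF K.source.Arr_hom[OF that]] .
  define v where "v A = {x \<in> extensional (Obj J). matching J K A x}" for A
  define a where "a A h x = (\<lambda>j\<in>Obj J. pull G (on_obj K j) A h (x j))" for A h x
  define F where "F = presheaf_of_pull G v a"
  have vD: "x j \<in> val (on_obj K j) A" if "x \<in> v A" "j \<in> Obj J" for A x j
    using that by (auto simp: v_def matching_def)
  have veq: "x = y" if "x \<in> v A" "y \<in> v A" "\<And>j. j \<in> Obj J \<Longrightarrow> x j = y j" for A x y
    using that by (intro extensionalityI[of _ "Obj J"]) (auto simp: v_def)
  have av: "a A h x \<in> v B" if h: "h \<in> hvhom G B A" and x: "x \<in> v A" for A B h x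
    unfolding v_def matching_def
  proof (intro CollectI conjI ballI)
    show "a A h x \<in> extensional (Obj J)" by (simp add: a_def)
    show "a A h x j \<in> val (on_obj K j) B" if "j \<in> Obj J" for j
      using sheaf_pull_in[OF Ks[OF that] vD[OF x that] h] that by (simp add: a_def)
    fix u assume u: "u \<in> Arr J"
    have O: "Dom J u \<in> Obj J" "Cod J u \<in> Obj J" using K.source.Dom_Obj K.source.Cod_Obj u by auto
    show "cmpt (on_arr K u) B (a A h x (Dom J u)) = a A h x (Cod J u)"
      using Sh_mor_pull[OF Ku[OF u] h vD[OF x O(1)]] x u O by (simp add: a_def v_def matching_def)
  qed
  have ai: "a A (Idt G A) x = x" if A: "A \<in> Obj G" and x: "x \<in> v A" for A x
    using veq[OF av[OF Idt_hvhom[OF ole_refl[OF A]] x] x] sheaf_pull_Idt[OF Ks A vD[OF x]]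
    by (simp add: a_def)
  have ac: "a B k (a A h x) = a A (hvcmp G h k) x"
    if h: "h \<in> hvhom G B A" and k: "k \<in> hvhom G D B" and x: "x \<in> v A" for A B D h k x
    using veq[OF av[OF k av[OF h x]] av[OF hvcmp_hvhom[OF k h] x]]
      sheaf_pull_pull[OF Ks vD[OF x] h k] by (simp add: a_def)
  have P: "is_presheaf G F"
    unfolding F_def by (rule presheaf_of_pull(1)) (rule av ai ac; assumption)+
  have Fp: "pull G F A h x = a A h x" if "h \<in> hvhom G B A" "x \<in> v A" for A B h x
    unfolding F_def using that by (intro presheaf_of_pull(2)[where v = v]) (rule av ai ac; assumption)+
  have Fv: "val F = v" by (simp add: F_def presheaf_of_pull_def)
  have F: "is_sheaf G T F"
  proof (rule is_sheafI[OF P])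
    fix A x y
    assume A: "A \<in> Obj G" and xy: "x \<in> val F A" "y \<in> val F A"
      and l: "locally T A (\<lambda>B. pull G F A (Idt G B) x = pull G F A (Idt G B) y)"
    have xv: "x \<in> v A" "y \<in> v A" using xy Fv by auto
    show "x = y"
    proof (rule veq[OF xv])
      fix j assume j: "j \<in> Obj J"
      show "x j = y j"
      proof (rule sheaf_separated[OF Ks[OF j] A vD[OF xv(1) j] vD[OF xv(2) j] locally_mono[OF A l]])
        fix B assume B: "ole G B A" "pull G F A (Idt G B) x = pull G F A (Idt G B) y"
        then have "a A (Idt G B) x j = a A (Idt G B) y j"
          using Fp[OF Idt_hvhom[OF B(1)]] xv by simp
        then show "pull G (on_obj K j) A (Idt G B) (x j) = pull G (on_obj K j) A (Idt G B) (y j)"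
          using j by (simp add: a_def)
      qed
    qed
  next
    fix A S x
    assume A: "A \<in> Obj G" and S: "S \<in> T A" and x: "\<And>B. B \<in> S \<Longrightarrow> x B \<in> val F B"
      and m: "\<And>B D. B \<in> S \<Longrightarrow> ole G D B \<Longrightarrow> pull G F B (Idt G D) (x B) = x D"
    have xv: "x B \<in> v B" if "B \<in> S" for B using x[OF that] Fv by auto
    have le: "ole G B A" if "B \<in> S" for B using covering_le[OF A S that] .
    have "\<exists>y\<in>val (on_obj K j) A. \<forall>B\<in>S. pull G (on_obj K j) A (Idt G B) y = x B j" if j: "j \<in> Obj J" for j
    proof (rule sheaf_glue_family[OF Ks[OF j] A S vD[OF xv j]])
      fix B D assume *: "B \<in> S" "ole G D B"
      then have "a B (Idt G D) (x B) = x D"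
        using m[OF *] Fp[OF Idt_hvhom xv] by simp
      from fun_cong[OF this, of j] show "pull G (on_obj K j) B (Idt G D) (x B j) = x D j"
        using j by (simp add: a_def)
    qed
    then obtain y0 where y0: "\<And>j. j \<in> Obj J \<Longrightarrow> y0 j \<in> val (on_obj K j) A"
      "\<And>j B. j \<in> Obj J \<Longrightarrow> B \<in> S \<Longrightarrow> pull G (on_obj K j) A (Idt G B) (y0 j) = x B j"
      by metis
    define y where "y = restrict y0 (Obj J)"
    have y: "y \<in> v A"
      unfolding v_def matching_def
    proof (intro CollectI conjI ballI)
      show "y \<in> extensional (Obj J)" by (simp add: y_def)
      show "y j \<in> val (on_obj K j) A" if "j \<in> Obj J" for j using y0(1)[OF that] that by (simp add: y_def)
      fix u assume u: "u \<in> Arr J"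
      have O: "Dom J u \<in> Obj J" "Cod J u \<in> Obj J" using K.source.Dom_Obj K.source.Cod_Obj u by auto
      \<comment> \<open>The components were glued one object of \<open>J\<close> at a time; the
        diagram equations hold on the cover, and separatedness extends them to
        \<open>A\<close>.\<close>
      have "cmpt (on_arr K u) A (y0 (Dom J u)) = y0 (Cod J u)"
      proof (rule sheaf_separated[OF Ks[OF O(2)] A Sh_mor_in[OF Ku[OF u] A y0(1)[OF O(1)]] y0(1)[OF O(2)]])
        have "locally T A (\<lambda>B. B \<in> S)" using S by (auto simp: locally_def)
        then show "locally T A (\<lambda>B. pull G (on_obj K (Cod J u)) A (Idt G B) (cmpt (on_arr K u) A (y0 (Dom J u)))
          = pull G (on_obj K (Cod J u)) A (Idt G B) (y0 (Cod J u)))"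
        proof (rule locally_mono[OF A])
          fix B assume B: "ole G B A" "B \<in> S"
          have "cmpt (on_arr K u) B (x B (Dom J u)) = x B (Cod J u)"
            using xv[OF B(2)] u by (simp add: v_def matching_def)
          then show "pull G (on_obj K (Cod J u)) A (Idt G B) (cmpt (on_arr K u) A (y0 (Dom J u)))
            = pull G (on_obj K (Cod J u)) A (Idt G B) (y0 (Cod J u))"
            using Sh_mor_pull[OF Ku[OF u] Idt_hvhom[OF B(1)] y0(1)[OF O(1)]] y0(2)[OF O(1) B(2)]
              y0(2)[OF O(2) B(2)] by simp
        qed
      qed
      then show "cmpt (on_arr K u) A (y (Dom J u)) = y (Cod J u)"
        using O by (simp add: y_def)
    qed
    have "pull G F A (Idt G B) y = x B" if B: "B \<in> S" for B
    proof -
      have "a A (Idt G B) y = x B"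
        by (rule veq[OF av[OF Idt_hvhom[OF le[OF B]] y] xv[OF B]]) (simp add: a_def y_def y0(2) B)
      then show ?thesis using Fp[OF Idt_hvhom[OF le[OF B]] y] by simp
    qed
    then show "\<exists>y\<in>val F A. \<forall>B\<in>S. pull G F A (Idt G B) y = x B"
      using y Fv by (intro bexI[of _ y]) auto
  qed
  have size: "val F A \<lesssim> (UNIV :: 'u set)" for A
  proof -
    have "val F A \<subseteq> (Obj J \<rightarrow>\<^sub>E (UNIV :: 'u set))" by (auto simp: Fv v_def PiE_def)
    then show ?thesis
      using finite_funcset_lepoll[OF inf fin] subset_imp_lepoll lepoll_trans by blast
  qed
  from sheaf_transport[OF F size] obtain V :: "('o, 'a, 'u) presheaf" and e where V: "is_sheaf G T V"
    and bij: "\<And>A. A \<in> Obj G \<Longrightarrow> bij_betw (e A) (v A) (val V A)"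
    and nat: "\<And>A B h x. h \<in> hvhom G B A \<Longrightarrow> x \<in> v A \<Longrightarrow> e B (a A h x) = pull G V A h (e A x)"
    unfolding Fv using Fp by metis
  define d where "d A = inv_into (v A) (e A)" for A
  have d: "d A z \<in> v A" "e A (d A z) = z" if "A \<in> Obj G" "z \<in> val V A" for A z
    using bij[OF that(1)] that(2) unfolding d_def
    by (metis bij_betw_def inv_into_into, metis bij_betw_def f_inv_into_f)
  have de: "d A (e A x) = x" if "A \<in> Obj G" "x \<in> v A" for A x
    using bij[OF that(1)] that(2) unfolding d_def by (simp add: bij_betw_def)
  have "\<exists>m\<in>hom (Sh G T) V (on_obj K j). \<forall>A\<in>Obj G. \<forall>z\<in>val V A. cmpt m A z = d A z j" if j: "j \<in> Obj J" for j
  proof (rule Sh_mor_ex[OF V Ks[OF j]])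
    show "d A z j \<in> val (on_obj K j) A" if "A \<in> Obj G" "z \<in> val V A" for A z
      using vD[OF d(1)[OF that] j] .
    fix A B h z assume h: "h \<in> hvhom G B A" and z: "z \<in> val V A"
    have O: "A \<in> Obj G" "B \<in> Obj G" using hvhom_Obj[OF h] by auto
    have "d B (pull G V A h z) = a A h (d A z)"
      using nat[OF h d(1)[OF O(1) z]] d(2)[OF O(1) z] de[OF O(2) av[OF h d(1)[OF O(1) z]]] by simp
    then show "d B (pull G V A h z) j = pull G (on_obj K j) A h (d A z j)"
      using j by (simp add: a_def)
  qed
  then obtain p where p: "\<And>j. j \<in> Obj J \<Longrightarrow> p j \<in> hom (Sh G T) V (on_obj K j)"
    "\<And>j A z. j \<in> Obj J \<Longrightarrow> A \<in> Obj G \<Longrightarrow> z \<in> val V A \<Longrightarrow> cmpt (p j) A z = d A z j"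
    by metis
  have "pointwise_limit G T J K V p"
    unfolding pointwise_limit_def is_cone_def
  proof (intro conjI ballI allI impI p(1))
    show "V \<in> Obj (Sh G T)" using V by simp
    fix u assume u: "u \<in> Arr J"
    have O: "Dom J u \<in> Obj J" "Cod J u \<in> Obj J" using K.source.Dom_Obj K.source.Cod_Obj u by auto
    show "Cmp (Sh G T) (on_arr K u) (p (Dom J u)) = p (Cod J u)"
    proof (rule Sh_mor_eqI[OF Sh_Cmp[OF p(1)[OF O(1)] Ku[OF u]] p(1)[OF O(2)]])
      fix A z assume A: "A \<in> Obj G" and z: "z \<in> val V A"
      show "cmpt (Cmp (Sh G T) (on_arr K u) (p (Dom J u))) A z = cmpt (p (Cod J u)) A z"
        using Sh_Cmp_apply[OF p(1)[OF O(1)] A z, of "on_arr K u"] p(2)[OF O(1) A z] p(2)[OF O(2) A z]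
          d(1)[OF A z] u by (simp add: v_def matching_def)
    qed
  next
    fix A x assume A: "A \<in> Obj G" and x: "matching J K A x"
    define x' where "x' = restrict x (Obj J)"
    have x': "x' \<in> v A"
      using x K.source.Dom_Obj K.source.Cod_Obj by (auto simp: v_def matching_def x'_def)
    show "\<exists>!z. z \<in> val V A \<and> (\<forall>j\<in>Obj J. cmpt (p j) A z = x j)"
    proof (intro ex1I[of _ "e A x'"] conjI ballI)
      show ex: "e A x' \<in> val V A" using bij_betwE[OF bij[OF A]] x' by blast
      show "cmpt (p j) A (e A x') = x j" if "j \<in> Obj J" for j
        using p(2)[OF that A ex] de[OF A x'] that by (simp add: x'_def)
      fix z assume z: "z \<in> val V A \<and> (\<forall>j\<in>Obj J. cmpt (p j) A z = x j)"
      have "d A z = x'"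
        by (rule veq[OF d(1)[OF A conjunct1[OF z]] x']) (use z p(2)[OF _ A conjunct1[OF z]] in \<open>simp add: x'_def\<close>)
      then show "z = e A x'" using d(2)[OF A conjunct1[OF z]] by simp
    qed
  qed
  then show ?thesis by blast
qed

text \<open>Limits are unique up to isomorphism, so the given one inherits the elementwise property
  from the constructed one along the two comparison morphisms. Uniqueness of elements comes from
  \<open>k\<close> after \<open>m\<close> being the identity.\<close>

lemma limit_imp_pointwise_limit:
  fixes K :: "('i, 'j, ('o, 'a, 'u) presheaf, ('o, 'a, 'u) presheaf_mor) fnctr"
  assumes K: "is_functor J (Sh G T) K" and fin: "finite (Obj J)" and inf: "infinite (UNIV :: 'u set)"
    and lim: "is_limit_cone J (Sh G T) K V p"
  shows "pointwise_limit G T J K V p"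
proof -
  have J: "is_category J" using K by (simp add: is_functor_def)
  obtain W q where W: "pointwise_limit G T J K W q"
    using pointwise_limit_exists[OF K fin inf] by blast
  note Wl = pointwise_limit_imp_limit[OF J W]
  have cV: "is_cone J (Sh G T) K V p" and cW: "is_cone J (Sh G T) K W q"
    using lim Wl by (auto simp: is_limit_cone_def)
  have p: "p j \<in> hom (Sh G T) V (on_obj K j)" and q: "q j \<in> hom (Sh G T) W (on_obj K j)" if "j \<in> Obj J" for j
    using cV cW that by (auto simp: is_cone_def)
  have V: "is_sheaf G T V" using cV by (simp add: is_cone_def)
  obtain k where k: "k \<in> hom (Sh G T) W V" "\<And>j. j \<in> Obj J \<Longrightarrow> Cmp (Sh G T) (p j) k = q j"
    using lim cW unfolding is_limit_cone_def by blast
  obtain m where m: "m \<in> hom (Sh G T) V W" "\<And>j. j \<in> Obj J \<Longrightarrow> Cmp (Sh G T) (q j) m = p j"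
    using Wl cV unfolding is_limit_cone_def by blast
  have pk: "cmpt (p j) A (cmpt k A w) = cmpt (q j) A w" if "j \<in> Obj J" "A \<in> Obj G" "w \<in> val W A" for j A w
    using Sh_Cmp_apply[OF k(1) that(2,3), of "p j"] k(2)[OF that(1)] by simp
  have qm: "cmpt (q j) A (cmpt m A v) = cmpt (p j) A v" if "j \<in> Obj J" "A \<in> Obj G" "v \<in> val V A" for j A v
    using Sh_Cmp_apply[OF m(1) that(2,3), of "q j"] m(2)[OF that(1)] by simp
  have km: "Cmp (Sh G T) k m = Idt (Sh G T) V"
  proof -
    have "\<exists>!k. k \<in> hom (Sh G T) V V \<and> (\<forall>i\<in>Obj J. Cmp (Sh G T) (p i) k = p i)"
      using lim cV unfolding is_limit_cone_def by blast
    moreover have "Cmp (Sh G T) (p j) (Cmp (Sh G T) k m) = p j" if "j \<in> Obj J" for j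
      using is_category.Cmp_assoc[OF Sh_category m(1) k(1) p[OF that]] k(2)[OF that] m(2)[OF that] by simp
    moreover have "Cmp (Sh G T) (p j) (Idt (Sh G T) V) = p j" if "j \<in> Obj J" for j
      using is_category.Cmp_Idt_hom[OF Sh_category p[OF that]] .
    ultimately show ?thesis
      using Sh_Cmp[OF m(1) k(1)] Sh_Idt[OF V] by blast
  qed
  show ?thesis
    unfolding pointwise_limit_def
  proof (intro conjI cV ballI allI impI)
    fix A x assume A: "A \<in> Obj G" and x: "matching J K A x"
    have ex1: "\<exists>!z. z \<in> val W A \<and> (\<forall>j\<in>Obj J. cmpt (q j) A z = x j)"
      using W A x by (simp add: pointwise_limit_def)
    then obtain w where w: "w \<in> val W A" "\<forall>j\<in>Obj J. cmpt (q j) A w = x j" by blast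
    show "\<exists>!z. z \<in> val V A \<and> (\<forall>j\<in>Obj J. cmpt (p j) A z = x j)"
    proof (intro ex1I[of _ "cmpt k A w"] conjI ballI)
      show "cmpt k A w \<in> val V A" using Sh_mor_in[OF k(1) A w(1)] .
      show "cmpt (p j) A (cmpt k A w) = x j" if "j \<in> Obj J" for j
        using pk[OF that A w(1)] w(2) that by simp
      fix v assume v: "v \<in> val V A \<and> (\<forall>j\<in>Obj J. cmpt (p j) A v = x j)"
      have "cmpt m A v = w"
        by (rule ex1_unique[OF ex1]) (use w Sh_mor_in[OF m(1) A] v qm[OF _ A] in simp_all)
      moreover have "cmpt k A (cmpt m A v) = v"
        using Sh_Cmp_apply[OF m(1) A, of v k] v km Sh_Idt_apply[OF A, of v V] by simp
      ultimately show "v = cmpt k A w" by simp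
    qed
  qed
qed

end

section \<open>Double functors between Ehresmann sites\<close>

context is_double_functor
begin

lemma Arr_sel:
  assumes "f \<in> Arr G"
  shows "on_arr M f \<in> Arr G'" "Dom G' (on_arr M f) = on_obj M (Dom G f)"
    "Cod G' (on_arr M f) = on_obj M (Cod G f)"
  using fnctr_arr[OF source.Arr_hom[OF assms]] by (auto simp: hom_def)

lemma fnctr_ole: "ole G B A \<Longrightarrow> ole G' (on_obj M B) (on_obj M A)"
  unfolding ole_def using fnctr_obj fnctr_Idt fnctr_ale source.Idt_sel(1) by metis

lemma fnctr_hvhom: "h \<in> hvhom G B A \<Longrightarrow> on_arr M h \<in> hvhom G' (on_obj M B) (on_obj M A)"
  using Arr_sel[of h] fnctr_ole by (auto simp: hvhom_def)

lemma fnctr_arr_restrict: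
  assumes "f \<in> Arr G" "ole G A (Dom G f)"
  shows "on_arr M (arr_restrict G f A) = arr_restrict G' (on_arr M f) (on_obj M A)"
proof -
  note r = source.arr_restrict[OF assms]
  have "ale G' (on_arr M (arr_restrict G f A)) (on_arr M f)"
    using fnctr_ale r assms by blast
  then show ?thesis
    using target.arr_restrict_eqI[OF Arr_sel(1)[OF assms(1)] Arr_sel(1)[OF r(1)]] Arr_sel(2)[OF r(1)] r(2)
    by simp
qed

lemma fnctr_hvcmp:
  assumes h: "h \<in> hvhom G B A" and t: "t \<in> hvhom G A D"
  shows "on_arr M (hvcmp G t h) = hvcmp G' (on_arr M t) (on_arr M h)"
proof -
  have arr: "h \<in> Arr G" "t \<in> Arr G" "ole G (Cod G h) (Dom G t)"
    using h t by (auto simp: hvhom_def)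
  note r = source.arr_restrict[OF arr(2,3)]
  have "on_arr M (hvcmp G t h) = Cmp G' (on_arr M (arr_restrict G t (Cod G h))) (on_arr M h)"
    unfolding hvcmp_def
    by (rule fnctr_Cmp[OF source.Arr_hom[OF arr(1)]]) (use r in \<open>simp add: hom_def\<close>)
  then show ?thesis
    using fnctr_arr_restrict[OF arr(2,3)] Arr_sel(3)[OF arr(1)] by (simp add: hvcmp_def)
qed

lemma precomp_presheaf:
  assumes F: "is_presheaf G' F"
  shows "is_presheaf G (presheaf_precomp M F)"
proof -
  let ?P = "presheaf_precomp M F"
  note F' = F[unfolded is_presheaf_def]
  show ?thesis
    unfolding is_presheaf_def
  proof (intro conjI allI impI ballI)
    fix A B f assume "f \<in> hom G A B"
    then show "hmap ?P f \<in> val ?P B \<rightarrow> val ?P A"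
      using target.hmap_in[OF F fnctr_arr] by (simp add: presheaf_precomp_def)
  next
    fix A x assume "A \<in> Obj G" "x \<in> val ?P A"
    then show "hmap ?P (Idt G A) x = x" "vmap ?P A A x = x"
      using F' fnctr_obj[of A] fnctr_Idt[of A] by (simp_all add: presheaf_precomp_def)
  next
    fix A B D f g x
    assume *: "f \<in> hom G A B" "g \<in> hom G B D" "x \<in> val ?P D"
    have "\<forall>x\<in>val F (on_obj M D). hmap F (Cmp G' (on_arr M g) (on_arr M f)) x =
        hmap F (on_arr M f) (hmap F (on_arr M g) x)"
      using conjunct1[OF conjunct2[OF conjunct2[OF F']]] fnctr_arr[OF *(1)] fnctr_arr[OF *(2)] by blast
    then show "hmap ?P (Cmp G g f) x =
        hmap ?P f (hmap ?P g x)"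
      using *(3) fnctr_Cmp[OF *(1,2)] by (simp add: presheaf_precomp_def)
  next
    fix A A' assume "ole G A' A"
    then show "vmap ?P A A' \<in> val ?P A \<rightarrow> val ?P A'"
      using target.vmap_in[OF F fnctr_ole] by (simp add: presheaf_precomp_def)
  next
    fix A A' A'' x
    assume *: "ole G A'' A'" "ole G A' A" "x \<in> val ?P A"
    have "\<forall>x\<in>val F (on_obj M A). vmap F (on_obj M A) (on_obj M A'') x =
        vmap F (on_obj M A') (on_obj M A'') (vmap F (on_obj M A) (on_obj M A') x)"
      using conjunct1[OF conjunct2[OF conjunct2[OF conjunct2[OF conjunct2[OF conjunct2[OF F']]]]]]
        fnctr_ole[OF *(1)] fnctr_ole[OF *(2)] by blast
    then show "vmap ?P A A'' x =
        vmap ?P A' A'' (vmap ?P A A' x)"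
      using *(3) by (simp add: presheaf_precomp_def)
  next
    fix A B A' B' f f' x
    assume *: "f \<in> hom G A B" "f' \<in> hom G A' B'" "ale G f' f" "x \<in> val ?P B"
    have "ale G' (on_arr M f') (on_arr M f)"
      using fnctr_ale * by (simp add: hom_def)
    then have "\<forall>x\<in>val F (on_obj M B). hmap F (on_arr M f') (vmap F (on_obj M B) (on_obj M B') x) =
        vmap F (on_obj M A) (on_obj M A') (hmap F (on_arr M f) x)"
      using conjunct2[OF conjunct2[OF conjunct2[OF conjunct2[OF conjunct2[OF conjunct2[OF F']]]]]]
        fnctr_arr[OF *(1)] fnctr_arr[OF *(2)] by blast
    then show "hmap ?P f' (vmap ?P B B' x) =
        vmap ?P A A' (hmap ?P f x)"
      using *(4) by (simp add: presheaf_precomp_def)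
  qed
qed

lemma precomp_sel [simp]: "val (presheaf_precomp M F) A = val F (on_obj M A)"
  by (simp add: presheaf_precomp_def)

lemma precomp_pull:
  "h \<in> hvhom G B A \<Longrightarrow> pull G (presheaf_precomp M F) A h x = pull G' F (on_obj M A) (on_arr M h) x"
  using Arr_sel(3)[of h] by (simp add: pull_def presheaf_precomp_def hvhom_def)

text \<open>Read with the domain of \<open>M\<close> as the shape of a diagram: hv-cones are cones
  for \<open>hvcmp\<close>. The equality of codomains is contained in the equation of composites,
  since \<open>hvcmp\<close> ends where the restricted arrow ends.\<close>

lemma hv_cone_iff:
  "is_hv_cone G G' M U \<xi> \<longleftrightarrow> U \<in> Obj G' \<and> (\<forall>i\<in>Obj G. \<xi> i \<in> hvhom G' U (on_obj M i)) \<and>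
     (\<forall>i i' \<alpha>. \<alpha> \<in> hom G i i' \<longrightarrow> hvcmp G' (on_arr M \<alpha>) (\<xi> i) = \<xi> i') \<and>
     (\<forall>i i'. ole G i i' \<longrightarrow> \<xi> i = \<xi> i')"
proof -
  have "Cod G' (arr_restrict G' (on_arr M \<alpha>) (Cod G' (\<xi> i))) = Cod G' (\<xi> i')"
    if \<xi>: "\<forall>i\<in>Obj G. \<xi> i \<in> hvhom G' U (on_obj M i)" and \<alpha>: "\<alpha> \<in> hom G i i'"
      and e: "hvcmp G' (on_arr M \<alpha>) (\<xi> i) = \<xi> i'" for \<alpha> i i'
  proof -
    have i: "\<xi> i \<in> hvhom G' U (on_obj M i)" using \<xi> source.hom_Obj[OF \<alpha>] by blast
    have "on_arr M \<alpha> \<in> Arr G'" "Dom G' (on_arr M \<alpha>) = on_obj M i"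
      using fnctr_arr[OF \<alpha>] by (auto simp: hom_def)
    from target.hvcmp(3)[OF i this] e show ?thesis by simp
  qed
  then show ?thesis
    unfolding is_hv_cone_def Let_def hvcmp_def[symmetric]
    unfolding hvhom_def by blast
qed

lemma double_functor_comp:
  assumes "is_double_functor G' G'' N"
  shows "is_double_functor G G'' (fnctr_comp N M)"
proof -
  interpret N: is_double_functor G' G'' N by (rule assms)
  show ?thesis
  proof unfold_locales
    fix A B D f g
    show "A \<in> Obj G \<Longrightarrow> on_obj (fnctr_comp N M) A \<in> Obj G''"
      "f \<in> hom G A B \<Longrightarrow> on_arr (fnctr_comp N M) f \<in>
        hom G'' (on_obj (fnctr_comp N M) A) (on_obj (fnctr_comp N M) B)"
      "A \<in> Obj G \<Longrightarrow> on_arr (fnctr_comp N M) (Idt G A) = Idt G'' (on_obj (fnctr_comp N M) A)"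
      using fnctr_obj N.fnctr_obj fnctr_arr[of f A B] N.fnctr_arr fnctr_Idt N.fnctr_Idt
      by (simp_all add: fnctr_comp_def)
    show "on_arr (fnctr_comp N M) (Cmp G g f) =
        Cmp G'' (on_arr (fnctr_comp N M) g) (on_arr (fnctr_comp N M) f)"
      if "f \<in> hom G A B" "g \<in> hom G B D"
      using fnctr_Cmp[OF that] N.fnctr_Cmp[OF fnctr_arr[OF that(1)] fnctr_arr[OF that(2)]]
      by (simp add: fnctr_comp_def)
    show "ale G'' (on_arr (fnctr_comp N M) f) (on_arr (fnctr_comp N M) g)"
      if "f \<in> Arr G" "g \<in> Arr G" "ale G f g"
      using N.fnctr_ale fnctr_ale Arr_sel(1) that by (simp add: fnctr_comp_def)
  qed
qed

end

locale site_functor = S: is_Ehresmann_site G T + S': is_Ehresmann_site G' T' + is_double_functor G G' M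
  for G :: "('o, 'a, 'z) ordered_groupoid_scheme" and T :: "'o \<Rightarrow> 'o set set"
    and G' :: "('p, 'b, 'y) ordered_groupoid_scheme" and T' :: "'p \<Rightarrow> 'p set set"
    and M :: "('o, 'a, 'p, 'b) fnctr"
begin

lemma precomp_functor:
  assumes "\<And>F :: ('p, 'b, 'u) presheaf. is_sheaf G' T' F \<Longrightarrow> is_sheaf G T (presheaf_precomp M F)"
  shows "is_functor (Sh G' T' :: (('p, 'b, 'u) presheaf, ('p, 'b, 'u) presheaf_mor) category)
    (Sh G T) (precomp_functor G M)"
proof -
  let ?R = "precomp_functor G M :: (('p, 'b, 'u) presheaf, ('p, 'b, 'u) presheaf_mor,
     ('o, 'a, 'u) presheaf, ('o, 'a, 'u) presheaf_mor) fnctr"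
  have arr: "on_arr ?R f \<in> hom (Sh G T) (on_obj ?R X) (on_obj ?R Y)"
    if f: "f \<in> hom (Sh G' T') X Y" for f X Y
  proof -
    have XY: "is_sheaf G' T' X" "is_sheaf G' T' Y" "src f = X" "tgt f = Y"
      using f by (auto simp: Sh_hom)
    note P = precomp_presheaf[OF S'.sheaf_presheaf[OF XY(1)]] precomp_presheaf[OF S'.sheaf_presheaf[OF XY(2)]]
    have "is_presheaf_mor G (on_arr ?R f)"
    proof (subst S.presheaf_mor_iff)
      show "cmpt (on_arr ?R f) \<in> (\<Pi>\<^sub>E A\<in>Obj G. val (src (on_arr ?R f)) A \<rightarrow>\<^sub>E val (tgt (on_arr ?R f)) A) \<and>
        (\<forall>A B h. h \<in> hvhom G B A \<longrightarrow> (\<forall>x\<in>val (src (on_arr ?R f)) A.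
          cmpt (on_arr ?R f) B (pull G (src (on_arr ?R f)) A h x) =
          pull G (tgt (on_arr ?R f)) A h (cmpt (on_arr ?R f) A x)))"
      proof (intro conjI allI impI ballI)
        have "cmpt f \<in> (\<Pi>\<^sub>E A\<in>Obj G'. val X A \<rightarrow>\<^sub>E val Y A)"
          using f by (auto simp: Sh_hom is_presheaf_mor_def)
        then show "cmpt (on_arr ?R f) \<in> (\<Pi>\<^sub>E A\<in>Obj G. val (src (on_arr ?R f)) A \<rightarrow>\<^sub>E val (tgt (on_arr ?R f)) A)"
          using fnctr_obj by (auto simp: precomp_functor_def XY PiE_iff)
        fix A B h x assume h: "h \<in> hvhom G B A" and x: "x \<in> val (src (on_arr ?R f)) A"
        have x': "x \<in> val X (on_obj M A)" using x by (simp add: precomp_functor_def XY)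
        show "cmpt (on_arr ?R f) B (pull G (src (on_arr ?R f)) A h x) =
          pull G (tgt (on_arr ?R f)) A h (cmpt (on_arr ?R f) A x)"
          using S'.Sh_mor_pull[OF f fnctr_hvhom[OF h] x'] S.hvhom_Obj[OF h]
          by (simp add: precomp_functor_def XY precomp_pull[OF h])
      qed
    qed (use P XY in \<open>simp_all add: precomp_functor_def\<close>)
    then show ?thesis
      using assms XY by (simp add: Sh_hom precomp_functor_def)
  qed
  show ?thesis
  proof (intro is_functor.intro is_functor_axioms.intro S.Sh_category S'.Sh_category arr)
    fix X assume X: "X \<in> Obj (Sh G' T' :: (('p, 'b, 'u) presheaf, ('p, 'b, 'u) presheaf_mor) category)"
    then show X': "on_obj ?R X \<in> Obj (Sh G T)" using assms by (simp add: precomp_functor_def)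
    show "on_arr ?R (Idt (Sh G' T') X) = Idt (Sh G T) (on_obj ?R X)"
      using X X' by (intro S.Sh_mor_eqI[OF arr[OF S'.Sh_Idt] S.Sh_Idt])
        (auto simp: precomp_functor_def S.Sh_Idt_apply S'.Sh_Idt_apply fnctr_obj)
  next
    fix X Y Z f g
    assume f: "f \<in> hom (Sh G' T' :: (('p, 'b, 'u) presheaf, ('p, 'b, 'u) presheaf_mor) category) X Y"
      and g: "g \<in> hom (Sh G' T') Y Z"
    show "on_arr ?R (Cmp (Sh G' T') g f) = Cmp (Sh G T) (on_arr ?R g) (on_arr ?R f)"
    proof (rule S.Sh_mor_eqI[OF arr[OF S'.Sh_Cmp[OF f g]] S.Sh_Cmp[OF arr[OF f] arr[OF g]]])
      fix A x assume A: "A \<in> Obj G" and x: "x \<in> val (on_obj ?R X) A"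
      have x': "x \<in> val X (on_obj M A)" using x by (simp add: precomp_functor_def)
      show "cmpt (on_arr ?R (Cmp (Sh G' T') g f)) A x = cmpt (Cmp (Sh G T) (on_arr ?R g) (on_arr ?R f)) A x"
        using S.Sh_Cmp_apply[OF arr[OF f] A x, of "on_arr ?R g"]
          S'.Sh_Cmp_apply[OF f fnctr_obj[OF A] x', of g] A by (simp add: precomp_functor_def)
    qed
  qed
qed

lemma precomp_functor_sel [simp]:
  "on_obj (precomp_functor G M) F = presheaf_precomp M F"
  "A \<in> Obj G \<Longrightarrow> cmpt (on_arr (precomp_functor G M) m) A = cmpt m (on_obj M A)"
  by (simp_all add: precomp_functor_def)

text \<open>An object \<open>V'\<close> below the image of \<open>V\<close> together with an arrow
  \<open>h\<close> onto it is a single arrow \<open>k\<close> to that image, with \<open>V'\<close>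
  recovered as the codomain of \<open>k\<close>.\<close>

lemma flat_body_iff:
  assumes I: "is_double_functor I G D" and \<xi>: "\<And>i. i \<in> Obj I \<Longrightarrow> \<xi> i \<in> hvhom G' U (X i)" and U': "ole G' U' U"
  shows "(\<exists>V \<theta> V' h. is_hv_cone I G D V \<theta> \<and> ole G' V' (on_obj M V) \<and> h \<in> hom G' U' V' \<and>
      (\<forall>i\<in>Obj I. arr_restrict G' (\<xi> i) U' = Cmp G' (arr_restrict G' (on_arr M (\<theta> i)) V') h)) \<longleftrightarrow>
    (\<exists>V \<theta> k. is_hv_cone I G D V \<theta> \<and> k \<in> hvhom G' U' (on_obj M V) \<and>
      (\<forall>i\<in>Obj I. hvcmp G' (on_arr M (\<theta> i)) k = hvcmp G' (\<xi> i) (Idt G' U')))"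
proof -
  have e: "hvcmp G' (\<xi> i) (Idt G' U') = arr_restrict G' (\<xi> i) U'" if "i \<in> Obj I" for i
    using S'.hvcmp_Idt_right[of "\<xi> i" U'] \<xi>[OF that] U' by (auto simp: hvhom_def)
  show ?thesis
  proof safe
    fix V \<theta> V' h
    assume "is_hv_cone I G D V \<theta>" "ole G' V' (on_obj M V)" "h \<in> hom G' U' V'"
      "\<forall>i\<in>Obj I. arr_restrict G' (\<xi> i) U' = Cmp G' (arr_restrict G' (on_arr M (\<theta> i)) V') h"
    then show "\<exists>V \<theta> k. is_hv_cone I G D V \<theta> \<and> k \<in> hvhom G' U' (on_obj M V) \<and>
      (\<forall>i\<in>Obj I. hvcmp G' (on_arr M (\<theta> i)) k = hvcmp G' (\<xi> i) (Idt G' U'))"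
      using e by (intro exI[of _ V] exI[of _ \<theta>] exI[of _ h]) (auto simp: hvhom_def hom_def hvcmp_def)
  next
    fix V \<theta> k
    assume "is_hv_cone I G D V \<theta>" "k \<in> hvhom G' U' (on_obj M V)"
      "\<forall>i\<in>Obj I. hvcmp G' (on_arr M (\<theta> i)) k = hvcmp G' (\<xi> i) (Idt G' U')"
    then show "\<exists>V \<theta> V' h. is_hv_cone I G D V \<theta> \<and> ole G' V' (on_obj M V) \<and> h \<in> hom G' U' V' \<and>
      (\<forall>i\<in>Obj I. arr_restrict G' (\<xi> i) U' = Cmp G' (arr_restrict G' (on_arr M (\<theta> i)) V') h)"
      using e by (intro exI[of _ V] exI[of _ \<theta>] exI[of _ "Cod G' k"] exI[of _ k])
        (auto simp: hvhom_def hom_def hvcmp_def)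
  qed
qed

lemma covering_flat_iff:
  "covering_flat G G' T' M \<longleftrightarrow>
     (\<forall>(I :: (nat, nat) ordered_groupoid) D U \<xi>.
        finite (Obj I) \<and> finite (Arr I) \<and> is_double_functor I G D \<and>
        is_hv_cone I G' (fnctr_comp M D) U \<xi> \<longrightarrow>
        locally T' U (\<lambda>U'. \<exists>V \<theta> k. is_hv_cone I G D V \<theta> \<and> k \<in> hvhom G' U' (on_obj M V) \<and>
          (\<forall>i\<in>Obj I. hvcmp G' (on_arr M (\<theta> i)) k = hvcmp G' (\<xi> i) (Idt G' U'))))"
proof -
  have eq: "(\<exists>S\<in>T' U. \<forall>U'\<in>S. \<exists>V \<theta> V' h. is_hv_cone I G D V \<theta> \<and> ole G' V' (on_obj M V) \<and> h \<in> hom G' U' V' \<and>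
      (\<forall>i\<in>Obj I. arr_restrict G' (\<xi> i) U' = Cmp G' (arr_restrict G' (on_arr M (\<theta> i)) V') h)) \<longleftrightarrow>
    locally T' U (\<lambda>U'. \<exists>V \<theta> k. is_hv_cone I G D V \<theta> \<and> k \<in> hvhom G' U' (on_obj M V) \<and>
          (\<forall>i\<in>Obj I. hvcmp G' (on_arr M (\<theta> i)) k = hvcmp G' (\<xi> i) (Idt G' U')))"
    if I: "is_double_functor I G D" and c: "is_hv_cone I G' (fnctr_comp M D) U \<xi>"
    for I :: "(nat, nat) ordered_groupoid" and D U \<xi>
  proof -
    have "is_double_functor I G' (fnctr_comp M D)"
      using is_double_functor.double_functor_comp[OF I is_double_functor_axioms] .
    note cone = is_double_functor.hv_cone_iff[OF this, of U \<xi>]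
    have \<xi>: "\<xi> i \<in> hvhom G' U (on_obj (fnctr_comp M D) i)" if "i \<in> Obj I" for i
      using cone c that by simp
    have U: "U \<in> Obj G'" using cone c by simp
    show ?thesis
      unfolding locally_def
    proof (rule bex_cong[OF refl], rule ball_cong[OF refl])
      fix S U' assume S: "S \<in> T' U" "U' \<in> S"
      show "(\<exists>V \<theta> V' h. is_hv_cone I G D V \<theta> \<and> ole G' V' (on_obj M V) \<and> h \<in> hom G' U' V' \<and>
          (\<forall>i\<in>Obj I. arr_restrict G' (\<xi> i) U' = Cmp G' (arr_restrict G' (on_arr M (\<theta> i)) V') h)) \<longleftrightarrow>
        (\<exists>V \<theta> k. is_hv_cone I G D V \<theta> \<and> k \<in> hvhom G' U' (on_obj M V) \<and>
          (\<forall>i\<in>Obj I. hvcmp G' (on_arr M (\<theta> i)) k = hvcmp G' (\<xi> i) (Idt G' U')))"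
        using flat_body_iff[OF I \<xi> S'.covering_le[OF U S]] .
    qed
  qed
  show ?thesis
    unfolding covering_flat_def by (intro all_cong1 imp_cong[OF refl], elim conjE, rule eq)
qed

text \<open>Objects below the image of \<open>A\<close> need not be images themselves; each member
  of the generated sieve at least lies below the image of an \<open>A'\<close> where
  \<open>P\<close> holds.\<close>

lemma locally_fnctr:
  assumes pres: "covering_preserving G T G' T' M" and A: "A \<in> Obj G" and l: "locally T A P"
  shows "locally T' (on_obj M A) (\<lambda>B. \<exists>A'. ole G A' A \<and> P A' \<and> ole G' B (on_obj M A'))"
proof -
  obtain S where S: "S \<in> T A" "\<forall>B\<in>S. P B" using l by (auto simp: locally_def)
  then have "sieve_generated G' (on_obj M ` S) \<in> T' (on_obj M A)"
    using pres A by (simp add: covering_preserving_def)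
  then show ?thesis
    unfolding locally_def
    by (intro bexI) (use S S.covering_le[OF A S(1)] in \<open>auto simp: sieve_generated_def\<close>)
qed

end

section \<open>Covering flat functors\<close>

text \<open>The shape of finite families of objects; an hv-cone over it is a family of arrows with
  common domain.\<close>

definition discrete_groupoid :: "nat set \<Rightarrow> (nat, nat) ordered_groupoid" where
  "discrete_groupoid X = \<lparr>Obj = X, Arr = X, Dom = (\<lambda>a. a), Cod = (\<lambda>a. a), Idt = (\<lambda>a. a),
     Cmp = (\<lambda>g f. f), ale = (=)\<rparr>"

lemma discrete_groupoid: "is_ordered_groupoid (discrete_groupoid X)"
  by unfold_locales (auto simp: discrete_groupoid_def hom_def ole_def)

text \<open>Two objects \<open>0 \<cong> 1\<close>, both below an object \<open>2\<close>; \<open>3\<close> and \<open>4\<close> are the nonidentity arrows.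
  A pair \<open>f\<close>, \<open>g\<close> of horizontal arrows from \<open>A\<close> to objects below \<open>B\<close> gives the diagram with
  \<open>Cod f\<close>, \<open>Cod g\<close>, \<open>B\<close> at \<open>0\<close>, \<open>1\<close>, \<open>2\<close> and \<open>g f\<inverse>\<close> at \<open>3\<close>. A cone over it takes the same value
  at all three objects, so composing it with \<open>f\<inverse>\<close> yields an arrow that equalizes \<open>f\<close> and \<open>g\<close>.\<close>

definition parallel_groupoid :: "(nat, nat) ordered_groupoid" where
  "parallel_groupoid = \<lparr>Obj = {0, 1, 2}, Arr = {0, 1, 2, 3, 4},
     Dom = (\<lambda>a. if a = 3 then 0 else if a = 4 then 1 else a),
     Cod = (\<lambda>a. if a = 3 then 1 else if a = 4 then 0 else a), Idt = (\<lambda>a. a),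
     Cmp = (\<lambda>g f. if f \<noteq> 3 \<and> f \<noteq> 4 then g else if g \<noteq> 3 \<and> g \<noteq> 4 then f else if f = 3 then 0 else 1),
     ale = (\<lambda>a b. a = b \<or> ((a = 0 \<or> a = 1) \<and> b = 2))\<rparr>"

lemma parallel_groupoid_sel [simp]:
  "Obj parallel_groupoid = {0, 1, 2}" "Arr parallel_groupoid = {0, 1, 2, 3, 4}"
  "Dom parallel_groupoid a = (if a = 3 then 0 else if a = 4 then 1 else a)"
  "Cod parallel_groupoid a = (if a = 3 then 1 else if a = 4 then 0 else a)"
  "Idt parallel_groupoid a = a"
  "Cmp parallel_groupoid g f =
     (if f \<noteq> 3 \<and> f \<noteq> 4 then g else if g \<noteq> 3 \<and> g \<noteq> 4 then f else if f = 3 then 0 else 1)"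
  "ale parallel_groupoid a b \<longleftrightarrow> a = b \<or> ((a = 0 \<or> a = 1) \<and> b = 2)"
  by (simp_all add: parallel_groupoid_def)

lemma parallel_groupoid: "is_ordered_groupoid parallel_groupoid"
proof -
  let ?P = parallel_groupoid
  have cat: "is_category ?P"
  proof
    fix f A B g D h E
    show "f \<in> Arr ?P \<Longrightarrow> Dom ?P f \<in> Obj ?P" "f \<in> Arr ?P \<Longrightarrow> Cod ?P f \<in> Obj ?P"
      "f \<in> Arr ?P \<Longrightarrow> Cmp ?P f (Idt ?P (Dom ?P f)) = f"
      "f \<in> Arr ?P \<Longrightarrow> Cmp ?P (Idt ?P (Cod ?P f)) f = f"
      by (simp_all, (elim disjE; simp)+)
    show "A \<in> Obj ?P \<Longrightarrow> Idt ?P A \<in> hom ?P A A"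
      by (simp add: hom_def, elim disjE; simp)
    assume f: "f \<in> hom ?P A B" and g: "g \<in> hom ?P B D"
    then have fa: "f = 0 \<or> f = 1 \<or> f = 2 \<or> f = 3 \<or> f = 4" and ga: "g = 0 \<or> g = 1 \<or> g = 2 \<or> g = 3 \<or> g = 4"
      and c: "Cod ?P f = Dom ?P g" and A: "Dom ?P f = A" "Cod ?P g = D"
      by (auto simp: hom_def simp del: parallel_groupoid_sel(3,4))
    show "Cmp ?P g f \<in> hom ?P A D"
      using fa ga c unfolding A[symmetric] by (elim disjE; simp add: hom_def)
    assume "h \<in> hom ?P D E"
    then have ha: "h = 0 \<or> h = 1 \<or> h = 2 \<or> h = 3 \<or> h = 4" and c': "Cod ?P g = Dom ?P h"
      using A(2) by (auto simp: hom_def simp del: parallel_groupoid_sel(3,4))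
    show "Cmp ?P h (Cmp ?P g f) = Cmp ?P (Cmp ?P h g) f"
      using fa ga ha c c' by (elim disjE; simp)
  qed
  interpret is_category ?P by (rule cat)
  have inv: "\<exists>g\<in>hom ?P (Cod ?P f) (Dom ?P f). Cmp ?P g f = Idt ?P (Dom ?P f) \<and> Cmp ?P f g = Idt ?P (Cod ?P f)"
    if "f \<in> Arr ?P" for f
  proof (rule bexI[of _ "if f = 3 then 4 else if f = 4 then 3 else f"])
    have f: "f = 0 \<or> f = 1 \<or> f = 2 \<or> f = 3 \<or> f = 4" using that by simp
    show "Cmp ?P (if f = 3 then 4 else if f = 4 then 3 else f) f = Idt ?P (Dom ?P f) \<and>
        Cmp ?P f (if f = 3 then 4 else if f = 4 then 3 else f) = Idt ?P (Cod ?P f)"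
      "(if f = 3 then 4 else if f = 4 then 3 else f) \<in> hom ?P (Cod ?P f) (Dom ?P f)"
      using f by (elim disjE; simp add: hom_def)+
  qed
  interpret is_groupoid ?P
    using cat inv by (simp add: is_groupoid_def is_groupoid_axioms_def)
  have ai: "arr_inv ?P f = (if f = 3 then 4 else if f = 4 then 3 else f)" if "f \<in> Arr ?P" for f
  proof -
    have f: "f = 0 \<or> f = 1 \<or> f = 2 \<or> f = 3 \<or> f = 4" using that by simp
    define g where "g = arr_inv ?P f"
    have "g \<in> hom ?P (Cod ?P f) (Dom ?P f)"
      using conjunct1[OF arr_inv_hom[OF that]] by (simp only: g_def)
    from hom_Arr[OF this] have "g \<in> Arr ?P" and c: "Dom ?P g = Cod ?P f" "Cod ?P g = Dom ?P f"
      by (simp_all only:)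
    then have "g = 0 \<or> g = 1 \<or> g = 2 \<or> g = 3 \<or> g = 4" by simp
    then have "g = (if f = 3 then 4 else if f = 4 then 3 else f)"
      using f c by (elim disjE; simp)
    then show ?thesis by (simp only: g_def)
  qed
  show ?thesis
  proof (intro is_ordered_groupoid.intro is_ordered_groupoid_axioms.intro is_groupoid_axioms)
    fix a b c d
    show "ale ?P a a" by simp
    show "ale ?P a b \<Longrightarrow> ale ?P b a \<Longrightarrow> a = b" by (simp, elim disjE conjE; simp)
    show "ale ?P a b \<Longrightarrow> ale ?P b c \<Longrightarrow> ale ?P a c" by (simp, elim disjE conjE; simp)
    assume *: "a \<in> Arr ?P" "b \<in> Arr ?P" and ab: "ale ?P a b"
    then have a: "a = 0 \<or> a = 1 \<or> a = 2 \<or> a = 3 \<or> a = 4" and ab': "a = b \<or> ((a = 0 \<or> a = 1) \<and> b = 2)"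
      by simp_all
    show "ale ?P (arr_inv ?P a) (arr_inv ?P b)"
      unfolding ai[OF *(1)] ai[OF *(2)] using ab' by (elim disjE conjE; simp)
    assume "c \<in> Arr ?P" "d \<in> Arr ?P" and e: "Cod ?P c = Dom ?P a" "Cod ?P d = Dom ?P b" and cd: "ale ?P c d"
    then have c: "c = 0 \<or> c = 1 \<or> c = 2 \<or> c = 3 \<or> c = 4" "d = 0 \<or> d = 1 \<or> d = 2 \<or> d = 3 \<or> d = 4"
      and cd': "c = d \<or> ((c = 0 \<or> c = 1) \<and> d = 2)"
      by simp_all
    consider "a = b" "c = d" | "a = b" "c = 0 \<or> c = 1" "d = 2" | "a = 0 \<or> a = 1" "b = 2"
      using ab' cd' by blast
    then show "ale ?P (Cmp ?P a c) (Cmp ?P b d)"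
    proof cases
      case 1
      then show ?thesis by simp
    next
      \<comment> \<open>Vacuous: \<open>c\<close> and \<open>d\<close> have the same codomain here,
        yet that of \<open>c\<close> is 0 or 1 and that of \<open>d\<close> is 2.\<close>
      case 2
      have "Cod ?P c = Cod ?P d" using e 2(1) by (simp only:)
      then show ?thesis using 2(2,3) by (elim disjE; simp)
    next
      case 3
      have "Cod ?P d = 2" using e(2) 3(2) by simp
      then have d: "d = 2" using c(2) by (elim disjE; simp)
      have "Cod ?P c = a" using e(1) 3(1) by (elim disjE; simp)
      then show ?thesis using 3 d cd' by (elim disjE conjE; simp)
    qed
  next
    fix f A
    assume *: "f \<in> Arr ?P" "ole ?P A (Dom ?P f)"
    then have f: "f = 0 \<or> f = 1 \<or> f = 2 \<or> f = 3 \<or> f = 4" by simp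
    have A: "(A = 0 \<or> A = 1 \<or> A = 2) \<and> (A = Dom ?P f \<or> (A = 0 \<or> A = 1) \<and> Dom ?P f = 2)"
      using *(2) by (simp add: ole_def)
    show "\<exists>!f'. f' \<in> Arr ?P \<and> Dom ?P f' = A \<and> ale ?P f' f"
    proof (rule ex1I[of _ "if f = 2 then A else f"])
      show "(if f = 2 then A else f) \<in> Arr ?P \<and> Dom ?P (if f = 2 then A else f) = A \<and>
          ale ?P (if f = 2 then A else f) f"
        using f A by (elim disjE conjE; simp)
      fix f' assume f': "f' \<in> Arr ?P \<and> Dom ?P f' = A \<and> ale ?P f' f"
      then have "f' = f \<or> (f' = 0 \<or> f' = 1) \<and> f = 2" "Dom ?P f' = A" by auto
      then show "f' = (if f = 2 then A else f)"
        by (elim disjE conjE; simp split: if_splits)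
    qed
  qed
qed

section \<open>Flatness as local cofilteredness\<close>

locale flat_site_functor = site_functor G T G' T' M
  for G :: "('o, 'a, 'z) ordered_groupoid_scheme" and T :: "'o \<Rightarrow> 'o set set"
    and G' :: "('p, 'b, 'y) ordered_groupoid_scheme" and T' :: "'p \<Rightarrow> 'p set set"
    and M :: "('o, 'a, 'p, 'b) fnctr" +
  assumes pres: "covering_preserving G T G' T' M" and flat: "covering_flat G G' T' M"
begin

text \<open>Flatness for a discrete diagram. With arrows from \<open>U\<close> into images of
  \<open>M\<close> regarded as objects of a comma category, it is the local form of having a common
  predecessor for finitely many of them.\<close>

lemma flat_family:
  fixes X :: "nat set"
  assumes X: "finite X" and U: "U \<in> Obj G'" and A: "\<And>i. i \<in> X \<Longrightarrow> A i \<in> Obj G"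
    and h: "\<And>i. i \<in> X \<Longrightarrow> h i \<in> hvhom G' U (on_obj M (A i))"
  shows "locally T' U (\<lambda>U'. \<exists>V t k. V \<in> Obj G \<and> k \<in> hvhom G' U' (on_obj M V) \<and>
    (\<forall>i\<in>X. t i \<in> hvhom G V (A i) \<and> hvcmp G' (on_arr M (t i)) k = hvcmp G' (h i) (Idt G' U')))"
proof -
  define I where "I = discrete_groupoid X"
  define D where "D = \<lparr>on_obj = A, on_arr = (\<lambda>i. Idt G (A i))\<rparr>"
  interpret I: is_ordered_groupoid I
    unfolding I_def by (rule discrete_groupoid)
  have I_sel: "Obj I = X" "Arr I = X" "\<alpha> \<in> hom I i j \<longleftrightarrow> \<alpha> \<in> X \<and> i = \<alpha> \<and> j = \<alpha>" "ole I i j \<longleftrightarrow> i \<in> X \<and> i = j"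
    "Idt I i = i" "Cmp I \<alpha> i = i" "ale I i j \<longleftrightarrow> i = j" for \<alpha> i j
    by (auto simp: I_def discrete_groupoid_def hom_def ole_def)
  interpret D: is_double_functor I G D
  proof unfold_locales
    show "on_obj D i \<in> Obj G" if "i \<in> Obj I" for i using that A by (simp add: D_def I_sel)
    show "on_arr D f \<in> hom G (on_obj D i) (on_obj D j)" if "f \<in> hom I i j" for f i j
      using that S.Idt_hom[OF A] by (auto simp: D_def I_sel)
    show "on_arr D (Idt I i) = Idt G (on_obj D i)" for i by (simp add: D_def I_sel)
    show "on_arr D (Cmp I g f) = Cmp G (on_arr D g) (on_arr D f)"
      if "f \<in> hom I i j" "g \<in> hom I j l" for f g i j l
      using that S.Idt_Cmp_hom[OF S.Idt_hom[OF A]] by (auto simp: D_def I_sel)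
    show "ale G (on_arr D f) (on_arr D g)" if "f \<in> Arr I" "ale I f g" for f g
      using that S.ale_refl A by (simp add: D_def I_sel)
  qed
  note MD = D.double_functor_comp[OF is_double_functor_axioms]
  have "is_hv_cone I G' (fnctr_comp M D) U h"
    unfolding is_double_functor.hv_cone_iff[OF MD]
    using U h S'.Idt_hvcmp fnctr_Idt[OF A] by (auto simp: I_sel fnctr_comp_def D_def)
  then have l: "locally T' U (\<lambda>U'. \<exists>V \<theta> k. is_hv_cone I G D V \<theta> \<and> k \<in> hvhom G' U' (on_obj M V) \<and>
          (\<forall>i\<in>Obj I. hvcmp G' (on_arr M (\<theta> i)) k = hvcmp G' (h i) (Idt G' U')))"
    using flat[unfolded covering_flat_iff, rule_format, of I D U h] X D.is_double_functor_axioms I_sel(1,2)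
    by simp
  show ?thesis
  proof (rule S'.locally_mono[OF U l])
    fix U' assume "\<exists>V \<theta> k. is_hv_cone I G D V \<theta> \<and> k \<in> hvhom G' U' (on_obj M V) \<and>
          (\<forall>i\<in>Obj I. hvcmp G' (on_arr M (\<theta> i)) k = hvcmp G' (h i) (Idt G' U'))"
    then obtain V \<theta> k where *: "is_hv_cone I G D V \<theta>" "k \<in> hvhom G' U' (on_obj M V)"
      "\<forall>i\<in>X. hvcmp G' (on_arr M (\<theta> i)) k = hvcmp G' (h i) (Idt G' U')"
      unfolding I_sel by blast
    then have "V \<in> Obj G" "\<forall>i\<in>X. \<theta> i \<in> hvhom G V (A i)"
      by (auto simp: D.hv_cone_iff I_sel) (auto simp: D_def)
    then show "\<exists>V t k. V \<in> Obj G \<and> k \<in> hvhom G' U' (on_obj M V) \<and>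
      (\<forall>i\<in>X. t i \<in> hvhom G V (A i) \<and> hvcmp G' (on_arr M (t i)) k = hvcmp G' (h i) (Idt G' U'))"
      using * by blast
  qed
qed

text \<open>The shape must itself be an ordered groupoid, so the parallel pair is encoded: in the
  left cancellative category of \<open>parallel_groupoid\<close> there are exactly two arrows from 0
  to 2, the inclusion of 0 and the arrow 3 followed by the inclusion of 1. The isomorphism
  \<open>f\<close> replaces \<open>A\<close> by \<open>Cod G f\<close> as their domain.\<close>

lemma flat_eq:
  assumes f: "f \<in> hvhom G A B" and g: "g \<in> hvhom G A B" and h: "h \<in> hvhom G' U (on_obj M A)"
    and fg: "hvcmp G' (on_arr M f) h = hvcmp G' (on_arr M g) h"
  shows "locally T' U (\<lambda>U'. \<exists>V t k. t \<in> hvhom G V A \<and> k \<in> hvhom G' U' (on_obj M V) \<and>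
    hvcmp G' (on_arr M t) k = hvcmp G' h (Idt G' U') \<and> hvcmp G f t = hvcmp G g t)"
proof -
  let ?I = parallel_groupoid
  interpret I: is_ordered_groupoid ?I by (rule parallel_groupoid)
  define f' where "f' = arr_inv G f"
  define g' where "g' = arr_inv G g"
  have U: "U \<in> Obj G'" using S'.hvhom_Obj[OF h] by simp
  have O: "A \<in> Obj G" "B \<in> Obj G" using S.hvhom_Obj[OF f] by auto
  have fh: "f \<in> hom G A (Cod G f)" "g \<in> hom G A (Cod G g)"
    using S.hvhom_hom f g by auto
  have f': "f' \<in> hom G (Cod G f) A" "Cmp G f' f = Idt G A" "Cmp G f f' = Idt G (Cod G f)"
    using S.arr_inv_hom[of f] f by (auto simp: f'_def hvhom_def)
  have g': "g' \<in> hom G (Cod G g) A" "Cmp G g' g = Idt G A" "Cmp G g g' = Idt G (Cod G g)"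
    using S.arr_inv_hom[of g] g by (auto simp: g'_def hvhom_def)
  have le: "ole G (Cod G f) B" "ole G (Cod G g) B" using f g by (auto simp: hvhom_def)
  have CO: "Cod G f \<in> Obj G" "Cod G g \<in> Obj G" using le S.ole_Obj by auto
  define gf where "gf = Cmp G g f'"
  define fg' where "fg' = Cmp G f g'"
  have gf: "gf \<in> hom G (Cod G f) (Cod G g)" and fg'h: "fg' \<in> hom G (Cod G g) (Cod G f)"
    using S.Cmp_hom[OF f'(1) fh(2)] S.Cmp_hom[OF g'(1) fh(1)] by (auto simp: gf_def fg'_def)
  have inv: "Cmp G fg' gf = Idt G (Cod G f)" "Cmp G gf fg' = Idt G (Cod G g)"
  proof -
    have "Cmp G fg' gf = Cmp G f (Cmp G g' (Cmp G g f'))"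
      unfolding fg'_def gf_def
      by (rule S.Cmp_assoc[OF S.Cmp_hom[OF f'(1) fh(2)] g'(1) fh(1), symmetric])
    then show "Cmp G fg' gf = Idt G (Cod G f)"
      using S.Cmp_assoc[OF f'(1) fh(2) g'(1)] g'(2) f'(3) S.Idt_Cmp_hom[OF f'(1)] by simp
    have "Cmp G gf fg' = Cmp G g (Cmp G f' (Cmp G f g'))"
      unfolding fg'_def gf_def
      by (rule S.Cmp_assoc[OF S.Cmp_hom[OF g'(1) fh(1)] f'(1) fh(2), symmetric])
    then show "Cmp G gf fg' = Idt G (Cod G g)"
      using S.Cmp_assoc[OF g'(1) fh(1) f'(1)] f'(2) g'(3) S.Idt_Cmp_hom[OF g'(1)] by simp
  qed
  define Do where "Do i = (if i = 0 then Cod G f else if i = 1 then Cod G g else B)" for i :: nat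
  define Da where "Da a = (if a = 3 then gf else if a = 4 then fg' else Idt G (Do a))" for a :: nat
  define D where "D = \<lparr>on_obj = Do, on_arr = Da\<rparr>"
  have D_sel: "on_obj D = Do" "on_arr D = Da" by (auto simp: D_def)
  have Do_sel: "Do 0 = Cod G f" "Do 1 = Cod G g" "Do (Suc 0) = Cod G g" "Do 2 = B" by (auto simp: Do_def)
  have Da_sel: "Da 0 = Idt G (Cod G f)" "Da 1 = Idt G (Cod G g)" "Da (Suc 0) = Idt G (Cod G g)"
    "Da 2 = Idt G B" "Da 3 = gf" "Da 4 = fg'"
    by (auto simp: Da_def Do_def)
  note Ih = S.Idt_hom[OF CO(1)] S.Idt_hom[OF CO(2)] S.Idt_hom[OF O(2)]
  have arr_cases: "a = 0 \<or> a = 1 \<or> a = 2 \<or> a = 3 \<or> a = 4" if "a \<in> hom ?I i j" for a i j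
    using that by (simp add: hom_def)
  interpret D: is_double_functor ?I G D
  proof unfold_locales
    show "on_obj D i \<in> Obj G" if "i \<in> Obj ?I" for i
      using that O CO by (auto simp: D_sel Do_def)
    show "on_arr D a \<in> hom G (on_obj D i) (on_obj D j)" if "a \<in> hom ?I i j" for a i j
    proof -
      have ij: "i = Dom ?I a" "j = Cod ?I a"
        using I.hom_Arr[OF that] by (simp_all only:)
      show ?thesis
        unfolding ij using arr_cases[OF that] gf fg'h Ih by (elim disjE; simp add: D_sel Da_sel Do_sel)
    qed
    show "on_arr D (Idt ?I i) = Idt G (on_obj D i)" if "i \<in> Obj ?I" for i
      using that by (auto simp: D_sel Da_def)
    show "on_arr D (Cmp ?I b a) = Cmp G (on_arr D b) (on_arr D a)"
      if a: "a \<in> hom ?I i j" and b: "b \<in> hom ?I j l" for a b i j l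
    proof -
      have c: "Cod ?I a = Dom ?I b" using a b by (simp add: hom_def del: parallel_groupoid_sel(3,4))
      note ids = S.Idt_Cmp_hom[OF gf] S.Cmp_Idt_hom[OF gf] S.Idt_Cmp_hom[OF fg'h] S.Cmp_Idt_hom[OF fg'h]
        S.Idt_Cmp_hom[OF Ih(1)] S.Idt_Cmp_hom[OF Ih(2)] S.Idt_Cmp_hom[OF Ih(3)]
      show ?thesis
        using arr_cases[OF a] arr_cases[OF b] c by (elim disjE; simp add: D_sel Da_sel inv ids)
    qed
    show "ale G (on_arr D a) (on_arr D b)" if "a \<in> Arr ?I" "b \<in> Arr ?I" "ale ?I a b" for a b
    proof -
      have "a = b \<or> (a = 0 \<or> a = 1) \<and> b = 2" using that(3) by simp
      moreover have "a = 0 \<or> a = 1 \<or> a = 2 \<or> a = 3 \<or> a = 4" using that(1) by simp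
      moreover have "Da a \<in> Arr G" if "a = 0 \<or> a = 1 \<or> a = 2 \<or> a = 3 \<or> a = 4"
        using that gf fg'h Ih by (elim disjE; simp add: Da_sel hom_def)
      ultimately show ?thesis
        using S.ale_refl le by (elim disjE conjE; simp add: D_sel Da_sel ole_def)
    qed
  qed
  note MD = D.double_functor_comp[OF is_double_functor_axioms]
  \<comment> \<open>The common composite. Every leg of the hv-cone over the image diagram is
    \<open>e\<close>, as the condition on comparable objects demands.\<close>
  define e where "e = hvcmp G' (on_arr M f) h"
  have eg: "e = hvcmp G' (on_arr M g) h" using fg by (simp add: e_def)
  note fv = S.hom_hvhom[OF fh(1)] and gv = S.hom_hvhom[OF fh(2)] and f'v = S.hom_hvhom[OF f'(1)]
    and g'v = S.hom_hvhom[OF g'(1)]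
  have e: "e \<in> hvhom G' U (on_obj M (Cod G f))" "e \<in> hvhom G' U (on_obj M (Cod G g))"
    using S'.hvcmp_hvhom[OF h fnctr_hvhom[OF fv]] S'.hvcmp_hvhom[OF h fnctr_hvhom[OF gv]] e_def eg by auto
  have cmp_f: "hvcmp G' (on_arr M (Cmp G a f')) e = hvcmp G' (on_arr M a) h" if a: "a \<in> hom G A X" for a X
  proof -
    note av = S.hom_hvhom[OF a]
    have "hvcmp G' (on_arr M (Cmp G a f')) e = hvcmp G' (hvcmp G' (on_arr M a) (on_arr M f')) (hvcmp G' (on_arr M f) h)"
      using fnctr_hvcmp[OF f'v av] S.hvcmp_eq_Cmp[OF f'(1) a] by (simp add: e_def)
    also have "\<dots> = hvcmp G' (on_arr M a) (hvcmp G' (hvcmp G' (on_arr M f') (on_arr M f)) h)"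
      using S'.hvcmp_assoc[OF S'.hvcmp_hvhom[OF h fnctr_hvhom[OF fv]] fnctr_hvhom[OF f'v] fnctr_hvhom[OF av]]
        S'.hvcmp_assoc[OF h fnctr_hvhom[OF fv] fnctr_hvhom[OF f'v]] by simp
    also have "hvcmp G' (on_arr M f') (on_arr M f) = Idt G' (on_obj M A)"
      using fnctr_hvcmp[OF fv f'v] S.hvcmp_eq_Cmp[OF fh(1) f'(1)] f'(2) fnctr_Idt[OF O(1)] by simp
    finally show ?thesis using S'.Idt_hvcmp[OF h] by simp
  qed
  have cmp_g: "hvcmp G' (on_arr M (Cmp G a g')) e = hvcmp G' (on_arr M a) h" if a: "a \<in> hom G A X" for a X
  proof -
    note av = S.hom_hvhom[OF a]
    have "hvcmp G' (on_arr M (Cmp G a g')) e = hvcmp G' (hvcmp G' (on_arr M a) (on_arr M g')) (hvcmp G' (on_arr M g) h)"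
      using fnctr_hvcmp[OF g'v av] S.hvcmp_eq_Cmp[OF g'(1) a] by (simp add: eg)
    also have "\<dots> = hvcmp G' (on_arr M a) (hvcmp G' (hvcmp G' (on_arr M g') (on_arr M g)) h)"
      using S'.hvcmp_assoc[OF S'.hvcmp_hvhom[OF h fnctr_hvhom[OF gv]] fnctr_hvhom[OF g'v] fnctr_hvhom[OF av]]
        S'.hvcmp_assoc[OF h fnctr_hvhom[OF gv] fnctr_hvhom[OF g'v]] by simp
    also have "hvcmp G' (on_arr M g') (on_arr M g) = Idt G' (on_obj M A)"
      using fnctr_hvcmp[OF gv g'v] S.hvcmp_eq_Cmp[OF fh(2) g'(1)] g'(2) fnctr_Idt[OF O(1)] by simp
    finally show ?thesis using S'.Idt_hvcmp[OF h] by simp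
  qed
  have id: "hvcmp G' (on_arr M (Idt G X)) e = e" if "X \<in> Obj G" "e \<in> hvhom G' U (on_obj M X)" for X
    using S'.Idt_hvcmp[OF that(2)] fnctr_Idt[OF that(1)] by simp
  have eB: "e \<in> hvhom G' U (on_obj M B)"
    using S'.hvhom_mono[OF e(1) fnctr_ole[OF le(1)]] .
  have "is_hv_cone ?I G' (fnctr_comp M D) U (\<lambda>_. e)"
    unfolding is_double_functor.hv_cone_iff[OF MD]
  proof (intro conjI allI impI ballI U)
    show "e \<in> hvhom G' U (on_obj (fnctr_comp M D) i)" if "i \<in> Obj ?I" for i
      using that e eB by (auto simp: fnctr_comp_def D_sel Do_sel)
    fix i j a assume a: "a \<in> hom ?I i j"
    show "hvcmp G' (on_arr (fnctr_comp M D) a) e = e"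
      using arr_cases[OF a] id[OF CO(1) e(1)] id[OF CO(2) e(2)] id[OF O(2) eB] cmp_f[OF fh(2)] cmp_g[OF fh(1)]
      by (elim disjE; simp add: fnctr_comp_def D_sel Da_sel gf_def fg'_def e_def[symmetric] eg[symmetric])
  qed simp
  then have l: "locally T' U (\<lambda>U'. \<exists>V \<theta> k. is_hv_cone ?I G D V \<theta> \<and> k \<in> hvhom G' U' (on_obj M V) \<and>
          (\<forall>i\<in>Obj ?I. hvcmp G' (on_arr M (\<theta> i)) k = hvcmp G' e (Idt G' U')))"
    using flat[unfolded covering_flat_iff, rule_format, of ?I D U "\<lambda>_. e"] D.is_double_functor_axioms by simp
  show ?thesis
  proof (rule S'.locally_mono[OF U l])
    fix U' assume U': "ole G' U' U" and "\<exists>V \<theta> k. is_hv_cone ?I G D V \<theta> \<and> k \<in> hvhom G' U' (on_obj M V) \<and>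
          (\<forall>i\<in>Obj ?I. hvcmp G' (on_arr M (\<theta> i)) k = hvcmp G' e (Idt G' U'))"
    then obtain V \<theta> k where c: "is_hv_cone ?I G D V \<theta>" and k: "k \<in> hvhom G' U' (on_obj M V)"
      and ek: "hvcmp G' (on_arr M (\<theta> 0)) k = hvcmp G' e (Idt G' U')"
      by auto
    note c' = c[unfolded D.hv_cone_iff]
    have \<theta>: "\<theta> 0 \<in> hvhom G V (Cod G f)"
      using c' by (simp add: D_sel Do_sel)
    have "ole ?I 0 2" "ole ?I 1 2" by (simp_all add: ole_def)
    then have "\<theta> 0 = \<theta> 2" "\<theta> 1 = \<theta> 2" using c' by blast+
    moreover have "3 \<in> hom ?I 0 1" by (simp add: hom_def)
    then have "hvcmp G (on_arr D 3) (\<theta> 0) = \<theta> 1" using c' by blast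
    ultimately have gf\<theta>: "hvcmp G gf (\<theta> 0) = \<theta> 0" by (simp add: D_sel Da_sel)
    \<comment> \<open>Undoing the isomorphism \<open>f\<close>: then \<open>f\<close> after
      \<open>t\<close> is the common leg \<open>\<theta> 0\<close>, and so is \<open>g\<close> after
      \<open>t\<close>, because \<open>gf\<close> fixes this leg.\<close>
    define t where "t = hvcmp G f' (\<theta> 0)"
    have t: "t \<in> hvhom G V A" using S.hvcmp_hvhom[OF \<theta> f'v] by (simp add: t_def)
    have "hvcmp G f t = \<theta> 0"
      using S.hvcmp_assoc[OF \<theta> f'v fv] S.hvcmp_eq_Cmp[OF f'(1) fh(1)] f'(3) S.Idt_hvcmp[OF \<theta>]
      by (simp add: t_def)
    moreover have "hvcmp G g t = \<theta> 0"
      using S.hvcmp_assoc[OF \<theta> f'v gv] S.hvcmp_eq_Cmp[OF f'(1) fh(2)] gf\<theta> by (simp add: t_def gf_def)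
    moreover have "hvcmp G' (on_arr M t) k = hvcmp G' h (Idt G' U')"
    proof -
      have "hvcmp G' (on_arr M t) k = hvcmp G' (on_arr M f') (hvcmp G' e (Idt G' U'))"
        using fnctr_hvcmp[OF \<theta> f'v] S'.hvcmp_assoc[OF k fnctr_hvhom[OF \<theta>] fnctr_hvhom[OF f'v]] ek
        by (simp add: t_def)
      also have "\<dots> = hvcmp G' (hvcmp G' (on_arr M f') e) (Idt G' U')"
        using S'.hvcmp_move[OF fnctr_hvhom[OF f'v] e(1) U'] by simp
      also have "hvcmp G' (on_arr M f') e = h"
        using cmp_f[OF S.Idt_hom[OF O(1)]] S.Idt_Cmp_hom[OF f'(1)] fnctr_Idt[OF O(1)] S'.Idt_hvcmp[OF h]
        by simp
      finally show ?thesis .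
    qed
    ultimately show "\<exists>V t k. t \<in> hvhom G V A \<and> k \<in> hvhom G' U' (on_obj M V) \<and>
      hvcmp G' (on_arr M t) k = hvcmp G' h (Idt G' U') \<and> hvcmp G f t = hvcmp G g t"
      using t k by (intro exI[of _ V] exI[of _ t] exI[of _ k]) simp
  qed
qed

text \<open>Two successive local factorizations compose: \<open>h\<close> through \<open>t\<close>
  with remaining factor \<open>k\<close>, then \<open>k\<close> through \<open>s\<close>. This is
  the bookkeeping behind repeated uses of flatness.\<close>

lemma refine_lift:
  assumes t: "t \<in> hvhom G V A" and k: "k \<in> hvhom G' U' (on_obj M V)"
    and tk: "hvcmp G' (on_arr M t) k = hvcmp G' h (Idt G' U')"
    and s: "s \<in> hvhom G W V" and l: "l \<in> hvhom G' U'' (on_obj M W)"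
    and sl: "hvcmp G' (on_arr M s) l = hvcmp G' k (Idt G' U'')"
    and h: "h \<in> hvhom G' U X" and U: "ole G' U' U" "ole G' U'' U'"
  shows "hvcmp G' (on_arr M (hvcmp G t s)) l = hvcmp G' h (Idt G' U'')"
proof -
  have "hvcmp G' (on_arr M (hvcmp G t s)) l = hvcmp G' (on_arr M t) (hvcmp G' k (Idt G' U''))"
    using fnctr_hvcmp[OF s t] S'.hvcmp_assoc[OF l fnctr_hvhom[OF s] fnctr_hvhom[OF t]] sl by simp
  also have "\<dots> = hvcmp G' (hvcmp G' h (Idt G' U')) (Idt G' U'')"
    using S'.hvcmp_move[OF fnctr_hvhom[OF t] k U(2)] tk by simp
  finally show ?thesis
    using S'.hvcmp_Idt_Idt[OF h U] by simp
qed

text \<open>A local Ore condition, obtained in two refinements: \<open>flat_family\<close> joins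
  \<open>A1\<close> and \<open>A2\<close> by a span, and \<open>flat_eq\<close> equalizes the two
  composites to \<open>B\<close>.\<close>

lemma flat_square:
  assumes h: "h1 \<in> hvhom G' U (on_obj M A1)" "h2 \<in> hvhom G' U (on_obj M A2)"
    and f: "f1 \<in> hvhom G A1 B" "f2 \<in> hvhom G A2 B"
    and eq: "hvcmp G' (on_arr M f1) h1 = hvcmp G' (on_arr M f2) h2"
  shows "locally T' U (\<lambda>U'. \<exists>V t1 t2 k. t1 \<in> hvhom G V A1 \<and> t2 \<in> hvhom G V A2 \<and>
    k \<in> hvhom G' U' (on_obj M V) \<and> hvcmp G' (on_arr M t1) k = hvcmp G' h1 (Idt G' U') \<and>
    hvcmp G' (on_arr M t2) k = hvcmp G' h2 (Idt G' U') \<and> hvcmp G f1 t1 = hvcmp G f2 t2)"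
proof -
  have U: "U \<in> Obj G'" using S'.hvhom_Obj[OF h(1)] by simp
  define A where "A i = (if i = 0 then A1 else A2)" for i :: nat
  define H where "H i = (if i = 0 then h1 else h2)" for i :: nat
  have l: "locally T' U (\<lambda>U'. \<exists>V t k. V \<in> Obj G \<and> k \<in> hvhom G' U' (on_obj M V) \<and>
    (\<forall>i\<in>{0, 1}. t i \<in> hvhom G V (A i) \<and> hvcmp G' (on_arr M (t i)) k = hvcmp G' (H i) (Idt G' U')))"
    using h S.hvhom_Obj[OF f(1)] S.hvhom_Obj[OF f(2)]
    by (intro flat_family[OF _ U]) (auto simp: A_def H_def)
  show ?thesis
  proof (rule S'.locally_bind[OF U l])
    fix U' assume U': "ole G' U' U" and "\<exists>V t k. V \<in> Obj G \<and> k \<in> hvhom G' U' (on_obj M V) \<and>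
      (\<forall>i\<in>{0, 1}. t i \<in> hvhom G V (A i) \<and> hvcmp G' (on_arr M (t i)) k = hvcmp G' (H i) (Idt G' U'))"
    then obtain V t k where k: "k \<in> hvhom G' U' (on_obj M V)"
      and t': "\<forall>i\<in>{0, 1}. t i \<in> hvhom G V (A i) \<and> hvcmp G' (on_arr M (t i)) k = hvcmp G' (H i) (Idt G' U')"
      by blast
    from t' have t: "t 0 \<in> hvhom G V A1" "t 1 \<in> hvhom G V A2"
      "hvcmp G' (on_arr M (t 0)) k = hvcmp G' h1 (Idt G' U')"
      "hvcmp G' (on_arr M (t 1)) k = hvcmp G' h2 (Idt G' U')"
      by (auto simp: A_def H_def)
    have "hvcmp G' (on_arr M (hvcmp G f1 (t 0))) k = hvcmp G' (hvcmp G' (on_arr M f1) h1) (Idt G' U')"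
      using fnctr_hvcmp[OF t(1) f(1)] S'.hvcmp_assoc[OF k fnctr_hvhom[OF t(1)] fnctr_hvhom[OF f(1)]] t(3)
        S'.hvcmp_move[OF fnctr_hvhom[OF f(1)] h(1) U'] by simp
    moreover have "hvcmp G' (on_arr M (hvcmp G f2 (t 1))) k = hvcmp G' (hvcmp G' (on_arr M f2) h2) (Idt G' U')"
      using fnctr_hvcmp[OF t(2) f(2)] S'.hvcmp_assoc[OF k fnctr_hvhom[OF t(2)] fnctr_hvhom[OF f(2)]] t(4)
        S'.hvcmp_move[OF fnctr_hvhom[OF f(2)] h(2) U'] by simp
    ultimately have "hvcmp G' (on_arr M (hvcmp G f1 (t 0))) k = hvcmp G' (on_arr M (hvcmp G f2 (t 1))) k"
      using eq by simp
    note l' = flat_eq[OF S.hvcmp_hvhom[OF t(1) f(1)] S.hvcmp_hvhom[OF t(2) f(2)] k this]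
    have U'O: "U' \<in> Obj G'" using S'.ole_Obj[OF U'] by simp
    show "locally T' U' (\<lambda>U'. \<exists>V t1 t2 k. t1 \<in> hvhom G V A1 \<and> t2 \<in> hvhom G V A2 \<and>
      k \<in> hvhom G' U' (on_obj M V) \<and> hvcmp G' (on_arr M t1) k = hvcmp G' h1 (Idt G' U') \<and>
      hvcmp G' (on_arr M t2) k = hvcmp G' h2 (Idt G' U') \<and> hvcmp G f1 t1 = hvcmp G f2 t2)"
    proof (rule S'.locally_mono[OF U'O l'])
      fix U'' assume U'': "ole G' U'' U'" and "\<exists>W s l. s \<in> hvhom G W V \<and> l \<in> hvhom G' U'' (on_obj M W) \<and>
        hvcmp G' (on_arr M s) l = hvcmp G' k (Idt G' U'') \<and>
        hvcmp G (hvcmp G f1 (t 0)) s = hvcmp G (hvcmp G f2 (t 1)) s"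
      then obtain W s l where s: "s \<in> hvhom G W V" "l \<in> hvhom G' U'' (on_obj M W)"
        "hvcmp G' (on_arr M s) l = hvcmp G' k (Idt G' U'')"
        and e: "hvcmp G (hvcmp G f1 (t 0)) s = hvcmp G (hvcmp G f2 (t 1)) s" by blast
      show "\<exists>V t1 t2 k. t1 \<in> hvhom G V A1 \<and> t2 \<in> hvhom G V A2 \<and>
        k \<in> hvhom G' U'' (on_obj M V) \<and> hvcmp G' (on_arr M t1) k = hvcmp G' h1 (Idt G' U'') \<and>
        hvcmp G' (on_arr M t2) k = hvcmp G' h2 (Idt G' U'') \<and> hvcmp G f1 t1 = hvcmp G f2 t2"
        using S.hvcmp_hvhom[OF s(1) t(1)] S.hvcmp_hvhom[OF s(1) t(2)] s(2)
          refine_lift[OF t(1) k t(3) s h(1) U' U''] refine_lift[OF t(2) k t(4) s h(2) U' U'']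
          e S.hvcmp_assoc[OF s(1) t(1) f(1)] S.hvcmp_assoc[OF s(1) t(2) f(2)]
        by (intro exI[of _ W] exI[of _ "hvcmp G (t 0) s"] exI[of _ "hvcmp G (t 1) s"] exI[of _ l]) simp
    qed
  qed
qed

text \<open>A second modality, combining passage to a cover of \<open>U\<close> with refinement
  along an arrow into \<open>A\<close>. It preserves finite conjunctions of conditions stable under
  refinement, and the exactness of the inverse image rests on this.\<close>

definition lifts :: "'p \<Rightarrow> 'o \<Rightarrow> 'b \<Rightarrow> ('o \<Rightarrow> 'a \<Rightarrow> bool) \<Rightarrow> bool" where
  "lifts U A h Q \<longleftrightarrow> locally T' U (\<lambda>U'. \<exists>V t k. t \<in> hvhom G V A \<and> k \<in> hvhom G' U' (on_obj M V) \<and>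
     hvcmp G' (on_arr M t) k = hvcmp G' h (Idt G' U') \<and> Q V t)"

text \<open>Both factorizations represent the same arrow into the image of \<open>A\<close>, so
  \<open>flat_square\<close> yields a common refinement of \<open>t1\<close> and \<open>t2\<close>,
  where both conditions persist.\<close>

lemma lifts_conj:
  assumes h: "h \<in> hvhom G' U (on_obj M A)" and A: "A \<in> Obj G" and l: "lifts U A h P" "lifts U A h Q"
    and P: "\<And>V W t s. t \<in> hvhom G V A \<Longrightarrow> s \<in> hvhom G W V \<Longrightarrow> P V t \<Longrightarrow> P W (hvcmp G t s)"
    and Q: "\<And>V W t s. t \<in> hvhom G V A \<Longrightarrow> s \<in> hvhom G W V \<Longrightarrow> Q V t \<Longrightarrow> Q W (hvcmp G t s)"
  shows "lifts U A h (\<lambda>V t. P V t \<and> Q V t)"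
proof -
  have U: "U \<in> Obj G'" using S'.hvhom_Obj[OF h] by simp
  show ?thesis
    unfolding lifts_def
  proof (rule S'.locally_bind[OF U S'.locally_conj[OF U l[unfolded lifts_def]]])
    fix U' assume U': "ole G' U' U"
      and "(\<exists>V t k. t \<in> hvhom G V A \<and> k \<in> hvhom G' U' (on_obj M V) \<and>
          hvcmp G' (on_arr M t) k = hvcmp G' h (Idt G' U') \<and> P V t) \<and>
        (\<exists>V t k. t \<in> hvhom G V A \<and> k \<in> hvhom G' U' (on_obj M V) \<and>
          hvcmp G' (on_arr M t) k = hvcmp G' h (Idt G' U') \<and> Q V t)"
    then obtain V1 t1 k1 V2 t2 k2 where
      1: "t1 \<in> hvhom G V1 A" "k1 \<in> hvhom G' U' (on_obj M V1)"
        "hvcmp G' (on_arr M t1) k1 = hvcmp G' h (Idt G' U')" "P V1 t1" and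
      2: "t2 \<in> hvhom G V2 A" "k2 \<in> hvhom G' U' (on_obj M V2)"
        "hvcmp G' (on_arr M t2) k2 = hvcmp G' h (Idt G' U')" "Q V2 t2"
      by blast
    have U'O: "U' \<in> Obj G'" using S'.ole_Obj[OF U'] by simp
    have "hvcmp G' (on_arr M t1) k1 = hvcmp G' (on_arr M t2) k2" using 1 2 by simp
    from flat_square[OF 1(2) 2(2) 1(1) 2(1) this]
    show "locally T' U' (\<lambda>U'. \<exists>V t k. t \<in> hvhom G V A \<and> k \<in> hvhom G' U' (on_obj M V) \<and>
          hvcmp G' (on_arr M t) k = hvcmp G' h (Idt G' U') \<and> P V t \<and> Q V t)"
    proof (rule S'.locally_mono[OF U'O])
      fix U'' assume U'': "ole G' U'' U'"
        and "\<exists>V s1 s2 k. s1 \<in> hvhom G V V1 \<and> s2 \<in> hvhom G V V2 \<and>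
        k \<in> hvhom G' U'' (on_obj M V) \<and> hvcmp G' (on_arr M s1) k = hvcmp G' k1 (Idt G' U'') \<and>
        hvcmp G' (on_arr M s2) k = hvcmp G' k2 (Idt G' U'') \<and> hvcmp G t1 s1 = hvcmp G t2 s2"
      then obtain V s1 s2 k where s: "s1 \<in> hvhom G V V1" "s2 \<in> hvhom G V V2"
        "k \<in> hvhom G' U'' (on_obj M V)" "hvcmp G' (on_arr M s1) k = hvcmp G' k1 (Idt G' U'')"
        "hvcmp G t1 s1 = hvcmp G t2 s2" by blast
      show "\<exists>V t k. t \<in> hvhom G V A \<and> k \<in> hvhom G' U'' (on_obj M V) \<and>
          hvcmp G' (on_arr M t) k = hvcmp G' h (Idt G' U'') \<and> P V t \<and> Q V t"
        using S.hvcmp_hvhom[OF s(1) 1(1)] s(3) refine_lift[OF 1(1-3) s(1,3,4) h U' U'']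
          P[OF 1(1) s(1) 1(4)] Q[OF 2(1) s(2) 2(4)] s(5)
        by (intro exI[of _ V] exI[of _ "hvcmp G t1 s1"] exI[of _ k]) simp
    qed
  qed
qed

lemma lifts_finite_ball:
  assumes h: "h \<in> hvhom G' U (on_obj M A)" and A: "A \<in> Obj G" and "finite X"
    and "\<And>i. i \<in> X \<Longrightarrow> lifts U A h (P i)"
    and "\<And>i V W t s. i \<in> X \<Longrightarrow> t \<in> hvhom G V A \<Longrightarrow> s \<in> hvhom G W V \<Longrightarrow> P i V t \<Longrightarrow> P i W (hvcmp G t s)"
  shows "lifts U A h (\<lambda>V t. \<forall>i\<in>X. P i V t)"
  using assms(3-5)
proof (induction X)
  case empty
  have U: "U \<in> Obj G'" using S'.hvhom_Obj[OF h] by simp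
  show ?case
    unfolding lifts_def
  proof (rule S'.locally_all[OF U])
    fix U' assume U': "ole G' U' U"
    have "hvcmp G' (on_arr M (Idt G A)) (hvcmp G' h (Idt G' U')) = hvcmp G' h (Idt G' U')"
      using S'.Idt_hvcmp[OF S'.hvcmp_hvhom[OF S'.Idt_hvhom[OF U'] h]] fnctr_Idt[OF A] by simp
    then show "\<exists>V t k. t \<in> hvhom G V A \<and> k \<in> hvhom G' U' (on_obj M V) \<and>
        hvcmp G' (on_arr M t) k = hvcmp G' h (Idt G' U') \<and> (\<forall>i\<in>{}. P i V t)"
      using S'.hvcmp_hvhom[OF S'.Idt_hvhom[OF U'] h] S.Idt_hvhom[OF S.ole_refl[OF A]] by blast
  qed
next
  case (insert i X)
  have "lifts U A h (\<lambda>V t. P i V t \<and> (\<forall>i\<in>X. P i V t))"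
    by (rule lifts_conj[OF h A]) (use insert in auto)
  then show ?case by simp
qed

text \<open>Separatedness comes from preservation of covers. Gluing also meets objects below the
  images of two members of \<open>S\<close> at once, where the matching condition of
  \<open>G\<close> says nothing directly; flatness provides, locally, an object \<open>V\<close> of
  \<open>G\<close> over both members to which it applies.\<close>

lemma precomp_sheaf:
  assumes Y: "is_sheaf G' T' Y"
  shows "is_sheaf G T (presheaf_precomp M Y)"
proof (rule S.is_sheafI[OF precomp_presheaf[OF S'.sheaf_presheaf[OF Y]]])
  let ?F = "presheaf_precomp M Y"
  have pullI: "pull G ?F A (Idt G B) x = pull G' Y (on_obj M A) (Idt G' (on_obj M B)) x"
    if "ole G B A" for A B x
    using precomp_pull[OF S.Idt_hvhom[OF that]] fnctr_Idt[of B] S.ole_Obj[OF that] by simp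
  {
    fix A x y
    assume A: "A \<in> Obj G" and x: "x \<in> val ?F A" and y: "y \<in> val ?F A"
      and l: "locally T A (\<lambda>B. pull G ?F A (Idt G B) x = pull G ?F A (Idt G B) y)"
    note MA = fnctr_obj[OF A]
    have xy: "x \<in> val Y (on_obj M A)" "y \<in> val Y (on_obj M A)" using x y by auto
    show "x = y"
    proof (rule S'.sheaf_separated[OF Y MA xy S'.locally_mono[OF MA locally_fnctr[OF pres A l]]])
      fix B assume "\<exists>A'. ole G A' A \<and> pull G ?F A (Idt G A') x = pull G ?F A (Idt G A') y \<and>
        ole G' B (on_obj M A')"
      then obtain A' where A': "ole G A' A" "ole G' B (on_obj M A')"
        and e: "pull G ?F A (Idt G A') x = pull G ?F A (Idt G A') y" by blast
      note i = S'.Idt_hvhom[OF fnctr_ole[OF A'(1)]] and j = S'.Idt_hvhom[OF A'(2)]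
      have "pull G' Y (on_obj M A) (Idt G' B) z =
          pull G' Y (on_obj M A') (Idt G' B) (pull G' Y (on_obj M A) (Idt G' (on_obj M A')) z)"
        if "z \<in> val Y (on_obj M A)" for z
        using S'.sheaf_pull_pull[OF Y that i j] S'.Idt_hvcmp[OF j] by simp
      then show "pull G' Y (on_obj M A) (Idt G' B) x = pull G' Y (on_obj M A) (Idt G' B) y"
        using e xy pullI[OF A'(1)] by simp
    qed
  }
  fix A S x
  assume A: "A \<in> Obj G" and S: "S \<in> T A" and x: "\<And>B. B \<in> S \<Longrightarrow> x B \<in> val ?F B"
    and m: "\<And>B D. B \<in> S \<Longrightarrow> ole G D B \<Longrightarrow> pull G ?F B (Idt G D) (x B) = x D"
  note MA = fnctr_obj[OF A] and FS = precomp_presheaf[OF S'.sheaf_presheaf[OF Y]]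
  have le: "ole G B A" if "B \<in> S" for B using S.covering_le[OF A S that] .
  have xY: "x B \<in> val Y (on_obj M B)" if "B \<in> S" for B using x[OF that] by simp
  define Q where "Q B z \<longleftrightarrow> (\<exists>A'\<in>S. ole G' B (on_obj M A') \<and> z = pull G' Y (on_obj M A') (Idt G' B) (x A'))" for B z
  have "\<exists>y\<in>val Y (on_obj M A). \<forall>B z. ole G' B (on_obj M A) \<longrightarrow> z \<in> val Y B \<longrightarrow> Q B z \<longrightarrow>
      pull G' Y (on_obj M A) (Idt G' B) y = z"
  proof (rule S'.sheaf_glue[OF Y MA])
    have "locally T A (\<lambda>B. B \<in> S)" using S by (auto simp: locally_def)
    from locally_fnctr[OF pres A this] show "locally T' (on_obj M A) (\<lambda>B. \<exists>z\<in>val Y B. Q B z)"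
    proof (rule S'.locally_mono[OF MA])
      fix B assume "\<exists>A'. ole G A' A \<and> A' \<in> S \<and> ole G' B (on_obj M A')"
      then obtain A' where A': "A' \<in> S" "ole G' B (on_obj M A')" by blast
      have "Q B (pull G' Y (on_obj M A') (Idt G' B) (x A'))"
        unfolding Q_def using A' by blast
      then show "\<exists>z\<in>val Y B. Q B z"
        using S'.sheaf_pull_in[OF Y xY[OF A'(1)] S'.Idt_hvhom[OF A'(2)]] by blast
    qed
  next
    fix B D z assume D: "ole G' D B" and "Q B z"
    then obtain A' where A': "A' \<in> S" "ole G' B (on_obj M A')"
      "z = pull G' Y (on_obj M A') (Idt G' B) (x A')" by (auto simp: Q_def)
    have "pull G' Y B (Idt G' D) z = pull G' Y (on_obj M A') (Idt G' D) (x A')"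
      using S'.sheaf_pull_pull[OF Y xY[OF A'(1)] S'.Idt_hvhom[OF A'(2)] S'.Idt_hvhom[OF D]]
        S'.Idt_hvcmp[OF S'.Idt_hvhom[OF D]] A'(3) by simp
    then show "Q D (pull G' Y B (Idt G' D) z)"
      unfolding Q_def using A' S'.ole_trans[OF D A'(2)] by blast
  next
    fix B z w assume "ole G' B (on_obj M A)" and z: "z \<in> val Y B" and w: "w \<in> val Y B" and "Q B z" "Q B w"
    then obtain A1 A2 where A1: "A1 \<in> S" "ole G' B (on_obj M A1)" "z = pull G' Y (on_obj M A1) (Idt G' B) (x A1)"
      and A2: "A2 \<in> S" "ole G' B (on_obj M A2)" "w = pull G' Y (on_obj M A2) (Idt G' B) (x A2)"
      by (auto simp: Q_def)
    have BO: "B \<in> Obj G'" using S'.ole_Obj[OF A1(2)] by simp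
    note i1 = S'.Idt_hvhom[OF A1(2)] and i2 = S'.Idt_hvhom[OF A2(2)]
    note f1 = S.Idt_hvhom[OF le[OF A1(1)]] and f2 = S.Idt_hvhom[OF le[OF A2(1)]]
    have O: "A1 \<in> Obj G" "A2 \<in> Obj G" using le A1(1) A2(1) S.ole_Obj by blast+
    have "hvcmp G' (on_arr M (Idt G A1)) (Idt G' B) = hvcmp G' (on_arr M (Idt G A2)) (Idt G' B)"
      using fnctr_Idt O S'.Idt_hvcmp[OF i1] S'.Idt_hvcmp[OF i2] by simp
    note sq = flat_square[OF i1 i2 f1 f2 this]
    show "z = w"
    proof (rule S'.sheaf_separated[OF Y BO z w S'.locally_mono[OF BO sq]])
      fix B' assume B': "ole G' B' B"
        and "\<exists>V t1 t2 k. t1 \<in> hvhom G V A1 \<and> t2 \<in> hvhom G V A2 \<and>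
        k \<in> hvhom G' B' (on_obj M V) \<and> hvcmp G' (on_arr M t1) k = hvcmp G' (Idt G' B) (Idt G' B') \<and>
        hvcmp G' (on_arr M t2) k = hvcmp G' (Idt G' B) (Idt G' B') \<and>
        hvcmp G (Idt G A1) t1 = hvcmp G (Idt G A2) t2"
      then obtain V t1 t2 k where t: "t1 \<in> hvhom G V A1" "t2 \<in> hvhom G V A2" "k \<in> hvhom G' B' (on_obj M V)"
        "hvcmp G' (on_arr M t1) k = hvcmp G' (Idt G' B) (Idt G' B')"
        and e: "hvcmp G (Idt G A1) t1 = hvcmp G (Idt G A2) t2" by blast
      have t12: "t1 = t2" using e S.Idt_hvcmp[OF t(1)] S.Idt_hvcmp[OF t(2)] by simp
      \<comment> \<open>The two composites into \<open>A\<close> agree, so \<open>t1\<close> and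
        \<open>t2\<close> are the same horizontal arrow. Its codomain lies below \<open>A1\<close>
        and \<open>A2\<close>, and there matching compares \<open>x A1\<close> with
        \<open>x A2\<close>.\<close>
      define C where "C = Cod G t1"
      have tC: "t1 \<in> hvhom G V C" "ole G C A1" "ole G C A2"
        using t(1,2) t12 S.Arr_hvhom[of t1] by (auto simp: C_def hvhom_def)
      have "pull G ?F A1 t1 (x A1) = pull G ?F A2 t1 (x A2)"
        using S.pull_pull[OF FS x[OF A1(1)] S.Idt_hvhom[OF tC(2)] tC(1)]
          S.pull_pull[OF FS x[OF A2(1)] S.Idt_hvhom[OF tC(3)] tC(1)] S.Idt_hvcmp[OF tC(1)]
          m[OF A1(1) tC(2)] m[OF A2(1) tC(3)] by simp
      then have eq: "pull G' Y (on_obj M A1) (on_arr M t1) (x A1) = pull G' Y (on_obj M A2) (on_arr M t1) (x A2)"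
        using precomp_pull[OF t(1)] precomp_pull[OF t(2)] t12 by metis
      have z': "pull G' Y B (Idt G' B') z = pull G' Y (on_obj M V) k (pull G' Y (on_obj M A1) (on_arr M t1) (x A1))"
        using S'.sheaf_pull_pull[OF Y xY[OF A1(1)] i1 S'.Idt_hvhom[OF B']] t(4) A1(3)
          S'.sheaf_pull_pull[OF Y xY[OF A1(1)] fnctr_hvhom[OF t(1)] t(3)] by simp
      have w': "pull G' Y B (Idt G' B') w = pull G' Y (on_obj M V) k (pull G' Y (on_obj M A2) (on_arr M t1) (x A2))"
        using S'.sheaf_pull_pull[OF Y xY[OF A2(1)] i2 S'.Idt_hvhom[OF B']] t(4) A2(3) t12
          S'.sheaf_pull_pull[OF Y xY[OF A2(1)] fnctr_hvhom[OF t(2)] t(3)] by simp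
      show "pull G' Y B (Idt G' B') z = pull G' Y B (Idt G' B') w"
        using z' w' eq by simp
    qed
  qed
  then obtain y where y: "y \<in> val Y (on_obj M A)" "\<And>B z. ole G' B (on_obj M A) \<Longrightarrow> z \<in> val Y B \<Longrightarrow> Q B z \<Longrightarrow>
      pull G' Y (on_obj M A) (Idt G' B) y = z" by blast
  have "pull G ?F A (Idt G B) y = x B" if B: "B \<in> S" for B
  proof -
    have BO: "on_obj M B \<in> Obj G'" using fnctr_obj S.ole_Obj[OF le[OF B]] by blast
    have "Q (on_obj M B) (x B)"
      unfolding Q_def using B S'.sheaf_pull_Idt[OF Y BO xY[OF B]] S'.ole_refl[OF BO]
      by (intro bexI[of _ B]) simp_all
    then show ?thesis
      using y(2)[OF fnctr_ole[OF le[OF B]] xY[OF B]] pullI[OF le[OF B]] by simp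
  qed
  then show "\<exists>y\<in>val ?F A. \<forall>B\<in>S. pull G ?F A (Idt G B) y = x B"
    using y(1) by (intro bexI[of _ y]) auto
qed

end

section \<open>The inverse image functor\<close>

context flat_site_functor
begin

text \<open>\<open>kan_gen F U\<close> consists of the generators of the left Kan extension of \<open>F\<close> along \<open>M\<close> at \<open>U\<close>.
  Since \<open>M\<close> is covering flat, the local form \<open>kan_eqv\<close> of the identifications in the Kan
  extension needs no zigzags.\<close>

definition kan_gen :: "('o, 'a, 'u) presheaf \<Rightarrow> 'p \<Rightarrow> ('o \<times> 'b \<times> 'u) set" where
  "kan_gen F U = {(A, h, x). A \<in> Obj G \<and> h \<in> hvhom G' U (on_obj M A) \<and> x \<in> val F A}"

definition kan_res :: "'b \<Rightarrow> 'o \<times> 'b \<times> 'u \<Rightarrow> 'o \<times> 'b \<times> 'u" where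
  "kan_res k = (\<lambda>(A, h, x). (A, hvcmp G' h k, x))"

definition kan_eqv :: "('o, 'a, 'u) presheaf \<Rightarrow> 'p \<Rightarrow> 'o \<times> 'b \<times> 'u \<Rightarrow> 'o \<times> 'b \<times> 'u \<Rightarrow> bool" where
  "kan_eqv F U = (\<lambda>(A, h, x) (A', h', x'). locally T' U (\<lambda>U'. \<exists>V t t' k.
     t \<in> hvhom G V A \<and> t' \<in> hvhom G V A' \<and> k \<in> hvhom G' U' (on_obj M V) \<and>
     hvcmp G' (on_arr M t) k = hvcmp G' h (Idt G' U') \<and>
     hvcmp G' (on_arr M t') k = hvcmp G' h' (Idt G' U') \<and>
     pull G F A t x = pull G F A' t' x'))"

text \<open>The two witnessing spans both have a leg into \<open>A'\<close> that represents
  \<open>h'\<close>, so \<open>flat_square\<close> completes them over \<open>A'\<close> to a single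
  span.\<close>

lemma kan_eqv_trans:
  assumes F: "is_presheaf G F" and U: "U \<in> Obj G'"
    and g: "(A, h, x) \<in> kan_gen F U" "(A', h', x') \<in> kan_gen F U" "(A'', h'', x'') \<in> kan_gen F U"
    and e: "kan_eqv F U (A, h, x) (A', h', x')" "kan_eqv F U (A', h', x') (A'', h'', x'')"
  shows "kan_eqv F U (A, h, x) (A'', h'', x'')"
  unfolding kan_eqv_def prod.case
proof (rule S'.locally_bind[OF U S'.locally_conj[OF U e[unfolded kan_eqv_def prod.case]]])
  have h: "h \<in> hvhom G' U (on_obj M A)" "h' \<in> hvhom G' U (on_obj M A')" "h'' \<in> hvhom G' U (on_obj M A'')"
    and x: "x \<in> val F A" "x' \<in> val F A'" "x'' \<in> val F A''"
    using g by (auto simp: kan_gen_def)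
  fix U' assume U': "ole G' U' U"
    and "(\<exists>V t t' k. t \<in> hvhom G V A \<and> t' \<in> hvhom G V A' \<and> k \<in> hvhom G' U' (on_obj M V) \<and>
        hvcmp G' (on_arr M t) k = hvcmp G' h (Idt G' U') \<and>
        hvcmp G' (on_arr M t') k = hvcmp G' h' (Idt G' U') \<and> pull G F A t x = pull G F A' t' x') \<and>
      (\<exists>V t t' k. t \<in> hvhom G V A' \<and> t' \<in> hvhom G V A'' \<and> k \<in> hvhom G' U' (on_obj M V) \<and>
        hvcmp G' (on_arr M t) k = hvcmp G' h' (Idt G' U') \<and>
        hvcmp G' (on_arr M t') k = hvcmp G' h'' (Idt G' U') \<and> pull G F A' t x' = pull G F A'' t' x'')"
  then obtain V1 t1 t1' k1 V2 t2 t2' k2 where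
    1: "t1 \<in> hvhom G V1 A" "t1' \<in> hvhom G V1 A'" "k1 \<in> hvhom G' U' (on_obj M V1)"
      "hvcmp G' (on_arr M t1) k1 = hvcmp G' h (Idt G' U')"
      "hvcmp G' (on_arr M t1') k1 = hvcmp G' h' (Idt G' U')" "pull G F A t1 x = pull G F A' t1' x'" and
    2: "t2 \<in> hvhom G V2 A'" "t2' \<in> hvhom G V2 A''" "k2 \<in> hvhom G' U' (on_obj M V2)"
      "hvcmp G' (on_arr M t2) k2 = hvcmp G' h' (Idt G' U')"
      "hvcmp G' (on_arr M t2') k2 = hvcmp G' h'' (Idt G' U')" "pull G F A' t2 x' = pull G F A'' t2' x''"
    by blast
  have U'O: "U' \<in> Obj G'" using S'.ole_Obj[OF U'] by simp
  have "hvcmp G' (on_arr M t1') k1 = hvcmp G' (on_arr M t2) k2" using 1 2 by simp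
  from flat_square[OF 1(3) 2(3) 1(2) 2(1) this]
  show "locally T' U' (\<lambda>U'. \<exists>V t t' k. t \<in> hvhom G V A \<and> t' \<in> hvhom G V A'' \<and>
      k \<in> hvhom G' U' (on_obj M V) \<and> hvcmp G' (on_arr M t) k = hvcmp G' h (Idt G' U') \<and>
      hvcmp G' (on_arr M t') k = hvcmp G' h'' (Idt G' U') \<and> pull G F A t x = pull G F A'' t' x'')"
  proof (rule S'.locally_mono[OF U'O])
    fix U'' assume U'': "ole G' U'' U'"
      and "\<exists>V s1 s2 k. s1 \<in> hvhom G V V1 \<and> s2 \<in> hvhom G V V2 \<and>
      k \<in> hvhom G' U'' (on_obj M V) \<and> hvcmp G' (on_arr M s1) k = hvcmp G' k1 (Idt G' U'') \<and>
      hvcmp G' (on_arr M s2) k = hvcmp G' k2 (Idt G' U'') \<and> hvcmp G t1' s1 = hvcmp G t2 s2"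
    then obtain V s1 s2 k where s: "s1 \<in> hvhom G V V1" "s2 \<in> hvhom G V V2"
      "k \<in> hvhom G' U'' (on_obj M V)" "hvcmp G' (on_arr M s1) k = hvcmp G' k1 (Idt G' U'')"
      "hvcmp G' (on_arr M s2) k = hvcmp G' k2 (Idt G' U'')" "hvcmp G t1' s1 = hvcmp G t2 s2" by blast
    have "pull G F A (hvcmp G t1 s1) x = pull G F A'' (hvcmp G t2' s2) x''"
      using S.pull_pull[OF F x(1) 1(1) s(1)] S.pull_pull[OF F x(2) 1(2) s(1)]
        S.pull_pull[OF F x(2) 2(1) s(2)] S.pull_pull[OF F x(3) 2(2) s(2)] 1(6) 2(6) s(6) by simp
    then show "\<exists>V t t' k. t \<in> hvhom G V A \<and> t' \<in> hvhom G V A'' \<and>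
      k \<in> hvhom G' U'' (on_obj M V) \<and> hvcmp G' (on_arr M t) k = hvcmp G' h (Idt G' U'') \<and>
      hvcmp G' (on_arr M t') k = hvcmp G' h'' (Idt G' U'') \<and> pull G F A t x = pull G F A'' t' x''"
      using S.hvcmp_hvhom[OF s(1) 1(1)] S.hvcmp_hvhom[OF s(2) 2(2)] s(3)
        refine_lift[OF 1(1,3,4) s(1,3,4) h(1) U' U''] refine_lift[OF 2(2,3,5) s(2,3,5) h(3) U' U'']
      by blast
  qed
qed

lemma kan_congruence:
  assumes F: "is_presheaf G F"
  shows "local_congruence G' T' (kan_gen F) kan_res (kan_eqv F)"
proof
  show "kan_res k g \<in> kan_gen F B" if "k \<in> hvhom G' B A" "g \<in> kan_gen F A" for k B A g
    using that S'.hvcmp_hvhom[OF that(1)] by (auto simp: kan_gen_def kan_res_def)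
  show "kan_res (Idt G' A) g = g" if "g \<in> kan_gen F A" for A g
    using that S'.hvcmp_Idt by (auto simp: kan_gen_def kan_res_def)
  show "kan_res k (kan_res h g) = kan_res (hvcmp G' h k) g"
    if "h \<in> hvhom G' B A" "k \<in> hvhom G' D B" "g \<in> kan_gen F A" for h k g A B D
    using that S'.hvcmp_assoc[OF that(2,1)] by (auto simp: kan_gen_def kan_res_def)
  show "kan_eqv F U g g" if U: "U \<in> Obj G'" and g: "g \<in> kan_gen F U" for U g
  proof -
    obtain A h x where [simp]: "g = (A, h, x)" by (cases g)
    have A: "A \<in> Obj G" and h: "h \<in> hvhom G' U (on_obj M A)" using g by (auto simp: kan_gen_def)
    show ?thesis
      unfolding kan_eqv_def \<open>g = _\<close> prod.case
    proof (rule S'.locally_all[OF U])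
      fix U' assume U': "ole G' U' U"
      note k = S'.hvcmp_hvhom[OF S'.Idt_hvhom[OF U'] h]
      have "hvcmp G' (on_arr M (Idt G A)) (hvcmp G' h (Idt G' U')) = hvcmp G' h (Idt G' U')"
        using S'.Idt_hvcmp[OF k] fnctr_Idt[OF A] by simp
      then show "\<exists>V t t' k. t \<in> hvhom G V A \<and> t' \<in> hvhom G V A \<and> k \<in> hvhom G' U' (on_obj M V) \<and>
          hvcmp G' (on_arr M t) k = hvcmp G' h (Idt G' U') \<and>
          hvcmp G' (on_arr M t') k = hvcmp G' h (Idt G' U') \<and> pull G F A t x = pull G F A t' x"
        using S.Idt_hvhom[OF S.ole_refl[OF A]] k by blast
    qed
  qed
  show "kan_eqv F U g' g" if U: "U \<in> Obj G'" and e: "kan_eqv F U g g'" for U g g'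
  proof -
    obtain A h x A' h' x' where g: "g = (A, h, x)" "g' = (A', h', x')" by (cases g; cases g')
    show ?thesis
      unfolding kan_eqv_def g prod.case
    proof (rule S'.locally_mono[OF U e[unfolded kan_eqv_def g prod.case]])
      fix U' assume "\<exists>V t t' k. t \<in> hvhom G V A \<and> t' \<in> hvhom G V A' \<and> k \<in> hvhom G' U' (on_obj M V) \<and>
        hvcmp G' (on_arr M t) k = hvcmp G' h (Idt G' U') \<and>
        hvcmp G' (on_arr M t') k = hvcmp G' h' (Idt G' U') \<and> pull G F A t x = pull G F A' t' x'"
      then show "\<exists>V t t' k. t \<in> hvhom G V A' \<and> t' \<in> hvhom G V A \<and> k \<in> hvhom G' U' (on_obj M V) \<and>
        hvcmp G' (on_arr M t) k = hvcmp G' h' (Idt G' U') \<and>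
        hvcmp G' (on_arr M t') k = hvcmp G' h (Idt G' U') \<and> pull G F A' t x' = pull G F A t' x"
        by metis
    qed
  qed
  show "kan_eqv F U g g''" if "U \<in> Obj G'" "g \<in> kan_gen F U" "g' \<in> kan_gen F U" "g'' \<in> kan_gen F U"
    "kan_eqv F U g g'" "kan_eqv F U g' g''" for U g g' g''
    using that by (cases g; cases g'; cases g'') (blast intro: kan_eqv_trans[OF F])
  show "kan_eqv F B (kan_res l g) (kan_res l g')"
    if l: "l \<in> hvhom G' B U" and g0: "g \<in> kan_gen F U" "g' \<in> kan_gen F U" and e: "kan_eqv F U g g'"
    for l B U g g'
  proof -
    obtain A h x A' h' x' where g: "g = (A, h, x)" "g' = (A', h', x')" by (cases g; cases g')
    have h: "h \<in> hvhom G' U (on_obj M A)" "h' \<in> hvhom G' U (on_obj M A')"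
      using g0 g by (auto simp: kan_gen_def)
    show ?thesis
      unfolding kan_eqv_def kan_res_def g prod.case
    proof (rule S'.locally_pullI[OF e[unfolded kan_eqv_def g prod.case] l])
      fix B' E l' assume B': "ole G' B' B" and l'_def: "l' = hvcmp G' l (Idt G' B')"
        and l': "l' \<in> hvhom G' B' E" "hvcmp G' (Idt G' E) l' = l'" and E: "ole G' E U"
        and "\<exists>V t t' k. t \<in> hvhom G V A \<and> t' \<in> hvhom G V A' \<and> k \<in> hvhom G' E (on_obj M V) \<and>
          hvcmp G' (on_arr M t) k = hvcmp G' h (Idt G' E) \<and>
          hvcmp G' (on_arr M t') k = hvcmp G' h' (Idt G' E) \<and> pull G F A t x = pull G F A' t' x'"
      then obtain V t t' k where t: "t \<in> hvhom G V A" "t' \<in> hvhom G V A'" and k: "k \<in> hvhom G' E (on_obj M V)"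
        and eq: "hvcmp G' (on_arr M t) k = hvcmp G' h (Idt G' E)"
          "hvcmp G' (on_arr M t') k = hvcmp G' h' (Idt G' E)" "pull G F A t x = pull G F A' t' x'"
        by blast
      have "hvcmp G' (on_arr M s) (hvcmp G' k l') = hvcmp G' (hvcmp G' j l) (Idt G' B')"
        if "s \<in> hvhom G V X" "j \<in> hvhom G' U (on_obj M X)"
          "hvcmp G' (on_arr M s) k = hvcmp G' j (Idt G' E)" for s j X
        using S'.hvcmp_assoc[OF l'(1) k fnctr_hvhom[OF that(1)]] that(3)
          S'.hvcmp_assoc[OF l'(1) S'.Idt_hvhom[OF E] that(2)] l'(2) S'.hvcmp_move[OF that(2) l B']
        by (simp add: l'_def)
      then show "\<exists>V t t' k. t \<in> hvhom G V A \<and> t' \<in> hvhom G V A' \<and> k \<in> hvhom G' B' (on_obj M V) \<and>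
        hvcmp G' (on_arr M t) k = hvcmp G' (hvcmp G' h l) (Idt G' B') \<and>
        hvcmp G' (on_arr M t') k = hvcmp G' (hvcmp G' h' l) (Idt G' B') \<and>
        pull G F A t x = pull G F A' t' x'"
        using t eq h S'.hvcmp_hvhom[OF l'(1) k] by blast
    qed
  qed
  show "kan_eqv F U g g'"
    if U: "U \<in> Obj G'" and g0: "g \<in> kan_gen F U" "g' \<in> kan_gen F U"
      and l: "locally T' U (\<lambda>B. kan_eqv F B (kan_res (Idt G' B) g) (kan_res (Idt G' B) g'))" for U g g'
  proof -
    obtain A h x A' h' x' where g: "g = (A, h, x)" "g' = (A', h', x')" by (cases g; cases g')
    have h: "h \<in> hvhom G' U (on_obj M A)" "h' \<in> hvhom G' U (on_obj M A')"
      using g0 g by (auto simp: kan_gen_def)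
    show ?thesis
      unfolding kan_eqv_def g prod.case
    proof (rule S'.locally_bind[OF U l[unfolded kan_eqv_def kan_res_def g prod.case]])
      fix B assume B: "ole G' B U"
        and l': "locally T' B (\<lambda>U'. \<exists>V t t' k. t \<in> hvhom G V A \<and> t' \<in> hvhom G V A' \<and>
          k \<in> hvhom G' U' (on_obj M V) \<and>
          hvcmp G' (on_arr M t) k = hvcmp G' (hvcmp G' h (Idt G' B)) (Idt G' U') \<and>
          hvcmp G' (on_arr M t') k = hvcmp G' (hvcmp G' h' (Idt G' B)) (Idt G' U') \<and>
          pull G F A t x = pull G F A' t' x')"
      have BO: "B \<in> Obj G'" using S'.ole_Obj[OF B] by simp
      show "locally T' B (\<lambda>U'. \<exists>V t t' k. t \<in> hvhom G V A \<and> t' \<in> hvhom G V A' \<and>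
          k \<in> hvhom G' U' (on_obj M V) \<and> hvcmp G' (on_arr M t) k = hvcmp G' h (Idt G' U') \<and>
          hvcmp G' (on_arr M t') k = hvcmp G' h' (Idt G' U') \<and> pull G F A t x = pull G F A' t' x')"
        using S'.hvcmp_Idt_Idt[OF h(1) B] S'.hvcmp_Idt_Idt[OF h(2) B]
        by (intro S'.locally_mono[OF BO l']) simp
    qed
  qed
qed

text \<open>The inverse image described through its unit \<open>\<eta>\<close>: a generator
  \<open>(A, h, x)\<close> becomes the pullback of \<open>\<eta> A x\<close> along \<open>h\<close>.
  The kernel clause states the direction that is not automatic; the other follows from naturality of
  \<open>\<eta>\<close> and separatedness.\<close>

definition kan_sheaf ::
  "('o, 'a, 'u) presheaf \<Rightarrow> ('p, 'b, 'u) presheaf \<Rightarrow> ('o \<Rightarrow> 'u \<Rightarrow> 'u) \<Rightarrow> bool" where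
  "kan_sheaf F N \<eta> \<longleftrightarrow> is_sheaf G' T' N \<and>
     (\<forall>A x. A \<in> Obj G \<longrightarrow> x \<in> val F A \<longrightarrow> \<eta> A x \<in> val N (on_obj M A)) \<and>
     (\<forall>A B t x. t \<in> hvhom G B A \<longrightarrow> x \<in> val F A \<longrightarrow>
        pull G' N (on_obj M A) (on_arr M t) (\<eta> A x) = \<eta> B (pull G F A t x)) \<and>
     (\<forall>U z. U \<in> Obj G' \<longrightarrow> z \<in> val N U \<longrightarrow> locally T' U (\<lambda>U'. \<exists>A h x. A \<in> Obj G \<and>
        h \<in> hvhom G' U' (on_obj M A) \<and> x \<in> val F A \<and>
        pull G' N U (Idt G' U') z = pull G' N (on_obj M A) h (\<eta> A x))) \<and>
     (\<forall>U A A' h h' x x'. (A, h, x) \<in> kan_gen F U \<longrightarrow> (A', h', x') \<in> kan_gen F U \<longrightarrow>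
        pull G' N (on_obj M A) h (\<eta> A x) = pull G' N (on_obj M A') h' (\<eta> A' x') \<longrightarrow>
        kan_eqv F U (A, h, x) (A', h', x'))"

lemma kan_sheafD:
  assumes "kan_sheaf F N \<eta>"
  shows "is_sheaf G' T' N"
    and "A \<in> Obj G \<Longrightarrow> x \<in> val F A \<Longrightarrow> \<eta> A x \<in> val N (on_obj M A)"
    and "t \<in> hvhom G B A \<Longrightarrow> x \<in> val F A \<Longrightarrow>
      pull G' N (on_obj M A) (on_arr M t) (\<eta> A x) = \<eta> B (pull G F A t x)"
    and "U \<in> Obj G' \<Longrightarrow> z \<in> val N U \<Longrightarrow> locally T' U (\<lambda>U'. \<exists>A h x. A \<in> Obj G \<and>
        h \<in> hvhom G' U' (on_obj M A) \<and> x \<in> val F A \<and>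
        pull G' N U (Idt G' U') z = pull G' N (on_obj M A) h (\<eta> A x))"
    and "(A, h, x) \<in> kan_gen F U \<Longrightarrow> (A', h', x') \<in> kan_gen F U \<Longrightarrow>
        pull G' N (on_obj M A) h (\<eta> A x) = pull G' N (on_obj M A') h' (\<eta> A' x') \<Longrightarrow>
        kan_eqv F U (A, h, x) (A', h', x')"
  using assms unfolding kan_sheaf_def by blast+

lemma kan_sheaf_exists:
  fixes F :: "('o, 'a, 'u) presheaf"
  assumes F: "is_presheaf G F" and small: "small_groupoid TYPE('u) G" "small_groupoid TYPE('u) G'"
  shows "\<exists>N \<eta>. kan_sheaf F N \<eta>"
proof -
  interpret local_congruence G' T' "kan_gen F" kan_res "kan_eqv F"
    by (rule kan_congruence[OF F])
  have inf: "infinite (UNIV :: 'u set)" using small by (simp add: small_groupoid_def)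
  have "(\<Union>U\<in>Obj G'. kan_gen F U) \<subseteq> Obj G \<times> Arr G' \<times> (UNIV :: 'u set)"
    by (auto simp: kan_gen_def hvhom_def)
  moreover have "Obj G \<lesssim> (UNIV :: 'u set)"
    using S.Obj_lepoll_Arr small_groupoid_Arr(1)[OF small(1)] by (rule lepoll_trans)
  then have "Obj G \<times> Arr G' \<times> (UNIV :: 'u set) \<lesssim> (UNIV :: 'u set)"
    by (intro infinite_times_lepoll[OF inf] small_groupoid_Arr(1)[OF small(2)] lepoll_refl)
  ultimately have size: "(\<Union>U\<in>Obj G'. kan_gen F U) \<lesssim> (UNIV :: 'u set)"
    using subset_imp_lepoll lepoll_trans by blast
  obtain N :: "('p, 'b, 'u) presheaf" and \<iota> where "is_sheafification N \<iota>"
    using sheafification[OF small(2) size] by blast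
  note N = is_sheafificationD[OF this]
  \<comment> \<open>The class of the generator with identity leg; every other generator is a
    pullback of one of these.\<close>
  define \<eta> where "\<eta> A x = \<iota> (on_obj M A) (A, Idt G' (on_obj M A), x)" for A x
  have gen: "(A, Idt G' (on_obj M A), x) \<in> kan_gen F (on_obj M A)" if "A \<in> Obj G" "x \<in> val F A" for A x
    using that S'.Idt_hvhom[OF S'.ole_refl[OF fnctr_obj[OF that(1)]]] by (simp add: kan_gen_def)
  have pull_\<eta>: "pull G' N (on_obj M A) h (\<eta> A x) = \<iota> U (A, h, x)"
    if "A \<in> Obj G" "h \<in> hvhom G' U (on_obj M A)" "x \<in> val F A" for A h x U
    using N(3)[OF that(2) gen[OF that(1,3)]] S'.Idt_hvcmp[OF that(2)] by (simp add: \<eta>_def kan_res_def)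
  have "kan_sheaf F N \<eta>"
    unfolding kan_sheaf_def
  proof (intro conjI allI impI N(1))
    show "\<eta> A x \<in> val N (on_obj M A)" if "A \<in> Obj G" "x \<in> val F A" for A x
      using N(2)[OF fnctr_obj[OF that(1)] gen[OF that]] by (simp add: \<eta>_def)
    show "pull G' N (on_obj M A) (on_arr M t) (\<eta> A x) = \<eta> B (pull G F A t x)"
      if t: "t \<in> hvhom G B A" and x: "x \<in> val F A" for A B t x
    proof -
      have O: "A \<in> Obj G" "B \<in> Obj G" using S.hvhom_Obj[OF t] by auto
      note MB = fnctr_obj[OF O(2)]
      have tx: "pull G F A t x \<in> val F B" using S.pull_in[OF F x t] .
      have "kan_eqv F (on_obj M B) (A, on_arr M t, x) (B, Idt G' (on_obj M B), pull G F A t x)"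
        unfolding kan_eqv_def prod.case
      proof (rule S'.locally_all[OF MB])
        fix U' assume U': "ole G' U' (on_obj M B)"
        have "hvcmp G' (on_arr M (Idt G B)) (Idt G' U') = hvcmp G' (Idt G' (on_obj M B)) (Idt G' U')"
          using fnctr_Idt[OF O(2)] by simp
        moreover have "pull G F A t x = pull G F B (Idt G B) (pull G F A t x)"
          using S.pull_Idt[OF F O(2) tx] by simp
        ultimately show "\<exists>V s s' k. s \<in> hvhom G V A \<and> s' \<in> hvhom G V B \<and> k \<in> hvhom G' U' (on_obj M V) \<and>
          hvcmp G' (on_arr M s) k = hvcmp G' (on_arr M t) (Idt G' U') \<and>
          hvcmp G' (on_arr M s') k = hvcmp G' (Idt G' (on_obj M B)) (Idt G' U') \<and>
          pull G F A s x = pull G F B s' (pull G F A t x)"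
          using t S.Idt_hvhom[OF S.ole_refl[OF O(2)]] S'.Idt_hvhom[OF U'] by blast
      qed
      then have "\<iota> (on_obj M B) (A, on_arr M t, x) = \<iota> (on_obj M B) (B, Idt G' (on_obj M B), pull G F A t x)"
        using N(5)[OF MB] gen[OF O(2) tx] O(1) fnctr_hvhom[OF t] x by (simp add: kan_gen_def)
      then show ?thesis
        using pull_\<eta>[OF O(1) fnctr_hvhom[OF t] x] by (simp add: \<eta>_def)
    qed
    show "locally T' U (\<lambda>U'. \<exists>A h x. A \<in> Obj G \<and> h \<in> hvhom G' U' (on_obj M A) \<and> x \<in> val F A \<and>
        pull G' N U (Idt G' U') z = pull G' N (on_obj M A) h (\<eta> A x))"
      if U: "U \<in> Obj G'" and z: "z \<in> val N U" for U z
    proof (rule S'.locally_mono[OF U N(4)[OF U z]])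
      fix B assume "\<exists>g\<in>kan_gen F B. pull G' N U (Idt G' B) z = \<iota> B g"
      then obtain A h x where "A \<in> Obj G" "h \<in> hvhom G' B (on_obj M A)" "x \<in> val F A"
        "pull G' N U (Idt G' B) z = \<iota> B (A, h, x)" by (auto simp: kan_gen_def)
      then show "\<exists>A h x. A \<in> Obj G \<and> h \<in> hvhom G' B (on_obj M A) \<and> x \<in> val F A \<and>
          pull G' N U (Idt G' B) z = pull G' N (on_obj M A) h (\<eta> A x)"
        using pull_\<eta> by metis
    qed
    show "kan_eqv F U (A, h, x) (A', h', x')"
      if g: "(A, h, x) \<in> kan_gen F U" "(A', h', x') \<in> kan_gen F U"
        and e: "pull G' N (on_obj M A) h (\<eta> A x) = pull G' N (on_obj M A') h' (\<eta> A' x')"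
      for U A A' h h' x x'
    proof -
      have U: "U \<in> Obj G'" using g(1) S'.hvhom_Obj by (auto simp: kan_gen_def)
      have "\<iota> U (A, h, x) = \<iota> U (A', h', x')"
        using e g pull_\<eta>[of A h U x] pull_\<eta>[of A' h' U x'] by (simp add: kan_gen_def)
      then show ?thesis using N(5)[OF U g] by simp
    qed
  qed
  then show ?thesis by blast
qed

text \<open>Values are prescribed on the image of \<open>\<eta>\<close> only; pulling back extends
  them to all generators, and naturality of \<open>c\<close> along the legs of a witnessing span
  shows that congruent generators get equal values.\<close>

lemma kan_sheaf_mor_ex:
  assumes k: "kan_sheaf F N \<eta>" and F: "is_presheaf G F" and Y: "is_sheaf G' T' Y"
    and c: "\<And>A x. A \<in> Obj G \<Longrightarrow> x \<in> val F A \<Longrightarrow> c A x \<in> val Y (on_obj M A)"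
    and n: "\<And>A B t x. t \<in> hvhom G B A \<Longrightarrow> x \<in> val F A \<Longrightarrow>
      pull G' Y (on_obj M A) (on_arr M t) (c A x) = c B (pull G F A t x)"
  shows "\<exists>m\<in>hom (Sh G' T') N Y. \<forall>A\<in>Obj G. \<forall>x\<in>val F A. cmpt m (on_obj M A) (\<eta> A x) = c A x"
proof -
  interpret local_congruence G' T' "kan_gen F" kan_res "kan_eqv F"
    by (rule kan_congruence[OF F])
  note K = kan_sheafD[OF k]
  define \<iota> where "\<iota> U = (\<lambda>(A, h, x). pull G' N (on_obj M A) h (\<eta> A x))" for U :: 'p
  define d where "d U = (\<lambda>(A, h, x). pull G' Y (on_obj M A) h (c A x))" for U :: 'p
  have "\<exists>m\<in>hom (Sh G' T') N Y. \<forall>U\<in>Obj G'. \<forall>g\<in>kan_gen F U. cmpt m U (\<iota> U g) = d U g"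
  proof (rule S'.extend_along_generators[OF K(1) Y, where r = kan_res])
    fix U g assume U: "U \<in> Obj G'" and g: "g \<in> kan_gen F U"
    then show "\<iota> U g \<in> val N U" "d U g \<in> val Y U"
      using S'.sheaf_pull_in[OF K(1) K(2)] S'.sheaf_pull_in[OF Y c] by (auto simp: kan_gen_def \<iota>_def d_def)
    fix g' assume g': "g' \<in> kan_gen F U" and e: "\<iota> U g = \<iota> U g'"
    obtain A h x A' h' x' where gg: "g = (A, h, x)" "g' = (A', h', x')" by (cases g; cases g')
    have h: "h \<in> hvhom G' U (on_obj M A)" "h' \<in> hvhom G' U (on_obj M A')" and x: "x \<in> val F A" "x' \<in> val F A'"
      and O: "A \<in> Obj G" "A' \<in> Obj G"
      using g g' gg by (auto simp: kan_gen_def)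
    have "kan_eqv F U (A, h, x) (A', h', x')"
      using K(5) g g' e gg by (simp add: \<iota>_def)
    then have l: "locally T' U (\<lambda>U'. \<exists>V t t' k.
     t \<in> hvhom G V A \<and> t' \<in> hvhom G V A' \<and> k \<in> hvhom G' U' (on_obj M V) \<and>
     hvcmp G' (on_arr M t) k = hvcmp G' h (Idt G' U') \<and>
     hvcmp G' (on_arr M t') k = hvcmp G' h' (Idt G' U') \<and>
     pull G F A t x = pull G F A' t' x')" unfolding kan_eqv_def prod.case .
    have "pull G' Y (on_obj M A) h (c A x) = pull G' Y (on_obj M A') h' (c A' x')"
    proof (rule S'.sheaf_separated[OF Y U S'.sheaf_pull_in[OF Y c[OF O(1) x(1)] h(1)]
          S'.sheaf_pull_in[OF Y c[OF O(2) x(2)] h(2)] S'.locally_mono[OF U l]])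
      fix U' assume U': "ole G' U' U" and "\<exists>V t t' k.
         t \<in> hvhom G V A \<and> t' \<in> hvhom G V A' \<and> k \<in> hvhom G' U' (on_obj M V) \<and>
         hvcmp G' (on_arr M t) k = hvcmp G' h (Idt G' U') \<and>
         hvcmp G' (on_arr M t') k = hvcmp G' h' (Idt G' U') \<and>
         pull G F A t x = pull G F A' t' x'"
      then obtain V t t' k where t: "t \<in> hvhom G V A" "t' \<in> hvhom G V A'" "k \<in> hvhom G' U' (on_obj M V)"
        "hvcmp G' (on_arr M t) k = hvcmp G' h (Idt G' U')"
        "hvcmp G' (on_arr M t') k = hvcmp G' h' (Idt G' U')" "pull G F A t x = pull G F A' t' x'" by blast
      have "pull G' Y U (Idt G' U') (pull G' Y (on_obj M A) h (c A x)) = pull G' Y (on_obj M V) k (c V (pull G F A t x))"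
        using S'.sheaf_pull_pull[OF Y c[OF O(1) x(1)] h(1) S'.Idt_hvhom[OF U']] t(4)
          S'.sheaf_pull_pull[OF Y c[OF O(1) x(1)] fnctr_hvhom[OF t(1)] t(3)] n[OF t(1) x(1)] by simp
      moreover have "pull G' Y U (Idt G' U') (pull G' Y (on_obj M A') h' (c A' x')) =
          pull G' Y (on_obj M V) k (c V (pull G F A' t' x'))"
        using S'.sheaf_pull_pull[OF Y c[OF O(2) x(2)] h(2) S'.Idt_hvhom[OF U']] t(5)
          S'.sheaf_pull_pull[OF Y c[OF O(2) x(2)] fnctr_hvhom[OF t(2)] t(3)] n[OF t(2) x(2)] by simp
      ultimately show "pull G' Y U (Idt G' U') (pull G' Y (on_obj M A) h (c A x)) =
          pull G' Y U (Idt G' U') (pull G' Y (on_obj M A') h' (c A' x'))"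
        using t(6) by simp
    qed
    then show "d U g = d U g'" by (simp add: gg d_def)
  next
    fix U B k g assume kk: "k \<in> hvhom G' B U" and g: "g \<in> kan_gen F U"
    obtain A h x where gg: "g = (A, h, x)" by (cases g)
    have h: "h \<in> hvhom G' U (on_obj M A)" and x: "x \<in> val F A" and A: "A \<in> Obj G"
      using g gg by (auto simp: kan_gen_def)
    show "kan_res k g \<in> kan_gen F B \<and> pull G' N U k (\<iota> U g) = \<iota> B (kan_res k g)"
      using r_in[OF kk g] S'.sheaf_pull_pull[OF K(1) K(2)[OF A x] h kk] by (simp add: gg \<iota>_def kan_res_def)
    show "pull G' Y U k (d U g) = d B (kan_res k g)"
      using S'.sheaf_pull_pull[OF Y c[OF A x] h kk] by (simp add: gg d_def kan_res_def)
  next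
    fix U z assume U: "U \<in> Obj G'" and z: "z \<in> val N U"
    show "locally T' U (\<lambda>B. \<exists>g\<in>kan_gen F B. pull G' N U (Idt G' B) z = \<iota> B g)"
    proof (rule S'.locally_mono[OF U K(4)[OF U z]])
      fix B assume "\<exists>A h x. A \<in> Obj G \<and> h \<in> hvhom G' B (on_obj M A) \<and> x \<in> val F A \<and>
        pull G' N U (Idt G' B) z = pull G' N (on_obj M A) h (\<eta> A x)"
      then obtain A h x where "A \<in> Obj G" "h \<in> hvhom G' B (on_obj M A)" "x \<in> val F A"
        "pull G' N U (Idt G' B) z = pull G' N (on_obj M A) h (\<eta> A x)" by blast
      then show "\<exists>g\<in>kan_gen F B. pull G' N U (Idt G' B) z = \<iota> B g"
        by (intro bexI[of _ "(A, h, x)"]) (auto simp: \<iota>_def kan_gen_def)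
    qed
  qed
  then obtain m where m: "m \<in> hom (Sh G' T') N Y"
    "\<And>U g. U \<in> Obj G' \<Longrightarrow> g \<in> kan_gen F U \<Longrightarrow> cmpt m U (\<iota> U g) = d U g" by blast
  have "cmpt m (on_obj M A) (\<eta> A x) = c A x" if A: "A \<in> Obj G" and x: "x \<in> val F A" for A x
  proof -
    note MA = fnctr_obj[OF A]
    have "(A, Idt G' (on_obj M A), x) \<in> kan_gen F (on_obj M A)"
      using A x S'.Idt_hvhom[OF S'.ole_refl[OF MA]] by (simp add: kan_gen_def)
    from m(2)[OF MA this] show ?thesis
      using S'.sheaf_pull_Idt[OF K(1) MA K(2)[OF A x]] S'.sheaf_pull_Idt[OF Y MA c[OF A x]]
      by (simp add: \<iota>_def d_def)
  qed
  then show ?thesis using m(1) by blast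
qed

lemma kan_sheaf_mor_eqI:
  assumes k: "kan_sheaf F N \<eta>" and m: "m \<in> hom (Sh G' T') N Y" "m' \<in> hom (Sh G' T') N Y"
    and eq: "\<And>A x. A \<in> Obj G \<Longrightarrow> x \<in> val F A \<Longrightarrow> cmpt m (on_obj M A) (\<eta> A x) = cmpt m' (on_obj M A) (\<eta> A x)"
  shows "m = m'"
proof (rule S'.Sh_mor_eqI[OF m])
  note K = kan_sheafD[OF k]
  have Y: "is_sheaf G' T' Y" using m by (simp add: Sh_hom)
  fix U z assume U: "U \<in> Obj G'" and z: "z \<in> val N U"
  show "cmpt m U z = cmpt m' U z"
  proof (rule S'.sheaf_separated[OF Y U S'.Sh_mor_in[OF m(1) U z] S'.Sh_mor_in[OF m(2) U z]
        S'.locally_mono[OF U K(4)[OF U z]]])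
    fix B assume B: "ole G' B U" and "\<exists>A h x. A \<in> Obj G \<and> h \<in> hvhom G' B (on_obj M A) \<and> x \<in> val F A \<and>
        pull G' N U (Idt G' B) z = pull G' N (on_obj M A) h (\<eta> A x)"
    then obtain A h x where A: "A \<in> Obj G" and h: "h \<in> hvhom G' B (on_obj M A)" and x: "x \<in> val F A"
      and e: "pull G' N U (Idt G' B) z = pull G' N (on_obj M A) h (\<eta> A x)" by blast
    note i = S'.Idt_hvhom[OF B]
    show "pull G' Y U (Idt G' B) (cmpt m U z) = pull G' Y U (Idt G' B) (cmpt m' U z)"
      using S'.Sh_mor_pull[OF m(1) i z] S'.Sh_mor_pull[OF m(2) i z] e eq[OF A x]
        S'.Sh_mor_pull[OF m(1) h K(2)[OF A x]] S'.Sh_mor_pull[OF m(2) h K(2)[OF A x]] by simp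
  qed
qed

lemma kan_universal:
  fixes F :: "('o, 'a, 'u) presheaf"
  assumes F: "is_sheaf G T F" and k: "kan_sheaf F N \<eta>"
  shows "\<exists>e. universal_arrow (Sh G T) (Sh G' T') (precomp_functor G M) F N e \<and>
    (\<forall>A\<in>Obj G. \<forall>x\<in>val F A. cmpt e A x = \<eta> A x)"
proof -
  note K = kan_sheafD[OF k] and FP = S.sheaf_presheaf[OF F]
  note R = precomp_functor[OF precomp_sheaf]
  interpret R: is_functor "Sh G' T' :: (('p, 'b, 'u) presheaf, ('p, 'b, 'u) presheaf_mor) category"
    "Sh G T" "precomp_functor G M"
    by (rule R)
  have "\<exists>e\<in>hom (Sh G T) F (presheaf_precomp M N). \<forall>A\<in>Obj G. \<forall>x\<in>val F A. cmpt e A x = \<eta> A x"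
    by (rule S.Sh_mor_ex[OF F precomp_sheaf[OF K(1)]]) (simp_all add: K(2,3) precomp_pull)
  then obtain e where e: "e \<in> hom (Sh G T) F (presheaf_precomp M N)"
    "\<And>A x. A \<in> Obj G \<Longrightarrow> x \<in> val F A \<Longrightarrow> cmpt e A x = \<eta> A x" by blast
  have comp: "cmpt (Cmp (Sh G T) (on_arr (precomp_functor G M) m) e) A x = cmpt m (on_obj M A) (\<eta> A x)"
    if "A \<in> Obj G" "x \<in> val F A" for A x m
    using S.Sh_Cmp_apply[OF e(1) that, of "on_arr (precomp_functor G M) m"] e(2)[OF that] that(1) by simp
  have Rm: "on_arr (precomp_functor G M) m \<in> hom (Sh G T) (presheaf_precomp M N) (presheaf_precomp M Y)"
    if "m \<in> hom (Sh G' T') N Y" for m Y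
    using R.fnctr_arr[OF that] by simp
  have "universal_arrow (Sh G T) (Sh G' T') (precomp_functor G M) F N e"
    unfolding universal_arrow_def
  proof (intro conjI ballI)
    show "N \<in> Obj (Sh G' T')" using K(1) by simp
    show "e \<in> hom (Sh G T) F (on_obj (precomp_functor G M) N)" using e(1) by simp
    fix Y :: "('p, 'b, 'u) presheaf" and g
    assume "Y \<in> Obj (Sh G' T')" and "g \<in> hom (Sh G T) F (on_obj (precomp_functor G M) Y)"
    then have Y: "is_sheaf G' T' Y" and g: "g \<in> hom (Sh G T) F (presheaf_precomp M Y)" by simp_all
    have "\<exists>m\<in>hom (Sh G' T') N Y. \<forall>A\<in>Obj G. \<forall>x\<in>val F A. cmpt m (on_obj M A) (\<eta> A x) = cmpt g A x"
    proof (rule kan_sheaf_mor_ex[OF k FP Y])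
      show "cmpt g A x \<in> val Y (on_obj M A)" if "A \<in> Obj G" "x \<in> val F A" for A x
        using S.Sh_mor_in[OF g that] by simp
      show "pull G' Y (on_obj M A) (on_arr M t) (cmpt g A x) = cmpt g B (pull G F A t x)"
        if "t \<in> hvhom G B A" "x \<in> val F A" for A B t x
        using S.Sh_mor_pull[OF g that] precomp_pull[OF that(1), of Y] by simp
    qed
    then obtain m where m: "m \<in> hom (Sh G' T') N Y"
      "\<And>A x. A \<in> Obj G \<Longrightarrow> x \<in> val F A \<Longrightarrow> cmpt m (on_obj M A) (\<eta> A x) = cmpt g A x" by blast
    show "\<exists>!m. m \<in> hom (Sh G' T') N Y \<and> Cmp (Sh G T) (on_arr (precomp_functor G M) m) e = g"
    proof (intro ex1I[of _ m] conjI m(1))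
      show "Cmp (Sh G T) (on_arr (precomp_functor G M) m) e = g"
        by (rule S.Sh_mor_eqI[OF S.Sh_Cmp[OF e(1) Rm[OF m(1)]] g]) (simp add: comp m(2))
      fix m' assume m': "m' \<in> hom (Sh G' T') N Y \<and> Cmp (Sh G T) (on_arr (precomp_functor G M) m') e = g"
      show "m' = m"
        by (rule kan_sheaf_mor_eqI[OF k conjunct1[OF m'] m(1)]) (use comp m' m(2) in metis)
    qed
  qed
  then show ?thesis using e(2) by blast
qed

end

section \<open>Exactness of the inverse image\<close>

context flat_site_functor
begin

lemma kan_pull_lift:
  assumes K: "kan_sheaf F N \<eta>" and y: "y \<in> val F V" and k: "k \<in> hvhom G' U (on_obj M V)" and U': "ole G' U' U"
    and t: "t \<in> hvhom G W V" and l: "l \<in> hvhom G' U' (on_obj M W)"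
    and eq: "hvcmp G' (on_arr M t) l = hvcmp G' k (Idt G' U')"
  shows "pull G' N U (Idt G' U') (pull G' N (on_obj M V) k (\<eta> V y)) =
    pull G' N (on_obj M W) l (\<eta> W (pull G F V t y))"
proof -
  note D = kan_sheafD[OF K]
  have V: "V \<in> Obj G" using S.hvhom_Obj[OF t] by simp
  show ?thesis
    using S'.sheaf_pull_pull[OF D(1) D(2)[OF V y] k S'.Idt_hvhom[OF U']] eq
      S'.sheaf_pull_pull[OF D(1) D(2)[OF V y] fnctr_hvhom[OF t] l] D(3)[OF t y] by simp
qed

text \<open>The congruence gives two arrows \<open>t\<close> and \<open>t'\<close> that need not
  coincide, but both represent \<open>k\<close>; \<open>flat_eq\<close> equalizes them after a
  further refinement.\<close>

lemma kan_kernel_lifts: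
  assumes K: "kan_sheaf F N \<eta>" and F: "is_presheaf G F" and V: "V \<in> Obj G"
    and y: "y \<in> val F V" "y' \<in> val F V" and k: "k \<in> hvhom G' U (on_obj M V)"
    and eq: "pull G' N (on_obj M V) k (\<eta> V y) = pull G' N (on_obj M V) k (\<eta> V y')"
  shows "lifts U V k (\<lambda>W t. pull G F V t y = pull G F V t y')"
proof -
  have U: "U \<in> Obj G'" using S'.hvhom_Obj[OF k] by simp
  have "kan_eqv F U (V, k, y) (V, k, y')"
    using kan_sheafD(5)[OF K _ _ eq] V y k by (simp add: kan_gen_def)
  then have l: "locally T' U (\<lambda>U'. \<exists>W t t' j. t \<in> hvhom G W V \<and> t' \<in> hvhom G W V \<and>
     j \<in> hvhom G' U' (on_obj M W) \<and> hvcmp G' (on_arr M t) j = hvcmp G' k (Idt G' U') \<and>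
     hvcmp G' (on_arr M t') j = hvcmp G' k (Idt G' U') \<and> pull G F V t y = pull G F V t' y')"
    unfolding kan_eqv_def prod.case .
  show ?thesis
    unfolding lifts_def
  proof (rule S'.locally_bind[OF U l])
    fix U' assume U': "ole G' U' U" and "\<exists>W t t' j. t \<in> hvhom G W V \<and> t' \<in> hvhom G W V \<and>
     j \<in> hvhom G' U' (on_obj M W) \<and> hvcmp G' (on_arr M t) j = hvcmp G' k (Idt G' U') \<and>
     hvcmp G' (on_arr M t') j = hvcmp G' k (Idt G' U') \<and> pull G F V t y = pull G F V t' y'"
    then obtain W t t' j where t: "t \<in> hvhom G W V" "t' \<in> hvhom G W V" "j \<in> hvhom G' U' (on_obj M W)"
      "hvcmp G' (on_arr M t) j = hvcmp G' k (Idt G' U')"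
      "hvcmp G' (on_arr M t') j = hvcmp G' k (Idt G' U')" "pull G F V t y = pull G F V t' y'" by blast
    have U'O: "U' \<in> Obj G'" using S'.ole_Obj[OF U'] by simp
    have "hvcmp G' (on_arr M t) j = hvcmp G' (on_arr M t') j" using t by simp
    note l' = flat_eq[OF t(1,2,3) this]
    show "locally T' U' (\<lambda>U'. \<exists>W t j. t \<in> hvhom G W V \<and> j \<in> hvhom G' U' (on_obj M W) \<and>
      hvcmp G' (on_arr M t) j = hvcmp G' k (Idt G' U') \<and> pull G F V t y = pull G F V t y')"
    proof (rule S'.locally_mono[OF U'O l'])
      fix U'' assume U'': "ole G' U'' U'" and "\<exists>W' s i. s \<in> hvhom G W' W \<and> i \<in> hvhom G' U'' (on_obj M W') \<and>
        hvcmp G' (on_arr M s) i = hvcmp G' j (Idt G' U'') \<and> hvcmp G t s = hvcmp G t' s"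
      then obtain W' s i where s: "s \<in> hvhom G W' W" "i \<in> hvhom G' U'' (on_obj M W')"
        "hvcmp G' (on_arr M s) i = hvcmp G' j (Idt G' U'')" "hvcmp G t s = hvcmp G t' s" by blast
      have "pull G F V (hvcmp G t s) y = pull G F V (hvcmp G t s) y'"
        using S.pull_pull[OF F y(1) t(1) s(1)] S.pull_pull[OF F y(2) t(2) s(1)] t(6) s(4) by simp
      then show "\<exists>W t j. t \<in> hvhom G W V \<and> j \<in> hvhom G' U'' (on_obj M W) \<and>
        hvcmp G' (on_arr M t) j = hvcmp G' k (Idt G' U'') \<and> pull G F V t y = pull G F V t y'"
        using S.hvcmp_hvhom[OF s(1) t(1)] s(2) refine_lift[OF t(1,3,4) s(1-3) k U' U''] by blast
    qed
  qed
qed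

text \<open>Each \<open>z i\<close> is locally a generator over its own \<open>A i\<close>; since
  \<open>X\<close> is finite, one cover serves all of them, and \<open>flat_family\<close> pulls the
  generators back to a common \<open>V\<close>.\<close>

lemma kan_common_stage:
  fixes X :: "nat set"
  assumes X: "finite X" and U: "U \<in> Obj G'" and K: "\<And>i. i \<in> X \<Longrightarrow> kan_sheaf (F i) (N i) (\<eta> i)"
    and F: "\<And>i. i \<in> X \<Longrightarrow> is_presheaf G (F i)" and z: "\<And>i. i \<in> X \<Longrightarrow> z i \<in> val (N i) U"
  shows "locally T' U (\<lambda>U'. \<exists>V k y. V \<in> Obj G \<and> k \<in> hvhom G' U' (on_obj M V) \<and>
    (\<forall>i\<in>X. y i \<in> val (F i) V \<and>
       pull G' (N i) U (Idt G' U') (z i) = pull G' (N i) (on_obj M V) k (\<eta> i V (y i))))"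
proof -
  have "locally T' U (\<lambda>U'. \<forall>i\<in>X. \<exists>A h x. A \<in> Obj G \<and> h \<in> hvhom G' U' (on_obj M A) \<and> x \<in> val (F i) A \<and>
      pull G' (N i) U (Idt G' U') (z i) = pull G' (N i) (on_obj M A) h (\<eta> i A x))"
    by (rule S'.locally_finite_ball[OF U X]) (rule kan_sheafD(4)[OF K U z])
  then show ?thesis
  proof (rule S'.locally_bind[OF U])
    fix U1 assume U1: "ole G' U1 U"
      and "\<forall>i\<in>X. \<exists>A h x. A \<in> Obj G \<and> h \<in> hvhom G' U1 (on_obj M A) \<and> x \<in> val (F i) A \<and>
        pull G' (N i) U (Idt G' U1) (z i) = pull G' (N i) (on_obj M A) h (\<eta> i A x)"
    then obtain A h x where A: "\<And>i. i \<in> X \<Longrightarrow> A i \<in> Obj G" and h: "\<And>i. i \<in> X \<Longrightarrow> h i \<in> hvhom G' U1 (on_obj M (A i))"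
      and x: "\<And>i. i \<in> X \<Longrightarrow> x i \<in> val (F i) (A i)"
      and e: "\<And>i. i \<in> X \<Longrightarrow> pull G' (N i) U (Idt G' U1) (z i) = pull G' (N i) (on_obj M (A i)) (h i) (\<eta> i (A i) (x i))"
      by metis
    have U1O: "U1 \<in> Obj G'" using S'.ole_Obj[OF U1] by simp
    note l = flat_family[of X U1 A h, OF X U1O A h]
    show "locally T' U1 (\<lambda>U'. \<exists>V k y. V \<in> Obj G \<and> k \<in> hvhom G' U' (on_obj M V) \<and> (\<forall>i\<in>X. y i \<in> val (F i) V \<and>
       pull G' (N i) U (Idt G' U') (z i) = pull G' (N i) (on_obj M V) k (\<eta> i V (y i))))"
    proof (rule S'.locally_mono[OF U1O l])
      fix U2 assume U2: "ole G' U2 U1" and "\<exists>V t k. V \<in> Obj G \<and> k \<in> hvhom G' U2 (on_obj M V) \<and>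
        (\<forall>i\<in>X. t i \<in> hvhom G V (A i) \<and> hvcmp G' (on_arr M (t i)) k = hvcmp G' (h i) (Idt G' U2))"
      then obtain V t k where V: "V \<in> Obj G" and k: "k \<in> hvhom G' U2 (on_obj M V)"
        and t: "\<And>i. i \<in> X \<Longrightarrow> t i \<in> hvhom G V (A i)"
          "\<And>i. i \<in> X \<Longrightarrow> hvcmp G' (on_arr M (t i)) k = hvcmp G' (h i) (Idt G' U2)" by blast
      have "pull G (F i) (A i) (t i) (x i) \<in> val (F i) V \<and> pull G' (N i) U (Idt G' U2) (z i) =
          pull G' (N i) (on_obj M V) k (\<eta> i V (pull G (F i) (A i) (t i) (x i)))" if i: "i \<in> X" for i
      proof -
        have "pull G' (N i) U (Idt G' U2) (z i) = pull G' (N i) U1 (Idt G' U2) (pull G' (N i) U (Idt G' U1) (z i))"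
          using S'.sheaf_pull_pull[OF kan_sheafD(1)[OF K[OF i]] z[OF i] S'.Idt_hvhom[OF U1] S'.Idt_hvhom[OF U2]]
            S'.Idt_hvcmp[OF S'.Idt_hvhom[OF U2]] by simp
        then show ?thesis
          using kan_pull_lift[OF K[OF i] x[OF i] h[OF i] U2 t(1)[OF i] k t(2)[OF i]] e[OF i]
            S.pull_in[OF F[OF i] x[OF i] t(1)[OF i]] by simp
      qed
      then show "\<exists>V k y. V \<in> Obj G \<and> k \<in> hvhom G' U2 (on_obj M V) \<and> (\<forall>i\<in>X. y i \<in> val (F i) V \<and>
         pull G' (N i) U (Idt G' U2) (z i) = pull G' (N i) (on_obj M V) k (\<eta> i V (y i)))"
        using V k by (intro exI[of _ V] exI[of _ k] exI[of _ "\<lambda>i. pull G (F i) (A i) (t i) (x i)"]) blast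
    qed
  qed
qed

text \<open>The classical argument that filtered colimits commute with finite limits, made local.
  Finitely many sections have a common stage \<open>W\<close>, finitely many equations between them
  hold after one refinement of \<open>W\<close>, and at that stage the limit property of
  \<open>V\<close> applies.\<close>

lemma kan_preserves_pointwise_limit:
  fixes J :: "(nat, nat) category" and K :: "(nat, nat, ('o, 'a, 'u) presheaf, ('o, 'a, 'u) presheaf_mor) fnctr"
  assumes L: "is_functor (Sh G T) (Sh G' T') L"
    and kan: "\<And>F :: ('o, 'a, 'u) presheaf. is_sheaf G T F \<Longrightarrow> kan_sheaf F (on_obj L F) (\<eta> F)"
    and L\<eta>: "\<And>F F' m A x. m \<in> hom (Sh G T) F F' \<Longrightarrow> A \<in> Obj G \<Longrightarrow> x \<in> val F A \<Longrightarrow>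
      cmpt (on_arr L m) (on_obj M A) (\<eta> F A x) = \<eta> F' A (cmpt m A x)"
    and K: "is_functor J (Sh G T) K" and fin: "finite (Obj J)" "finite (Arr J)"
    and lim: "pointwise_limit G T J K V p"
  shows "pointwise_limit G' T' J (fnctr_comp L K) (on_obj L V) (on_arr L \<circ> p)"
proof -
  interpret L: is_functor "Sh G T" "Sh G' T'" L by (rule L)
  interpret K: is_functor J "Sh G T" K by (rule K)
  have c: "is_cone J (Sh G T) K V p" and
    ex1: "\<And>A x. A \<in> Obj G \<Longrightarrow> matching J K A x \<Longrightarrow> \<exists>!z. z \<in> val V A \<and> (\<forall>j\<in>Obj J. cmpt (p j) A z = x j)"
    using lim by (auto simp: pointwise_limit_def)
  have V: "is_sheaf G T V" using c by (simp add: is_cone_def)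
  have p: "p j \<in> hom (Sh G T) V (on_obj K j)" if "j \<in> Obj J" for j
    using c that by (simp add: is_cone_def)
  have Ks: "is_sheaf G T (on_obj K j)" if "j \<in> Obj J" for j
    using K.fnctr_obj[OF that] by simp
  have Ku: "on_arr K u \<in> hom (Sh G T) (on_obj K (Dom J u)) (on_obj K (Cod J u))" if "u \<in> Arr J" for u
    using K.fnctr_arr[OF K.source.Arr_hom[OF that]] .
  have JO: "Dom J u \<in> Obj J" "Cod J u \<in> Obj J" if "u \<in> Arr J" for u
    using K.source.Dom_Obj K.source.Cod_Obj that by auto
  note D = kan_sheafD[OF kan]
  note VD = D[OF V]
  have Lp: "on_arr L (p j) \<in> hom (Sh G' T') (on_obj L V) (on_obj L (on_obj K j))" if "j \<in> Obj J" for j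
    using L.fnctr_arr[OF p[OF that]] .
  have Lm: "cmpt (on_arr L m) U (pull G' (on_obj L F) (on_obj M A) h (\<eta> F A x)) =
      pull G' (on_obj L F') (on_obj M A) h (\<eta> F' A (cmpt m A x))"
    if m: "m \<in> hom (Sh G T) F F'" and h: "h \<in> hvhom G' U (on_obj M A)" and A: "A \<in> Obj G" and x: "x \<in> val F A"
    for m F F' U A h x
  proof -
    have F: "is_sheaf G T F" using m by (simp add: Sh_hom)
    show ?thesis
      using S'.Sh_mor_pull[OF L.fnctr_arr[OF m] h D(2)[OF F A x]] L\<eta>[OF m A x] by simp
  qed
  \<comment> \<open>Joint injectivity of the projections comes first, because it serves both the
    gluing of local solutions and the final uniqueness.\<close>
  have uniq: "z = z'"
    if U: "U \<in> Obj G'" and z: "z \<in> val (on_obj L V) U" "z' \<in> val (on_obj L V) U"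
      and eq: "\<And>j. j \<in> Obj J \<Longrightarrow> cmpt (on_arr L (p j)) U z = cmpt (on_arr L (p j)) U z'" for U z z'
  proof (rule S'.sheaf_separated[OF VD(1) U z])
    let ?P = "\<lambda>U'. pull G' (on_obj L V) U (Idt G' U') z = pull G' (on_obj L V) U (Idt G' U') z'"
    \<comment> \<open>Indexing the two sections by \<open>{0, 1}\<close> lets
      \<open>kan_common_stage\<close> bring them to the same stage.\<close>
    define zz where "zz i = (if i = 0 then z else z')" for i :: nat
    have "locally T' U (\<lambda>U'. \<exists>W k y. W \<in> Obj G \<and> k \<in> hvhom G' U' (on_obj M W) \<and>
        (\<forall>i\<in>{0, 1}. y i \<in> val V W \<and> pull G' (on_obj L V) U (Idt G' U') (zz i) =
           pull G' (on_obj L V) (on_obj M W) k (\<eta> V W (y i))))"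
      by (rule kan_common_stage[OF _ U kan[OF V]]) (use z S.sheaf_presheaf[OF V] in \<open>auto simp: zz_def\<close>)
    then show "locally T' U ?P"
    proof (rule S'.locally_bind[OF U])
      fix U1 assume U1: "ole G' U1 U" and "\<exists>W k y. W \<in> Obj G \<and> k \<in> hvhom G' U1 (on_obj M W) \<and>
        (\<forall>i\<in>{0, 1}. y i \<in> val V W \<and> pull G' (on_obj L V) U (Idt G' U1) (zz i) =
           pull G' (on_obj L V) (on_obj M W) k (\<eta> V W (y i)))"
      then obtain W k y where W: "W \<in> Obj G" and k: "k \<in> hvhom G' U1 (on_obj M W)"
        and yy: "\<forall>i\<in>{0, 1}. y i \<in> val V W \<and> pull G' (on_obj L V) U (Idt G' U1) (zz i) =
           pull G' (on_obj L V) (on_obj M W) k (\<eta> V W (y i))" by blast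
      from yy have y: "y 0 \<in> val V W" "y 1 \<in> val V W"
        and e: "pull G' (on_obj L V) U (Idt G' U1) z = pull G' (on_obj L V) (on_obj M W) k (\<eta> V W (y 0))"
          "pull G' (on_obj L V) U (Idt G' U1) z' = pull G' (on_obj L V) (on_obj M W) k (\<eta> V W (y 1))"
        by (auto simp: zz_def)
      have U1O: "U1 \<in> Obj G'" using S'.ole_Obj[OF U1] by simp
      define Q where "Q j W' t \<longleftrightarrow> pull G (on_obj K j) W t (cmpt (p j) W (y 0)) =
        pull G (on_obj K j) W t (cmpt (p j) W (y 1))" for j and W' :: 'o and t
      have pyj: "cmpt (p j) W (y 0) \<in> val (on_obj K j) W" "cmpt (p j) W (y 1) \<in> val (on_obj K j) W"
        if "j \<in> Obj J" for j
        using S.Sh_mor_in[OF p[OF that] W y(1)] S.Sh_mor_in[OF p[OF that] W y(2)] .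
      have lift: "lifts U1 W k (\<lambda>W' t. \<forall>j\<in>Obj J. Q j W' t)"
      proof (rule lifts_finite_ball[OF k W fin(1)])
        fix j assume j: "j \<in> Obj J"
        note i1 = S'.Idt_hvhom[OF U1]
        have "pull G' (on_obj L (on_obj K j)) (on_obj M W) k (\<eta> (on_obj K j) W (cmpt (p j) W (y 0))) =
          pull G' (on_obj L (on_obj K j)) (on_obj M W) k (\<eta> (on_obj K j) W (cmpt (p j) W (y 1)))"
          using Lm[OF p[OF j] k W y(1)] Lm[OF p[OF j] k W y(2)] e eq[OF j]
            S'.Sh_mor_pull[OF Lp[OF j] i1 z(1)] S'.Sh_mor_pull[OF Lp[OF j] i1 z(2)] by simp
        from kan_kernel_lifts[OF kan[OF Ks[OF j]] S.sheaf_presheaf[OF Ks[OF j]] W pyj[OF j] k this]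
        show "lifts U1 W k (Q j)" unfolding Q_def .
        fix W1 W2 t s assume t: "t \<in> hvhom G W1 W" and s: "s \<in> hvhom G W2 W1" and "Q j W1 t"
        then show "Q j W2 (hvcmp G t s)"
          using S.sheaf_pull_pull[OF Ks[OF j] pyj(1)[OF j] t s] S.sheaf_pull_pull[OF Ks[OF j] pyj(2)[OF j] t s]
          by (simp add: Q_def)
      qed
      show "locally T' U1 ?P"
      proof (rule S'.locally_mono[OF U1O lift[unfolded lifts_def]])
        fix U2 assume U2: "ole G' U2 U1" and "\<exists>W' t l. t \<in> hvhom G W' W \<and> l \<in> hvhom G' U2 (on_obj M W') \<and>
          hvcmp G' (on_arr M t) l = hvcmp G' k (Idt G' U2) \<and> (\<forall>j\<in>Obj J. Q j W' t)"
        then obtain W' t l where t: "t \<in> hvhom G W' W" "l \<in> hvhom G' U2 (on_obj M W')"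
          "hvcmp G' (on_arr M t) l = hvcmp G' k (Idt G' U2)" and q: "\<forall>j\<in>Obj J. Q j W' t" by blast
        have W'O: "W' \<in> Obj G" using S.hvhom_Obj[OF t(1)] by simp
        note ty = S.sheaf_pull_in[OF V y(1) t(1)] S.sheaf_pull_in[OF V y(2) t(1)]
        have "pull G V W t (y 0) = pull G V W t (y 1)"
        proof (rule ex1_unique[OF ex1[OF W'O S.cone_matching[OF K.source.is_category_axioms c W'O ty(2)]]])
          show "pull G V W t (y 0) \<in> val V W' \<and>
            (\<forall>j\<in>Obj J. cmpt (p j) W' (pull G V W t (y 0)) = cmpt (p j) W' (pull G V W t (y 1)))"
            using ty(1) q S.Sh_mor_pull[OF p t(1) y(1)] S.Sh_mor_pull[OF p t(1) y(2)] by (simp add: Q_def)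
        qed (use ty in simp)
        then have "pull G' (on_obj L V) U1 (Idt G' U2) (pull G' (on_obj L V) U (Idt G' U1) z) =
          pull G' (on_obj L V) U1 (Idt G' U2) (pull G' (on_obj L V) U (Idt G' U1) z')"
          using kan_pull_lift[OF kan[OF V] y(1) k U2 t] kan_pull_lift[OF kan[OF V] y(2) k U2 t] e by simp
        then show "?P U2"
          using S'.sheaf_pull_pull[OF VD(1) z(1) S'.Idt_hvhom[OF U1] S'.Idt_hvhom[OF U2]]
            S'.sheaf_pull_pull[OF VD(1) z(2) S'.Idt_hvhom[OF U1] S'.Idt_hvhom[OF U2]]
            S'.Idt_hvcmp[OF S'.Idt_hvhom[OF U2]] by simp
      qed
    qed
  qed
  have sel: "on_obj (fnctr_comp L K) j = on_obj L (on_obj K j)" "on_arr (fnctr_comp L K) u = on_arr L (on_arr K u)" for j u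
    by (simp_all add: fnctr_comp_def)
  show ?thesis
    unfolding pointwise_limit_def
  proof (intro conjI ballI allI impI)
    show "is_cone J (Sh G' T') (fnctr_comp L K) (on_obj L V) (on_arr L \<circ> p)"
      unfolding is_cone_def
    proof (intro conjI ballI)
      show "on_obj L V \<in> Obj (Sh G' T')" using VD(1) by simp
      show "(on_arr L \<circ> p) j \<in> hom (Sh G' T') (on_obj L V) (on_obj (fnctr_comp L K) j)" if "j \<in> Obj J" for j
        using Lp[OF that] by (simp add: sel)
      show "Cmp (Sh G' T') (on_arr (fnctr_comp L K) u) ((on_arr L \<circ> p) (Dom J u)) = (on_arr L \<circ> p) (Cod J u)"
        if u: "u \<in> Arr J" for u
        using L.fnctr_Cmp[OF p[OF JO(1)[OF u]] Ku[OF u]] c u by (simp add: sel is_cone_def)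
    qed
    fix U x assume U: "U \<in> Obj G'" and "matching J (fnctr_comp L K) U x"
    then have x: "\<And>j. j \<in> Obj J \<Longrightarrow> x j \<in> val (on_obj L (on_obj K j)) U"
      and xu: "\<And>u. u \<in> Arr J \<Longrightarrow> cmpt (on_arr L (on_arr K u)) U (x (Dom J u)) = x (Cod J u)"
      by (auto simp: matching_def sel)
    \<comment> \<open>A description of the wanted section on \<open>U'\<close>; by
      \<open>uniq\<close> it has at most one solution, so local solutions glue.\<close>
    define Q where "Q U' z \<longleftrightarrow> (\<forall>j\<in>Obj J. cmpt (on_arr L (p j)) U' z =
      pull G' (on_obj L (on_obj K j)) U (Idt G' U') (x j))" for U' z
    have loc: "locally T' U (\<lambda>U'. \<exists>z\<in>val (on_obj L V) U'. Q U' z)"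
    proof (rule S'.locally_bind[OF U kan_common_stage[OF fin(1) U kan[OF Ks] S.sheaf_presheaf[OF Ks] x]])
      fix U1 assume U1: "ole G' U1 U" and "\<exists>W k y. W \<in> Obj G \<and> k \<in> hvhom G' U1 (on_obj M W) \<and>
        (\<forall>j\<in>Obj J. y j \<in> val (on_obj K j) W \<and> pull G' (on_obj L (on_obj K j)) U (Idt G' U1) (x j) =
           pull G' (on_obj L (on_obj K j)) (on_obj M W) k (\<eta> (on_obj K j) W (y j)))"
      then obtain W k y where W: "W \<in> Obj G" and k: "k \<in> hvhom G' U1 (on_obj M W)"
        and y: "\<And>j. j \<in> Obj J \<Longrightarrow> y j \<in> val (on_obj K j) W"
        and e: "\<And>j. j \<in> Obj J \<Longrightarrow> pull G' (on_obj L (on_obj K j)) U (Idt G' U1) (x j) =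
           pull G' (on_obj L (on_obj K j)) (on_obj M W) k (\<eta> (on_obj K j) W (y j))" by blast
      have U1O: "U1 \<in> Obj G'" using S'.ole_Obj[OF U1] by simp
      \<comment> \<open>The images of the \<open>y j\<close> under the unit satisfy the diagram
        equations on \<open>U1\<close>, but the \<open>y j\<close> themselves may not. For each of
        the finitely many arrows of \<open>J\<close> the equation becomes true after
        refinement.\<close>
      define R where "R u W' t \<longleftrightarrow> pull G (on_obj K (Cod J u)) W t (cmpt (on_arr K u) W (y (Dom J u))) =
        pull G (on_obj K (Cod J u)) W t (y (Cod J u))" for u and W' :: 'o and t
      have Kuy: "cmpt (on_arr K u) W (y (Dom J u)) \<in> val (on_obj K (Cod J u)) W" if "u \<in> Arr J" for u
        using S.Sh_mor_in[OF Ku[OF that] W y[OF JO(1)[OF that]]] .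
      have lift: "lifts U1 W k (\<lambda>W' t. \<forall>u\<in>Arr J. R u W' t)"
      proof (rule lifts_finite_ball[OF k W fin(2)])
        fix u assume u: "u \<in> Arr J"
        note i1 = S'.Idt_hvhom[OF U1] and O = JO[OF u]
        have "pull G' (on_obj L (on_obj K (Cod J u))) (on_obj M W) k
            (\<eta> (on_obj K (Cod J u)) W (cmpt (on_arr K u) W (y (Dom J u)))) =
          pull G' (on_obj L (on_obj K (Cod J u))) (on_obj M W) k (\<eta> (on_obj K (Cod J u)) W (y (Cod J u)))"
          using Lm[OF Ku[OF u] k W y[OF O(1)]] e[OF O(1)] e[OF O(2)] xu[OF u]
            S'.Sh_mor_pull[OF L.fnctr_arr[OF Ku[OF u]] i1 x[OF O(1)]] by simp
        from kan_kernel_lifts[OF kan[OF Ks[OF O(2)]] S.sheaf_presheaf[OF Ks[OF O(2)]] W Kuy[OF u] y[OF O(2)] k this]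
        show "lifts U1 W k (R u)" unfolding R_def .
        fix W1 W2 t s assume t: "t \<in> hvhom G W1 W" and s: "s \<in> hvhom G W2 W1" and "R u W1 t"
        then show "R u W2 (hvcmp G t s)"
          using S.sheaf_pull_pull[OF Ks[OF O(2)] Kuy[OF u] t s] S.sheaf_pull_pull[OF Ks[OF O(2)] y[OF O(2)] t s]
          by (simp add: R_def)
      qed
      show "locally T' U1 (\<lambda>U'. \<exists>z\<in>val (on_obj L V) U'. Q U' z)"
      proof (rule S'.locally_mono[OF U1O lift[unfolded lifts_def]])
        fix U2 assume U2: "ole G' U2 U1" and "\<exists>W' t l. t \<in> hvhom G W' W \<and> l \<in> hvhom G' U2 (on_obj M W') \<and>
          hvcmp G' (on_arr M t) l = hvcmp G' k (Idt G' U2) \<and> (\<forall>u\<in>Arr J. R u W' t)"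
        then obtain W' t l where t: "t \<in> hvhom G W' W" "l \<in> hvhom G' U2 (on_obj M W')"
          "hvcmp G' (on_arr M t) l = hvcmp G' k (Idt G' U2)" and r: "\<And>u. u \<in> Arr J \<Longrightarrow> R u W' t" by blast
        have W'O: "W' \<in> Obj G" using S.hvhom_Obj[OF t(1)] by simp
        have "matching J K W' (\<lambda>j. pull G (on_obj K j) W t (y j))"
          unfolding matching_def
        proof (intro conjI ballI)
          show "pull G (on_obj K j) W t (y j) \<in> val (on_obj K j) W'" if "j \<in> Obj J" for j
            using S.sheaf_pull_in[OF Ks[OF that] y[OF that] t(1)] .
          show "cmpt (on_arr K u) W' (pull G (on_obj K (Dom J u)) W t (y (Dom J u))) =
            pull G (on_obj K (Cod J u)) W t (y (Cod J u))" if u: "u \<in> Arr J" for u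
            using S.Sh_mor_pull[OF Ku[OF u] t(1) y[OF JO(1)[OF u]]] r[OF u] by (simp add: R_def)
        qed
        then obtain v where v: "v \<in> val V W'" "\<And>j. j \<in> Obj J \<Longrightarrow> cmpt (p j) W' v = pull G (on_obj K j) W t (y j)"
          using ex1[OF W'O] by blast
        have "cmpt (on_arr L (p j)) U2 (pull G' (on_obj L V) (on_obj M W') l (\<eta> V W' v)) =
          pull G' (on_obj L (on_obj K j)) U (Idt G' U2) (x j)" if j: "j \<in> Obj J" for j
          using Lm[OF p[OF j] t(2) W'O v(1)] v(2)[OF j] kan_pull_lift[OF kan[OF Ks[OF j]] y[OF j] k U2 t] e[OF j]
            S'.sheaf_pull_pull[OF D(1)[OF Ks[OF j]] x[OF j] S'.Idt_hvhom[OF U1] S'.Idt_hvhom[OF U2]]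
            S'.Idt_hvcmp[OF S'.Idt_hvhom[OF U2]] by simp
        then show "\<exists>z\<in>val (on_obj L V) U2. Q U2 z"
          using S'.sheaf_pull_in[OF VD(1) VD(2)[OF W'O v(1)] t(2)] by (auto simp: Q_def)
      qed
    qed
    have "\<exists>y\<in>val (on_obj L V) U. \<forall>B z. ole G' B U \<longrightarrow> z \<in> val (on_obj L V) B \<longrightarrow> Q B z \<longrightarrow>
        pull G' (on_obj L V) U (Idt G' B) y = z"
    proof (rule S'.sheaf_glue[OF VD(1) U loc])
      fix B E z assume B: "ole G' B U" and E: "ole G' E B" and z: "z \<in> val (on_obj L V) B" and q: "Q B z"
      show "Q E (pull G' (on_obj L V) B (Idt G' E) z)"
        unfolding Q_def
      proof
        fix j assume j: "j \<in> Obj J"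
        show "cmpt (on_arr L (p j)) E (pull G' (on_obj L V) B (Idt G' E) z) =
          pull G' (on_obj L (on_obj K j)) U (Idt G' E) (x j)"
          using S'.Sh_mor_pull[OF Lp[OF j] S'.Idt_hvhom[OF E] z] q j
            S'.sheaf_pull_pull[OF D(1)[OF Ks[OF j]] x[OF j] S'.Idt_hvhom[OF B] S'.Idt_hvhom[OF E]]
            S'.Idt_hvcmp[OF S'.Idt_hvhom[OF E]] by (simp add: Q_def)
      qed
    next
      fix B z w assume B: "ole G' B U" and zw: "z \<in> val (on_obj L V) B" "w \<in> val (on_obj L V) B" "Q B z" "Q B w"
      show "z = w"
        by (rule uniq[OF _ zw(1,2)]) (use zw(3,4) S'.ole_Obj[OF B] in \<open>auto simp: Q_def\<close>)
    qed
    then obtain z where z: "z \<in> val (on_obj L V) U" and zQ: "\<And>B w. ole G' B U \<Longrightarrow> w \<in> val (on_obj L V) B \<Longrightarrow>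
        Q B w \<Longrightarrow> pull G' (on_obj L V) U (Idt G' B) z = w" by blast
    show "\<exists>!z. z \<in> val (on_obj L V) U \<and> (\<forall>j\<in>Obj J. cmpt ((on_arr L \<circ> p) j) U z = x j)"
    proof (intro ex1I[of _ z] conjI ballI z)
      fix j assume j: "j \<in> Obj J"
      have "cmpt (on_arr L (p j)) U z = x j"
      proof (rule S'.sheaf_separated[OF D(1)[OF Ks[OF j]] U S'.Sh_mor_in[OF Lp[OF j] U z] x[OF j] S'.locally_mono[OF U loc]])
        fix B assume B: "ole G' B U" "\<exists>w\<in>val (on_obj L V) B. Q B w"
        then obtain w where w: "w \<in> val (on_obj L V) B" "Q B w" by blast
        show "pull G' (on_obj L (on_obj K j)) U (Idt G' B) (cmpt (on_arr L (p j)) U z) =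
          pull G' (on_obj L (on_obj K j)) U (Idt G' B) (x j)"
          using S'.Sh_mor_pull[OF Lp[OF j] S'.Idt_hvhom[OF B(1)] z] zQ[OF B(1) w] w(2) j by (simp add: Q_def)
      qed
      then show "cmpt ((on_arr L \<circ> p) j) U z = x j" by simp
    next
      fix z' assume z': "z' \<in> val (on_obj L V) U \<and> (\<forall>j\<in>Obj J. cmpt ((on_arr L \<circ> p) j) U z' = x j)"
      show "z' = z"
      proof (rule uniq[OF U conjunct1[OF z'] z])
        fix j assume j: "j \<in> Obj J"
        show "cmpt (on_arr L (p j)) U z' = cmpt (on_arr L (p j)) U z"
        proof (rule S'.sheaf_separated[OF D(1)[OF Ks[OF j]] U S'.Sh_mor_in[OF Lp[OF j] U conjunct1[OF z']]
              S'.Sh_mor_in[OF Lp[OF j] U z] S'.locally_mono[OF U loc]])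
          fix B assume B: "ole G' B U" "\<exists>w\<in>val (on_obj L V) B. Q B w"
          then obtain w where w: "w \<in> val (on_obj L V) B" "Q B w" by blast
          show "pull G' (on_obj L (on_obj K j)) U (Idt G' B) (cmpt (on_arr L (p j)) U z') =
            pull G' (on_obj L (on_obj K j)) U (Idt G' B) (cmpt (on_arr L (p j)) U z)"
            using S'.Sh_mor_pull[OF Lp[OF j] S'.Idt_hvhom[OF B(1)] z] zQ[OF B(1) w] w(2) j z' by (simp add: Q_def)
        qed
      qed
    qed
  qed
qed

theorem precomp_direct_image:
  assumes small: "small_groupoid TYPE('u) G" "small_groupoid TYPE('u) G'"
  shows "\<exists>L. is_geometric_morphism
     (Sh G' T' :: (('p, 'b, 'u) presheaf, ('p, 'b, 'u) presheaf_mor) category)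
     (Sh G T :: (('o, 'a, 'u) presheaf, ('o, 'a, 'u) presheaf_mor) category) (precomp_functor G M) L"
proof -
  have inf: "infinite (UNIV :: 'u set)" using small by (simp add: small_groupoid_def)
  have "\<exists>N e \<eta>. kan_sheaf F N \<eta> \<and> universal_arrow (Sh G T) (Sh G' T') (precomp_functor G M) F N e \<and>
      (\<forall>A\<in>Obj G. \<forall>x\<in>val F A. cmpt e A x = \<eta> A x)"
    if F: "is_sheaf G T F" for F :: "('o, 'a, 'u) presheaf"
    using kan_sheaf_exists[OF S.sheaf_presheaf[OF F] small] kan_universal[OF F] by blast
  then obtain N e \<eta> where kan: "\<And>F :: ('o, 'a, 'u) presheaf. is_sheaf G T F \<Longrightarrow> kan_sheaf F (N F) (\<eta> F)"
    and univ: "\<And>F :: ('o, 'a, 'u) presheaf. is_sheaf G T F \<Longrightarrow>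
      universal_arrow (Sh G T) (Sh G' T') (precomp_functor G M) F (N F) (e F)"
    and e\<eta>: "\<And>(F :: ('o, 'a, 'u) presheaf) A x. is_sheaf G T F \<Longrightarrow> A \<in> Obj G \<Longrightarrow> x \<in> val F A \<Longrightarrow>
      cmpt (e F) A x = \<eta> F A x"
    by metis
  have "\<exists>L. is_left_adjoint (Sh G T) (Sh G' T') L (precomp_functor G M) \<and> (\<forall>X\<in>Obj (Sh G T). on_obj L X = N X) \<and>
    (\<forall>X X' f. f \<in> hom (Sh G T) X X' \<longrightarrow> Cmp (Sh G T) (on_arr (precomp_functor G M) (on_arr L f)) (e X) =
       Cmp (Sh G T) (e X') f)"
    by (rule left_adjoint_of_universal_arrows[OF precomp_functor[OF precomp_sheaf]]) (simp_all add: univ)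
  then obtain L where adj: "is_left_adjoint (Sh G T) (Sh G' T') L (precomp_functor G M)"
    and LN: "\<And>X. is_sheaf G T X \<Longrightarrow> on_obj L X = N X"
    and Le: "\<And>X X' f. f \<in> hom (Sh G T) X X' \<Longrightarrow>
      Cmp (Sh G T) (on_arr (precomp_functor G M) (on_arr L f)) (e X) = Cmp (Sh G T) (e X') f"
    by auto
  have Lf: "is_functor (Sh G T) (Sh G' T') L" using adj by (simp add: is_left_adjoint_def)
  have kanL: "kan_sheaf F (on_obj L F) (\<eta> F)" if "is_sheaf G T F" for F
    using kan[OF that] LN[OF that] by simp
  have L\<eta>: "cmpt (on_arr L m) (on_obj M A) (\<eta> F A x) = \<eta> F' A (cmpt m A x)"
    if m: "m \<in> hom (Sh G T) F F'" and A: "A \<in> Obj G" and x: "x \<in> val F A" for m F F' A x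
  proof -
    have F: "is_sheaf G T F" "is_sheaf G T F'" using m by (auto simp: Sh_hom)
    have eF: "e F \<in> hom (Sh G T) F (on_obj (precomp_functor G M) (N F))"
      using univ[OF F(1)] by (simp add: universal_arrow_def)
    have "cmpt (Cmp (Sh G T) (on_arr (precomp_functor G M) (on_arr L m)) (e F)) A x =
        cmpt (on_arr L m) (on_obj M A) (\<eta> F A x)"
      using S.Sh_Cmp_apply[OF eF A x, of "on_arr (precomp_functor G M) (on_arr L m)"] A e\<eta>[OF F(1) A x] by simp
    moreover have "cmpt (Cmp (Sh G T) (e F') m) A x = \<eta> F' A (cmpt m A x)"
      using S.Sh_Cmp_apply[OF m A x, of "e F'"] e\<eta>[OF F(2) A S.Sh_mor_in[OF m A x]] by simp
    ultimately show ?thesis using Le[OF m] by simp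
  qed
  have "preserves_finite_limits (Sh G T) (Sh G' T') L"
    unfolding preserves_finite_limits_def
  proof (intro allI impI, elim conjE)
    fix J :: "(nat, nat) category"
      and K :: "(nat, nat, ('o, 'a, 'u) presheaf, ('o, 'a, 'u) presheaf_mor) fnctr" and V p
    assume J: "is_category J" "finite (Obj J)" "finite (Arr J)" and K: "is_functor J (Sh G T) K"
      and lim: "is_limit_cone J (Sh G T) K V p"
    show "is_limit_cone J (Sh G' T') (fnctr_comp L K) (on_obj L V) (on_arr L \<circ> p)"
      by (rule S'.pointwise_limit_imp_limit[OF J(1) kan_preserves_pointwise_limit[OF Lf kanL L\<eta> K J(2,3)
            S.limit_imp_pointwise_limit[OF K J(2) inf lim]]])
  qed
  then show ?thesis
    using adj by (auto simp: is_geometric_morphism_def)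
qed

end

section \<open>Necessity\<close>

lemma is_functor_comp:
  assumes "is_functor C D F" "is_functor D E H"
  shows "is_functor C E (fnctr_comp H F)"
proof -
  interpret F: is_functor C D F by (rule assms)
  interpret H: is_functor D E H by (rule assms)
  show ?thesis
  proof (intro is_functor.intro is_functor_axioms.intro F.source.is_category_axioms H.target.is_category_axioms)
    fix A B X f g
    show "A \<in> Obj C \<Longrightarrow> on_obj (fnctr_comp H F) A \<in> Obj E"
      "A \<in> Obj C \<Longrightarrow> on_arr (fnctr_comp H F) (Idt C A) = Idt E (on_obj (fnctr_comp H F) A)"
      using F.fnctr_obj H.fnctr_obj F.fnctr_Idt H.fnctr_Idt by (simp_all add: fnctr_comp_def)
    assume f: "f \<in> hom C A B"
    show "on_arr (fnctr_comp H F) f \<in> hom E (on_obj (fnctr_comp H F) A) (on_obj (fnctr_comp H F) B)"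
      using H.fnctr_arr[OF F.fnctr_arr[OF f]] by (simp add: fnctr_comp_def)
    assume g: "g \<in> hom C B X"
    show "on_arr (fnctr_comp H F) (Cmp C g f) = Cmp E (on_arr (fnctr_comp H F) g) (on_arr (fnctr_comp H F) f)"
      using F.fnctr_Cmp[OF f g] H.fnctr_Cmp[OF F.fnctr_arr[OF f] F.fnctr_arr[OF g]]
      by (simp add: fnctr_comp_def)
  qed
qed

text \<open>An arrow \<open>i \<rightarrow> i'\<close> of the left cancellative category of \<open>I\<close> is coded by its horizontal arrow
  together with \<open>i'\<close>, since the horizontal arrow does not determine \<open>i'\<close>.\<close>

definition hv_category :: "(nat, nat) ordered_groupoid \<Rightarrow> (nat, nat) category" where
  "hv_category I = \<lparr>Obj = Obj I,
     Arr = {u. fst (prod_decode u) \<in> Arr I \<and> ole I (Cod I (fst (prod_decode u))) (snd (prod_decode u))},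
     Dom = (\<lambda>u. Dom I (fst (prod_decode u))), Cod = (\<lambda>u. snd (prod_decode u)),
     Idt = (\<lambda>i. prod_encode (Idt I i, i)),
     Cmp = (\<lambda>v u. prod_encode (hvcmp I (fst (prod_decode v)) (fst (prod_decode u)), snd (prod_decode v)))\<rparr>"

lemma hv_category_hom:
  "u \<in> hom (hv_category I) i i' \<longleftrightarrow> fst (prod_decode u) \<in> hvhom I i i' \<and> snd (prod_decode u) = i'"
  by (auto simp: hv_category_def hom_def hvhom_def)

lemma hv_category_hom_encode: "\<alpha> \<in> hvhom I i i' \<Longrightarrow> prod_encode (\<alpha>, i') \<in> hom (hv_category I) i i'"
  by (simp add: hv_category_hom)

lemma hv_category:
  assumes "is_ordered_groupoid I"
  shows "is_category (hv_category I)"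
proof -
  interpret is_ordered_groupoid I by (rule assms)
  show ?thesis
  proof
    fix f g h A B D E
    show "A \<in> Obj (hv_category I) \<Longrightarrow> Idt (hv_category I) A \<in> hom (hv_category I) A A"
      using Idt_hvhom[OF ole_refl] by (simp add: hv_category_hom) (simp add: hv_category_def)
    {
      assume "f \<in> Arr (hv_category I)"
      then have f: "fst (prod_decode f) \<in> hvhom I (Dom I (fst (prod_decode f))) (snd (prod_decode f))"
        by (simp add: hv_category_def hvhom_def)
      show "Dom (hv_category I) f \<in> Obj (hv_category I)" "Cod (hv_category I) f \<in> Obj (hv_category I)"
        using hvhom_Obj[OF f] by (simp_all add: hv_category_def)
      show "Cmp (hv_category I) f (Idt (hv_category I) (Dom (hv_category I) f)) = f"
        "Cmp (hv_category I) (Idt (hv_category I) (Cod (hv_category I) f)) f = f"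
        using hvcmp_Idt[OF f] Idt_hvcmp[OF f] by (simp_all add: hv_category_def)
    }
    assume f: "f \<in> hom (hv_category I) A B" and g: "g \<in> hom (hv_category I) B D"
    then have fg: "fst (prod_decode f) \<in> hvhom I A B" "fst (prod_decode g) \<in> hvhom I B D" "snd (prod_decode g) = D"
      by (simp_all add: hv_category_hom)
    show "Cmp (hv_category I) g f \<in> hom (hv_category I) A D"
      using hvcmp_hvhom[OF fg(1,2)] fg(3) by (simp add: hv_category_hom) (simp add: hv_category_def)
    assume "h \<in> hom (hv_category I) D E"
    then have "fst (prod_decode h) \<in> hvhom I D E"
      by (simp add: hv_category_hom)
    from hvcmp_assoc[OF fg(1,2) this]
    show "Cmp (hv_category I) h (Cmp (hv_category I) g f) = Cmp (hv_category I) (Cmp (hv_category I) h g) f"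
      by (simp add: hv_category_def)
  qed
qed

lemma hv_category_finite:
  assumes "is_ordered_groupoid I" "finite (Obj I)" "finite (Arr I)"
  shows "finite (Obj (hv_category I))" "finite (Arr (hv_category I))"
proof -
  interpret is_ordered_groupoid I by (rule assms)
  show "finite (Obj (hv_category I))" using assms by (simp add: hv_category_def)
  have "Arr (hv_category I) \<subseteq> prod_encode ` (Arr I \<times> Obj I)"
  proof
    fix u assume u: "u \<in> Arr (hv_category I)"
    have "fst (prod_decode u) \<in> Arr I" "snd (prod_decode u) \<in> Obj I"
      using u ole_Obj[of "Cod I (fst (prod_decode u))" "snd (prod_decode u)"]
      by (simp_all add: hv_category_def)
    then show "u \<in> prod_encode ` (Arr I \<times> Obj I)"
      by (intro image_eqI[of _ _ "prod_decode u"]) (simp_all add: mem_Times_iff)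
  qed
  then show "finite (Arr (hv_category I))"
    using assms(2,3) by (auto intro: finite_subset)
qed

text \<open>The data of an arbitrary geometric morphism with the given direct image. Nothing ties
  \<open>L\<close> to the Kan extension, so its values are reached only through the unit
  \<open>e\<close>, the universal property and finite limits.\<close>

locale direct_image = site_functor G T G' T' M
  for G :: "('o, 'a, 'z) ordered_groupoid_scheme" and T :: "'o \<Rightarrow> 'o set set"
    and G' :: "('p, 'b, 'y) ordered_groupoid_scheme" and T' :: "'p \<Rightarrow> 'p set set"
    and M :: "('o, 'a, 'p, 'b) fnctr" +
  fixes L :: "(('o, 'a, 'u) presheaf, ('o, 'a, 'u) presheaf_mor,
      ('p, 'b, 'u) presheaf, ('p, 'b, 'u) presheaf_mor) fnctr"
    and e :: "('o, 'a, 'u) presheaf \<Rightarrow> ('o, 'a, 'u) presheaf_mor"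
  assumes small: "small_groupoid TYPE('u) G" "small_groupoid TYPE('u) G'"
    and sheaf: "\<And>Y :: ('p, 'b, 'u) presheaf. is_sheaf G' T' Y \<Longrightarrow> is_sheaf G T (presheaf_precomp M Y)"
    and L: "is_functor (Sh G T) (Sh G' T') L"
    and univ: "\<And>F. is_sheaf G T F \<Longrightarrow>
      universal_arrow (Sh G T) (Sh G' T') (precomp_functor G M) F (on_obj L F) (e F)"
    and e_nat: "\<And>F F' m. m \<in> hom (Sh G T) F F' \<Longrightarrow>
      Cmp (Sh G T) (on_arr (precomp_functor G M) (on_arr L m)) (e F) = Cmp (Sh G T) (e F') m"
    and lim: "preserves_finite_limits (Sh G T) (Sh G' T') L"
begin

lemma infinite_univ: "infinite (UNIV :: 'u set)"
  using small by (simp add: small_groupoid_def)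

lemma covering_preserving: "covering_preserving G T G' T' M"
  unfolding covering_preserving_def
proof (intro ballI)
  fix A S assume A: "A \<in> Obj G" and S: "S \<in> T A"
  define R where "R = sieve_generated G' (on_obj M ` S)"
  have le: "ole G B A" if "B \<in> S" for B using S.covering_le[OF A S that] .
  have R: "is_vertical_sieve G' (on_obj M A) R"
    unfolding is_vertical_sieve_def R_def sieve_generated_def down_def
    using S'.ole_trans fnctr_ole[OF le] by blast
  obtain N :: "('p, 'b, 'u) presheaf" and u v where N: "is_sheaf G' T' N" "u \<in> val N (on_obj M A)"
    "v \<in> val N (on_obj M A)"
    "\<forall>B\<in>R. pull G' N (on_obj M A) (Idt G' B) u = pull G' N (on_obj M A) (Idt G' B) v"
    "u = v \<longrightarrow> R \<in> T' (on_obj M A)"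
    using S'.sieve_detecting_sheaf[OF small(2) fnctr_obj[OF A] R] by blast
  \<comment> \<open>For \<open>B\<close> in \<open>S\<close> the object \<open>on_obj M B\<close>
    belongs to \<open>R\<close>, so the restrictions of \<open>u\<close> and \<open>v\<close> to
    \<open>B\<close> agree.\<close>
  have "u = v"
  proof (rule S.sheaf_separated[OF sheaf[OF N(1)] A])
    have "locally T A (\<lambda>B. B \<in> S)" using S by (auto simp: locally_def)
    then show "locally T A (\<lambda>B. pull G (presheaf_precomp M N) A (Idt G B) u =
        pull G (presheaf_precomp M N) A (Idt G B) v)"
    proof (rule S.locally_mono[OF A])
      fix B assume B: "ole G B A" "B \<in> S"
      have BO: "B \<in> Obj G" using S.ole_Obj[OF B(1)] by simp
      have "on_obj M B \<in> R"
        using B(2) S'.ole_refl[OF fnctr_obj[OF BO]] by (auto simp: R_def sieve_generated_def)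
      then show "pull G (presheaf_precomp M N) A (Idt G B) u = pull G (presheaf_precomp M N) A (Idt G B) v"
        using N(4) precomp_pull[OF S.Idt_hvhom[OF B(1)], of N] fnctr_Idt[OF BO] by simp
    qed
  qed (use N in simp_all)
  then show "sieve_generated G' (on_obj M ` S) \<in> T' (on_obj M A)"
    using N(5) by (simp add: R_def)
qed

lemma LD:
  assumes F: "is_sheaf G T F"
  shows "is_sheaf G' T' (on_obj L F)" "e F \<in> hom (Sh G T) F (presheaf_precomp M (on_obj L F))"
  using univ[OF F] by (simp_all add: universal_arrow_def)

lemma e_in: "is_sheaf G T F \<Longrightarrow> A \<in> Obj G \<Longrightarrow> x \<in> val F A \<Longrightarrow> cmpt (e F) A x \<in> val (on_obj L F) (on_obj M A)"
  using S.Sh_mor_in[OF LD(2)] by simp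

lemma e_pull:
  assumes "is_sheaf G T F" "t \<in> hvhom G B A" "x \<in> val F A"
  shows "pull G' (on_obj L F) (on_obj M A) (on_arr M t) (cmpt (e F) A x) = cmpt (e F) B (pull G F A t x)"
  using S.Sh_mor_pull[OF LD(2)[OF assms(1)] assms(2,3)] precomp_pull[OF assms(2), of "on_obj L F"] by simp

lemma L_e:
  assumes m: "m \<in> hom (Sh G T) F F'" and A: "A \<in> Obj G" and x: "x \<in> val F A"
  shows "cmpt (on_arr L m) (on_obj M A) (cmpt (e F) A x) = cmpt (e F') A (cmpt m A x)"
proof -
  have F: "is_sheaf G T F" using m by (simp add: Sh_hom)
  show ?thesis
    using S.Sh_Cmp_apply[OF LD(2)[OF F] A x, of "on_arr (precomp_functor G M) (on_arr L m)"]
      S.Sh_Cmp_apply[OF m A x, of "e F'"] e_nat[OF m] A by simp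
qed

lemma R_functor: "is_functor (Sh G' T' :: (('p, 'b, 'u) presheaf, ('p, 'b, 'u) presheaf_mor) category)
    (Sh G T) (precomp_functor G M)"
  by (rule precomp_functor[OF sheaf])

lemma L_mor_hom: "m \<in> hom (Sh G T) F F' \<Longrightarrow> on_arr L m \<in> hom (Sh G' T') (on_obj L F) (on_obj L F')"
  using is_functor.fnctr_arr[OF L] .

text \<open>The elements that locally come from the unit form a subsheaf through which the unit factors,
  so they are all of \<open>L F\<close>.\<close>

lemma L_generated:
  assumes F: "is_sheaf G T F" and U: "U \<in> Obj G'" and z: "z \<in> val (on_obj L F) U"
  shows "locally T' U (\<lambda>U'. \<exists>A h x. A \<in> Obj G \<and> h \<in> hvhom G' U' (on_obj M A) \<and> x \<in> val F A \<and>
    pull G' (on_obj L F) U (Idt G' U') z = pull G' (on_obj L F) (on_obj M A) h (cmpt (e F) A x))"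
proof -
  define N where "N = on_obj L F"
  have N: "is_sheaf G' T' N" using LD(1)[OF F] by (simp add: N_def)
  note eN = e_in[OF F, folded N_def]
  define gen where "gen U w \<longleftrightarrow> (\<exists>A h x. A \<in> Obj G \<and> h \<in> hvhom G' U (on_obj M A) \<and> x \<in> val F A \<and>
    w = pull G' N (on_obj M A) h (cmpt (e F) A x))" for U w
  have gen_pull: "gen B (pull G' N U k w)" if k: "k \<in> hvhom G' B U" and w: "gen U w" for B U k w
  proof -
    obtain A h x where w': "A \<in> Obj G" "h \<in> hvhom G' U (on_obj M A)" "x \<in> val F A"
      "w = pull G' N (on_obj M A) h (cmpt (e F) A x)"
      using w by (auto simp: gen_def)
    have "pull G' N U k w = pull G' N (on_obj M A) (hvcmp G' h k) (cmpt (e F) A x)"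
      using S'.sheaf_pull_pull[OF N eN[OF w'(1,3)] w'(2) k] w'(4) by simp
    then show ?thesis
      unfolding gen_def using w' S'.hvcmp_hvhom[OF k w'(2)] by blast
  qed
  \<comment> \<open>Being generated is required only locally, which makes \<open>v\<close> closed
    under gluing.\<close>
  define v where "v U = {w \<in> val N U. locally T' U (\<lambda>U'. gen U' (pull G' N U (Idt G' U') w))}" for U
  define H where "H = presheaf_of_pull G' v (\<lambda>U. pull G' N U)"
  have vN: "w \<in> val N U" if "w \<in> v U" for U w using that by (simp add: v_def)
  have v_pull: "pull G' N U k w \<in> v B" if k: "k \<in> hvhom G' B U" and w: "w \<in> v U" for B U k w
  proof -
    have "locally T' U (\<lambda>U'. gen U' (pull G' N U (Idt G' U') w))" using w by (simp add: v_def)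
    then have "locally T' B (\<lambda>B'. gen B' (pull G' N B (Idt G' B') (pull G' N U k w)))"
    proof (rule S'.locally_pullI[OF _ k])
      fix B' E k' assume B': "ole G' B' B" and k'_def: "k' = hvcmp G' k (Idt G' B')"
        and k': "k' \<in> hvhom G' B' E" "hvcmp G' (Idt G' E) k' = k'" and E: "ole G' E U"
        and g: "gen E (pull G' N U (Idt G' E) w)"
      from gen_pull[OF k'(1) g] show "gen B' (pull G' N B (Idt G' B') (pull G' N U k w))"
        using S'.sheaf_pull_pull[OF N vN[OF w] S'.Idt_hvhom[OF E] k'(1)] k'(2)
          S'.sheaf_pull_pull[OF N vN[OF w] k S'.Idt_hvhom[OF B']] by (simp add: k'_def)
    qed
    then show ?thesis using S'.sheaf_pull_in[OF N vN[OF w] k] by (simp add: v_def)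
  qed
  have vI: "pull G' N U (Idt G' U) w = w" if "U \<in> Obj G'" "w \<in> v U" for U w
    using S'.sheaf_pull_Idt[OF N that(1) vN[OF that(2)]] .
  have vC: "pull G' N B k (pull G' N U h w) = pull G' N U (hvcmp G' h k) w"
    if "h \<in> hvhom G' B U" "k \<in> hvhom G' E B" "w \<in> v U" for U B E h k w
    using S'.sheaf_pull_pull[OF N vN[OF that(3)] that(1,2)] .
  have HP: "is_presheaf G' H"
    unfolding H_def by (rule S'.presheaf_of_pull(1)) (rule v_pull vI vC; assumption)+
  have Hp: "pull G' H U k w = pull G' N U k w" if "k \<in> hvhom G' B U" "w \<in> v U" for U B k w
    unfolding H_def using that by (intro S'.presheaf_of_pull(2)[where v = v]) (rule v_pull vI vC; assumption)+
  have Hv: "val H = v" by (simp add: H_def presheaf_of_pull_def)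
  have H: "is_sheaf G' T' H"
  proof (rule S'.is_sheafI[OF HP])
    fix U x y
    assume U: "U \<in> Obj G'" and "x \<in> val H U" "y \<in> val H U"
      and l: "locally T' U (\<lambda>B. pull G' H U (Idt G' B) x = pull G' H U (Idt G' B) y)"
    then have xy: "x \<in> v U" "y \<in> v U" by (simp_all add: Hv)
    show "x = y"
    proof (rule S'.sheaf_separated[OF N U vN[OF xy(1)] vN[OF xy(2)] S'.locally_mono[OF U l]])
      fix B assume "ole G' B U" "pull G' H U (Idt G' B) x = pull G' H U (Idt G' B) y"
      then show "pull G' N U (Idt G' B) x = pull G' N U (Idt G' B) y"
        using Hp[OF S'.Idt_hvhom] xy by simp
    qed
  next
    fix U S x
    assume U: "U \<in> Obj G'" and S: "S \<in> T' U" and "\<And>B. B \<in> S \<Longrightarrow> x B \<in> val H B"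
      and m: "\<And>B D. B \<in> S \<Longrightarrow> ole G' D B \<Longrightarrow> pull G' H B (Idt G' D) (x B) = x D"
    then have x: "\<And>B. B \<in> S \<Longrightarrow> x B \<in> v B" by (simp add: Hv)
    have "\<exists>y\<in>val N U. \<forall>B\<in>S. pull G' N U (Idt G' B) y = x B"
    proof (rule S'.sheaf_glue_family[OF N U S vN[OF x]])
      show "pull G' N B (Idt G' D) (x B) = x D" if "B \<in> S" "ole G' D B" for B D
        using m[OF that] Hp[OF S'.Idt_hvhom[OF that(2)] x[OF that(1)]] by simp
    qed
    then obtain y where y: "y \<in> val N U" "\<And>B. B \<in> S \<Longrightarrow> pull G' N U (Idt G' B) y = x B" by blast
    have "locally T' U (\<lambda>B. B \<in> S)" using S by (auto simp: locally_def)
    then have "locally T' U (\<lambda>U'. gen U' (pull G' N U (Idt G' U') y))"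
    proof (rule S'.locally_bind[OF U])
      fix B assume B: "ole G' B U" "B \<in> S"
      have BO: "B \<in> Obj G'" using S'.ole_Obj[OF B(1)] by simp
      have "locally T' B (\<lambda>U'. gen U' (pull G' N B (Idt G' U') (x B)))"
        using x[OF B(2)] by (simp add: v_def)
      then show "locally T' B (\<lambda>U'. gen U' (pull G' N U (Idt G' U') y))"
      proof (rule S'.locally_mono[OF BO])
        fix U' assume U': "ole G' U' B" "gen U' (pull G' N B (Idt G' U') (x B))"
        then show "gen U' (pull G' N U (Idt G' U') y)"
          using S'.sheaf_pull_pull[OF N y(1) S'.Idt_hvhom[OF B(1)] S'.Idt_hvhom[OF U'(1)]] y(2)[OF B(2)]
            S'.Idt_hvcmp[OF S'.Idt_hvhom[OF U'(1)]] by simp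
      qed
    qed
    then have yv: "y \<in> v U" using y(1) by (simp add: v_def)
    then show "\<exists>y\<in>val H U. \<forall>B\<in>S. pull G' H U (Idt G' B) y = x B"
      using y(2) Hp[OF S'.Idt_hvhom[OF S'.covering_le[OF U S]] yv] by (intro bexI[of _ y]) (simp_all add: Hv)
  qed
  have "\<exists>i\<in>hom (Sh G' T') H N. \<forall>U\<in>Obj G'. \<forall>w\<in>val H U. cmpt i U w = w"
    by (rule S'.Sh_mor_ex[OF H N]) (simp_all add: Hv vN Hp)
  then obtain i where i: "i \<in> hom (Sh G' T') H N" "\<And>U w. U \<in> Obj G' \<Longrightarrow> w \<in> v U \<Longrightarrow> cmpt i U w = w"
    by (auto simp: Hv)
  have ev: "cmpt (e F) A x \<in> v (on_obj M A)" if A: "A \<in> Obj G" and x: "x \<in> val F A" for A x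
  proof -
    note MA = fnctr_obj[OF A]
    have "locally T' (on_obj M A) (\<lambda>U'. gen U' (pull G' N (on_obj M A) (Idt G' U') (cmpt (e F) A x)))"
      unfolding gen_def using A x S'.Idt_hvhom by (intro S'.locally_all[OF MA]) blast
    then show ?thesis using eN[OF A x] by (simp add: v_def)
  qed
  have "\<exists>e'\<in>hom (Sh G T) F (presheaf_precomp M H). \<forall>A\<in>Obj G. \<forall>x\<in>val F A. cmpt e' A x = cmpt (e F) A x"
    by (rule S.Sh_mor_ex[OF F sheaf[OF H]])
      (simp_all add: Hv ev precomp_pull Hp[OF fnctr_hvhom] S.hvhom_Obj e_pull[OF F, folded N_def])
  then obtain e' where e': "e' \<in> hom (Sh G T) F (presheaf_precomp M H)"
    "\<And>A x. A \<in> Obj G \<Longrightarrow> x \<in> val F A \<Longrightarrow> cmpt e' A x = cmpt (e F) A x" by blast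
  have "H \<in> Obj (Sh G' T')" "e' \<in> hom (Sh G T) F (on_obj (precomp_functor G M) H)"
    using H e' by simp_all
  \<comment> \<open>Since the unit factors through the subsheaf \<open>H\<close>, universality
    induces \<open>k\<close> opposite to the inclusion \<open>i\<close>. The composite
    \<open>i\<close> after \<open>k\<close> fixes the unit, hence is the identity, and so
    \<open>i\<close> is onto.\<close>
  then obtain k where k: "k \<in> hom (Sh G' T') N H" "Cmp (Sh G T) (on_arr (precomp_functor G M) k) (e F) = e'"
    using univ[OF F] unfolding universal_arrow_def N_def by blast
  note eF = LD(2)[OF F, folded N_def]
  have "\<exists>!k. k \<in> hom (Sh G' T') N N \<and> Cmp (Sh G T) (on_arr (precomp_functor G M) k) (e F) = e F"
    using univ[OF F] N eF unfolding universal_arrow_def N_def by simp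
  then have "Cmp (Sh G' T') i k = Idt (Sh G' T') N"
  proof (rule ex1_unique)
    have R: "on_arr (precomp_functor G M) m \<in> hom (Sh G T) (presheaf_precomp M N) (presheaf_precomp M N)"
      if "m \<in> hom (Sh G' T') N N" for m
      using is_functor.fnctr_arr[OF R_functor that] by simp
    have app: "cmpt (Cmp (Sh G T) (on_arr (precomp_functor G M) m) (e F)) A x =
        cmpt m (on_obj M A) (cmpt (e F) A x)" if "A \<in> Obj G" "x \<in> val F A" for A x m
      using S.Sh_Cmp_apply[OF eF that, of "on_arr (precomp_functor G M) m"] that(1) by simp
    note ik = S'.Sh_Cmp[OF k(1) i(1)] and I = S'.Sh_Idt[OF N]
    show "Cmp (Sh G' T') i k \<in> hom (Sh G' T') N N \<and>
        Cmp (Sh G T) (on_arr (precomp_functor G M) (Cmp (Sh G' T') i k)) (e F) = e F"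
    proof (intro conjI ik S.Sh_mor_eqI[OF S.Sh_Cmp[OF eF R[OF ik]] eF])
      fix A x assume A: "A \<in> Obj G" and x: "x \<in> val F A"
      have "cmpt k (on_obj M A) (cmpt (e F) A x) = cmpt (e F) A x"
        using app[OF A x, of k] k(2) e'(2)[OF A x] by simp
      then show "cmpt (Cmp (Sh G T) (on_arr (precomp_functor G M) (Cmp (Sh G' T') i k)) (e F)) A x = cmpt (e F) A x"
        using app[OF A x] S'.Sh_Cmp_apply[OF k(1) fnctr_obj[OF A] eN[OF A x], of i]
          i(2)[OF fnctr_obj[OF A] ev[OF A x]] by simp
    qed
    show "Idt (Sh G' T') N \<in> hom (Sh G' T') N N \<and>
        Cmp (Sh G T) (on_arr (precomp_functor G M) (Idt (Sh G' T') N)) (e F) = e F"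
    proof (intro conjI I S.Sh_mor_eqI[OF S.Sh_Cmp[OF eF R[OF I]] eF])
      fix A x assume A: "A \<in> Obj G" and x: "x \<in> val F A"
      show "cmpt (Cmp (Sh G T) (on_arr (precomp_functor G M) (Idt (Sh G' T') N)) (e F)) A x = cmpt (e F) A x"
        using app[OF A x] S'.Sh_Idt_apply[OF fnctr_obj[OF A] eN[OF A x]] by simp
    qed
  qed
  then have "cmpt i U (cmpt k U z) = z"
    using S'.Sh_Cmp_apply[OF k(1) U, of z i] S'.Sh_Idt_apply[OF U, of z N] z by (simp add: N_def)
  moreover have kz: "cmpt k U z \<in> v U"
    using S'.Sh_mor_in[OF k(1) U] z by (simp add: N_def Hv)
  ultimately have "z \<in> v U" using i(2)[OF U kz] by simp
  then show ?thesis by (simp add: v_def gen_def N_def)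
qed

text \<open>A comparison in one direction suffices: the universal element of a representable sheaf
  on \<open>on_obj M A\<close> induces a morphism from \<open>on_obj L Y\<close> that hits it, so
  arrows identified in \<open>on_obj L Y\<close> are identified there, that is, locally
  equal.\<close>

lemma e_representable:
  assumes A: "A \<in> Obj G" and Y: "represents G T A (Y :: ('o, 'a, 'u) presheaf) u"
    and f: "f \<in> hvhom G' U (on_obj M A)" and g: "g \<in> hvhom G' U (on_obj M A)"
    and eq: "pull G' (on_obj L Y) (on_obj M A) f (cmpt (e Y) A u) =
      pull G' (on_obj L Y) (on_obj M A) g (cmpt (e Y) A u)"
  shows "locally T' U (\<lambda>B. hvcmp G' f (Idt G' B) = hvcmp G' g (Idt G' B))"
proof -
  have Ys: "is_sheaf G T Y" and u: "u \<in> val Y A" using Y by (auto simp: represents_def)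
  obtain Y' :: "('p, 'b, 'u) presheaf" and u' where Y': "represents G' T' (on_obj M A) Y' u'"
    using S'.representable_sheaf[OF small(2) fnctr_obj[OF A]] by blast
  have Y's: "is_sheaf G' T' Y'" and u': "u' \<in> val Y' (on_obj M A)" using Y' by (auto simp: represents_def)
  have "\<exists>m\<in>hom (Sh G T) Y (presheaf_precomp M Y'). cmpt m A u = u'"
    using Y sheaf[OF Y's] u' unfolding represents_def by simp
  then obtain m where m: "m \<in> hom (Sh G T) Y (presheaf_precomp M Y')" "cmpt m A u = u'" by blast
  have "Y' \<in> Obj (Sh G' T')" "m \<in> hom (Sh G T) Y (on_obj (precomp_functor G M) Y')"
    using Y's m by simp_all
  then obtain k where k: "k \<in> hom (Sh G' T') (on_obj L Y) Y'"
    "Cmp (Sh G T) (on_arr (precomp_functor G M) k) (e Y) = m"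
    using univ[OF Ys] unfolding universal_arrow_def by blast
  have ku: "cmpt k (on_obj M A) (cmpt (e Y) A u) = u'"
    using S.Sh_Cmp_apply[OF LD(2)[OF Ys] A u, of "on_arr (precomp_functor G M) k"] k(2) m(2) A by simp
  have "pull G' Y' (on_obj M A) f u' = pull G' Y' (on_obj M A) g u'"
    using S'.Sh_mor_pull[OF k(1) f e_in[OF Ys A u]] S'.Sh_mor_pull[OF k(1) g e_in[OF Ys A u]] eq ku by simp
  then show ?thesis
    using Y' f g unfolding represents_def by blast
qed

text \<open>Limits are taken over ordinary categories, so the shape \<open>I\<close> is replaced by
  its left cancellative category. The cover of \<open>U\<close> is refined three times: to make the
  limit section a generator, to turn its stage into an hv-cone, and to pass from equal sections to
  equal arrows.\<close>

lemma hv_cones_lift: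
  fixes I :: "(nat, nat) ordered_groupoid"
  assumes D: "is_double_functor I G D" and fin: "finite (Obj I)" "finite (Arr I)"
    and c: "is_hv_cone I G' (fnctr_comp M D) U \<xi>"
  shows "locally T' U (\<lambda>U'. \<exists>V \<theta> k. is_hv_cone I G D V \<theta> \<and> k \<in> hvhom G' U' (on_obj M V) \<and>
      (\<forall>i\<in>Obj I. hvcmp G' (on_arr M (\<theta> i)) k = hvcmp G' (\<xi> i) (Idt G' U')))"
proof -
  interpret D: is_double_functor I G D by (rule D)
  define J where "J = hv_category I"
  have J: "is_category J" "finite (Obj J)" "finite (Arr J)"
    using hv_category hv_category_finite D.source.is_ordered_groupoid_axioms fin by (simp_all add: J_def)
  have JO: "Obj J = Obj I" by (simp add: J_def hv_category_def)
  define hv where "hv w = fst (prod_decode w)" for w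
  have Jhom: "w \<in> hom J i i' \<longleftrightarrow> hv w \<in> hvhom I i i' \<and> snd (prod_decode w) = i'" for w i i'
    by (simp add: J_def hv_category_hom hv_def)
  have JC: "hv (Idt J i) = Idt I i" "hv (Cmp J w' w) = hvcmp I (hv w') (hv w)" for i w w'
    by (simp_all add: J_def hv_category_def hv_def)
  have DO: "on_obj D i \<in> Obj G" if "i \<in> Obj I" for i using D.fnctr_obj[OF that] .
  have "\<exists>(Y :: ('o, 'a, 'u) presheaf) u. represents G T (on_obj D i) Y u" if "i \<in> Obj I" for i
    using S.representable_sheaf[OF small(1) DO[OF that]] .
  then obtain Y :: "nat \<Rightarrow> ('o, 'a, 'u) presheaf" and u
    where Y: "\<And>i. i \<in> Obj I \<Longrightarrow> represents G T (on_obj D i) (Y i) (u i)"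
    by metis
  have Ys: "is_sheaf G T (Y i)" and u: "u i \<in> val (Y i) (on_obj D i)" if "i \<in> Obj I" for i
    using Y[OF that] by (auto simp: represents_def)
  have YD: "\<exists>m\<in>hom (Sh G T) (Y i) F. cmpt m (on_obj D i) (u i) = y"
    if "i \<in> Obj I" "is_sheaf G T F" "y \<in> val F (on_obj D i)" for i F y
    using Y[OF that(1)] that(2,3) unfolding represents_def by blast
  have Dhv: "on_arr D \<alpha> \<in> hvhom G (on_obj D i) (on_obj D i')" if "\<alpha> \<in> hvhom I i i'" for \<alpha> i i'
    using D.fnctr_hvhom[OF that] .
  \<comment> \<open>By the Yoneda property the arrow \<open>on_arr D (hv w)\<close> induces a
    morphism of representable sheaves. Its value on the universal element determines it by
    \<open>represents_mor_eqI\<close>, and functoriality of \<open>K\<close> is checked on these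
    values.\<close>
  define Ka where "Ka w = (SOME m. m \<in> hom (Sh G T) (Y (Dom J w)) (Y (Cod J w)) \<and>
    cmpt m (on_obj D (Dom J w)) (u (Dom J w)) =
      pull G (Y (Cod J w)) (on_obj D (Cod J w)) (on_arr D (hv w)) (u (Cod J w)))" for w
  have Ka: "Ka w \<in> hom (Sh G T) (Y i) (Y i')"
    "cmpt (Ka w) (on_obj D i) (u i) = pull G (Y i') (on_obj D i') (on_arr D (hv w)) (u i')"
    if w: "w \<in> hom J i i'" for w i i'
  proof -
    have \<alpha>: "hv w \<in> hvhom I i i'" using w Jhom by simp
    have O: "i \<in> Obj I" "i' \<in> Obj I" using D.source.hvhom_Obj[OF \<alpha>] by auto
    have dc: "Dom J w = i" "Cod J w = i'" using w by (auto simp: hom_def)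
    have "\<exists>m. m \<in> hom (Sh G T) (Y i) (Y i') \<and> cmpt m (on_obj D i) (u i) =
        pull G (Y i') (on_obj D i') (on_arr D (hv w)) (u i')"
      using YD[OF O(1) Ys[OF O(2)] S.sheaf_pull_in[OF Ys[OF O(2)] u[OF O(2)] Dhv[OF \<alpha>]]] by blast
    from someI_ex[OF this] show "Ka w \<in> hom (Sh G T) (Y i) (Y i')"
      "cmpt (Ka w) (on_obj D i) (u i) = pull G (Y i') (on_obj D i') (on_arr D (hv w)) (u i')"
      unfolding Ka_def dc by auto
  qed
  define K where "K = \<lparr>on_obj = Y, on_arr = Ka\<rparr>"
  have Ksel: "on_obj K = Y" "on_arr K = Ka" by (simp_all add: K_def)
  have K: "is_functor J (Sh G T) K"
  proof (intro is_functor.intro is_functor_axioms.intro J(1) S.Sh_category)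
    fix i assume i: "i \<in> Obj J"
    then have i': "i \<in> Obj I" by (simp add: JO)
    show "on_obj K i \<in> Obj (Sh G T)" using Ys[OF i'] by (simp add: Ksel)
    have Ii: "Idt J i \<in> hom J i i" using is_category.Idt_hom[OF J(1) i] .
    show "on_arr K (Idt J i) = Idt (Sh G T) (on_obj K i)"
      unfolding Ksel
    proof (rule S.represents_mor_eqI[OF Y[OF i'] Ka(1)[OF Ii] S.Sh_Idt[OF Ys[OF i']]])
      show "cmpt (Ka (Idt J i)) (on_obj D i) (u i) = cmpt (Idt (Sh G T) (Y i)) (on_obj D i) (u i)"
        using Ka(2)[OF Ii] S.Sh_Idt_apply[OF DO[OF i'] u[OF i']] D.fnctr_Idt[OF i']
          S.sheaf_pull_Idt[OF Ys[OF i'] DO[OF i'] u[OF i']] by (simp add: JC)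
    qed
  next
    fix i i' w assume "w \<in> hom J i i'"
    then show "on_arr K w \<in> hom (Sh G T) (on_obj K i) (on_obj K i')"
      using Ka(1) by (simp add: Ksel)
  next
    fix i i' i'' w w' assume w: "w \<in> hom J i i'" and w': "w' \<in> hom J i' i''"
    have ww: "Cmp J w' w \<in> hom J i i''" using is_category.Cmp_hom[OF J(1) w w'] .
    have \<alpha>: "hv w \<in> hvhom I i i'" and \<alpha>': "hv w' \<in> hvhom I i' i''" using w w' Jhom by auto
    have O: "i \<in> Obj I" "i' \<in> Obj I" "i'' \<in> Obj I"
      using D.source.hvhom_Obj[OF \<alpha>] D.source.hvhom_Obj[OF \<alpha>'] by auto
    show "on_arr K (Cmp J w' w) = Cmp (Sh G T) (on_arr K w') (on_arr K w)"
      unfolding Ksel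
    proof (rule S.represents_mor_eqI[OF Y[OF O(1)] Ka(1)[OF ww] S.Sh_Cmp[OF Ka(1)[OF w] Ka(1)[OF w']]])
      have "cmpt (Cmp (Sh G T) (Ka w') (Ka w)) (on_obj D i) (u i) =
          cmpt (Ka w') (on_obj D i) (pull G (Y i') (on_obj D i') (on_arr D (hv w)) (u i'))"
        using S.Sh_Cmp_apply[OF Ka(1)[OF w] DO[OF O(1)] u[OF O(1)], of "Ka w'"] Ka(2)[OF w] by simp
      also have "\<dots> = pull G (Y i'') (on_obj D i') (on_arr D (hv w))
          (pull G (Y i'') (on_obj D i'') (on_arr D (hv w')) (u i''))"
        using S.Sh_mor_pull[OF Ka(1)[OF w'] Dhv[OF \<alpha>] u[OF O(2)]] Ka(2)[OF w'] by simp
      also have "\<dots> = pull G (Y i'') (on_obj D i'') (on_arr D (hv (Cmp J w' w))) (u i'')"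
        using S.sheaf_pull_pull[OF Ys[OF O(3)] u[OF O(3)] Dhv[OF \<alpha>'] Dhv[OF \<alpha>]] D.fnctr_hvcmp[OF \<alpha> \<alpha>']
        by (simp add: JC)
      finally show "cmpt (Ka (Cmp J w' w)) (on_obj D i) (u i) =
          cmpt (Cmp (Sh G T) (Ka w') (Ka w)) (on_obj D i) (u i)"
        using Ka(2)[OF ww] by simp
    qed
  qed
  \<comment> \<open>Elements of this limit are compatible families of sections of the
    representables: hv-cones over \<open>D\<close>, up to localization.\<close>
  obtain W q where Wq: "pointwise_limit G T J K W q"
    using S.pointwise_limit_exists[OF K J(2) infinite_univ] by blast
  have cW: "is_cone J (Sh G T) K W q" using Wq by (simp add: pointwise_limit_def)
  have Ws: "is_sheaf G T W" using cW by (simp add: is_cone_def)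
  have q: "q i \<in> hom (Sh G T) W (Y i)" if "i \<in> Obj I" for i
    using cW that by (simp add: is_cone_def JO Ksel)
  have "is_limit_cone J (Sh G' T') (fnctr_comp L K) (on_obj L W) (on_arr L \<circ> q)"
    using lim J K S.pointwise_limit_imp_limit[OF J(1) Wq] unfolding preserves_finite_limits_def by blast
  from S'.limit_imp_pointwise_limit[OF is_functor_comp[OF K L] J(2) infinite_univ this]
  have Lex: "\<And>x. U \<in> Obj G' \<Longrightarrow> matching J (fnctr_comp L K) U x \<Longrightarrow>
      \<exists>!z. z \<in> val (on_obj L W) U \<and> (\<forall>j\<in>Obj J. cmpt ((on_arr L \<circ> q) j) U z = x j)"
    by (simp add: pointwise_limit_def)
  have c': "U \<in> Obj G' \<and> (\<forall>i\<in>Obj I. \<xi> i \<in> hvhom G' U (on_obj M (on_obj D i))) \<and>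
     (\<forall>i i' \<alpha>. \<alpha> \<in> hom I i i' \<longrightarrow> hvcmp G' (on_arr M (on_arr D \<alpha>)) (\<xi> i) = \<xi> i') \<and>
     (\<forall>i i'. ole I i i' \<longrightarrow> \<xi> i = \<xi> i')"
    using c is_double_functor.hv_cone_iff[OF D.double_functor_comp[OF is_double_functor_axioms], of U \<xi>]
    by (simp add: fnctr_comp_def)
  then have U: "U \<in> Obj G'" and \<xi>: "\<And>i. i \<in> Obj I \<Longrightarrow> \<xi> i \<in> hvhom G' U (on_obj M (on_obj D i))" by auto
  have \<xi>\<alpha>: "hvcmp G' (on_arr M (on_arr D \<alpha>)) (\<xi> i) = \<xi> i'" if "\<alpha> \<in> hvhom I i i'" for \<alpha> i i'
  proof -
    have "\<alpha> \<in> hom I i (Cod I \<alpha>)" "ole I (Cod I \<alpha>) i'" using that by (auto simp: hvhom_def hom_def)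
    then show ?thesis using c' by metis
  qed
  note eY = e_in[OF Ys DO u]
  \<comment> \<open>The given hv-cone as a family of sections: each \<open>\<xi> i\<close> pulls
    back the image of the universal element, and the cone equations become the matching
    condition.\<close>
  define x where "x i = pull G' (on_obj L (Y i)) (on_obj M (on_obj D i)) (\<xi> i) (cmpt (e (Y i)) (on_obj D i) (u i))" for i
  have xv: "x i \<in> val (on_obj L (Y i)) U" if "i \<in> Obj I" for i
    using S'.sheaf_pull_in[OF LD(1)[OF Ys[OF that]] eY[OF that that that] \<xi>[OF that]] by (simp add: x_def)
  have "matching J (fnctr_comp L K) U x"
    unfolding matching_def
  proof (intro conjI ballI)
    show "x i \<in> val (on_obj (fnctr_comp L K) i) U" if "i \<in> Obj J" for i
      using xv that by (simp add: JO fnctr_comp_def Ksel)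
    fix w assume "w \<in> Arr J"
    then have w: "w \<in> hom J (Dom J w) (Cod J w)" by (simp add: hom_def)
    then have \<alpha>: "hv w \<in> hvhom I (Dom J w) (Cod J w)" using Jhom by simp
    define i where "i = Dom J w"
    define i' where "i' = Cod J w"
    note w = w[folded i_def i'_def] and \<alpha> = \<alpha>[folded i_def i'_def]
    have O: "i \<in> Obj I" "i' \<in> Obj I" using D.source.hvhom_Obj[OF \<alpha>] by auto
    have "cmpt (on_arr L (Ka w)) U (x i) = pull G' (on_obj L (Y i')) (on_obj M (on_obj D i)) (\<xi> i)
        (cmpt (e (Y i')) (on_obj D i) (pull G (Y i') (on_obj D i') (on_arr D (hv w)) (u i')))"
      using S'.Sh_mor_pull[OF L_mor_hom[OF Ka(1)[OF w]] \<xi>[OF O(1)] eY[OF O(1) O(1) O(1)]]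
        L_e[OF Ka(1)[OF w] DO[OF O(1)] u[OF O(1)]] Ka(2)[OF w] by (simp add: x_def)
    also have "\<dots> = pull G' (on_obj L (Y i')) (on_obj M (on_obj D i)) (\<xi> i)
        (pull G' (on_obj L (Y i')) (on_obj M (on_obj D i')) (on_arr M (on_arr D (hv w)))
          (cmpt (e (Y i')) (on_obj D i') (u i')))"
      using e_pull[OF Ys[OF O(2)] Dhv[OF \<alpha>] u[OF O(2)]] by simp
    also have "\<dots> = x i'"
      using S'.sheaf_pull_pull[OF LD(1)[OF Ys[OF O(2)]] eY[OF O(2) O(2) O(2)] fnctr_hvhom[OF Dhv[OF \<alpha>]] \<xi>[OF O(1)]]
        \<xi>\<alpha>[OF \<alpha>] by (simp add: x_def)
    finally show "cmpt (on_arr (fnctr_comp L K) w) U (x (Dom J w)) = x (Cod J w)"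
      by (simp add: fnctr_comp_def Ksel i_def i'_def)
  qed
  from Lex[OF U this] obtain z where z: "z \<in> val (on_obj L W) U"
    and zx: "\<And>i. i \<in> Obj I \<Longrightarrow> cmpt (on_arr L (q i)) U z = x i"
    by (auto simp: JO)
  \<comment> \<open>A section of \<open>W\<close> gives local arrows \<open>t i\<close>. Their cone
    equations hold between sections of the representables, hence locally between the arrows
    themselves, and finiteness of \<open>Arr J\<close> allows one cover for all of them.\<close>
  have cones: "locally T V (\<lambda>V'. \<exists>\<theta>. is_hv_cone I G D V' \<theta> \<and>
      (\<forall>i\<in>Obj I. pull G (Y i) V (Idt G V') (cmpt (q i) V w) = pull G (Y i) (on_obj D i) (\<theta> i) (u i)))"
    if V: "V \<in> Obj G" and w: "w \<in> val W V" for V w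
  proof -
    have qw: "cmpt (q i) V w \<in> val (Y i) V" if "i \<in> Obj I" for i using S.Sh_mor_in[OF q[OF that] V w] .
    have "locally T V (\<lambda>B. \<forall>i\<in>Obj I. \<exists>t\<in>hvhom G B (on_obj D i).
        pull G (Y i) V (Idt G B) (cmpt (q i) V w) = pull G (Y i) (on_obj D i) t (u i))"
    proof (rule S.locally_finite_ball[OF V fin(1)])
      fix i assume i: "i \<in> Obj I"
      show "locally T V (\<lambda>B. \<exists>t\<in>hvhom G B (on_obj D i).
          pull G (Y i) V (Idt G B) (cmpt (q i) V w) = pull G (Y i) (on_obj D i) t (u i))"
        using Y[OF i] V qw[OF i] unfolding represents_def by blast
    qed
    then show ?thesis
    proof (rule S.locally_bind[OF V])
      fix B assume B: "ole G B V" and "\<forall>i\<in>Obj I. \<exists>t\<in>hvhom G B (on_obj D i).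
        pull G (Y i) V (Idt G B) (cmpt (q i) V w) = pull G (Y i) (on_obj D i) t (u i)"
      then obtain t where t: "\<And>i. i \<in> Obj I \<Longrightarrow> t i \<in> hvhom G B (on_obj D i)"
        and tu: "\<And>i. i \<in> Obj I \<Longrightarrow> pull G (Y i) V (Idt G B) (cmpt (q i) V w) = pull G (Y i) (on_obj D i) (t i) (u i)"
        by metis
      have BO: "B \<in> Obj G" using S.ole_Obj[OF B] by simp
      define E where "E a B' \<longleftrightarrow> hvcmp G (hvcmp G (on_arr D (hv a)) (t (Dom J a))) (Idt G B') =
        hvcmp G (t (Cod J a)) (Idt G B')" for a B'
      have "locally T B (\<lambda>B'. \<forall>a\<in>Arr J. E a B')"
      proof (rule S.locally_finite_ball[OF BO J(3)])
        fix a assume "a \<in> Arr J"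
        then have a: "a \<in> hom J (Dom J a) (Cod J a)" by (simp add: hom_def)
        define i where "i = Dom J a"
        define i' where "i' = Cod J a"
        note a = a[folded i_def i'_def]
        have \<alpha>: "hv a \<in> hvhom I i i'" using a Jhom by simp
        have O: "i \<in> Obj I" "i' \<in> Obj I" using D.source.hvhom_Obj[OF \<alpha>] by auto
        have "cmpt (Ka a) V (cmpt (q i) V w) = cmpt (q i') V w"
          using S.cone_matching[OF J(1) cW V w] \<open>a \<in> Arr J\<close> by (simp add: matching_def Ksel i_def i'_def)
        then have "pull G (Y i') (on_obj D i') (t i') (u i') =
            cmpt (Ka a) B (pull G (Y i) (on_obj D i) (t i) (u i))"
          using S.Sh_mor_pull[OF Ka(1)[OF a] S.Idt_hvhom[OF B] qw[OF O(1)]] tu O by simp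
        also have "\<dots> = pull G (Y i') (on_obj D i) (t i) (pull G (Y i') (on_obj D i') (on_arr D (hv a)) (u i'))"
          using S.Sh_mor_pull[OF Ka(1)[OF a] t[OF O(1)] u[OF O(1)]] Ka(2)[OF a] by simp
        also have "\<dots> = pull G (Y i') (on_obj D i') (hvcmp G (on_arr D (hv a)) (t i)) (u i')"
          using S.sheaf_pull_pull[OF Ys[OF O(2)] u[OF O(2)] Dhv[OF \<alpha>] t[OF O(1)]] .
        finally have "pull G (Y i') (on_obj D i') (hvcmp G (on_arr D (hv a)) (t i)) (u i') =
          pull G (Y i') (on_obj D i') (t i') (u i')" by simp
        then have "locally T B (\<lambda>B'. hvcmp G (hvcmp G (on_arr D (hv a)) (t i)) (Idt G B') = hvcmp G (t i') (Idt G B'))"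
          using Y[OF O(2)] S.hvcmp_hvhom[OF t[OF O(1)] Dhv[OF \<alpha>]] t[OF O(2)] unfolding represents_def by blast
        then show "locally T B (E a)" unfolding E_def i_def i'_def .
      qed
      then show "locally T B (\<lambda>V'. \<exists>\<theta>. is_hv_cone I G D V' \<theta> \<and>
        (\<forall>i\<in>Obj I. pull G (Y i) V (Idt G V') (cmpt (q i) V w) = pull G (Y i) (on_obj D i) (\<theta> i) (u i)))"
      proof (rule S.locally_mono[OF BO])
        fix V' assume V': "ole G V' B" and E: "\<forall>a\<in>Arr J. E a V'"
        note iV = S.Idt_hvhom[OF V']
        define \<theta> where "\<theta> i = hvcmp G (t i) (Idt G V')" for i
        have \<theta>\<alpha>: "hvcmp G (on_arr D \<alpha>) (\<theta> i) = \<theta> i'" if \<alpha>: "\<alpha> \<in> hvhom I i i'" for \<alpha> i i'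
        proof -
          have O: "i \<in> Obj I" "i' \<in> Obj I" using D.source.hvhom_Obj[OF \<alpha>] by auto
          have a: "prod_encode (\<alpha>, i') \<in> hom J i i'"
            using hv_category_hom_encode[OF \<alpha>] by (simp add: J_def)
          then have "E (prod_encode (\<alpha>, i')) V'" using E by (simp add: hom_def)
          then show ?thesis
            using a S.hvcmp_move[OF Dhv[OF \<alpha>] t[OF O(1)] V'] by (simp add: E_def \<theta>_def hv_def hom_def)
        qed
        have \<theta>: "\<theta> i \<in> hvhom G V' (on_obj D i)" if "i \<in> Obj I" for i
          using S.hvcmp_hvhom[OF iV t[OF that]] by (simp add: \<theta>_def)
        have "is_hv_cone I G D V' \<theta>"
          unfolding D.hv_cone_iff
        proof (intro conjI ballI allI impI \<theta>)
          show "V' \<in> Obj G" using S.ole_Obj[OF V'] by simp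
          show "hvcmp G (on_arr D \<alpha>) (\<theta> i) = \<theta> i'" if "\<alpha> \<in> hom I i i'" for i i' \<alpha>
            using \<theta>\<alpha>[OF D.source.hom_hvhom[OF that]] .
          show "\<theta> i = \<theta> i'" if l: "ole I i i'" for i i'
          proof -
            have i: "i \<in> Obj I" using D.source.ole_Obj[OF l] by simp
            show ?thesis
              using \<theta>\<alpha>[OF D.source.Idt_hvhom[OF l]] D.fnctr_Idt[OF i] S.Idt_hvcmp[OF \<theta>[OF i]] by simp
          qed
        qed
        moreover have "pull G (Y i) V (Idt G V') (cmpt (q i) V w) = pull G (Y i) (on_obj D i) (\<theta> i) (u i)"
          if i: "i \<in> Obj I" for i
          using S.sheaf_pull_pull[OF Ys[OF i] qw[OF i] S.Idt_hvhom[OF B] iV] S.Idt_hvcmp[OF iV] tu[OF i]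
            S.sheaf_pull_pull[OF Ys[OF i] u[OF i] t[OF i] iV] by (simp add: \<theta>_def)
        ultimately show "\<exists>\<theta>. is_hv_cone I G D V' \<theta> \<and>
          (\<forall>i\<in>Obj I. pull G (Y i) V (Idt G V') (cmpt (q i) V w) = pull G (Y i) (on_obj D i) (\<theta> i) (u i))"
          by blast
      qed
    qed
  qed
  show ?thesis
  proof (rule S'.locally_bind[OF U L_generated[OF Ws U z]])
    fix U1 assume U1: "ole G' U1 U" and "\<exists>V h w. V \<in> Obj G \<and> h \<in> hvhom G' U1 (on_obj M V) \<and> w \<in> val W V \<and>
      pull G' (on_obj L W) U (Idt G' U1) z = pull G' (on_obj L W) (on_obj M V) h (cmpt (e W) V w)"
    then obtain V h w where V: "V \<in> Obj G" and h: "h \<in> hvhom G' U1 (on_obj M V)" and w: "w \<in> val W V"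
      and zw: "pull G' (on_obj L W) U (Idt G' U1) z = pull G' (on_obj L W) (on_obj M V) h (cmpt (e W) V w)"
      by blast
    have U1O: "U1 \<in> Obj G'" using S'.ole_Obj[OF U1] by simp
    \<comment> \<open>The cover that yields hv-cones lives on \<open>V\<close>. Preservation of
      covers, already established, carries it to the image of \<open>V\<close>, and pulling back
      along \<open>h\<close> brings it to \<open>U1\<close>.\<close>
    note l = S'.locally_pull[OF locally_fnctr[OF covering_preserving V cones[OF V w]] h]
    show "locally T' U1 (\<lambda>U'. \<exists>V \<theta> k. is_hv_cone I G D V \<theta> \<and> k \<in> hvhom G' U' (on_obj M V) \<and>
      (\<forall>i\<in>Obj I. hvcmp G' (on_arr M (\<theta> i)) k = hvcmp G' (\<xi> i) (Idt G' U')))"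
    proof (rule S'.locally_bind[OF U1O l])
      fix U2 assume U2: "ole G' U2 U1"
      define k where "k = hvcmp G' h (Idt G' U2)"
      assume "\<exists>V'. ole G V' V \<and> (\<exists>\<theta>. is_hv_cone I G D V' \<theta> \<and>
        (\<forall>i\<in>Obj I. pull G (Y i) V (Idt G V') (cmpt (q i) V w) = pull G (Y i) (on_obj D i) (\<theta> i) (u i))) \<and>
        ole G' (Cod G' (hvcmp G' h (Idt G' U2))) (on_obj M V')"
      then obtain V' \<theta> where V': "ole G V' V" and \<theta>c: "is_hv_cone I G D V' \<theta>"
        and \<theta>u: "\<And>i. i \<in> Obj I \<Longrightarrow> pull G (Y i) V (Idt G V') (cmpt (q i) V w) = pull G (Y i) (on_obj D i) (\<theta> i) (u i)"
        and kle: "ole G' (Cod G' k) (on_obj M V')"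
        unfolding k_def by blast
      have V'O: "V' \<in> Obj G" using S.ole_Obj[OF V'] by simp
      have k: "k \<in> hvhom G' U2 (on_obj M V')"
        using S'.hvcmp_hvhom[OF S'.Idt_hvhom[OF U2] h] kle by (auto simp: k_def hvhom_def)
      have \<theta>: "\<theta> i \<in> hvhom G V' (on_obj D i)" if "i \<in> Obj I" for i
        using \<theta>c that by (simp add: D.hv_cone_iff)
      have U2O: "U2 \<in> Obj G'" using S'.ole_Obj[OF U2] by simp
      have U20: "ole G' U2 U" using S'.ole_trans[OF U2 U1] .
      note iV = S.Idt_hvhom[OF V'] and i2 = S'.Idt_hvhom[OF U2] and i20 = S'.Idt_hvhom[OF U20]
      define w' where "w' = pull G W V (Idt G V') w"
      have w': "w' \<in> val W V'" using S.sheaf_pull_in[OF Ws w iV] by (simp add: w'_def)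
      have z2: "pull G' (on_obj L W) U (Idt G' U2) z = pull G' (on_obj L W) (on_obj M V') k (cmpt (e W) V' w')"
      proof -
        note LW = LD(1)[OF Ws] and eW = e_in[OF Ws V w]
        have "pull G' (on_obj L W) U (Idt G' U2) z =
            pull G' (on_obj L W) U1 (Idt G' U2) (pull G' (on_obj L W) U (Idt G' U1) z)"
          using S'.sheaf_pull_pull[OF LW z S'.Idt_hvhom[OF U1] i2] S'.Idt_hvcmp[OF i2] by simp
        also have "\<dots> = pull G' (on_obj L W) (on_obj M V) k (cmpt (e W) V w)"
          using S'.sheaf_pull_pull[OF LW eW h i2] zw by (simp add: k_def)
        \<comment> \<open>The arrow \<open>k\<close> factors through the image of the inclusion of
          \<open>V'\<close> into \<open>V\<close>, so naturality of the unit replaces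
          \<open>w\<close> by its restriction \<open>w'\<close>.\<close>
        also have "k = hvcmp G' (on_arr M (Idt G V')) k"
          using S'.Idt_hvcmp[OF k] fnctr_Idt[OF V'O] by simp
        also have "pull G' (on_obj L W) (on_obj M V) (hvcmp G' (on_arr M (Idt G V')) k) (cmpt (e W) V w) =
            pull G' (on_obj L W) (on_obj M V') k (cmpt (e W) V' w')"
          using S'.sheaf_pull_pull[OF LW eW fnctr_hvhom[OF iV] k] e_pull[OF Ws iV w] by (simp add: w'_def)
        finally show ?thesis .
      qed
      have eq: "pull G' (on_obj L (Y i)) (on_obj M (on_obj D i)) (hvcmp G' (on_arr M (\<theta> i)) k) (cmpt (e (Y i)) (on_obj D i) (u i)) =
          pull G' (on_obj L (Y i)) (on_obj M (on_obj D i)) (hvcmp G' (\<xi> i) (Idt G' U2)) (cmpt (e (Y i)) (on_obj D i) (u i))"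
        if i: "i \<in> Obj I" for i
      proof -
        note LY = LD(1)[OF Ys[OF i]] and ei = eY[OF i i i] and Lq = L_mor_hom[OF q[OF i]]
        have "pull G' (on_obj L (Y i)) (on_obj M (on_obj D i)) (hvcmp G' (\<xi> i) (Idt G' U2)) (cmpt (e (Y i)) (on_obj D i) (u i)) =
            pull G' (on_obj L (Y i)) U (Idt G' U2) (cmpt (on_arr L (q i)) U z)"
          using S'.sheaf_pull_pull[OF LY ei \<xi>[OF i] i20] zx[OF i] by (simp add: x_def)
        also have "\<dots> = cmpt (on_arr L (q i)) U2 (pull G' (on_obj L W) (on_obj M V') k (cmpt (e W) V' w'))"
          using S'.Sh_mor_pull[OF Lq i20 z] z2 by simp
        also have "\<dots> = pull G' (on_obj L (Y i)) (on_obj M V') k (cmpt (e (Y i)) V' (cmpt (q i) V' w'))"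
          using S'.Sh_mor_pull[OF Lq k e_in[OF Ws V'O w']] L_e[OF q[OF i] V'O w'] by simp
        also have "cmpt (q i) V' w' = pull G (Y i) (on_obj D i) (\<theta> i) (u i)"
          using S.Sh_mor_pull[OF q[OF i] iV w] \<theta>u[OF i] by (simp add: w'_def)
        also have "pull G' (on_obj L (Y i)) (on_obj M V') k (cmpt (e (Y i)) V' (pull G (Y i) (on_obj D i) (\<theta> i) (u i))) =
            pull G' (on_obj L (Y i)) (on_obj M (on_obj D i)) (hvcmp G' (on_arr M (\<theta> i)) k) (cmpt (e (Y i)) (on_obj D i) (u i))"
          using e_pull[OF Ys[OF i] \<theta>[OF i] u[OF i]] S'.sheaf_pull_pull[OF LY ei fnctr_hvhom[OF \<theta>[OF i]] k] by simp
        finally show ?thesis by simp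
      qed
      have "locally T' U2 (\<lambda>U3. \<forall>i\<in>Obj I. hvcmp G' (hvcmp G' (on_arr M (\<theta> i)) k) (Idt G' U3) =
          hvcmp G' (hvcmp G' (\<xi> i) (Idt G' U2)) (Idt G' U3))"
        by (rule S'.locally_finite_ball[OF U2O fin(1)], rule e_representable[OF DO Y _ _ eq])
          (use S'.hvcmp_hvhom[OF k fnctr_hvhom[OF \<theta>]] S'.hvcmp_hvhom[OF i20 \<xi>] in auto)
      then show "locally T' U2 (\<lambda>U'. \<exists>V \<theta> k. is_hv_cone I G D V \<theta> \<and> k \<in> hvhom G' U' (on_obj M V) \<and>
        (\<forall>i\<in>Obj I. hvcmp G' (on_arr M (\<theta> i)) k = hvcmp G' (\<xi> i) (Idt G' U')))"
      proof (rule S'.locally_mono[OF U2O])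
        fix U3 assume U3: "ole G' U3 U2" and "\<forall>i\<in>Obj I. hvcmp G' (hvcmp G' (on_arr M (\<theta> i)) k) (Idt G' U3) =
          hvcmp G' (hvcmp G' (\<xi> i) (Idt G' U2)) (Idt G' U3)"
        then have "\<forall>i\<in>Obj I. hvcmp G' (on_arr M (\<theta> i)) (hvcmp G' k (Idt G' U3)) = hvcmp G' (\<xi> i) (Idt G' U3)"
          using S'.hvcmp_move[OF fnctr_hvhom[OF \<theta>] k U3] S'.hvcmp_Idt_Idt[OF \<xi> U20 U3] by simp
        then show "\<exists>V \<theta> k. is_hv_cone I G D V \<theta> \<and> k \<in> hvhom G' U3 (on_obj M V) \<and>
          (\<forall>i\<in>Obj I. hvcmp G' (on_arr M (\<theta> i)) k = hvcmp G' (\<xi> i) (Idt G' U3))"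
          using \<theta>c S'.hvcmp_hvhom[OF S'.Idt_hvhom[OF U3] k] by blast
      qed
    qed
  qed
qed

lemma covering_flat: "covering_flat G G' T' M"
  unfolding covering_flat_iff using hv_cones_lift by blast

end

theorem theorem6p15:
  fixes G :: "('o, 'a) ordered_groupoid" and T :: "'o \<Rightarrow> 'o set set"
    and G' :: "('p, 'b) ordered_groupoid" and T' :: "'p \<Rightarrow> 'p set set"
    and M :: "('o, 'a, 'p, 'b) fnctr"
  assumes "is_Ehresmann_site G T" and "is_Ehresmann_site G' T'"
    and "is_double_functor G G' M"
    and "small_groupoid TYPE('u) G" and "small_groupoid TYPE('u) G'"
  shows "((\<forall>F :: ('p, 'b, 'u) presheaf. is_sheaf G' T' F \<longrightarrow> is_sheaf G T (presheaf_precomp M F)) \<and>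
          (\<exists>L. is_geometric_morphism
                 (Sh G' T' :: (('p, 'b, 'u) presheaf, ('p, 'b, 'u) presheaf_mor) category)
                 (Sh G T :: (('o, 'a, 'u) presheaf, ('o, 'a, 'u) presheaf_mor) category)
                 (precomp_functor G M) L))
    \<longleftrightarrow> covering_preserving G T G' T' M \<and> covering_flat G G' T' M"
    (is "?S \<and> ?G \<longleftrightarrow> _")
proof
  interpret site_functor G T G' T' M
    using assms(1-3) by (rule site_functor.intro)
  assume SG: "?S \<and> ?G"
  then obtain L where adj: "is_left_adjoint (Sh G T :: (('o, 'a, 'u) presheaf, ('o, 'a, 'u) presheaf_mor) category)
      (Sh G' T' :: (('p, 'b, 'u) presheaf, ('p, 'b, 'u) presheaf_mor) category) L (precomp_functor G M)"
    and lim: "preserves_finite_limits (Sh G T) (Sh G' T') L"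
    by (auto simp: is_geometric_morphism_def)
  obtain e where e: "\<forall>X\<in>Obj (Sh G T). universal_arrow (Sh G T) (Sh G' T') (precomp_functor G M) X (on_obj L X) (e X)"
    "\<forall>X X' f. f \<in> hom (Sh G T) X X' \<longrightarrow>
      Cmp (Sh G T) (on_arr (precomp_functor G M) (on_arr L f)) (e X) = Cmp (Sh G T) (e X') f"
    using universal_arrows_of_left_adjoint[OF adj] by blast
  interpret direct_image G T G' T' M L e
  proof (intro direct_image.intro direct_image_axioms.intro site_functor_axioms assms(4,5) lim)
    show "is_sheaf G T (presheaf_precomp M Y)" if "is_sheaf G' T' Y" for Y :: "('p, 'b, 'u) presheaf"
      using SG that by blast
    show "is_functor (Sh G T) (Sh G' T') L"
      using adj by (simp add: is_left_adjoint_def)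
    show "universal_arrow (Sh G T) (Sh G' T') (precomp_functor G M) F (on_obj L F) (e F)"
      if "is_sheaf G T F" for F
      using e(1) that by simp
    show "Cmp (Sh G T) (on_arr (precomp_functor G M) (on_arr L m)) (e F) = Cmp (Sh G T) (e F') m"
      if "m \<in> hom (Sh G T) F F'" for F F' m
      using e(2) that by blast
  qed
  show "covering_preserving G T G' T' M \<and> covering_flat G G' T' M"
    using covering_preserving covering_flat by blast
next
  assume "covering_preserving G T G' T' M \<and> covering_flat G G' T' M"
  then interpret flat_site_functor G T G' T' M
    using assms(1-3) by (intro flat_site_functor.intro site_functor.intro flat_site_functor_axioms.intro) auto
  show "?S \<and> ?G"
    using precomp_sheaf precomp_direct_image[OF assms(4,5)] by blast
qed

end
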